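(* Let $0<s<n/2$, $s=m+\gamma$ with $m\in\{0,1,2,\dots\}$, $\gamma\in[0,1)$, and let $f:\mathbb{R}^n\times[0,+\infty)\to[0,+\infty)$ be of class $C^{0,\varepsilon}_{loc}$ for some $\varepsilon\in(0,1)$. Let $c_{n,s}=\frac{\Gamma(\frac n2-s)}{\pi^{n/2}2^{2s}\Gamma(s)}$. Then: (i) any $v\in\mathcal L_s\cap C^{2m+\lfloor2\gamma\rfloor,\,2\gamma-\lfloor2\gamma\rfloor+\varepsilon}_{loc}(\mathbb{R}^n)$ solving $v(x)=c_{n,s}\int_{\mathbb{R}^n}\frac{f(y,v(y))}{|x-y|^{n-2s}}dy$ for all $x\in\mathbb{R}^n$ is a strong solution of $(-\Delta)^sv=f(x,v)$ in $\mathbb{R}^n$; (ii) let $v\in\mathcal L_s$ be a nonnegative strong solution of $(-\Delta)^sv=f(x,v)$ in $\mathbb{R}^n$. If either $f(x,t)$ is nondecreasing in $t\ge0$ and $\inf_{x\in\mathbb{R}^n}f(x,t)>0$ for every $t>0$, or $\lim_{|x|\to\infty}v(x)=0$, then $v$ is a nonnegative solution of $v(x)=c_{n,s}\int_{\mathbb{R}^n}\frac{f(y,v(y))}{|x-y|^{n-2s}}dy$, $x\in\mathbb{R}^n$.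
   Context: $(-\Delta)^\gamma$ ($0<\gamma<1$) is the fractional Laplacian with Fourier symbol $|\xi|^{2\gamma}$ (pointwise, up to a constant, $\mathrm{P.V.}\int\frac{v(x)-v(y)}{|x-y|^{n+2\gamma}}dy$); $(-\Delta)^0$ is the identity. $\mathcal L_s=\{v:\int_{\mathbb{R}^n}\frac{|v(x)|}{1+|x|^{n+2\gamma}}dx<\infty\}$. $v\in\mathcal L_s$ is a strong solution of $(-\Delta)^sv=F$ if $v\in C^{2m+\lfloor2\gamma\rfloor,2\gamma-\lfloor2\gamma\rfloor+\varepsilon'}_{loc}$ for some $\varepsilon'>0$ and $(-\Delta)^m(-\Delta)^\gamma v$ is pointwise defined, continuous, and equal to $F$. *)

theory Defs
  imports "HOL-Analysis.Analysis"
begin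

fun pdiff :: "'a::euclidean_space list \<Rightarrow> ('a \<Rightarrow> real) \<Rightarrow> 'a \<Rightarrow> real" where
  "pdiff [] u = u"
| "pdiff (b # bs) u = (\<lambda>x. deriv (\<lambda>t. pdiff bs u (x + t *\<^sub>R b)) 0)"

definition Ck :: "nat \<Rightarrow> ('a::euclidean_space \<Rightarrow> real) \<Rightarrow> bool" where
  "Ck k u \<longleftrightarrow>
     (\<forall>bs. set bs \<subseteq> Basis \<and> length bs \<le> k \<longrightarrow>
        continuous_on UNIV (pdiff bs u) \<and>
        (length bs < k \<longrightarrow>
           (\<forall>b\<in>Basis. \<forall>x. (\<lambda>t. pdiff bs u (x + t *\<^sub>R b)) differentiable (at 0))))"

definition loc_hoelder_on :: "'b::metric_space set \<Rightarrow> real \<Rightarrow> ('b \<Rightarrow> real) \<Rightarrow> bool" where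
  "loc_hoelder_on S \<alpha> g \<longleftrightarrow>
     (\<forall>K. compact K \<and> K \<subseteq> S \<longrightarrow>
        (\<exists>C. \<forall>x\<in>K. \<forall>y\<in>K. \<bar>g x - g y\<bar> \<le> C * dist x y powr \<alpha>))"

definition Ck_hoelder_basic :: "nat \<Rightarrow> real \<Rightarrow> ('a::euclidean_space \<Rightarrow> real) \<Rightarrow> bool" where
  "Ck_hoelder_basic k \<alpha> u \<longleftrightarrow>
     Ck k u \<and>
     (\<forall>bs. set bs \<subseteq> Basis \<and> length bs = k \<longrightarrow> loc_hoelder_on UNIV \<alpha> (pdiff bs u))"

text \<open>C^{k,alpha}_loc(R^n) for any alpha > 0, with the usual convention that for
  alpha > 1 one means C^{k+j, alpha-j}_loc where j = ceiling(alpha) - 1,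
  so that alpha - j lies in (0,1].\<close>
definition Ck_hoelder_loc :: "nat \<Rightarrow> real \<Rightarrow> ('a::euclidean_space \<Rightarrow> real) \<Rightarrow> bool" where
  "Ck_hoelder_loc k \<alpha> u \<longleftrightarrow>
     (let j = nat (\<lceil>\<alpha>\<rceil> - 1) in Ck_hoelder_basic (k + j) (\<alpha> - real j) u)"

text \<open>The weighted L^1 space L_s (the weight uses the fractional part gamma).\<close>
definition Ls_space :: "real \<Rightarrow> ('a::euclidean_space \<Rightarrow> real) set" where
  "Ls_space \<gamma> = {v. integrable lborel (\<lambda>x. \<bar>v x\<bar> / (1 + norm x powr (real DIM('a) + 2 * \<gamma>)))}"

text \<open>Normalisation constant of (-Delta)^gamma, 0<gamma<1, for Fourier symbol |xi|^(2 gamma):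
  4^gamma Gamma(n/2+gamma) / (pi^(n/2) |Gamma(-gamma)|), with |Gamma(-gamma)| = Gamma(1-gamma)/gamma.\<close>
definition frac_const :: "nat \<Rightarrow> real \<Rightarrow> real" where
  "frac_const n \<gamma> = 2 powr (2 * \<gamma>) * \<gamma> * Gamma (real n / 2 + \<gamma>) /
                     (pi powr (real n / 2) * Gamma (1 - \<gamma>))"

definition pv_trunc :: "real \<Rightarrow> ('a::euclidean_space \<Rightarrow> real) \<Rightarrow> 'a \<Rightarrow> real \<Rightarrow> real" where
  "pv_trunc \<gamma> v x \<epsilon> =
     (LINT y : {y. \<epsilon> < dist x y} | lborel.
        (v x - v y) / norm (x - y) powr (real DIM('a) + 2 * \<gamma>))"

definition frac_lap_defined :: "real \<Rightarrow> ('a::euclidean_space \<Rightarrow> real) \<Rightarrow> 'a \<Rightarrow> bool" where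
  "frac_lap_defined \<gamma> v x \<longleftrightarrow>
     \<gamma> = 0 \<or>
     ((\<forall>\<epsilon>>0. set_integrable lborel {y. \<epsilon> < dist x y}
                 (\<lambda>y. (v x - v y) / norm (x - y) powr (real DIM('a) + 2 * \<gamma>))) \<and>
      (\<exists>L. (pv_trunc \<gamma> v x \<longlongrightarrow> L) (at_right 0)))"

definition frac_lap :: "real \<Rightarrow> ('a::euclidean_space \<Rightarrow> real) \<Rightarrow> 'a \<Rightarrow> real" where
  "frac_lap \<gamma> v x =
     (if \<gamma> = 0 then v x
      else frac_const DIM('a) \<gamma> * Lim (at_right 0) (pv_trunc \<gamma> v x))"

definition lap_defined :: "('a::euclidean_space \<Rightarrow> real) \<Rightarrow> 'a \<Rightarrow> bool" where
  "lap_defined u x \<longleftrightarrow>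
     (\<forall>b\<in>Basis.
        (\<forall>\<^sub>F t in nhds 0. (\<lambda>r. u (x + r *\<^sub>R b)) differentiable (at t)) \<and>
        (\<lambda>t. deriv (\<lambda>r. u (x + r *\<^sub>R b)) t) differentiable (at 0))"

definition lap :: "('a::euclidean_space \<Rightarrow> real) \<Rightarrow> 'a \<Rightarrow> real" where
  "lap u x = (\<Sum>b\<in>Basis. deriv (\<lambda>t. deriv (\<lambda>r. u (x + r *\<^sub>R b)) t) 0)"

definition neg_lap :: "('a::euclidean_space \<Rightarrow> real) \<Rightarrow> 'a \<Rightarrow> real" where
  "neg_lap u = (\<lambda>x. - lap u x)"

definition strong_solution :: "nat \<Rightarrow> real \<Rightarrow> ('a::euclidean_space \<Rightarrow> real) \<Rightarrow> ('a \<Rightarrow> real) \<Rightarrow> bool" where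
  "strong_solution m \<gamma> v F \<longleftrightarrow>
     v \<in> Ls_space \<gamma> \<and>
     (\<exists>\<epsilon>'>0. Ck_hoelder_loc (2 * m + nat \<lfloor>2 * \<gamma>\<rfloor>) (2 * \<gamma> - of_int \<lfloor>2 * \<gamma>\<rfloor> + \<epsilon>') v) \<and>
     (\<forall>x. frac_lap_defined \<gamma> v x) \<and>
     (\<forall>k<m. \<forall>x. lap_defined ((neg_lap ^^ k) (frac_lap \<gamma> v)) x) \<and>
     continuous_on UNIV ((neg_lap ^^ m) (frac_lap \<gamma> v)) \<and>
     (\<forall>x. (neg_lap ^^ m) (frac_lap \<gamma> v) x = F x)"

definition riesz_const :: "nat \<Rightarrow> real \<Rightarrow> real" where
  "riesz_const n s = Gamma (real n / 2 - s) / (pi powr (real n / 2) * 2 powr (2 * s) * Gamma s)"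

definition integral_solution :: "real \<Rightarrow> ('a::euclidean_space \<Rightarrow> real \<Rightarrow> real) \<Rightarrow> ('a \<Rightarrow> real) \<Rightarrow> bool" where
  "integral_solution s f v \<longleftrightarrow>
     (\<forall>x. integrable lborel (\<lambda>y. f y (v y) / norm (x - y) powr (real DIM('a) - 2 * s)) \<and>
          v x = riesz_const DIM('a) s *
                (LINT y | lborel. f y (v y) / norm (x - y) powr (real DIM('a) - 2 * s)))"

end

theory Submission
  imports Defs "HOL-Probability.Probability"
begin

text \<open>
  The power \<open>(-\<Delta>)\<^sup>s\<close> of a test function \<open>\<phi>\<close> is written through the heat semigroup, which bounds it by \<open>(1 + |x|) powr (- n - 2\<gamma>)\<close>;
  it can therefore be paired with \<open>v\<close>, and a strong solution satisfies \<open>\<integral> F \<phi> = \<integral> v (-\<Delta>)\<^sup>s \<phi>\<close>. For part (i), the Riesz kernel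
  inverts \<open>(-\<Delta>)\<^sup>s\<close> on test functions, so the potential of \<open>F\<close> satisfies this weak identity, and regularity makes it pointwise.

  For part (ii), let \<open>h\<close> be a mollification of \<open>F\<close>. Integrating its heat flow in time against the truncated weight \<open>aR s R\<close>
  gives the mollified \<open>v\<close> minus the convolution of \<open>v\<close> with the kernel \<open>kap s R\<close>, a multiple of
  \<open>(R + |z|\<^sup>2 / 4) powr (- n/2 - s)\<close>. All terms are nonnegative, so \<open>R \<longrightarrow> \<infinity>\<close> is a monotone limit; as the kernel satisfies a
  Harnack inequality with constant tending to 1, the subtracted term converges to a constant \<open>c \<ge> 0\<close> independent of the point
  and of the mollifier. Hence \<open>v = c + I\<^sub>s F\<close>, and each of the two alternative hypotheses forces \<open>c = 0\<close>.
\<close>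

section \<open>Functions of class \<open>C\<^sup>k\<close>\<close>

text \<open>Three kernels occur: the singular kernel of the fractional Laplacian, the Riesz kernel
  and the bubble \<open>kap\<close>. Each is a superposition of heat kernels in time with an
  explicit weight, so relations between them reduce to Gamma and Beta integrals on the half line,
  and the normalising constants come out exactly without any Fourier transform.

  The obstacle in part (ii) is that the growth of F is unknown and that v is controlled only through
  the weight of exponent n + 2\<gamma>. Pairing with v consumes all spatial decay of the test
  function and leaves time decay of order m, whereas the weight t^(m+\<gamma>-1) needs more than m +
  \<gamma>. This failure by a margin \<gamma> < 1 is why the time weight is truncated, and the
  subtracted bubble term is the price. The limit of that term is found by comparing kernels, which v
  \<ge> 0 permits, instead of by a Liouville theorem; integer and fractional s are thus treated
  alike. The mollification enters because the weak identity only speaks of pairings with test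
  functions: translating one profile over all centres makes it a formula at points.\<close>

lemma pdiff_append: "pdiff (as @ bs) u = pdiff as (pdiff bs u)"
  by (induction as) auto

lemma Ck_0: "Ck 0 u \<longleftrightarrow> continuous_on UNIV u"
  by (auto simp: Ck_def)

text \<open>Turns the definition by lists of directions into a recursion on the order. The
  derivative split off is the innermost one, hence the last entry of the list: only then does the
  rest of the list act on the single function \<open>pdiff [b] u\<close>.\<close>

lemma Ck_Suc:
  fixes u :: "'a::euclidean_space \<Rightarrow> real"
  shows "Ck (Suc k) u \<longleftrightarrow> continuous_on UNIV u \<and>
    (\<forall>b\<in>Basis. (\<forall>x. (\<lambda>t. u (x + t *\<^sub>R b)) differentiable (at 0)) \<and> Ck k (pdiff [b] u))"
    (is "?L \<longleftrightarrow> ?R")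
proof
  assume L: ?L
  have 1: "continuous_on UNIV u" "\<And>b x. b\<in>Basis \<Longrightarrow> (\<lambda>t. u (x + t *\<^sub>R b)) differentiable (at 0)"
    using L[unfolded Ck_def, rule_format, of "[]"] by auto
  have "Ck k (pdiff [b] u)" if b: "b \<in> Basis" for b
    unfolding Ck_def
  proof (intro allI impI, goal_cases)
    case (1 bs)
    then show ?case
      using L[unfolded Ck_def, rule_format, of "bs @ [b]"] b by (simp add: pdiff_append)
  qed
  with 1 show ?R by auto
next
  assume R: ?R
  show ?L unfolding Ck_def
  proof (intro allI impI, goal_cases)
    case (1 bs)
    show ?case
    proof (cases bs rule: rev_cases)
      case Nil
      then show ?thesis using R by auto
    next
      case (snoc cs b)
      with 1 R have "Ck k (pdiff [b] u)" by auto
      from this[unfolded Ck_def, rule_format, of cs] 1 snoc show ?thesis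
        by (simp add: pdiff_append)
    qed
  qed
qed

lemma Ck_mono: "Ck k u \<Longrightarrow> j \<le> k \<Longrightarrow> Ck j u"
  unfolding Ck_def by auto

lemma Ck_cont: "Ck k u \<Longrightarrow> continuous_on UNIV u"
  unfolding Ck_def by (force dest: spec[of _ "[]"])

lemma Ck_pdiff: "Ck (k + length cs) u \<Longrightarrow> set cs \<subseteq> Basis \<Longrightarrow> Ck k (pdiff cs u)"
proof -
  assume a: "Ck (k + length cs) u" "set cs \<subseteq> Basis"
  show ?thesis
    unfolding Ck_def
  proof (intro allI impI, goal_cases)
    case (1 bs)
    then show ?case using a(1)[unfolded Ck_def, rule_format, of "bs @ cs"] a(2)
      by (auto simp: pdiff_append)
  qed
qed

lemma Ck_pdiff_cont: "Ck k u \<Longrightarrow> length cs \<le> k \<Longrightarrow> set cs \<subseteq> Basis \<Longrightarrow> continuous_on UNIV (pdiff cs u)"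
  unfolding Ck_def by auto

text \<open>\<open>pdiff\<close> records derivatives along a line at the parameter 0 only. Moving
  the base point along the line gives them at every parameter, which is what the mean value theorem
  asks for.\<close>

lemma line_shift_deriv:
  fixes u :: "'a::euclidean_space \<Rightarrow> real"
  assumes "((\<lambda>t. u (x + r *\<^sub>R b + t *\<^sub>R b)) has_field_derivative D) (at 0)"
  shows "((\<lambda>t. u (x + t *\<^sub>R b)) has_field_derivative D) (at r)"
proof -
  have "((\<lambda>t. (\<lambda>t. u (x + r *\<^sub>R b + t *\<^sub>R b)) (t - r)) has_field_derivative D * (1 - 0)) (at r)"
    by (rule DERIV_chain2[of _ D]) (use assms in \<open>auto intro!: derivative_eq_intros\<close>)
  moreover have "(\<lambda>t. (\<lambda>t. u (x + r *\<^sub>R b + t *\<^sub>R b)) (t - r)) = (\<lambda>t. u (x + t *\<^sub>R b))"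
    by (auto simp: algebra_simps scaleR_diff_left)
  ultimately show ?thesis by simp
qed

lemma Ck_DERIV_line:
  fixes u :: "'a::euclidean_space \<Rightarrow> real"
  assumes "Ck (Suc k) u" "b \<in> Basis"
  shows "((\<lambda>t. u (x + t *\<^sub>R b)) has_field_derivative pdiff [b] u (x + r *\<^sub>R b)) (at r)"
proof (rule line_shift_deriv)
  have "(\<lambda>t. u (x + r *\<^sub>R b + t *\<^sub>R b)) differentiable (at 0)"
    using assms by (auto simp: Ck_Suc)
  then show "((\<lambda>t. u (x + r *\<^sub>R b + t *\<^sub>R b)) has_field_derivative pdiff [b] u (x + r *\<^sub>R b)) (at 0)"
    by (simp add: DERIV_deriv_iff_real_differentiable)
qed

lemma Ck_SucI:
  fixes u :: "'a::euclidean_space \<Rightarrow> real"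
  assumes "continuous_on UNIV u"
    "\<And>b x. b \<in> Basis \<Longrightarrow> ((\<lambda>t. u (x + t *\<^sub>R b)) has_field_derivative g b x) (at 0)"
    "\<And>b. b \<in> Basis \<Longrightarrow> Ck k (g b)"
  shows "Ck (Suc k) u"
proof -
  have "pdiff [b] u = g b" if "b \<in> Basis" for b
    using assms(2)[OF that] by (auto simp: fun_eq_iff intro!: DERIV_imp_deriv)
  then show ?thesis
    unfolding Ck_Suc using assms real_differentiable_def by auto
qed

lemma pdiff1_eqI:
  assumes "\<And>x. ((\<lambda>t. u (x + t *\<^sub>R b)) has_field_derivative g x) (at 0)"
  shows "pdiff [b] u = g"
  using assms by (auto simp: fun_eq_iff intro!: DERIV_imp_deriv)

lemma Ck_DERIV0:
  fixes u :: "'a::euclidean_space \<Rightarrow> real"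
  assumes "Ck (Suc k) u" "b \<in> Basis"
  shows "((\<lambda>t. u (x + t *\<^sub>R b)) has_field_derivative pdiff [b] u x) (at 0)"
  using Ck_DERIV_line[OF assms, of x 0] by simp

lemma Ck_const: "Ck k (\<lambda>x::'a::euclidean_space. c)"
  by (induction k arbitrary: c) (auto simp: Ck_0 intro!: Ck_SucI[where g="\<lambda>_ _. 0"])

lemma Ck_inner: "Ck k (\<lambda>x::'a::euclidean_space. x \<bullet> c)"
proof (cases k)
  case 0 then show ?thesis by (auto simp: Ck_0 intro!: continuous_intros)
next
  case (Suc j)
  show ?thesis unfolding Suc
    by (rule Ck_SucI[where g="\<lambda>b _. b \<bullet> c"])
       (auto intro!: continuous_intros Ck_const derivative_eq_intros simp: inner_simps)
qed

lemma Ck_add: "Ck k u \<Longrightarrow> Ck k w \<Longrightarrow> Ck k (\<lambda>x::'a::euclidean_space. u x + w x)"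
proof (induction k arbitrary: u w)
  case 0 then show ?case by (auto simp: Ck_0 intro!: continuous_intros)
next
  case (Suc k)
  show ?case
    by (rule Ck_SucI[where g="\<lambda>b x. pdiff [b] u x + pdiff [b] w x"])
       (use Suc in \<open>auto intro!: continuous_on_add DERIV_add Ck_DERIV0 Suc.IH simp del: pdiff.simps dest: Ck_cont simp: Ck_Suc[of _ u] Ck_Suc[of _ w]\<close>)
qed

lemma Ck_mult: "Ck k u \<Longrightarrow> Ck k w \<Longrightarrow> Ck k (\<lambda>x::'a::euclidean_space. u x * w x)"
proof (induction k arbitrary: u w)
  case 0 then show ?case by (auto simp: Ck_0 intro!: continuous_intros)
next
  case (Suc k)
  have k: "Ck k u" "Ck k w" using Suc.prems Ck_mono[of "Suc k" _ k] by auto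
  have p: "Ck k (pdiff [b] u)" "Ck k (pdiff [b] w)" if "b \<in> Basis" for b
    using Suc.prems that unfolding Ck_Suc by auto
  show ?case
  proof (rule Ck_SucI[where g="\<lambda>b x. pdiff [b] u x * w x + pdiff [b] w x * u x"])
    show "continuous_on UNIV (\<lambda>x. u x * w x)"
      using Suc.prems by (auto intro!: continuous_intros dest: Ck_cont)
    fix b :: 'a assume b: "b \<in> Basis"
    show "Ck k (\<lambda>x. pdiff [b] u x * w x + pdiff [b] w x * u x)"
      by (intro Ck_add Suc.IH p k b)
    fix x
    have "((\<lambda>t. u (x + t *\<^sub>R b) * w (x + t *\<^sub>R b)) has_field_derivative
        (pdiff [b] u x * w (x + 0 *\<^sub>R b) + pdiff [b] w x * u (x + 0 *\<^sub>R b))) (at 0)"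
      by (rule DERIV_mult[OF Ck_DERIV0 Ck_DERIV0]) (use Suc.prems b in auto)
    then show "((\<lambda>t. u (x + t *\<^sub>R b) * w (x + t *\<^sub>R b)) has_field_derivative
        (pdiff [b] u x * w x + pdiff [b] w x * u x)) (at 0)" by simp
  qed
qed

lemma Ck_cmult: "Ck k u \<Longrightarrow> Ck k (\<lambda>x::'a::euclidean_space. c * u x)"
  by (intro Ck_mult Ck_const)

lemma Ck_uminus: "Ck k u \<Longrightarrow> Ck k (\<lambda>x::'a::euclidean_space. - u x)"
  using Ck_cmult[of k u "-1"] by simp

lemma Ck_diff: "Ck k u \<Longrightarrow> Ck k w \<Longrightarrow> Ck k (\<lambda>x::'a::euclidean_space. u x - w x)"
  using Ck_add[of k u "\<lambda>x. - w x"] Ck_uminus[of k w] by simp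

lemma Ck_sum: "(\<And>i. i \<in> I \<Longrightarrow> Ck k (u i)) \<Longrightarrow> Ck k (\<lambda>x::'a::euclidean_space. \<Sum>i\<in>I. u i x)"
  by (induction I rule: infinite_finite_induct) (auto intro!: Ck_const Ck_add)

lemma pdiff_add:
  fixes u w :: "'a::euclidean_space \<Rightarrow> real"
  assumes "Ck k u" "Ck k w" "length bs \<le> k" "set bs \<subseteq> Basis"
  shows "pdiff bs (\<lambda>x. u x + w x) = (\<lambda>x. pdiff bs u x + pdiff bs w x)"
  using assms(3,4)
proof (induction bs)
  case (Cons b bs)
  have C: "Ck (Suc 0) (pdiff bs u)" "Ck (Suc 0) (pdiff bs w)"
    using Cons assms(1,2) by (auto intro!: Ck_pdiff elim: Ck_mono)
  have "pdiff (b # bs) (\<lambda>x. u x + w x) = pdiff [b] (\<lambda>x. pdiff bs u x + pdiff bs w x)"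
    using Cons by simp
  also have "\<dots> = (\<lambda>x. pdiff [b] (pdiff bs u) x + pdiff [b] (pdiff bs w) x)"
    by (rule pdiff1_eqI, rule DERIV_add; rule Ck_DERIV0) (use C Cons in auto)
  finally show ?case by simp
qed auto

lemma pdiff_cmult:
  fixes u :: "'a::euclidean_space \<Rightarrow> real"
  assumes "Ck k u" "length bs \<le> k" "set bs \<subseteq> Basis"
  shows "pdiff bs (\<lambda>x. c * u x) = (\<lambda>x. c * pdiff bs u x)"
  using assms(2,3)
proof (induction bs)
  case (Cons b bs)
  have C: "Ck (Suc 0) (pdiff bs u)"
    using Cons assms(1) by (auto intro!: Ck_pdiff elim: Ck_mono)
  have "pdiff (b # bs) (\<lambda>x. c * u x) = pdiff [b] (\<lambda>x. c * pdiff bs u x)"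
    using Cons by simp
  also have "\<dots> = (\<lambda>x. c * pdiff [b] (pdiff bs u) x)"
    by (rule pdiff1_eqI, rule DERIV_cmult; rule Ck_DERIV0) (use C Cons in auto)
  finally show ?case by simp
qed auto

lemma DERIV_affine_line:
  fixes u :: "'a::euclidean_space \<Rightarrow> real"
  assumes "Ck (Suc k) u" "b \<in> Basis"
  shows "((\<lambda>t. u (d + c *\<^sub>R (x + t *\<^sub>R b))) has_field_derivative c * pdiff [b] u (d + c *\<^sub>R x)) (at 0)"
proof -
  have "((\<lambda>t. (\<lambda>t. u ((d + c *\<^sub>R x) + t *\<^sub>R b)) (c * t)) has_field_derivative
      pdiff [b] u (d + c *\<^sub>R x) * (c * 1)) (at 0)"
    by (rule DERIV_chain2[of _ "pdiff [b] u (d + c *\<^sub>R x)"])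
       (use Ck_DERIV0[OF assms] in \<open>auto intro!: derivative_eq_intros simp del: pdiff.simps\<close>)
  moreover have "(\<lambda>t. (\<lambda>t. u ((d + c *\<^sub>R x) + t *\<^sub>R b)) (c * t)) = (\<lambda>t. u (d + c *\<^sub>R (x + t *\<^sub>R b)))"
    by (auto simp: algebra_simps)
  ultimately show ?thesis by (simp add: mult.commute del: pdiff.simps)
qed

lemma Ck_affine:
  fixes u :: "'a::euclidean_space \<Rightarrow> real"
  shows "Ck k u \<Longrightarrow> Ck k (\<lambda>x. u (d + c *\<^sub>R x))"
proof (induction k arbitrary: u)
  case 0 then show ?case
    by (auto simp: Ck_0 intro!: continuous_intros elim: continuous_on_compose2)
next
  case (Suc k)
  show ?case
  proof (rule Ck_SucI[where g="\<lambda>b x. c * pdiff [b] u (d + c *\<^sub>R x)"])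
    show "continuous_on UNIV (\<lambda>x. u (d + c *\<^sub>R x))"
      using Ck_cont[OF Suc.prems] by (auto intro!: continuous_intros elim: continuous_on_compose2)
  qed (use Suc in \<open>auto intro!: DERIV_affine_line Ck_cmult Suc.IH simp: Ck_Suc[of _ u] simp del: pdiff.simps\<close>)
qed

lemma pdiff_affine:
  fixes u :: "'a::euclidean_space \<Rightarrow> real"
  assumes "Ck k u" "length bs \<le> k" "set bs \<subseteq> Basis"
  shows "pdiff bs (\<lambda>x. u (d + c *\<^sub>R x)) = (\<lambda>x. c ^ length bs * pdiff bs u (d + c *\<^sub>R x))"
  using assms(2,3)
proof (induction bs)
  case (Cons b bs)
  have C: "Ck (Suc 0) (pdiff bs u)"
    using Cons assms(1) by (auto intro!: Ck_pdiff elim: Ck_mono)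
  have "pdiff (b # bs) (\<lambda>x. u (d + c *\<^sub>R x)) = pdiff [b] (\<lambda>x. c ^ length bs * pdiff bs u (d + c *\<^sub>R x))"
    using Cons by simp
  also have "\<dots> = (\<lambda>x. c ^ length bs * (c * pdiff [b] (pdiff bs u) (d + c *\<^sub>R x)))"
    by (rule pdiff1_eqI, rule DERIV_cmult, rule DERIV_affine_line) (use C Cons in auto)
  finally show ?case by (simp add: mult_ac)
qed auto

lemma Ck_translate: "Ck k u \<Longrightarrow> Ck k (\<lambda>x::'a::euclidean_space. u (x + d))"
  using Ck_affine[of k u d 1] by (simp add: add.commute)

lemma pdiff_translate: "Ck k u \<Longrightarrow> length bs \<le> k \<Longrightarrow> set bs \<subseteq> Basis \<Longrightarrow>
    pdiff bs (\<lambda>x::'a::euclidean_space. u (x + d)) = (\<lambda>x. pdiff bs u (x + d))"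
  using pdiff_affine[of k u bs d 1] by (simp add: add.commute)

section \<open>The Laplacian as a sum of second partial derivatives\<close>

lemma line_shift_deriv_iff:
  fixes u :: "'a::euclidean_space \<Rightarrow> real"
  shows "((\<lambda>t. u (x + t *\<^sub>R b)) has_field_derivative D) (at r) \<longleftrightarrow>
    ((\<lambda>t. u (x + r *\<^sub>R b + t *\<^sub>R b)) has_field_derivative D) (at 0)"
proof
  assume "((\<lambda>t. u (x + t *\<^sub>R b)) has_field_derivative D) (at r)"
  then have "((\<lambda>t. (\<lambda>t. u (x + t *\<^sub>R b)) (t + r)) has_field_derivative D * (1 + 0)) (at 0)"
    by (intro DERIV_chain2[of _ D]) (auto intro!: derivative_eq_intros)
  then show "((\<lambda>t. u (x + r *\<^sub>R b + t *\<^sub>R b)) has_field_derivative D) (at 0)"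
    by (simp add: algebra_simps)
qed (rule line_shift_deriv)

text \<open>\<open>deriv\<close> is a choice from the derivative predicate, and the predicates
  belonging to the two sides are equivalent, so the values agree even where no derivative exists.
  Hence \<open>lap\<close> is the sum of second partials for arbitrary functions.\<close>

lemma deriv_line: "deriv (\<lambda>r. u (x + r *\<^sub>R b)) t = pdiff [b] u (x + t *\<^sub>R b)"
  for u :: "'a::euclidean_space \<Rightarrow> real"
  unfolding deriv_def line_shift_deriv_iff[of u x b _ t] pdiff.simps ..

lemma lap_eq_pdiff: "lap u x = (\<Sum>b\<in>Basis. pdiff [b, b] u x)"
  unfolding lap_def deriv_line by simp

lemma Ck_pdiff2: "Ck (Suc (Suc k)) u \<Longrightarrow> b \<in> Basis \<Longrightarrow> Ck k (pdiff [b, b] u)"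
  using Ck_pdiff[of k "[b,b]" u] by simp

lemma Ck_neg_lap: "Ck (Suc (Suc k)) u \<Longrightarrow> Ck k (neg_lap u)"
  unfolding neg_lap_def lap_eq_pdiff by (intro Ck_uminus Ck_sum Ck_pdiff2)

lemma Ck_neg_lap_pow: "Ck (k + 2 * j) u \<Longrightarrow> Ck k ((neg_lap ^^ j) u)"
proof (induction j arbitrary: k)
  case (Suc j)
  then have "Ck (Suc (Suc k)) ((neg_lap ^^ j) u)" by simp
  then show ?case by (simp add: Ck_neg_lap)
qed auto

lemma lap_defined_Ck:
  fixes u :: "'a::euclidean_space \<Rightarrow> real"
  assumes "Ck (Suc (Suc k)) u" shows "lap_defined u x"
  unfolding lap_defined_def
proof (intro ballI conjI)
  fix b :: 'a assume b: "b \<in> Basis"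
  show "\<forall>\<^sub>F t in nhds 0. (\<lambda>r. u (x + r *\<^sub>R b)) differentiable at t"
    using Ck_DERIV_line[OF assms b] by (auto simp: real_differentiable_def intro!: always_eventually)
  have "Ck (Suc k) (pdiff [b] u)" using assms b by (auto simp: Ck_Suc[of "Suc k"])
  from Ck_DERIV_line[OF this b, of x 0]
  show "(\<lambda>t. deriv (\<lambda>r. u (x + r *\<^sub>R b)) t) differentiable at 0"
    unfolding deriv_line by (auto simp: real_differentiable_def)
qed

lemma lap_affine:
  fixes u :: "'a::euclidean_space \<Rightarrow> real"
  assumes "Ck (Suc (Suc k)) u"
  shows "neg_lap (\<lambda>x. u (x + d)) = (\<lambda>x. neg_lap u (x + d))"
proof -
  have "pdiff [b,b] (\<lambda>x. u (x + d)) = (\<lambda>x. pdiff [b,b] u (x + d))" if "b \<in> Basis" for b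
    using that by (intro pdiff_translate[OF assms]) auto
  then show ?thesis unfolding neg_lap_def lap_eq_pdiff by (auto simp del: pdiff.simps)
qed

lemma neg_lap_pow_translate:
  fixes u :: "'a::euclidean_space \<Rightarrow> real"
  assumes "Ck (2 * j) u"
  shows "(neg_lap ^^ j) (\<lambda>x. u (x + d)) = (\<lambda>x. (neg_lap ^^ j) u (x + d))"
  using assms
proof (induction j)
  case (Suc j)
  have "Ck (Suc (Suc 0)) ((neg_lap ^^ j) u)"
    using Suc by (intro Ck_neg_lap_pow) (simp add: numeral_2_eq_2)
  from lap_affine[OF this, of d] Suc.IH Ck_mono[OF Suc.prems, of "2 * j"] show ?case by simp
qed auto

section \<open>Functions of bounded support and integration by parts\<close>

definition bdd_supp :: "('a::euclidean_space \<Rightarrow> real) \<Rightarrow> bool" where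
  "bdd_supp u \<longleftrightarrow> (\<exists>R. \<forall>x. R < norm x \<longrightarrow> u x = 0)"

text \<open>The exterior of a closed ball is open, so the function vanishes in a neighbourhood of
  every exterior point; the same radius serves for the derivative.\<close>

lemma bdd_supp_pdiff1:
  assumes "bdd_supp u" shows "bdd_supp (pdiff [b] u)"
proof -
  obtain R where R: "\<And>x. R < norm x \<Longrightarrow> u x = 0" using assms by (auto simp: bdd_supp_def)
  have "pdiff [b] u x = 0" if x: "R < norm x" for x
  proof -
    have "((\<lambda>t. x + t *\<^sub>R b) \<longlongrightarrow> x + 0 *\<^sub>R b) (nhds 0)"
      by (intro tendsto_intros filterlim_ident)
    then have "((\<lambda>t. x + t *\<^sub>R b) \<longlongrightarrow> x) (nhds 0)" by simp
    then have "\<forall>\<^sub>F t in nhds 0. x + t *\<^sub>R b \<in> {y. R < norm y}"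
      by (rule topological_tendstoD) (use x in \<open>auto intro!: open_Collect_less continuous_intros\<close>)
    then have "\<forall>\<^sub>F t in nhds 0. u (x + t *\<^sub>R b) = 0"
      by (rule eventually_mono) (auto intro: R)
    then have "deriv (\<lambda>t. u (x + t *\<^sub>R b)) 0 = deriv (\<lambda>t. 0) 0"
      by (intro deriv_cong_ev) auto
    then show ?thesis by simp
  qed
  then show ?thesis unfolding bdd_supp_def by blast
qed

lemma bdd_supp_pdiff: "bdd_supp u \<Longrightarrow> bdd_supp (pdiff bs u)"
proof (induction bs)
  case (Cons b bs)
  then show ?case using bdd_supp_pdiff1[of "pdiff bs u" b] by simp
qed auto

lemma bdd_supp_add: "bdd_supp u \<Longrightarrow> bdd_supp w \<Longrightarrow> bdd_supp (\<lambda>x. u x + w x)"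
  unfolding bdd_supp_def
proof (elim exE)
  fix R S assume "\<forall>x. R < norm x \<longrightarrow> u x = 0" "\<forall>x. S < norm x \<longrightarrow> w x = 0"
  then show "\<exists>R. \<forall>x. R < norm x \<longrightarrow> u x + w x = 0" by (intro exI[of _ "max R S"]) auto
qed

lemma bdd_supp_sum: "(\<And>i. i \<in> I \<Longrightarrow> bdd_supp (u i)) \<Longrightarrow> bdd_supp (\<lambda>x. \<Sum>i\<in>I. u i x)"
  by (induction I rule: infinite_finite_induct) (auto intro!: bdd_supp_add simp: bdd_supp_def[of "\<lambda>_. 0"])

lemma bdd_supp_mult: "bdd_supp w \<Longrightarrow> bdd_supp (\<lambda>x. u x * w x)"
  unfolding bdd_supp_def by fastforce

lemma bdd_supp_neg_lap: "bdd_supp u \<Longrightarrow> bdd_supp (neg_lap u)"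
proof -
  assume "bdd_supp u"
  then have "bdd_supp (\<lambda>x. (-1) * (\<Sum>b\<in>Basis. pdiff [b, b] u x))"
    by (intro bdd_supp_mult bdd_supp_sum bdd_supp_pdiff)
  then show ?thesis unfolding neg_lap_def lap_eq_pdiff by (simp del: pdiff.simps)
qed

lemma bdd_supp_neg_lap_pow: "bdd_supp u \<Longrightarrow> bdd_supp ((neg_lap ^^ j) u)"
  by (induction j) (auto intro: bdd_supp_neg_lap)

lemma bdd_supp_translate: "bdd_supp u \<Longrightarrow> bdd_supp (\<lambda>x. u (x + d))"
proof -
  assume "bdd_supp u"
  then obtain R where R: "\<And>x. R < norm x \<Longrightarrow> u x = 0" by (auto simp: bdd_supp_def)
  have "u (x + d) = 0" if "R + norm d < norm x" for x
    using that norm_triangle_ineq[of "x + d" "- d"] by (intro R) auto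
  then show ?thesis unfolding bdd_supp_def by blast
qed

lemma bdd_supp_bounded:
  fixes u :: "'a::euclidean_space \<Rightarrow> real"
  assumes "continuous_on UNIV u" "bdd_supp u"
  obtains M R where "0 < M" "0 < R" "\<And>x. \<bar>u x\<bar> \<le> M * indicator (cball 0 R) x"
proof -
  obtain R where R: "\<And>x. R < norm x \<Longrightarrow> u x = 0" using assms by (auto simp: bdd_supp_def)
  define R' where "R' = max R 1"
  have "compact (u ` cball 0 R')"
    using assms(1) by (intro compact_continuous_image) (auto elim: continuous_on_subset)
  then have "bounded (u ` cball 0 R')" by (rule compact_imp_bounded)
  then obtain M where M: "0 < M" "\<And>y. y \<in> u ` cball 0 R' \<Longrightarrow> norm y \<le> M"
    unfolding bounded_pos by auto
  show ?thesis
    by (rule that[of M R']) (use M R in \<open>auto simp: R'_def indicator_def\<close>)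
qed

lemma integrable_indicator_cball: "integrable lborel (indicator (cball (c::'a::euclidean_space) R) :: 'a \<Rightarrow> real)"
  using emeasure_lborel_cball_finite[of c R] by (intro integrable_real_indicator) (auto simp: infinity_ennreal_def)

lemma bdd_supp_integrable:
  fixes u :: "'a::euclidean_space \<Rightarrow> real"
  assumes "continuous_on UNIV u" "bdd_supp u"
  shows "integrable lborel u"
proof -
  obtain M R where M: "\<And>x. \<bar>u x\<bar> \<le> M * indicator (cball 0 R) x" 
    using bdd_supp_bounded[OF assms] by blast
  have m: "u \<in> borel_measurable borel" using assms(1) by (rule borel_measurable_continuous_onI)
  show ?thesis
  proof (rule Bochner_Integration.integrable_bound)
    show "integrable lborel (\<lambda>x::'a. M * indicator (cball 0 R) x)"
      by (intro integrable_mult_right integrable_indicator_cball)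
    have "norm (u x) \<le> norm (M * indicator (cball 0 R) x)" for x
      using M[of x] by simp
    then show "AE x in lborel. norm (u x) \<le> norm (M * indicator (cball 0 R) x)" by simp
  qed (use m in simp)
qed

text \<open>Translation invariance of Lebesgue measure gives every difference quotient integral
  zero, and dominated convergence passes this on to the derivative. No iterated integral over lines
  is involved.\<close>

lemma integral_pdiff_zero:
  fixes u :: "'a::euclidean_space \<Rightarrow> real"
  assumes C: "Ck (Suc k) u" and s: "bdd_supp u" and b: "b \<in> Basis"
  shows "(LINT x|lborel. pdiff [b] u x) = 0"
proof -
  let ?g = "pdiff [b] u"
  have cg: "continuous_on UNIV ?g" using C b by (intro Ck_pdiff_cont[OF C]) auto
  obtain M R where M: "0 < M" "0 < R" "\<And>x. \<bar>?g x\<bar> \<le> M * indicator (cball 0 R) x" 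
    using bdd_supp_bounded[OF cg bdd_supp_pdiff[OF s]] by blast
  have mu[measurable]: "u \<in> borel_measurable borel" 
    using Ck_cont[OF C] by (rule borel_measurable_continuous_onI)
  have mg[measurable]: "?g \<in> borel_measurable borel" 
    using cg by (rule borel_measurable_continuous_onI)
  have iu: "integrable lborel u" by (rule bdd_supp_integrable[OF Ck_cont[OF C] s])
  define h :: "nat \<Rightarrow> real" where "h n = inverse (real (Suc n))" for n
  have h: "h n > 0" "h n \<le> 1" for n by (auto simp: h_def field_simps)
  have h0: "h \<longlonglongrightarrow> 0" unfolding h_def by (rule LIMSEQ_inverse_real_of_nat)
  let ?q = "\<lambda>n x. (u (x + h n *\<^sub>R b) - u x) / h n"
  have tr: "integrable lborel (\<lambda>x. u (x + d))" "(LINT x|lborel. u (x + d)) = (LINT x|lborel. u x)" for d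
  proof -
    have "integrable (distr lborel borel ((+) d)) u" using iu by (simp add: lborel_distr_plus)
    then show "integrable lborel (\<lambda>x. u (x + d))"
      by (subst (asm) integrable_distr_eq) (auto simp: add.commute)
    have "(LINT x|lborel. u x) = (LINT x|distr lborel borel ((+) d). u x)" by (simp add: lborel_distr_plus)
    also have "\<dots> = (LINT x|lborel. u (x + d))" by (subst integral_distr) (auto simp: add.commute)
    finally show "(LINT x|lborel. u (x + d)) = (LINT x|lborel. u x)" ..
  qed
  have q0: "(LINT x|lborel. ?q n x) = 0" for n
    using tr[of "h n *\<^sub>R b"] iu by (simp add: Bochner_Integration.integral_diff)
  have "(\<lambda>n. LINT x|lborel. ?q n x) \<longlonglongrightarrow> (LINT x|lborel. ?g x)"
  proof (rule integral_dominated_convergence[where w="\<lambda>x. M * indicator (cball 0 (R+1)) x"])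
    show "integrable lborel (\<lambda>x::'a. M * indicator (cball 0 (R+1)) x)"
      by (intro integrable_mult_right integrable_indicator_cball)
    show "AE x in lborel. (\<lambda>n. ?q n x) \<longlonglongrightarrow> ?g x"
    proof (rule always_eventually, rule allI)
      fix x
      have "((\<lambda>t. u (x + t *\<^sub>R b)) has_field_derivative ?g x) (at 0)"
        by (rule Ck_DERIV0[OF C b])
      then have "((\<lambda>t. (u (x + t *\<^sub>R b) - u x) / t) \<longlongrightarrow> ?g x) (at 0)"
        by (simp add: has_field_derivative_iff del: pdiff.simps)
      moreover have "filterlim h (at 0) sequentially"
        using h0 h(1) by (auto simp: filterlim_at intro!: always_eventually) (metis less_irrefl)
      ultimately show "(\<lambda>n. ?q n x) \<longlonglongrightarrow> ?g x" by (rule filterlim_compose)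
    qed
    \<comment> \<open>The mean value point is displaced from x by less than \<open>h n\<close> \<le>
      1, hence the ball enlarged by one.\<close>
    show "AE x in lborel. norm (?q n x) \<le> M * indicator (cball 0 (R+1)) x" for n
    proof (rule always_eventually, rule allI)
      fix x
      obtain z where z: "0 < z" "z < h n" "u (x + h n *\<^sub>R b) - u (x + 0 *\<^sub>R b) = (h n - 0) * ?g (x + z *\<^sub>R b)"
        using MVT2[of 0 "h n" "\<lambda>t. u (x + t *\<^sub>R b)" "\<lambda>t. ?g (x + t *\<^sub>R b)"] Ck_DERIV_line[OF C b] h(1) by blast
      then have "?q n x = ?g (x + z *\<^sub>R b)" using h(1)[of n] by (simp add: field_simps)
      moreover have "x \<in> cball 0 (R + 1)" if "x + z *\<^sub>R b \<in> cball 0 R"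
      proof -
        have "norm (z *\<^sub>R b) \<le> 1" using z h(2)[of n] b by simp
        then show ?thesis using that norm_triangle_ineq4[of "x + z *\<^sub>R b" "z *\<^sub>R b"] by simp
      qed
      then have "M * indicator (cball 0 R) (x + z *\<^sub>R b) \<le> M * indicator (cball 0 (R+1)) x"
        using M(1) by (auto simp: indicator_def)
      ultimately show "norm (?q n x) \<le> M * indicator (cball 0 (R+1)) x"
        using M(3)[of "x + z *\<^sub>R b"] by (metis order_trans real_norm_def)
    qed
  qed measurable
  then show ?thesis unfolding q0 by (simp add: LIMSEQ_const_iff del: pdiff.simps)
qed

lemma pdiff1_mult:
  fixes u w :: "'a::euclidean_space \<Rightarrow> real"
  assumes "Ck (Suc k) u" "Ck (Suc k) w" "b \<in> Basis"
  shows "pdiff [b] (\<lambda>x. u x * w x) = (\<lambda>x. pdiff [b] u x * w x + pdiff [b] w x * u x)"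
proof (rule pdiff1_eqI)
  fix x
  have "((\<lambda>t. u (x + t *\<^sub>R b) * w (x + t *\<^sub>R b)) has_field_derivative
        (pdiff [b] u x * w (x + 0 *\<^sub>R b) + pdiff [b] w x * u (x + 0 *\<^sub>R b))) (at 0)"
    by (rule DERIV_mult[OF Ck_DERIV0 Ck_DERIV0]) (use assms in auto)
  then show "((\<lambda>t. u (x + t *\<^sub>R b) * w (x + t *\<^sub>R b)) has_field_derivative
        (pdiff [b] u x * w x + pdiff [b] w x * u x)) (at 0)" by simp
qed

lemma integral_by_parts_pdiff:
  fixes u w :: "'a::euclidean_space \<Rightarrow> real"
  assumes "Ck (Suc k) u" "Ck (Suc k) w" "bdd_supp w" "b \<in> Basis"
  shows "(LINT x|lborel. pdiff [b] u x * w x) = - (LINT x|lborel. u x * pdiff [b] w x)"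
proof -
  have C: "Ck (Suc k) (\<lambda>x. u x * w x)" using assms by (intro Ck_mult)
  have c: "continuous_on UNIV (pdiff [b] u)" "continuous_on UNIV (pdiff [b] w)"
    using Ck_pdiff_cont[OF assms(1), of "[b]"] Ck_pdiff_cont[OF assms(2), of "[b]"] assms(4) by auto
  have "integrable lborel (\<lambda>x. pdiff [b] u x * w x)"
    using assms c by (intro bdd_supp_integrable continuous_on_mult bdd_supp_mult) (auto dest: Ck_cont)
  moreover have "integrable lborel (\<lambda>x. u x * pdiff [b] w x)"
    using assms c by (intro bdd_supp_integrable continuous_on_mult bdd_supp_mult bdd_supp_pdiff) (auto dest: Ck_cont)
  ultimately show ?thesis
    using integral_pdiff_zero[OF C bdd_supp_mult[OF assms(3)] assms(4)] pdiff1_mult[OF assms(1,2,4)]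
    by (simp add: mult.commute Bochner_Integration.integral_add del: pdiff.simps)
qed

lemma Ck_mult_integrable:
  fixes u w :: "'a::euclidean_space \<Rightarrow> real"
  assumes "continuous_on UNIV u" "continuous_on UNIV w" "bdd_supp w"
  shows "integrable lborel (\<lambda>x. u x * w x)"
  using assms by (intro bdd_supp_integrable continuous_on_mult bdd_supp_mult)

lemma integral_neg_lap:
  fixes u w :: "'a::euclidean_space \<Rightarrow> real"
  assumes u: "Ck (Suc (Suc k)) u" and w: "Ck (Suc (Suc k)) w" and s: "bdd_supp w"
  shows "(LINT x|lborel. neg_lap u x * w x) = (LINT x|lborel. u x * neg_lap w x)"
proof -
  have "(LINT x|lborel. pdiff [b,b] u x * w x) = (LINT x|lborel. u x * pdiff [b,b] w x)" if b: "b \<in> Basis" for b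
  proof -
    have C: "Ck (Suc k) (pdiff [b] u)" "Ck (Suc k) (pdiff [b] w)" using u w b by (auto simp: Ck_Suc[of "Suc k"])
    have "(LINT x|lborel. pdiff [b] (pdiff [b] u) x * w x) = - (LINT x|lborel. pdiff [b] u x * pdiff [b] w x)"
      by (rule integral_by_parts_pdiff) (use C s b Ck_mono[OF w] in auto)
    also have "\<dots> = (LINT x|lborel. u x * pdiff [b] (pdiff [b] w) x)"
      by (subst integral_by_parts_pdiff[of k]) (use C s b Ck_mono[OF u] in \<open>auto intro!: bdd_supp_pdiff simp del: pdiff.simps\<close>)
    finally show ?thesis by simp
  qed
  moreover have "integrable lborel (\<lambda>x. pdiff [b,b] u x * w x)" "integrable lborel (\<lambda>x. u x * pdiff [b,b] w x)" if b: "b \<in> Basis" for b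
    using b s u w by (auto intro!: Ck_mult_integrable bdd_supp_pdiff Ck_cont[OF Ck_pdiff2] simp del: pdiff.simps dest: Ck_cont)
  ultimately show ?thesis
    unfolding neg_lap_def lap_eq_pdiff
    by (simp add: sum_distrib_left sum_distrib_right Bochner_Integration.integral_sum del: pdiff.simps)
qed

lemma integral_neg_lap_pow:
  fixes u w :: "'a::euclidean_space \<Rightarrow> real"
  assumes "Ck (2 * j) u" "Ck (2 * j) w" "bdd_supp w"
  shows "(LINT x|lborel. (neg_lap ^^ j) u x * w x) = (LINT x|lborel. u x * (neg_lap ^^ j) w x)"
  using assms
proof (induction j arbitrary: w)
  case (Suc j)
  have 1: "Ck (Suc (Suc 0)) ((neg_lap ^^ j) u)"
    using Suc by (intro Ck_neg_lap_pow) (simp add: numeral_2_eq_2)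
  have 2: "Ck (Suc (Suc 0)) w" using Suc.prems(2) by (rule Ck_mono) simp
  have 3: "Ck (2 * j) (neg_lap w)" using Suc.prems(2) by (intro Ck_neg_lap) simp
  have "(LINT x|lborel. (neg_lap ^^ Suc j) u x * w x) = (LINT x|lborel. (neg_lap ^^ j) u x * neg_lap w x)"
    using integral_neg_lap[OF 1 2 Suc.prems(3)] by simp
  also have "\<dots> = (LINT x|lborel. u x * (neg_lap ^^ j) (neg_lap w) x)"
    by (rule Suc.IH) (use 3 Suc.prems Ck_mono[OF Suc.prems(1)] in \<open>auto intro: bdd_supp_neg_lap\<close>)
  also have "(neg_lap ^^ j) (neg_lap w) = (neg_lap ^^ Suc j) w" by (simp add: funpow_swap1)
  finally show ?case .
qed auto

section \<open>Continuity and differentiation under the integral sign\<close>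

lemma DERIV_integral_dominated:
  fixes G :: "'z \<Rightarrow> real \<Rightarrow> real"
  assumes i: "\<And>t. \<bar>t\<bar> < r \<Longrightarrow> integrable M (\<lambda>z. G z t)" and r: "0 < r"
    and m': "(\<lambda>z. G' z 0) \<in> borel_measurable M"
    and d: "\<And>z t. \<bar>t\<bar> < r \<Longrightarrow> z \<in> space M \<Longrightarrow> (G z has_field_derivative G' z t) (at t)"
    and H: "integrable M H" "\<And>z t. \<bar>t\<bar> < r \<Longrightarrow> z \<in> space M \<Longrightarrow> \<bar>G' z t\<bar> \<le> H z"
  shows "((\<lambda>t. LINT z|M. G z t) has_field_derivative (LINT z|M. G' z 0)) (at 0)"
proof -
  have "((\<lambda>t. ((LINT z|M. G z t) - (LINT z|M. G z 0)) / (t - 0)) \<longlongrightarrow> (LINT z|M. G' z 0)) (at 0 within {-r<..<r})"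
    unfolding tendsto_at_iff_sequentially
  proof (intro allI impI)
    fix X :: "nat \<Rightarrow> real" assume X: "\<forall>i. X i \<in> {-r<..<r} - {0}" "X \<longlonglongrightarrow> 0"
    then have Xr: "\<bar>X n\<bar> < r" "X n \<noteq> 0" for n by (auto simp: abs_less_iff dest!: spec[of _ n])
    let ?q = "\<lambda>n z. (G z (X n) - G z 0) / X n"
    have L: "(\<lambda>n. LINT z|M. ?q n z) \<longlonglongrightarrow> (LINT z|M. G' z 0)"
    proof (rule integral_dominated_convergence[where w=H])
      show "?q n \<in> borel_measurable M" for n
        using i[OF Xr(1)[of n]] i[of 0] r by (auto intro!: borel_measurable_divide borel_measurable_diff)
      show "AE z in M. (\<lambda>n. ?q n z) \<longlonglongrightarrow> G' z 0"
      proof (rule AE_I2)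
        fix z assume "z \<in> space M"
        then have "((\<lambda>t. (G z t - G z 0) / t) \<longlongrightarrow> G' z 0) (at 0)"
          using d[of 0 z] r by (simp add: has_field_derivative_iff)
        moreover have "filterlim X (at 0) sequentially"
          using X Xr by (auto simp: filterlim_at intro!: always_eventually)
        ultimately show "(\<lambda>n. ?q n z) \<longlonglongrightarrow> G' z 0" by (rule filterlim_compose)
      qed
      \<comment> \<open>The mean value theorem turns the difference quotient into a value of the
        derivative at a parameter still inside (-r, r), where H dominates. The two signs of
        \<open>X n\<close> need the theorem on different intervals.\<close>
      show "AE z in M. norm (?q n z) \<le> H z" for n
      proof (rule AE_I2)
        fix z assume z: "z \<in> space M"
        have "\<exists>y. \<bar>y\<bar> < r \<and> ?q n z = G' z y"
        proof (cases "X n > 0")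
          case True
          have "\<exists>y. 0 < y \<and> y < X n \<and> G z (X n) - G z 0 = (X n - 0) * G' z y"
            by (rule MVT2) (use True Xr(1)[of n] d z in auto)
          then show ?thesis using True Xr(1)[of n] by (force simp: field_simps)
        next
          case False
          with Xr(2)[of n] have F: "X n < 0" by simp
          have "\<exists>y. X n < y \<and> y < 0 \<and> G z 0 - G z (X n) = (0 - X n) * G' z y"
            by (rule MVT2) (use F Xr(1)[of n] d z in auto)
          then obtain y where y: "X n < y" "y < 0" "G z 0 - G z (X n) = (0 - X n) * G' z y" by blast
          then have "G z (X n) - G z 0 = X n * G' z y" by simp
          then have "?q n z = G' z y" using F by simp
          then show ?thesis using y F Xr(1)[of n] by (intro exI[of _ y]) auto
        qed
        then show "norm (?q n z) \<le> H z" using H(2)[OF _ z] by (metis real_norm_def)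
      qed
    qed (use m' H in auto)
    have E: "(LINT z|M. ?q n z) = ((LINT z|M. G z (X n)) - (LINT z|M. G z 0)) / X n" for n
      using i[OF Xr(1)[of n]] i[of 0] r by (subst Bochner_Integration.integral_divide_zero) simp
    show "((\<lambda>t. ((LINT z|M. G z t) - (LINT z|M. G z 0)) / (t - 0)) \<circ> X) \<longlonglongrightarrow> (LINT z|M. G' z 0)"
      using L unfolding E by (simp add: o_def)
  qed
  moreover have "at 0 within {-r<..<r} = at (0::real)"
    using r by (intro at_within_open) auto
  ultimately show ?thesis by (simp add: has_field_derivative_iff)
qed

lemma continuous_on_integral_dominated:
  fixes G :: "'z \<Rightarrow> 'a::euclidean_space \<Rightarrow> real"
  assumes c: "\<And>z. z \<in> space M \<Longrightarrow> continuous_on UNIV (G z)"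
    and m: "\<And>x. (\<lambda>z. G z x) \<in> borel_measurable M"
    and H: "\<And>R. \<exists>H. integrable M H \<and> (\<forall>x z. norm x \<le> R \<longrightarrow> z \<in> space M \<longrightarrow> \<bar>G z x\<bar> \<le> H z)"
  shows "continuous_on UNIV (\<lambda>x. LINT z|M. G z x)"
  unfolding continuous_on_sequentially
proof (intro ballI allI impI, elim conjE)
  fix X :: "nat \<Rightarrow> 'a" and x assume X: "X \<longlonglongrightarrow> x"
  then have "Bseq X" using convergentI convergent_imp_Bseq by blast
  then obtain R where R: "\<And>n. norm (X n) \<le> R" unfolding Bseq_def by auto
  obtain H where H: "integrable M H" "\<And>x z. norm x \<le> R \<Longrightarrow> z \<in> space M \<Longrightarrow> \<bar>G z x\<bar> \<le> H z"
    using assms(3)[of R] by auto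
  have "(\<lambda>n. LINT z|M. G z (X n)) \<longlonglongrightarrow> (LINT z|M. G z x)"
  proof (rule integral_dominated_convergence[where w=H])
    show "AE z in M. (\<lambda>n. G z (X n)) \<longlonglongrightarrow> G z x"
      using c X by (intro AE_I2) (auto simp: continuous_on_sequentially o_def)
    show "AE z in M. norm (G z (X n)) \<le> H z" for n
      using H R by (intro AE_I2) auto
  qed (use m H in auto)
  then show "((\<lambda>x. LINT z|M. G z x) \<circ> X) \<longlonglongrightarrow> (LINT z|M. G z x)" by (simp add: o_def)
qed

text \<open>One dominating function is asked for per list of directions and per ball. Local
  uniformity in x is enough, since continuity and differentiability at a point only see a bounded
  neighbourhood; it allows for bounds such as \<open>wt_shift\<close> whose constants depend on the
  radius.\<close>

lemma Ck_integral:
  fixes G :: "'z \<Rightarrow> 'a::euclidean_space \<Rightarrow> real"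
  assumes C: "\<And>z. z \<in> space M \<Longrightarrow> Ck N (G z)"
    and m: "\<And>bs x. set bs \<subseteq> Basis \<Longrightarrow> length bs \<le> N \<Longrightarrow> (\<lambda>z. pdiff bs (G z) x) \<in> borel_measurable M"
    and H: "\<And>bs R. set bs \<subseteq> Basis \<Longrightarrow> length bs \<le> N \<Longrightarrow>
      \<exists>H. integrable M H \<and> (\<forall>x z. norm x \<le> R \<longrightarrow> z \<in> space M \<longrightarrow> \<bar>pdiff bs (G z) x\<bar> \<le> H z)"
  shows "Ck N (\<lambda>x. LINT z|M. G z x)"
    and "set bs \<subseteq> Basis \<Longrightarrow> length bs \<le> N \<Longrightarrow>
      pdiff bs (\<lambda>x. LINT z|M. G z x) = (\<lambda>x. LINT z|M. pdiff bs (G z) x)"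
proof -
  have int: "integrable M (\<lambda>z. pdiff bs (G z) x)" if bs: "set bs \<subseteq> Basis" "length bs \<le> N" for bs x
  proof -
    obtain H where "integrable M H" "\<And>z. z \<in> space M \<Longrightarrow> \<bar>pdiff bs (G z) x\<bar> \<le> H z"
      using H[OF bs, of "norm x"] by auto
    then show ?thesis
      by (intro Bochner_Integration.integrable_bound[OF _ m[OF bs]]) (auto intro!: AE_I2, force)
  qed
  have der: "((\<lambda>t. LINT z|M. pdiff bs (G z) (x + t *\<^sub>R b)) has_field_derivative
      (LINT z|M. pdiff (b # bs) (G z) x)) (at 0)"
    if bs: "set bs \<subseteq> Basis" "length bs < N" "b \<in> Basis" for bs b x
  proof -
    obtain H where H: "integrable M H"
      "\<And>y z. norm y \<le> norm x + 1 \<Longrightarrow> z \<in> space M \<Longrightarrow> \<bar>pdiff (b # bs) (G z) y\<bar> \<le> H z"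
      using H[of "b # bs" "norm x + 1"] bs by auto
    have "((\<lambda>t. LINT z|M. pdiff bs (G z) (x + t *\<^sub>R b)) has_field_derivative
      (LINT z|M. pdiff (b # bs) (G z) (x + 0 *\<^sub>R b))) (at 0)"
    proof (rule DERIV_integral_dominated[where r=1 and H=H and G'="\<lambda>z t. pdiff (b # bs) (G z) (x + t *\<^sub>R b)"])
      show "integrable M (\<lambda>z. pdiff bs (G z) (x + t *\<^sub>R b))" for t using bs by (intro int) auto
      show "(\<lambda>z. pdiff (b # bs) (G z) (x + 0 *\<^sub>R b)) \<in> borel_measurable M" using bs by (intro m) auto
      show "((\<lambda>t. pdiff bs (G z) (x + t *\<^sub>R b)) has_real_derivative pdiff (b # bs) (G z) (x + t *\<^sub>R b)) (at t)"
        if "z \<in> space M" for z t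
      proof -
        have "Ck (Suc 0) (pdiff bs (G z))" using C[OF that] bs by (intro Ck_pdiff) (auto elim: Ck_mono)
        from Ck_DERIV_line[OF this bs(3), of x t] show ?thesis by simp
      qed
      show "\<bar>pdiff (b # bs) (G z) (x + t *\<^sub>R b)\<bar> \<le> H z" if "\<bar>t\<bar> < 1" "z \<in> space M" for z t
      proof (rule H(2))
        have "norm (t *\<^sub>R b) \<le> 1" using bs(3) that by simp
        then show "norm (x + t *\<^sub>R b) \<le> norm x + 1" using norm_triangle_ineq[of x "t *\<^sub>R b"] by simp
      qed (rule that)
    qed (use H in auto)
    then show ?thesis by simp
  qed
  have eq: "pdiff bs (\<lambda>x. LINT z|M. G z x) = (\<lambda>x. LINT z|M. pdiff bs (G z) x)"
    if "set bs \<subseteq> Basis" "length bs \<le> N" for bs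
    using that
  proof (induction bs)
    case (Cons b bs)
    have "pdiff (b # bs) (\<lambda>x. LINT z|M. G z x) = pdiff [b] (\<lambda>x. LINT z|M. pdiff bs (G z) x)"
      using Cons by simp
    also have "\<dots> = (\<lambda>x. LINT z|M. pdiff (b # bs) (G z) x)"
      by (rule pdiff1_eqI, rule der) (use Cons in auto)
    finally show ?case .
  qed simp
  then show "set bs \<subseteq> Basis \<Longrightarrow> length bs \<le> N \<Longrightarrow>
      pdiff bs (\<lambda>x. LINT z|M. G z x) = (\<lambda>x. LINT z|M. pdiff bs (G z) x)" .
  show "Ck N (\<lambda>x. LINT z|M. G z x)"
    unfolding Ck_def
  proof (intro allI impI conjI ballI, goal_cases)
    case (1 bs)
    show ?case unfolding eq[OF 1[THEN conjunct1] 1[THEN conjunct2]]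
      by (rule continuous_on_integral_dominated[OF Ck_pdiff_cont[OF C] m H]) (use 1 in auto)
  next
    case (2 bs b x)
    then show ?case
      unfolding eq[OF 2(1)[THEN conjunct1] 2(1)[THEN conjunct2]]
      using der[of bs b x] by (auto simp: real_differentiable_def simp del: pdiff.simps)
  qed
qed

section \<open>Integration on the half line and on Euclidean space\<close>

lemma nn_integral_affine:
  fixes f :: "'a::euclidean_space \<Rightarrow> ennreal"
  assumes [measurable]: "f \<in> borel_measurable borel" and c: "c \<noteq> 0"
  shows "(\<integral>\<^sup>+x. f x \<partial>lborel) = ennreal (\<bar>c\<bar> ^ DIM('a)) * (\<integral>\<^sup>+x. f (t + c *\<^sub>R x) \<partial>lborel)"
  by (subst lborel_affine[OF c, of t])
     (simp add: nn_integral_density nn_integral_distr nn_integral_cmult ennreal_power)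

lemma integrable_affine:
  fixes f :: "'a::euclidean_space \<Rightarrow> real"
  assumes f: "integrable lborel f" and c: "c \<noteq> 0"
  shows "integrable lborel (\<lambda>x. f (t + c *\<^sub>R x))"
proof -
  have m[measurable]: "f \<in> borel_measurable borel" using f by auto
  have "ennreal (\<bar>c\<bar> ^ DIM('a)) * (\<integral>\<^sup>+x. norm (f (t + c *\<^sub>R x)) \<partial>lborel) = (\<integral>\<^sup>+x. norm (f x) \<partial>lborel)"
    by (rule nn_integral_affine[symmetric]) (use c in auto)
  also have "\<dots> < \<infinity>" using f by (simp add: integrable_iff_bounded)
  finally have "(\<integral>\<^sup>+x. norm (f (t + c *\<^sub>R x)) \<partial>lborel) < \<infinity>"
    using c by (auto simp: ennreal_mult_less_top)
  then show ?thesis by (simp add: integrable_iff_bounded)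
qed

lemma integral_affine:
  fixes f :: "'a::euclidean_space \<Rightarrow> real"
  assumes [measurable]: "f \<in> borel_measurable borel" and c: "c \<noteq> 0"
  shows "(LINT x|lborel. f x) = \<bar>c\<bar> ^ DIM('a) * (LINT x|lborel. f (t + c *\<^sub>R x))"
  by (subst lborel_affine[OF c, of t])
     (simp add: integral_density integral_distr)

lemma nn_integral_shift:
  fixes f :: "'a::euclidean_space \<Rightarrow> ennreal"
  assumes "f \<in> borel_measurable borel"
  shows "(\<integral>\<^sup>+x. f (x + t) \<partial>lborel) = (\<integral>\<^sup>+x. f x \<partial>lborel)" "(\<integral>\<^sup>+x. f (x - t) \<partial>lborel) = (\<integral>\<^sup>+x. f x \<partial>lborel)"
    "(\<integral>\<^sup>+x. f (t - x) \<partial>lborel) = (\<integral>\<^sup>+x. f x \<partial>lborel)"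
  using nn_integral_affine[OF assms, of 1 t] nn_integral_affine[OF assms, of 1 "-t"]
    nn_integral_affine[OF assms, of "-1" t] by (simp_all add: add.commute)

lemma integrable_shift:
  fixes f :: "'a::euclidean_space \<Rightarrow> real"
  assumes "integrable lborel f"
  shows "integrable lborel (\<lambda>x. f (x + t))" "integrable lborel (\<lambda>x. f (x - t))" "integrable lborel (\<lambda>x. f (t - x))"
  using integrable_affine[OF assms, of 1 t] integrable_affine[OF assms, of 1 "-t"]
    integrable_affine[OF assms, of "-1" t] by (simp_all add: add.commute)

lemma integral_shift:
  fixes f :: "'a::euclidean_space \<Rightarrow> real"
  assumes "f \<in> borel_measurable borel"
  shows "(LINT x|lborel. f (x + t)) = (LINT x|lborel. f x)" "(LINT x|lborel. f (x - t)) = (LINT x|lborel. f x)"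
    "(LINT x|lborel. f (t - x)) = (LINT x|lborel. f x)"
  using integral_affine[OF assms, of 1 t] integral_affine[OF assms, of 1 "-t"]
    integral_affine[OF assms, of "-1" t] by (simp_all add: add.commute)

text \<open>Lebesgue measure on the open half line, encoded as a measure on all of
  \<open>borel\<close>: products, Fubini and measurability then need no restricted spaces, and
  \<open>AE_lpos\<close> restores t > 0 under the integral.\<close>

definition lpos :: "real measure" where "lpos = density lborel (indicator {0<..})"

lemma sets_lpos[simp, measurable_cong]: "sets lpos = sets borel"
  by (simp add: lpos_def)

lemma space_lpos[simp]: "space lpos = UNIV"
  by (simp add: lpos_def)

lemma AE_lpos: "AE t in lpos. 0 < t"
  unfolding lpos_def by (subst AE_density) (auto simp: indicator_def)

lemma nn_lpos: "f \<in> borel_measurable borel \<Longrightarrow> (\<integral>\<^sup>+t. f t \<partial>lpos) = (\<integral>\<^sup>+t. f t * indicator {0<..} t \<partial>lborel)"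
  unfolding lpos_def by (subst nn_integral_density) (auto simp: mult.commute)

lemma nn_lpos_cong: "(\<And>t. 0 < t \<Longrightarrow> f t = g t) \<Longrightarrow> (\<integral>\<^sup>+t. f t \<partial>lpos) = (\<integral>\<^sup>+t. g t \<partial>lpos)"
  using AE_lpos by (intro nn_integral_cong_AE) auto

lemma nn_lpos_mono: "(\<And>t. 0 < t \<Longrightarrow> f t \<le> g t) \<Longrightarrow> (\<integral>\<^sup>+t. f t \<partial>lpos) \<le> (\<integral>\<^sup>+t. g t \<partial>lpos)"
  using AE_lpos by (intro nn_integral_mono_AE) auto

lemma lpos_cong:
  fixes f g :: "real \<Rightarrow> real"
  assumes [measurable]: "f \<in> borel_measurable borel" "g \<in> borel_measurable borel"
    and "\<And>t. 0 < t \<Longrightarrow> f t = g t"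
  shows "(LINT t|lpos. f t) = (LINT t|lpos. g t)"
  using AE_lpos assms(3) by (intro integral_cong_AE) auto

lemma int_lpos:
  fixes f :: "real \<Rightarrow> real"
  assumes [measurable]: "f \<in> borel_measurable borel"
  shows "(LINT t|lpos. f t) = (LINT t:{0<..}|lborel. f t)"
    "integrable lpos f \<longleftrightarrow> set_integrable lborel {0<..} f"
proof -
  have *: "lpos = density lborel (\<lambda>t. ennreal (indicator {0<..} t))"
    unfolding lpos_def by (intro arg_cong2[where f=density]) (auto simp: indicator_def)
  show "(LINT t|lpos. f t) = (LINT t:{0<..}|lborel. f t)"
    unfolding * set_lebesgue_integral_def by (subst integral_density) auto
  show "integrable lpos f \<longleftrightarrow> set_integrable lborel {0<..} f"
    unfolding * set_integrable_def by (subst integrable_density) auto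
qed

interpretation lpos: sigma_finite_measure lpos
  unfolding lpos_def by (subst sigma_finite_measure.sigma_finite_iff_density_finite[OF sigma_finite_lborel]) (auto simp: indicator_def)
interpretation lpos_lpos: pair_sigma_finite lpos lpos ..
interpretation lpos_lborel: pair_sigma_finite lpos "lborel :: 'a::euclidean_space measure" ..
interpretation lborel_lpos: pair_sigma_finite "lborel :: 'a::euclidean_space measure" lpos ..

text \<open>Bridge to the gauge integral, in which the Gamma and Beta integrals and the change of
  variables are available.\<close>

lemma has_integral_lpos:
  fixes f :: "real \<Rightarrow> real"
  assumes [measurable]: "f \<in> borel_measurable borel" and nn: "\<And>t. 0 < t \<Longrightarrow> 0 \<le> f t"
  shows "(f has_integral b) {0<..} \<longleftrightarrow> (\<integral>\<^sup>+t. f t \<partial>lpos) = ennreal b \<and> 0 \<le> b"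
proof -
  let ?g = "\<lambda>t. if t \<in> {0<..} then f t else 0"
  have "(\<integral>\<^sup>+t. f t \<partial>lpos) = (\<integral>\<^sup>+t. ?g t \<partial>lborel)"
    by (subst nn_lpos) (auto intro!: nn_integral_cong simp: indicator_def)
  moreover have "(f has_integral b) {0<..} \<longleftrightarrow> (?g has_integral b) UNIV"
    by (rule has_integral_restrict_UNIV[symmetric])
  moreover have "?g \<in> borel_measurable borel" by measurable
  ultimately show ?thesis
    using has_integral_iff_nn_integral_lebesgue[of ?g b] nn
    by (auto simp: nn_integral_completion measurable_completion)
qed

text \<open>The substitution t = 1/r, with Jacobian 1/r^2. The value is a real number b, not an
  extended one, because the argument runs through absolutely convergent gauge integrals.\<close>

lemma nn_lpos_inverse:
  fixes f :: "real \<Rightarrow> real"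
  assumes m[measurable]: "f \<in> borel_measurable borel" and nn: "\<And>t. 0 < t \<Longrightarrow> 0 \<le> f t" and b: "0 \<le> b"
    and I: "(\<integral>\<^sup>+t. f (1 / t) / t\<^sup>2 \<partial>lpos) = ennreal b"
  shows "(\<integral>\<^sup>+t. f t \<partial>lpos) = ennreal b"
proof -
  let ?h = "\<lambda>t. f (1 / t) / t\<^sup>2"
  have im: "(\<lambda>t::real. 1 / t) ` {0<..} = {0<..}"
    by (auto simp: image_iff intro!: bexI[of _ "1 / _"])
  have "(?h has_integral b) {0<..}"
    by (subst has_integral_lpos) (use nn I b in auto)
  then have h: "((\<lambda>x. \<bar>- (1 / x\<^sup>2)\<bar> * f (1 / x)) has_integral b) {0<..}"
    by (simp add: field_simps)
  have "(\<lambda>x. \<bar>- (1 / x\<^sup>2)\<bar> * f (1 / x)) absolutely_integrable_on {0<..} \<and>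
      integral {0<..} (\<lambda>x. \<bar>- (1 / x\<^sup>2)\<bar> * f (1 / x)) = b"
    using h nn by (auto intro!: nonnegative_absolutely_integrable_1 has_integral_integrable)
  then have "f absolutely_integrable_on ((\<lambda>t. 1 / t) ` {0<..}) \<and> integral ((\<lambda>t. 1 / t) ` {0<..}) f = b"
    by (subst (asm) has_absolute_integral_change_of_variables_1')
       (auto intro!: derivative_eq_intros inj_onI simp: power2_eq_square)
  then have "(f has_integral b) {0<..}"
    unfolding im using has_integral_integral set_lebesgue_integral_eq_integral(1) by (metis)
  then show ?thesis
    by (subst (asm) has_integral_lpos) (use nn in auto)
qed

lemma nn_lpos_scale:
  assumes [measurable]: "f \<in> borel_measurable borel" and c: "0 < (c::real)"
  shows "(\<integral>\<^sup>+t. f t \<partial>lpos) = ennreal c * (\<integral>\<^sup>+t. f (c * t) \<partial>lpos)"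
proof -
  have "(\<integral>\<^sup>+t. f t \<partial>lpos) = (\<integral>\<^sup>+t. f t * indicator {0<..} t \<partial>lborel)" by (rule nn_lpos) simp
  also have "\<dots> = ennreal c * (\<integral>\<^sup>+t. f (0 + c * t) * indicator {0<..} (0 + c * t) \<partial>lborel)"
    using c by (subst nn_integral_real_affine[of _ c 0]) auto
  also have "(\<integral>\<^sup>+t. f (0 + c * t) * indicator {0<..} (0 + c * t) \<partial>lborel) = (\<integral>\<^sup>+t. f (c * t) \<partial>lpos)"
    using c by (subst nn_lpos) (auto intro!: nn_integral_cong simp: indicator_def zero_less_mult_iff)
  finally show ?thesis .
qed

lemma nn_lpos_Gamma:
  assumes a: "0 < a" and c: "0 < (c::real)"
  shows "(\<integral>\<^sup>+t. t powr (a - 1) * exp (- c * t) \<partial>lpos) = ennreal (Gamma a * c powr (- a))"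
proof -
  have G: "0 < Gamma a" using a by (rule Gamma_real_pos)
  have "((\<lambda>t. t powr (a - 1) / exp t) has_integral Gamma a) {0<..}"
  proof (subst has_integral_spike_set_eq[of _ "{0..}"])
    show "negligible {x \<in> {0<..} - {0..}. x powr (a - 1) / exp x \<noteq> 0}"
      by (rule negligible_subset[of "{}"]) auto
    show "negligible {x \<in> {0..} - {0<..}. x powr (a - 1) / exp x \<noteq> 0}"
      by (rule negligible_subset[of "{0}"]) auto
  qed (rule Gamma_integral_real[OF a])
  then have 1: "(\<integral>\<^sup>+t. t powr (a - 1) / exp t \<partial>lpos) = ennreal (Gamma a)"
    by (subst (asm) has_integral_lpos) auto
  have "(\<integral>\<^sup>+t. t powr (a - 1) * exp (- c * t) \<partial>lpos) =
      (\<integral>\<^sup>+t. ennreal (c powr (1 - a)) * ennreal ((c * t) powr (a - 1) / exp (c * t)) \<partial>lpos)"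
  proof (rule nn_lpos_cong)
    fix t :: real assume t: "0 < t"
    have "c powr (1 - a) * c powr (a - 1) = 1" using c by (simp add: powr_add[symmetric])
    then have "t powr (a - 1) * exp (- c * t) = c powr (1 - a) * ((c * t) powr (a - 1) / exp (c * t))"
      using t c by (simp add: powr_mult exp_minus field_simps)
    then show "ennreal (t powr (a - 1) * exp (- c * t)) = ennreal (c powr (1 - a)) * ennreal ((c * t) powr (a - 1) / exp (c * t))"
      by (simp add: ennreal_mult[symmetric])
  qed
  also have "\<dots> = ennreal (c powr (1 - a)) * (\<integral>\<^sup>+t. ennreal ((c * t) powr (a - 1) / exp (c * t)) \<partial>lpos)"
    by (rule nn_integral_cmult) measurable
  also have "\<dots> = ennreal (c powr (-a)) * (ennreal c * (\<integral>\<^sup>+t. ennreal ((c * t) powr (a - 1) / exp (c * t)) \<partial>lpos))"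
    using c powr_add[of c "-a" 1] by (simp add: mult.assoc[symmetric] ennreal_mult[symmetric])
  also have "ennreal c * (\<integral>\<^sup>+t. ennreal ((c * t) powr (a - 1) / exp (c * t)) \<partial>lpos) = ennreal (Gamma a)"
    using nn_lpos_scale[of "\<lambda>t. ennreal (t powr (a - 1) / exp t)" c] c 1 by simp
  finally show ?thesis using G by (simp add: ennreal_mult[symmetric] mult.commute)
qed

lemma nn_lpos_inv_Gamma:
  assumes a: "0 < a" and c: "0 < (c::real)"
  shows "(\<integral>\<^sup>+t. t powr (- a - 1) * exp (- c / t) \<partial>lpos) = ennreal (Gamma a * c powr (- a))"
proof (rule nn_lpos_inverse)
  show "0 \<le> Gamma a * c powr (- a)" using Gamma_real_pos[OF a] by simp
  have "(\<integral>\<^sup>+t. (1 / t) powr (- a - 1) * exp (- c / (1 / t)) / t\<^sup>2 \<partial>lpos) = (\<integral>\<^sup>+t. t powr (a - 1) * exp (- c * t) \<partial>lpos)"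
  proof (rule nn_lpos_cong)
    fix t :: real assume t: "0 < t"
    have "(1 / t) powr (- a - 1) = t powr (a + 1)" using t by (simp add: powr_divide divide_eq_eq powr_add[symmetric])
    also have "\<dots> = t powr (a - 1) * t\<^sup>2" using t by (simp add: powr_add[symmetric] add.commute flip: powr_numeral)
    finally show "ennreal ((1 / t) powr (- a - 1) * exp (- c / (1 / t)) / t\<^sup>2) = ennreal (t powr (a - 1) * exp (- c * t))"
      using t by simp
  qed
  then show "(\<integral>\<^sup>+t. (1 / t) powr (- a - 1) * exp (- c / (1 / t)) / t\<^sup>2 \<partial>lpos) = ennreal (Gamma a * c powr (- a))"
    using nn_lpos_Gamma[OF a c] by simp
qed auto

lemma nn_lpos_Beta:
  fixes u :: real
  assumes a: "0 < a" and b: "0 < b" and u: "0 < u"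
  shows "(\<integral>\<^sup>+t. (t powr (a - 1) * (u - t) powr (b - 1)) * indicator {..<u} t \<partial>lpos) = ennreal (Beta a b * u powr (a + b - 1))"
proof -
  have B: "0 \<le> Beta a b" using a b by (simp add: Beta_def Gamma_real_pos less_imp_le)
  let ?f = "\<lambda>t::real. (t powr (a - 1) * (1 - t) powr (b - 1)) * indicator {..<1} t"
  have "((\<lambda>t. t powr (a - 1) * (1 - t) powr (b - 1)) has_integral Beta a b) {0<..<1}"
    using has_integral_Beta_real[OF a b] by (simp add: has_integral_Icc_iff_Ioo)
  then have "((\<lambda>t. if t \<in> {0<..<1} then t powr (a - 1) * (1 - t) powr (b - 1) else 0) has_integral Beta a b) {0<..}"
    by (subst has_integral_restrict) auto
  then have "(\<integral>\<^sup>+t. (if t \<in> {0<..<1} then t powr (a - 1) * (1 - t) powr (b - 1) else 0) \<partial>lpos) = ennreal (Beta a b)"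
    by (subst (asm) has_integral_lpos) auto
  also have "(\<integral>\<^sup>+t. (if t \<in> {0<..<1} then t powr (a - 1) * (1 - t) powr (b - 1) else 0) \<partial>lpos) = (\<integral>\<^sup>+t. ?f t \<partial>lpos)"
    by (rule nn_lpos_cong) (auto simp: indicator_def)
  finally have 1: "(\<integral>\<^sup>+t. ?f t \<partial>lpos) = ennreal (Beta a b)" .
  have "(\<integral>\<^sup>+t. (t powr (a - 1) * (u - t) powr (b - 1)) * indicator {..<u} t \<partial>lpos) =
     ennreal u * (\<integral>\<^sup>+t. ((u * t) powr (a - 1) * (u - (u * t)) powr (b - 1)) * indicator {..<u} (u * t) \<partial>lpos)"
    by (rule nn_lpos_scale) (use u in auto)
  also have "(\<integral>\<^sup>+t. ((u * t) powr (a - 1) * (u - (u * t)) powr (b - 1)) * indicator {..<u} (u * t) \<partial>lpos) =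
     (\<integral>\<^sup>+t. ennreal (u powr (a + b - 2)) * ennreal (?f t) \<partial>lpos)"
  proof (rule nn_lpos_cong)
    fix t :: real assume t: "0 < t"
    have "((u * t) powr (a - 1) * (u - (u * t)) powr (b - 1)) * indicator {..<u} (u * t) = u powr (a + b - 2) * ?f t"
    proof (cases "t < 1")
      case True
      have "u - u * t = u * (1 - t)" by (simp add: algebra_simps)
      moreover have "u powr (a + b - 2) = u powr (a - 1) * u powr (b - 1)" by (simp add: powr_add[symmetric])
      ultimately show ?thesis using True u t by (simp add: powr_mult)
    qed (use u in \<open>auto simp: indicator_def\<close>)
    then show "ennreal (((u * t) powr (a - 1) * (u - (u * t)) powr (b - 1)) * indicator {..<u} (u * t)) = ennreal (u powr (a + b - 2)) * ennreal (?f t)"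
      by (simp add: ennreal_mult'[symmetric])
  qed
  also have "\<dots> = ennreal (u powr (a + b - 2)) * ennreal (Beta a b)"
    by (subst nn_integral_cmult) (use 1 in auto)
  also have "ennreal u * \<dots> = ennreal (Beta a b * u powr (a + b - 1))"
  proof -
    have "u * u powr (a + b - 2) = u powr (a + b - 1)" using u by (simp add: powr_mult_base)
    then show ?thesis using u B by (simp add: ennreal_mult[symmetric] mult.assoc[symmetric] mult.commute)
  qed
  finally show ?thesis .
qed

lemma nn_lpos_shift:
  assumes [measurable]: "f \<in> borel_measurable borel" and r: "0 < (r::real)"
  shows "(\<integral>\<^sup>+t. f t \<partial>lpos) = (\<integral>\<^sup>+u. f (u - r) * indicator {r<..} u \<partial>lpos)"
proof -
  have "(\<integral>\<^sup>+t. f t \<partial>lpos) = (\<integral>\<^sup>+t. f t * indicator {0<..} t \<partial>lborel)" by (rule nn_lpos) simp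
  also have "\<dots> = (\<integral>\<^sup>+t. f (t - r) * indicator {0<..} (t - r) \<partial>lborel)"
    by (rule nn_integral_shift(2)[symmetric]) simp
  also have "\<dots> = (\<integral>\<^sup>+u. f (u - r) * indicator {r<..} u \<partial>lpos)"
    using r by (subst nn_lpos) (auto intro!: nn_integral_cong simp: indicator_def)
  finally show ?thesis .
qed

lemma lpos_shift:
  fixes f :: "real \<Rightarrow> real"
  assumes [measurable]: "f \<in> borel_measurable borel" and r: "0 < (r::real)"
  shows "(LINT t|lpos. f t) = (LINT u|lpos. f (u - r) * indicator {r<..} u)"
proof -
  have "(LINT t|lpos. f t) = (LINT t|lborel. indicator {0<..} t * f t)"
    by (subst int_lpos) (auto simp: set_lebesgue_integral_def)
  also have "\<dots> = (LINT t|lborel. indicator {0<..} (t - r) * f (t - r))"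
    by (rule integral_shift(2)[symmetric]) simp
  also have "\<dots> = (LINT u|lpos. f (u - r) * indicator {r<..} u)"
    using r by (subst int_lpos) (auto intro!: Bochner_Integration.integral_cong simp: set_lebesgue_integral_def indicator_def)
  finally show ?thesis .
qed

text \<open>Fubini after the substitution u = r + t: the inner integral over 0 < r < u is the
  convolution W of the two weights. Since g and h are nonnegative, integrability of
  \<open>W u * \<psi> u\<close> is precisely absolute convergence of the double integral, so \<psi>
  may change sign. The two weights of interest are a pair of powers (Beta integral) and
  \<open>kb\<close> with a power (\<open>kb_conv\<close>).\<close>

lemma conv_lpos:
  fixes g h \<psi> W :: "real \<Rightarrow> real"
  assumes [measurable]: "g \<in> borel_measurable borel" "h \<in> borel_measurable borel"
      "\<psi> \<in> borel_measurable borel" "W \<in> borel_measurable borel"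
    and nn: "\<And>t. 0 < t \<Longrightarrow> 0 \<le> g t" "\<And>t. 0 < t \<Longrightarrow> 0 \<le> h t" "\<And>t. 0 < t \<Longrightarrow> 0 \<le> W t"
    and w: "\<And>u. 0 < u \<Longrightarrow> (\<integral>\<^sup>+r. g r * h (u - r) * indicator {..<u} r \<partial>lpos) = ennreal (W u)"
    and int: "integrable lpos (\<lambda>u. W u * \<psi> u)"
  shows "(LINT r|lpos. g r * (LINT t|lpos. h t * \<psi> (r + t))) = (LINT u|lpos. W u * \<psi> u)" (is ?A)
    and "integrable lpos (\<lambda>r. g r * (LINT t|lpos. h t * \<psi> (r + t)))" (is ?B)
proof -
  define F where "F r u = g r * h (u - r) * indicator {..<u} r * \<psi> u" for r u
  have [measurable]: "(\<lambda>(r, u). F r u) \<in> borel_measurable (borel \<Otimes>\<^sub>M borel)"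
    unfolding F_def indicator_def lessThan_iff of_bool_def by measurable
  have inner: "g r * (LINT t|lpos. h t * \<psi> (r + t)) = (LINT u|lpos. F r u)" if "0 < r" for r
    using that unfolding F_def
    by (subst lpos_shift[of _ r])
       (auto simp flip: integral_mult_right_zero intro!: Bochner_Integration.integral_cong simp: indicator_def)
  have W: "(\<integral>\<^sup>+r. norm (F r u) \<partial>lpos) = ennreal (norm (W u * \<psi> u))" if u: "0 < u" for u
  proof -
    have "(\<integral>\<^sup>+r. norm (F r u) \<partial>lpos) = (\<integral>\<^sup>+r. ennreal (g r * h (u - r) * indicator {..<u} r) * ennreal \<bar>\<psi> u\<bar> \<partial>lpos)"
      by (rule nn_lpos_cong) (use nn in \<open>auto simp: F_def abs_mult ennreal_mult[symmetric] indicator_def\<close>)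
    also have "\<dots> = ennreal (W u) * ennreal \<bar>\<psi> u\<bar>"
      by (subst nn_integral_multc) (use w[OF u] in auto)
    finally show ?thesis using nn(3)[OF u] by (simp add: abs_mult ennreal_mult[symmetric])
  qed
  have "(\<integral>\<^sup>+z. norm (case z of (r, u) \<Rightarrow> F r u) \<partial>(lpos \<Otimes>\<^sub>M lpos)) = (\<integral>\<^sup>+u. \<integral>\<^sup>+r. norm (F r u) \<partial>lpos \<partial>lpos)"
    by (subst lpos_lpos.nn_integral_snd[symmetric]) auto
  also have "\<dots> = (\<integral>\<^sup>+u. norm (W u * \<psi> u) \<partial>lpos)" by (rule nn_lpos_cong) (rule W)
  also have "\<dots> < \<infinity>" using int by (simp add: integrable_iff_bounded)
  finally have iF: "integrable (lpos \<Otimes>\<^sub>M lpos) (case_prod F)"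
    by (subst integrable_iff_bounded) auto
  have sl: "(LINT r|lpos. F r u) = W u * \<psi> u" if u: "0 < u" for u
  proof -
    have "(LINT r|lpos. g r * h (u - r) * indicator {..<u} r) = enn2real (\<integral>\<^sup>+r. ennreal (g r * h (u - r) * indicator {..<u} r) \<partial>lpos)"
      by (rule integral_eq_nn_integral) (use AE_lpos nn in \<open>auto simp: indicator_def\<close>)
    then show ?thesis unfolding F_def using w[OF u] nn(3)[OF u] by simp
  qed
  have mI: "(\<lambda>r. LINT t|lpos. h t * \<psi> (r + t)) \<in> borel_measurable borel"
    by (rule lpos.borel_measurable_lebesgue_integral) measurable
  have "(LINT r|lpos. g r * (LINT t|lpos. h t * \<psi> (r + t))) = (LINT r|lpos. LINT u|lpos. F r u)"
    by (rule lpos_cong) (use inner mI in \<open>auto intro!: lpos.borel_measurable_lebesgue_integral\<close>)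
  also have "\<dots> = (LINT u|lpos. LINT r|lpos. F r u)"
    using lpos_lpos.Fubini_integral[OF iF] ..
  also have "\<dots> = (LINT u|lpos. W u * \<psi> u)"
    by (rule lpos_cong) (use sl in \<open>auto intro!: lpos.borel_measurable_lebesgue_integral\<close>)
  finally show ?A .
  have "integrable lpos (\<lambda>r. LINT u|lpos. F r u)"
    using lpos_lpos.integrable_fst[OF iF] .
  moreover have "AE r in lpos. g r * (LINT t|lpos. h t * \<psi> (r + t)) = (LINT u|lpos. F r u)"
    using AE_lpos by eventually_elim (rule inner)
  ultimately show ?B
    using mI by (subst integrable_cong_AE[of _ _ "\<lambda>r. LINT u|lpos. F r u"])
      (auto intro!: lpos.borel_measurable_lebesgue_integral)
qed

lemma integrable_lpos_bound:
  fixes f :: "real \<Rightarrow> real"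
  assumes "integrable lpos g" "f \<in> borel_measurable borel" "\<And>t. 0 < t \<Longrightarrow> \<bar>f t\<bar> \<le> g t"
  shows "integrable lpos f"
proof (rule Bochner_Integration.integrable_bound[OF assms(1)])
  show "AE t in lpos. norm (f t) \<le> norm (g t)"
    using AE_lpos by eventually_elim (use assms(3) in \<open>force\<close>)
qed (use assms(2) in simp)

text \<open>Compares with t^p near 0 and with t^(p-q) near infinity. On these pieces 1 + t,
  respectively (1 + t)/t, lies in [1, 2], and \<open>max 1 (2 powr (- q))\<close> bounds its power
  for either sign of q.\<close>

lemma integrable_lpos_powr:
  assumes p: "-1 < p" and q: "p - q < -1"
  shows "integrable lpos (\<lambda>t. t powr p * (1 + t) powr (- q))"
proof (rule integrable_lpos_bound)
  have "set_integrable lborel {0..1} (\<lambda>t::real. t powr p)"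
  proof -
    have "((\<lambda>x. x powr p) has_integral (1 powr (p+1) / (p+1))) {0..(1::real)}"
      by (rule has_integral_powr_from_0[OF p]) simp
    then have "(\<integral>\<^sup>+x. ennreal (indicator {0..1} x * x powr p) \<partial>lborel) = ennreal (1 powr (p+1) / (p+1))"
      by (intro nn_integral_has_integral_lebesgue) auto
    then show ?thesis unfolding set_integrable_def
      by (intro integrableI_nonneg) (auto simp: ennreal_mult'' ennreal_indicator)
  qed
  moreover have "set_integrable lborel {1..} (\<lambda>t::real. t powr (p - q))"
  proof -
    have "((\<lambda>x. x powr (p - q)) has_integral -(1 powr (p-q+1)) / (p-q+1)) {(1::real)..}"
      by (rule has_integral_powr_to_inf[OF q]) simp
    then have "(\<integral>\<^sup>+x. ennreal (indicator {1..} x * x powr (p-q)) \<partial>lborel) = ennreal (-(1 powr (p-q+1)) / (p-q+1))"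
      by (intro nn_integral_has_integral_lebesgue) auto
    then show ?thesis unfolding set_integrable_def
      by (intro integrableI_nonneg) (auto simp: ennreal_mult'' ennreal_indicator)
  qed
  ultimately have "integrable lborel (\<lambda>t::real. max 1 (2 powr (-q)) * (indicator {0..1} t *\<^sub>R t powr p) + max 1 (2 powr (-q)) * (indicator {1..} t *\<^sub>R t powr (p - q)))"
    unfolding set_integrable_def by auto
  then show "integrable lpos (\<lambda>t::real. max 1 (2 powr (-q)) * (indicator {0..1} t *\<^sub>R t powr p) + max 1 (2 powr (-q)) * (indicator {1..} t *\<^sub>R t powr (p - q)))"
    by (subst int_lpos(2), measurable, unfold set_integrable_def, intro integrable_mult_indicator) auto
  fix t :: real assume t: "0 < t"
  show "\<bar>t powr p * (1 + t) powr (- q)\<bar> \<le> max 1 (2 powr (-q)) * (indicator {0..1} t *\<^sub>R t powr p) + max 1 (2 powr (-q)) * (indicator {1..} t *\<^sub>R t powr (p - q))"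
  proof (cases "t < 1")
    case True
    have "(1 + t) powr (-q) \<le> max 1 (2 powr (-q))"
    proof (cases "q \<ge> 0")
      case True then show ?thesis using t powr_mono2'[of "-q" 1 "1+t"] by simp
    next
      case False then show ?thesis using t \<open>t < 1\<close> powr_mono2[of "-q" "1+t" 2] by simp
    qed
    then show ?thesis using True t by (simp add: indicator_def mult.commute mult_left_mono)
  next
    case False
    have "((1 + t) / t) powr (-q) \<le> max 1 (2 powr (-q))"
    proof (cases "q \<ge> 0")
      case True then show ?thesis using t powr_mono2'[of "-q" 1 "(1+t)/t"] by (simp add: field_simps)
    next
      case F: False then show ?thesis using t False powr_mono2[of "-q" "(1+t)/t" 2] by (simp add: field_simps)
    qed
    then have "t powr (p - q) * ((1 + t) / t) powr (-q) \<le> t powr (p - q) * max 1 (2 powr (-q))"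
      by (intro mult_left_mono) auto
    moreover have "t powr (p - q) * ((1 + t) / t) powr (-q) = t powr p * (1 + t) powr (-q)"
      using t by (simp add: powr_divide powr_diff powr_minus field_simps)
    ultimately have "t powr p * (1 + t) powr (-q) \<le> max 1 (2 powr (-q)) * t powr (p - q)" by (simp add: mult.commute)
    moreover have "0 \<le> max 1 (2 powr (-q)) * (indicator {0..1} t *\<^sub>R t powr p)" by simp
    moreover have i: "indicator {1..} t *\<^sub>R t powr (p - q) = t powr (p - q)" using False by simp
    moreover have "\<bar>t powr p * (1 + t) powr (- q)\<bar> = t powr p * (1 + t) powr (- q)" by simp
    ultimately show ?thesis unfolding i by linarith
  qed
qed measurable

text \<open>The Weyl fractional integral; on \<open>t \<mapsto> exp (- l * t)\<close> it acts as multiplication by \<open>l powr (- a)\<close>.\<close>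

definition RL :: "real \<Rightarrow> (real \<Rightarrow> real) \<Rightarrow> real \<Rightarrow> real" where
  "RL a \<psi> q = (LINT t|lpos. t powr (a - 1) * \<psi> (q + t)) / Gamma a"

lemma RL_integrable:
  assumes [measurable]: "\<psi> \<in> borel_measurable borel" and "0 < a" "a < p" "0 \<le> q"
    and b: "\<And>t. 0 \<le> t \<Longrightarrow> \<bar>\<psi> t\<bar> \<le> C * (1 + t) powr (- p)"
  shows "integrable lpos (\<lambda>t. t powr (a - 1) * \<psi> (q + t))"
proof (rule integrable_lpos_bound)
  have "0 \<le> C" using b[of 0] by simp
  show "integrable lpos (\<lambda>t. C * (t powr (a - 1) * (1 + t) powr (- p)))"
    using assms by (intro integrable_mult_right integrable_lpos_powr) auto
  fix t :: real assume t: "0 < t"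
  have "\<bar>\<psi> (q + t)\<bar> \<le> C * (1 + (q + t)) powr (- p)" using b[of "q + t"] t assms by simp
  also have "\<dots> \<le> C * (1 + t) powr (- p)"
    using assms t \<open>0 \<le> C\<close> by (intro mult_left_mono powr_mono2') auto
  finally show "\<bar>t powr (a - 1) * \<psi> (q + t)\<bar> \<le> C * (t powr (a - 1) * (1 + t) powr (- p))"
    using mult_left_mono[of _ _ "t powr (a - 1)"] by (fastforce simp: abs_mult mult_ac)
qed measurable

lemma RL_measurable[measurable]:
  assumes [measurable]: "\<psi> \<in> borel_measurable borel"
  shows "RL a \<psi> \<in> borel_measurable borel"
  unfolding RL_def by (intro borel_measurable_divide lpos.borel_measurable_lebesgue_integral) measurable

text \<open>The Beta integral is the convolution of the two power weights, and Beta is the quotient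
  of Gamma values that the normalisations require. Decay of order p > a + b makes the combined
  integral converge absolutely; the second claim records convergence of the outer integral, which
  the value of a Bochner integral alone does not reveal.\<close>

lemma RL_semigroup:
  assumes [measurable]: "\<psi> \<in> borel_measurable borel" and ab: "0 < a" "0 < b" "a + b < p" and q: "0 \<le> q"
    and bd: "\<And>t. 0 \<le> t \<Longrightarrow> \<bar>\<psi> t\<bar> \<le> C * (1 + t) powr (- p)"
  shows "RL a (RL b \<psi>) q = RL (a + b) \<psi> q"
    and "integrable lpos (\<lambda>t. t powr (a - 1) * RL b \<psi> (q + t))"
proof -
  have B: "Beta a b = Gamma a * Gamma b / Gamma (a + b)" by (simp add: Beta_def)
  have G: "0 < Gamma a" "0 < Gamma b" "0 < Gamma (a + b)" using ab by (auto intro!: Gamma_real_pos)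
  have B0: "0 \<le> Beta a b" using G by (simp add: B)
  have i: "integrable lpos (\<lambda>u. (Beta a b * u powr (a + b - 1)) * \<psi> (q + u))"
    using integrable_mult_right[OF RL_integrable[OF assms(1) _ ab(3) q bd], of "Beta a b"] ab
    by (simp add: mult_ac)
  have w: "(\<integral>\<^sup>+r. (r powr (a - 1) * (u - r) powr (b - 1)) * indicator {..<u} r \<partial>lpos) = ennreal (Beta a b * u powr (a + b - 1))"
    if "0 < u" for u :: real using nn_lpos_Beta[OF ab(1,2) that] .
  note c = conv_lpos[where g="\<lambda>r. r powr (a - 1)" and h="\<lambda>t. t powr (b - 1)" and \<psi>="\<lambda>t. \<psi> (q + t)"
    and W="\<lambda>u. Beta a b * u powr (a + b - 1)", OF _ _ _ _ _ _ _ w i]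
  have 1: "(LINT r|lpos. r powr (a - 1) * (LINT t|lpos. t powr (b - 1) * \<psi> (q + (r + t)))) =
     (LINT u|lpos. (Beta a b * u powr (a + b - 1)) * \<psi> (q + u))"
    by (rule c(1)) (use B0 in auto)
  have 2: "integrable lpos (\<lambda>r. r powr (a - 1) * (LINT t|lpos. t powr (b - 1) * \<psi> (q + (r + t))))"
    by (rule c(2)) (use B0 in auto)
  show "RL a (RL b \<psi>) q = RL (a + b) \<psi> q"
    using 1 G unfolding RL_def by (simp add: B add.assoc mult.assoc field_simps)
  show "integrable lpos (\<lambda>t. t powr (a - 1) * RL b \<psi> (q + t))"
    using 2 unfolding RL_def by (simp add: add.assoc)
qed

section \<open>Integrals of powers of the norm\<close>

lemma nn_lpos_powr_tail:
  assumes p: "0 < p" and r: "0 < (r::real)"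
  shows "(\<integral>\<^sup>+t. ennreal (t powr (- p - 1)) * indicator {r..} t \<partial>lpos) = ennreal (r powr (- p) / p)"
proof -
  have "((\<lambda>x. x powr (- p - 1)) has_integral -(r powr (- p - 1 + 1)) / (- p - 1 + 1)) {r..}"
    by (rule has_integral_powr_to_inf) (use p r in auto)
  then have "(\<integral>\<^sup>+x. ennreal (indicator {r..} x * x powr (- p - 1)) \<partial>lborel) = ennreal (-(r powr (- p - 1 + 1)) / (- p - 1 + 1))"
    by (intro nn_integral_has_integral_lebesgue) auto
  moreover have "(\<integral>\<^sup>+t. ennreal (t powr (- p - 1)) * indicator {r..} t \<partial>lpos) = (\<integral>\<^sup>+x. ennreal (indicator {r..} x * x powr (- p - 1)) \<partial>lborel)"
    using r by (subst nn_lpos) (auto intro!: nn_integral_cong simp: indicator_def)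
  ultimately show ?thesis by simp
qed

lemma nn_lpos_powr_init:
  assumes p: "0 < p" and r: "0 < (r::real)"
  shows "(\<integral>\<^sup>+t. ennreal (t powr (p - 1)) * indicator {..r} t \<partial>lpos) = ennreal (r powr p / p)"
proof -
  have "((\<lambda>x. x powr (p - 1)) has_integral (r powr (p - 1 + 1) / (p - 1 + 1))) {0..r}"
    by (rule has_integral_powr_from_0) (use p r in auto)
  then have "(\<integral>\<^sup>+x. ennreal (indicator {0..r} x * x powr (p - 1)) \<partial>lborel) = ennreal (r powr (p - 1 + 1) / (p - 1 + 1))"
    by (intro nn_integral_has_integral_lebesgue) auto
  moreover have "(\<integral>\<^sup>+t. ennreal (t powr (p - 1)) * indicator {..r} t \<partial>lpos) = (\<integral>\<^sup>+x. ennreal (indicator {0..r} x * x powr (p - 1)) \<partial>lborel)"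
    using r by (subst nn_lpos) (auto intro!: nn_integral_cong simp: indicator_def)
  ultimately show ?thesis by simp
qed

text \<open>Layer formula in place of polar coordinates: |z|^(-p) is the integral of p t^(-p-1) over
  t \<ge> |z|. After exchanging the integrals the section at height t is the ball of radius min(t,
  r), and the ranges t \<le> r and t \<ge> r give the two summands of the constant. The explicit
  power of r is needed when a mollifier is concentrated at scale r.\<close>

lemma nn_norm_powr_near:
  assumes p: "0 < p" "p < real DIM('a::euclidean_space)"
  shows "\<exists>C\<ge>0. \<forall>r>0. (\<integral>\<^sup>+z. ennreal (norm z powr (- p)) * indicator (cball 0 r) z \<partial>(lborel::'a measure)) \<le> ennreal (C * r powr (real DIM('a) - p))"
proof -
  define n where "n = real DIM('a)"
  define w where "w = unit_ball_vol n"
  have w: "w > 0" unfolding w_def n_def by simp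
  show ?thesis
  proof (intro exI[of _ "p * w / (n - p) + w"] conjI allI impI)
    show "0 \<le> p * w / (n - p) + w" using p w by (auto simp: n_def intro!: add_nonneg_nonneg divide_nonneg_nonneg)
    fix r :: real assume r: "0 < r"
    have "(\<integral>\<^sup>+z. ennreal (norm z powr (- p)) * indicator (cball 0 r) z \<partial>(lborel::'a measure)) \<le>
      (\<integral>\<^sup>+z. \<integral>\<^sup>+t. ennreal (p * t powr (- p - 1)) * (indicator {norm z..} t * indicator (cball 0 r) z) \<partial>lpos \<partial>(lborel::'a measure))"
    proof (rule nn_integral_mono)
      fix z :: 'a
      show "ennreal (norm z powr (- p)) * indicator (cball 0 r) z \<le> (\<integral>\<^sup>+t. ennreal (p * t powr (- p - 1)) * (indicator {norm z..} t * indicator (cball 0 r) z) \<partial>lpos)"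
      \<comment> \<open>At the origin \<open>0 powr (- p)\<close> is 0, so the layer formula matters
        only away from it.\<close>
      proof (cases "z = 0")
        case False
        have "(\<integral>\<^sup>+t. ennreal (p * t powr (- p - 1)) * (indicator {norm z..} t * indicator (cball 0 r) z) \<partial>lpos) =
          (\<integral>\<^sup>+t. (ennreal p * indicator (cball 0 r) z) * (ennreal (t powr (- p - 1)) * indicator {norm z..} t) \<partial>lpos)"
          using p by (intro nn_integral_cong) (auto simp: ennreal_mult mult_ac)
        also have "\<dots> = (ennreal p * indicator (cball 0 r) z) * ennreal (norm z powr (- p) / p)"
          using False p by (subst nn_integral_cmult) (auto simp: nn_lpos_powr_tail)
        also have "\<dots> = (ennreal p * ennreal (norm z powr (- p) / p)) * indicator (cball 0 r) z"
          by (simp only: mult_ac)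
        also have "ennreal p * ennreal (norm z powr (- p) / p) = ennreal (norm z powr (- p))"
          using p by (simp add: ennreal_mult[symmetric])
        finally show ?thesis by simp
      qed simp
    qed
    also have "\<dots> = (\<integral>\<^sup>+t. \<integral>\<^sup>+z. ennreal (p * t powr (- p - 1)) * (indicator {norm z..} t * indicator (cball 0 r) z) \<partial>(lborel::'a measure) \<partial>lpos)"
    proof (rule lborel_lpos.Fubini'[symmetric])
      have "(\<lambda>x. ennreal (p * snd x powr (- p - 1)) * (of_bool (norm (fst x) \<le> snd x) * of_bool (norm (fst x) \<le> r))) \<in> borel_measurable (lborel \<Otimes>\<^sub>M lpos)"
        unfolding of_bool_def by measurable
      then show "(\<lambda>(z::'a, t). ennreal (p * t powr (- p - 1)) * (indicator {norm z..} t * indicator (cball 0 r) z)) \<in> borel_measurable (lborel \<Otimes>\<^sub>M lpos)"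
        by (simp add: indicator_def split_beta')
    qed
    also have "\<dots> \<le> (\<integral>\<^sup>+t. ennreal (p * w) * (ennreal (t powr (n - p - 1)) * indicator {..r} t) + ennreal (p * w * r powr n) * (ennreal (t powr (- p - 1)) * indicator {r..} t) \<partial>lpos)"
    proof (rule nn_lpos_mono)
      fix t :: real assume t: "0 < t"
      have vol: "emeasure lborel (cball (0::'a) \<rho>) = ennreal (w * \<rho> powr n)" if "0 < \<rho>" for \<rho>
        using emeasure_cball[of \<rho> "0::'a"] that by (simp add: w_def n_def powr_realpow)
      have "(\<integral>\<^sup>+z. ennreal (p * t powr (- p - 1)) * (indicator {norm z..} t * indicator (cball 0 r) z) \<partial>(lborel::'a measure)) \<le>
        (\<integral>\<^sup>+z. ennreal (p * t powr (- p - 1)) * indicator (cball 0 (min t r)) z \<partial>(lborel::'a measure))"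
        by (intro nn_integral_mono) (auto simp: indicator_def)
      also have "\<dots> = ennreal (p * t powr (- p - 1)) * ennreal (w * (min t r) powr n)"
        using t r by (subst nn_integral_cmult_indicator) (auto simp: vol)
      also have "\<dots> \<le> ennreal (p * w) * (ennreal (t powr (n - p - 1)) * indicator {..r} t) + ennreal (p * w * r powr n) * (ennreal (t powr (- p - 1)) * indicator {r..} t)"
      proof (cases "t \<le> r")
        case True
        have "(p * t powr (- p - 1)) * (w * t powr n) = p * w * t powr (n - p - 1)"
          using powr_add[of t "- p - 1" n, symmetric] by (simp add: algebra_simps)
        then have "ennreal (p * t powr (- p - 1)) * ennreal (w * (min t r) powr n) = ennreal (p * w) * (ennreal (t powr (n - p - 1)) * indicator {..r} t)"
          using True p w t by (simp add: ennreal_mult[symmetric] min_def)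
        then show ?thesis by (simp add: add_increasing2)
      next
        case False
        have "(p * t powr (- p - 1)) * (w * r powr n) = p * w * r powr n * t powr (- p - 1)" by simp
        then have "ennreal (p * t powr (- p - 1)) * ennreal (w * (min t r) powr n) = ennreal (p * w * r powr n) * (ennreal (t powr (- p - 1)) * indicator {r..} t)"
          using False p w t by (simp add: ennreal_mult[symmetric] min_def)
        then show ?thesis by (simp add: add_increasing)
      qed
      finally show "(\<integral>\<^sup>+z. ennreal (p * t powr (- p - 1)) * (indicator {norm z..} t * indicator (cball 0 r) z) \<partial>(lborel::'a measure)) \<le> 
         ennreal (p * w) * (ennreal (t powr (n - p - 1)) * indicator {..r} t) + ennreal (p * w * r powr n) * (ennreal (t powr (- p - 1)) * indicator {r..} t)" .
    qed
    also have "\<dots> = ennreal (p * w) * ennreal (r powr (n - p) / (n - p)) + ennreal (p * w * r powr n) * ennreal (r powr (- p) / p)"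
      using nn_lpos_powr_init[of "n - p" r] nn_lpos_powr_tail[of p r] p r
      by (subst nn_integral_add) (auto simp: nn_integral_cmult n_def)
    also have "\<dots> = ennreal (p * w * (r powr (n - p) / (n - p)) + p * w * r powr n * (r powr (- p) / p))"
      using p w by (simp add: ennreal_mult[symmetric] n_def)
    also have "p * w * (r powr (n - p) / (n - p)) + p * w * r powr n * (r powr (- p) / p) = (p * w / (n - p) + w) * r powr (n - p)"
    proof -
      have "r powr n * r powr (- p) = r powr (n - p)" using r by (simp add: powr_add[symmetric])
      then have "p * w * r powr n * (r powr (- p) / p) = w * r powr (n - p)" using p by simp
      then show ?thesis by (simp add: algebra_simps)
    qed
    finally show "(\<integral>\<^sup>+z. ennreal (norm z powr (- p)) * indicator (cball 0 r) z \<partial>(lborel::'a measure)) \<le> ennreal ((p * w / (n - p) + w) * r powr (real DIM('a) - p))"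
      by (simp add: n_def)
  qed
qed

text \<open>The same layer formula: the section at height t is empty for t < 1 and contained in the
  ball of radius t otherwise, which leaves the tail of t^(n-p-1), integrable since p > n.\<close>

lemma nn_norm_powr_far:
  assumes p: "real DIM('a::euclidean_space) < p"
  shows "(\<integral>\<^sup>+z. ennreal (norm z powr (- p)) * indicator {z. 1 \<le> norm z} z \<partial>(lborel::'a measure)) < \<infinity>"
proof -
  define n where "n = real DIM('a)"
  define w where "w = unit_ball_vol n"
  have w: "w > 0" unfolding w_def n_def by simp
  have p0: "0 < p" using p by (meson of_nat_0_le_iff le_less_trans)
  have "(\<integral>\<^sup>+z. ennreal (norm z powr (- p)) * indicator {z. 1 \<le> norm z} z \<partial>(lborel::'a measure)) \<le>
      (\<integral>\<^sup>+z. \<integral>\<^sup>+t. ennreal (p * t powr (- p - 1)) * (indicator {norm z..} t * indicator {z. 1 \<le> norm z} z) \<partial>lpos \<partial>(lborel::'a measure))"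
  proof (rule nn_integral_mono)
    fix z :: 'a
    show "ennreal (norm z powr (- p)) * indicator {z. 1 \<le> norm z} z \<le> (\<integral>\<^sup>+t. ennreal (p * t powr (- p - 1)) * (indicator {norm z..} t * indicator {z. 1 \<le> norm z} z) \<partial>lpos)"
    proof (cases "1 \<le> norm z")
      case True
      then have "(\<integral>\<^sup>+t. ennreal (p * t powr (- p - 1)) * (indicator {norm z..} t * indicator {z. 1 \<le> norm z} z) \<partial>lpos) =
          (\<integral>\<^sup>+t. ennreal p * (ennreal (t powr (- p - 1)) * indicator {norm z..} t) \<partial>lpos)"
        using p0 by (intro nn_integral_cong) (auto simp: ennreal_mult mult_ac)
      also have "\<dots> = ennreal p * ennreal (norm z powr (- p) / p)"
        using True p0 nn_lpos_powr_tail[of p "norm z", OF p0 less_le_trans[OF zero_less_one True]] by (subst nn_integral_cmult) auto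
      also have "\<dots> = ennreal (norm z powr (- p))"
        using p0 by (simp add: ennreal_mult[symmetric])
      finally show ?thesis using True by simp
    qed simp
  qed
  also have "\<dots> = (\<integral>\<^sup>+t. \<integral>\<^sup>+z. ennreal (p * t powr (- p - 1)) * (indicator {norm z..} t * indicator {z. 1 \<le> norm z} z) \<partial>(lborel::'a measure) \<partial>lpos)"
  proof (rule lborel_lpos.Fubini'[symmetric])
    have "(\<lambda>x. ennreal (p * snd x powr (- p - 1)) * (of_bool (norm (fst x) \<le> snd x) * of_bool (1 \<le> norm (fst x)))) \<in> borel_measurable (lborel \<Otimes>\<^sub>M lpos)"
      unfolding of_bool_def by measurable
    then show "(\<lambda>(z::'a, t). ennreal (p * t powr (- p - 1)) * (indicator {norm z..} t * indicator {z. 1 \<le> norm z} z)) \<in> borel_measurable (lborel \<Otimes>\<^sub>M lpos)"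
      by (simp add: indicator_def split_beta')
  qed
  also have "\<dots> \<le> (\<integral>\<^sup>+t. ennreal (p * w) * (ennreal (t powr (- (p - n) - 1)) * indicator {1..} t) \<partial>lpos)"
  proof (rule nn_lpos_mono)
    fix t :: real assume t: "0 < t"
    have vol: "emeasure lborel (cball (0::'a) t) = ennreal (w * t powr n)"
      using emeasure_cball[of t "0::'a"] t by (simp add: w_def n_def powr_realpow)
    have "(\<integral>\<^sup>+z. ennreal (p * t powr (- p - 1)) * (indicator {norm z..} t * indicator {z. 1 \<le> norm z} z) \<partial>(lborel::'a measure)) \<le>
        (\<integral>\<^sup>+z. (ennreal (p * t powr (- p - 1)) * indicator {1..} t) * indicator (cball 0 t) z \<partial>(lborel::'a measure))"
      by (intro nn_integral_mono) (auto simp: indicator_def)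
    also have "\<dots> = (ennreal (p * t powr (- p - 1)) * indicator {1..} t) * ennreal (w * t powr n)"
      by (subst nn_integral_cmult_indicator) (auto simp: vol)
    also have "\<dots> = ennreal (p * w) * (ennreal (t powr (- (p - n) - 1)) * indicator {1..} t)"
    proof -
      have "(p * t powr (- p - 1)) * (w * t powr n) = p * w * t powr (- (p - n) - 1)"
        using powr_add[of t "- p - 1" n, symmetric] by (simp add: algebra_simps)
      then show ?thesis using p0 w by (simp add: ennreal_mult[symmetric] indicator_def)
    qed
    finally show "(\<integral>\<^sup>+z. ennreal (p * t powr (- p - 1)) * (indicator {norm z..} t * indicator {z. 1 \<le> norm z} z) \<partial>(lborel::'a measure)) \<le>
       ennreal (p * w) * (ennreal (t powr (- (p - n) - 1)) * indicator {1..} t)" .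
  qed
  also have "\<dots> = ennreal (p * w) * ennreal (1 powr (- (p - n)) / (p - n))"
    using nn_lpos_powr_tail[of "p - n" 1] p by (subst nn_integral_cmult) (auto simp: n_def)
  also have "\<dots> < \<infinity>" by (simp add: ennreal_mult_less_top)
  finally show ?thesis .
qed

section \<open>The heat kernel\<close>

definition hk :: "real \<Rightarrow> 'a::euclidean_space \<Rightarrow> real" where
  "hk t z = (4 * pi * t) powr (- (real DIM('a) / 2)) * exp (- ((z \<bullet> z) / (4 * t)))"

lemma hk_nonneg[simp]: "0 \<le> hk t z"
  by (simp add: hk_def)

lemma hk_measurable[measurable (raw)]:
  assumes [measurable]: "f \<in> borel_measurable M" "g \<in> borel_measurable M"
  shows "(\<lambda>x. hk (f x) (g x)) \<in> borel_measurable M"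
  unfolding hk_def by measurable

lemma hk_even[simp]: "hk t (- z) = hk t z"
  by (simp add: hk_def)

lemma hk_sym: "hk t (x - y) = hk t (y - x)"
  using hk_even[of t "x - y"] by simp

text \<open>The coordinates are independent normal variables of variance 2t; the total mass of the
  kernel then follows from the one-dimensional normal density.\<close>

lemma hk_prod:
  fixes z :: "'a::euclidean_space"
  assumes t: "0 < t"
  shows "hk t z = (\<Prod>b\<in>Basis. normal_density 0 (sqrt (2 * t)) (z \<bullet> b))"
proof -
  have "(\<Prod>b\<in>Basis. normal_density 0 (sqrt (2 * t)) (z \<bullet> b)) =
      (\<Prod>b\<in>(Basis::'a set). 1 / sqrt (4 * pi * t)) * (\<Prod>b\<in>Basis. exp (- ((z \<bullet> b)\<^sup>2 / (4 * t))))"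
    using t unfolding prod.distrib[symmetric] by (intro prod.cong) (auto simp: normal_density_def)
  also have "(\<Prod>b\<in>Basis. exp (- ((z \<bullet> b)\<^sup>2 / (4 * t)))) = exp (- ((z \<bullet> z) / (4 * t)))"
    by (simp add: exp_sum[symmetric] sum_negf sum_divide_distrib euclidean_inner[of z z] power2_eq_square)
  also have "(\<Prod>b\<in>(Basis::'a set). 1 / sqrt (4 * pi * t)) = (4 * pi * t) powr (- (real DIM('a) / 2))"
  proof -
    have "(1 / sqrt (4 * pi * t)) ^ DIM('a) = ((4 * pi * t) powr (-(1/2))) ^ DIM('a)"
      using t by (simp add: powr_minus powr_half_sqrt field_simps)
    also have "\<dots> = (4 * pi * t) powr (- (1/2) * real DIM('a))"
      using t by (simp add: powr_realpow[symmetric] powr_powr)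
    finally show ?thesis by simp
  qed
  finally show ?thesis by (simp add: hk_def)
qed

lemma hk_nn_integral:
  assumes t: "0 < t" shows "(\<integral>\<^sup>+z. ennreal (hk t z) \<partial>(lborel::'a::euclidean_space measure)) = 1"
proof -
  interpret prob_space "density lborel (\<lambda>y. ennreal (normal_density 0 (sqrt (2 * t)) y))"
    using t by (intro prob_space_normal_density) simp
  have 1: "(\<integral>\<^sup>+y. ennreal (normal_density 0 (sqrt (2 * t)) y) \<partial>lborel) = 1"
    using emeasure_space_1 by (simp add: emeasure_density)
  have "(\<integral>\<^sup>+z. ennreal (hk t z) \<partial>(lborel::'a measure)) = (\<integral>\<^sup>+z. (\<Prod>b\<in>Basis. ennreal (normal_density 0 (sqrt (2 * t)) (z \<bullet> b))) \<partial>(lborel::'a measure))"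
    using t by (simp add: hk_prod prod_ennreal)
  also have "\<dots> = (\<Prod>b\<in>(Basis::'a set). (\<integral>\<^sup>+y. ennreal (normal_density 0 (sqrt (2 * t)) y) \<partial>lborel))"
    by (rule nn_integral_lborel_prod) auto
  finally show ?thesis using 1 by simp
qed

lemma hk_integrable: "0 < t \<Longrightarrow> integrable lborel (hk t :: 'a::euclidean_space \<Rightarrow> real)"
  using hk_nn_integral[of t, where ?'a='a] by (intro integrableI_nonneg) auto

lemma hk_integral: "0 < t \<Longrightarrow> (LINT z|(lborel::'a::euclidean_space measure). hk t z) = 1"
  using hk_nn_integral[of t, where ?'a='a] by (subst integral_eq_nn_integral) auto

text \<open>Completing the square in z: the product of the two Gaussians is, as a function of z, a
  Gaussian of time st/(s+t) centred at (t/(s+t)) x, multiplied by the value of the convolution. The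
  semigroup property follows by integrating over z.\<close>

lemma hk_mult:
  fixes x z :: "'a::euclidean_space"
  assumes s: "0 < s" and t: "0 < t"
  shows "hk s (x - z) * hk t z = hk (s + t) x * hk (s * t / (s + t)) (z - (t / (s + t)) *\<^sub>R x)"
proof -
  let ?k = "- (real DIM('a) / 2)"
  have 1: "(4 * pi * s) powr ?k * (4 * pi * t) powr ?k = (4 * pi * (s + t)) powr ?k * (4 * pi * (s * t / (s + t))) powr ?k"
  proof -
    have "(4 * pi * s) * (4 * pi * t) = (4 * pi * (s + t)) * (4 * pi * (s * t / (s + t)))"
      using s t by (simp add: field_simps)
    then have "((4 * pi * s) * (4 * pi * t)) powr ?k = ((4 * pi * (s + t)) * (4 * pi * (s * t / (s + t)))) powr ?k" by simp
    then show ?thesis by (subst powr_mult[symmetric])+ (use s t in auto)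
  qed
  define a b c where "a = x \<bullet> x" and "b = z \<bullet> z" and "c = x \<bullet> z"
  have i1: "(x - z) \<bullet> (x - z) = a - 2 * c + b"
    by (simp add: a_def b_def c_def inner_diff_left inner_diff_right inner_commute)
  have i2: "(z - (t / (s + t)) *\<^sub>R x) \<bullet> (z - (t / (s + t)) *\<^sub>R x) = b - 2 * (t / (s + t)) * c + (t / (s + t))\<^sup>2 * a"
    by (simp add: a_def b_def c_def inner_diff_left inner_diff_right inner_commute power2_eq_square algebra_simps)
  have "(a - 2 * c + b) / (4 * s) + b / (4 * t) = a / (4 * (s + t)) + (b - 2 * (t / (s + t)) * c + (t / (s + t))\<^sup>2 * a) / (4 * (s * t / (s + t)))"
  proof -
    have st: "s + t \<noteq> 0" "s \<noteq> 0" "t \<noteq> 0" using s t by auto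
    then show ?thesis by (simp add: divide_simps) (simp add: algebra_simps power2_eq_square)
  qed
  then have 2: "exp (- (((x - z) \<bullet> (x - z)) / (4 * s))) * exp (- ((z \<bullet> z) / (4 * t))) =
     exp (- ((x \<bullet> x) / (4 * (s + t)))) * exp (- (((z - (t / (s + t)) *\<^sub>R x) \<bullet> (z - (t / (s + t)) *\<^sub>R x)) / (4 * (s * t / (s + t)))))"
    unfolding i1 i2 a_def[symmetric] b_def[symmetric] by (simp add: exp_add[symmetric])
  have "(p * e) * (q * f) = (p' * e') * (q' * f')" if "p * q = p' * q'" "e * f = e' * f'" for p q e f p' q' e' f' :: real
    using arg_cong2[where f="(*)", OF that] by (simp only: mult_ac)
  from this[OF 1 2] show ?thesis unfolding hk_def .
qed

lemma hk_conv_nn: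
  fixes x :: "'a::euclidean_space"
  assumes s: "0 < s" and t: "0 < t"
  shows "(\<integral>\<^sup>+z. ennreal (hk s (x - z) * hk t z) \<partial>lborel) = ennreal (hk (s + t) x)"
proof -
  have st: "0 < s * t / (s + t)" using s t by simp
  have "(\<integral>\<^sup>+z. ennreal (hk s (x - z) * hk t z) \<partial>lborel) =
     ennreal (hk (s + t) x) * (\<integral>\<^sup>+z. ennreal (hk (s * t / (s + t)) (z - (t / (s + t)) *\<^sub>R x)) \<partial>lborel)"
    by (subst nn_integral_cmult[symmetric]) (auto simp: hk_mult[OF s t] ennreal_mult)
  also have "(\<integral>\<^sup>+z. ennreal (hk (s * t / (s + t)) (z - (t / (s + t)) *\<^sub>R x)) \<partial>lborel) = 1"
    by (subst nn_integral_shift(2)) (auto simp: hk_nn_integral[OF st])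
  finally show ?thesis by simp
qed

lemma hk_le:
  fixes z :: "'a::euclidean_space"
  assumes a: "0 < a" and ab: "a \<le> b"
  shows "hk a z \<le> (b / a) powr (real DIM('a) / 2) * hk b z"
proof -
  have "(4 * pi * a) powr (- (real DIM('a) / 2)) = (b / a) powr (real DIM('a) / 2) * (4 * pi * b) powr (- (real DIM('a) / 2))"
    using a ab by (simp add: powr_mult powr_divide powr_minus field_simps)
  moreover have "exp (- ((z \<bullet> z) / (4 * a))) \<le> exp (- ((z \<bullet> z) / (4 * b)))"
    using a ab by (auto intro!: divide_left_mono mult_pos_pos)
  ultimately show ?thesis unfolding hk_def
    by (simp add: mult.assoc mult_left_mono)
qed

lemma hk_le0: "0 < t \<Longrightarrow> hk t (z::'a::euclidean_space) \<le> (4 * pi * t) powr (- (real DIM('a) / 2))"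
  unfolding hk_def by (simp add: mult_left_le)

text \<open>An inverse Gamma integral in t, since both exponents are multiples of 1/t. Three cases
  are used: \<beta> = -\<gamma> with R = 0 yields the singular kernel of the fractional Laplacian,
  \<beta> = s with R = 0 the Riesz kernel, and \<beta> = -s with R > 0 the bubble.\<close>

lemma hk_time_integral:
  fixes z :: "'a::euclidean_space"
  assumes b: "\<beta> < real DIM('a) / 2" and R: "0 \<le> R" "0 < R + (z \<bullet> z) / 4"
  shows "(\<integral>\<^sup>+t. ennreal (t powr (\<beta> - 1) * exp (- (R / t)) * hk t z) \<partial>lpos) =
    ennreal ((4 * pi) powr (- (real DIM('a) / 2)) * Gamma (real DIM('a) / 2 - \<beta>) * (R + (z \<bullet> z) / 4) powr (\<beta> - real DIM('a) / 2))"
proof -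
  define a where "a = real DIM('a) / 2 - \<beta>"
  have a: "0 < a" using b by (simp add: a_def)
  let ?c = "R + (z \<bullet> z) / 4"
  have "(\<integral>\<^sup>+t. ennreal (t powr (\<beta> - 1) * exp (- (R / t)) * hk t z) \<partial>lpos) =
     (\<integral>\<^sup>+t. ennreal ((4 * pi) powr (- (real DIM('a) / 2))) * ennreal (t powr (- a - 1) * exp (- ?c / t)) \<partial>lpos)"
  proof (rule nn_lpos_cong)
    fix t :: real assume t: "0 < t"
    have "t powr (\<beta> - 1) * (4 * pi * t) powr (- (real DIM('a) / 2)) = (4 * pi) powr (- (real DIM('a) / 2)) * t powr (- a - 1)"
      using t powr_add[of t "\<beta> - 1" "- (real DIM('a) / 2)"] by (simp add: powr_mult a_def algebra_simps)
    moreover have "exp (- (R / t)) * exp (- ((z \<bullet> z) / (4 * t))) = exp (- ?c / t)"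
      using t by (simp add: exp_add[symmetric] field_simps)
    moreover have "t powr (\<beta> - 1) * exp (- (R / t)) * hk t z = (t powr (\<beta> - 1) * (4 * pi * t) powr (- (real DIM('a) / 2))) * (exp (- (R / t)) * exp (- ((z \<bullet> z) / (4 * t))))"
      unfolding hk_def by (simp only: mult_ac)
    ultimately have "t powr (\<beta> - 1) * exp (- (R / t)) * hk t z = (4 * pi) powr (- (real DIM('a) / 2)) * (t powr (- a - 1) * exp (- ?c / t))"
      by (simp only: mult_ac)
    then show "ennreal (t powr (\<beta> - 1) * exp (- (R / t)) * hk t z) = ennreal ((4 * pi) powr (- (real DIM('a) / 2))) * ennreal (t powr (- a - 1) * exp (- ?c / t))"
      by (simp add: ennreal_mult[symmetric])
  qed
  also have "\<dots> = ennreal ((4 * pi) powr (- (real DIM('a) / 2))) * ennreal (Gamma a * ?c powr (- a))"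
    using nn_lpos_inv_Gamma[OF a R(2)] by (subst nn_integral_cmult) auto
  finally show ?thesis using Gamma_real_pos[OF a] by (simp add: ennreal_mult[symmetric] a_def mult.assoc)
qed

text \<open>The constant is the value of (1 + y)^k exp(-y) at its critical point y = k - 1. It comes
  from ln x \<le> x - 1 at x = (1 + y)/k.\<close>

lemma exp_powr_bound:
  assumes k: "0 < k" and y: "0 \<le> (y::real)"
  shows "exp (- y) \<le> exp (1 - k) * k powr k * (1 + y) powr (- k)"
proof -
  have "ln ((1 + y) / k) \<le> (1 + y) / k - 1" by (rule ln_le_minus_one) (use k y in simp)
  then have "k * (ln (1 + y) - ln k) \<le> k * ((1 + y) / k - 1)"
    using k y by (intro mult_left_mono) (auto simp: ln_div)
  then have "k * ln (1 + y) - k * ln k \<le> 1 + y - k" using k by (simp add: right_diff_distrib)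
  then have "- y \<le> (1 - k) + k * ln k + (- k) * ln (1 + y)" by simp
  then have "exp (- y) \<le> exp ((1 - k) + k * ln k + (- k) * ln (1 + y))" by simp
  also have "\<dots> = exp (1 - k) * k powr k * (1 + y) powr (- k)"
    using k y by (simp add: exp_add[symmetric] powr_def)
  finally show ?thesis .
qed

text \<open>Trades the Gaussian for the power n/2 + 1, one order beyond the normalisation, at the
  price of a factor 1 + q. That factor is paid for by one additional Laplacian, and a time integral
  of order 1 - \<gamma> then leaves the power n/2 + \<gamma>, matching the weight of the space
  containing v.\<close>

lemma hk_poly_bound:
  "\<exists>C>0. \<forall>q\<ge>0. \<forall>x::'a::euclidean_space. hk (1 + 2 * q) x \<le> C * (1 + q) * (1 + q + x \<bullet> x) powr (- (real DIM('a) / 2) - 1)"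
proof -
  define n2 where "n2 = real DIM('a) / 2"
  define k where "k = n2 + 1"
  \<comment> \<open>The 8 combines the 4 of the Gaussian exponent with a 2 from 1 + 2q \<le> 2(1 +
    q).\<close>
  define C where "C = exp (1 - k) * k powr k * 8 powr k"
  have n2: "n2 \<ge> 0" and k: "k > 0" by (auto simp: n2_def k_def)
  show ?thesis
  proof (intro exI[of _ C] conjI allI impI)
    show "C > 0" using k by (simp add: C_def)
    fix q :: real and x :: 'a assume q: "0 \<le> q"
    define r where "r = x \<bullet> x"
    have r: "0 \<le> r" by (simp add: r_def)
    have p1: "(4 * pi * (1 + 2 * q)) powr (- n2) \<le> (1 + q) powr (- n2)"
    proof (rule powr_mono2')
      have "1 * (1 + q) \<le> 4 * pi * (1 + 2 * q)" using q pi_gt3 by (intro mult_mono) auto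
      then show "1 + q \<le> 4 * pi * (1 + 2 * q)" by simp
    qed (use n2 q in auto)
    have "exp (- (r / (4 * (1 + 2 * q)))) \<le> exp (1 - k) * k powr k * (1 + r / (4 * (1 + 2 * q))) powr (- k)"
      by (rule exp_powr_bound) (use k q r in auto)
    also have "\<dots> \<le> exp (1 - k) * k powr k * ((1 + q + r) / (8 * (1 + q))) powr (- k)"
    proof (intro mult_left_mono powr_mono2')
      have "r / (8 * (1 + q)) \<le> r / (4 * (1 + 2 * q))"
        using q r by (intro divide_left_mono) auto
      moreover have "(1 + q + r) / (8 * (1 + q)) = 1 / 8 + r / (8 * (1 + q))"
        using q by (simp add: add_divide_distrib[of "1+q" r])
      ultimately show "(1 + q + r) / (8 * (1 + q)) \<le> 1 + r / (4 * (1 + 2 * q))" by linarith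
    qed (use q r k in auto)
    also have "((1 + q + r) / (8 * (1 + q))) powr (- k) = 8 powr k * (1 + q) powr k * (1 + q + r) powr (- k)"
    proof -
      have "((1 + q + r) / (8 * (1 + q))) powr (- k) = (1 + q + r) powr (- k) / (8 * (1 + q)) powr (- k)"
        by (rule powr_divide)
      also have "(8 * (1 + q)) powr (- k) = 8 powr (- k) * (1 + q) powr (- k)" by (rule powr_mult)
      finally show ?thesis by (simp add: powr_minus divide_inverse)
    qed
    finally have p2: "exp (- (r / (4 * (1 + 2 * q)))) \<le> C * (1 + q) powr k * (1 + q + r) powr (- k)"
      by (simp add: C_def mult_ac)
    have "hk (1 + 2 * q) x \<le> (1 + q) powr (- n2) * (C * (1 + q) powr k * (1 + q + r) powr (- k))"
      unfolding hk_def using p1 p2 by (intro mult_mono) (auto simp: n2_def r_def)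
    also have "\<dots> = C * ((1 + q) powr (- n2) * (1 + q) powr k) * (1 + q + r) powr (- k)" by simp
    also have "(1 + q) powr (- n2) * (1 + q) powr k = 1 + q" using q by (simp add: powr_add[symmetric] k_def)
    finally show "hk (1 + 2 * q) x \<le> C * (1 + q) * (1 + q + x \<bullet> x) powr (- (real DIM('a) / 2) - 1)"
      by (simp add: k_def n2_def r_def)
  qed
qed

subsection \<open>Iterated Laplacians of the heat kernel\<close>

text \<open>Polynomials in the self-similar variable |z|^2/t times the kernel form a class stable
  under the Laplacian, so all iterated Laplacians of the kernel are described by an operation on
  polynomials, uniformly in t.\<close>

definition hkp :: "real poly \<Rightarrow> real \<Rightarrow> 'a::euclidean_space \<Rightarrow> real" where
  "hkp Q t z = poly Q (z \<bullet> z / t) * hk t z"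

text \<open>Twice the derivative of Q(y) exp(-y/4) with the exponential factored out; the factor 2
  comes from the gradient of |z|^2.\<close>

definition hkD :: "real poly \<Rightarrow> real poly" where
  "hkD Q = smult 2 (pderiv Q) - smult (1/2) Q"

lemma hkp_cont: "0 < t \<Longrightarrow> continuous_on UNIV (hkp Q t)"
  unfolding hkp_def hk_def by (intro continuous_intros) auto

lemma hkp_DERIV:
  fixes z b :: "'a::euclidean_space"
  assumes t: "0 < t"
  shows "((\<lambda>r. hkp Q t (z + r *\<^sub>R b)) has_field_derivative (z \<bullet> b) * (hkp (hkD Q) t z / t)) (at 0)"
proof -
  have e: "(z + r *\<^sub>R b) \<bullet> (z + r *\<^sub>R b) = z \<bullet> z + 2 * r * (z \<bullet> b) + r\<^sup>2 * (b \<bullet> b)" for r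
    by (simp add: inner_add_left inner_add_right inner_commute power2_eq_square)
  show ?thesis unfolding hkp_def hk_def e hkD_def
    using t by (auto intro!: derivative_eq_intros poly_DERIV DERIV_chain2[where f="poly Q"] simp: field_simps)
qed

lemma hkp_Ck: "0 < t \<Longrightarrow> Ck k (hkp Q t :: 'a::euclidean_space \<Rightarrow> real)"
proof (induction k arbitrary: Q)
  case 0 then show ?case by (simp add: Ck_0 hkp_cont)
next
  case (Suc k)
  show ?case
  proof (rule Ck_SucI[OF hkp_cont hkp_DERIV])
    fix b :: 'a
    have "Ck k (\<lambda>z::'a. (z \<bullet> b) * ((1 / t) * hkp (hkD Q) t z))"
      using Suc by (intro Ck_mult Ck_inner Ck_const) auto
    then show "Ck k (\<lambda>z. (z \<bullet> b) * (hkp (hkD Q) t z / t))" by simp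
  qed (use Suc in auto)
qed

text \<open>Minus the divergence of z times the \<open>hkD\<close> profile, rescaled by t: the
  dimension arises from differentiating z, and \<open>pCons 0\<close> is multiplication by the
  variable y = |z|^2/t.\<close>

definition hkL :: "nat \<Rightarrow> real poly \<Rightarrow> real poly" where
  "hkL n Q = - (smult (real n) (hkD Q) + pCons 0 (hkD (hkD Q)))"

lemma hkp_neg_lap:
  assumes t: "0 < t"
  shows "neg_lap (hkp Q t) = (\<lambda>z::'a::euclidean_space. hkp (hkL DIM('a) Q) t z / t)"
proof
  fix z :: 'a
  have p1: "pdiff [b] (hkp Q t) = (\<lambda>z. (z \<bullet> b) * (hkp (hkD Q) t z / t))" for Q and b :: 'a
    by (rule pdiff1_eqI) (rule hkp_DERIV[OF t])
  have p2: "pdiff [b,b] (hkp Q t) z = hkp (hkD Q) t z / t + (z \<bullet> b)\<^sup>2 * hkp (hkD (hkD Q)) t z / t\<^sup>2" if b: "b \<in> Basis" for b :: 'a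
  proof -
    have "pdiff [b,b] (hkp Q t) = pdiff [b] (\<lambda>z. (z \<bullet> b) * (hkp (hkD Q) t z / t))"
      using p1[of b Q] by simp
    moreover have "((\<lambda>r. ((z + r *\<^sub>R b) \<bullet> b) * (hkp (hkD Q) t (z + r *\<^sub>R b) / t)) has_field_derivative
       hkp (hkD Q) t z / t + (z \<bullet> b)\<^sup>2 * hkp (hkD (hkD Q)) t z / t\<^sup>2) (at 0)"
      using b t by (auto intro!: derivative_eq_intros hkp_DERIV[OF t] simp: inner_add_left power2_eq_square field_simps)
    ultimately show ?thesis by (simp add: DERIV_imp_deriv)
  qed
  have zz: "(\<Sum>b\<in>Basis. (z \<bullet> b)\<^sup>2) = z \<bullet> z" by (simp add: euclidean_inner[of z z] power2_eq_square)
  have "lap (hkp Q t) z = (\<Sum>b\<in>(Basis::'a set). hkp (hkD Q) t z / t + (z \<bullet> b)\<^sup>2 * hkp (hkD (hkD Q)) t z / t\<^sup>2)"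
    unfolding lap_eq_pdiff by (rule sum.cong) (use p2 in auto)
  also have "\<dots> = DIM('a) * (hkp (hkD Q) t z / t) + (z \<bullet> z) * hkp (hkD (hkD Q)) t z / t\<^sup>2"
    by (simp add: sum.distrib sum_distrib_right[symmetric] sum_divide_distrib[symmetric] zz)
  finally show "neg_lap (hkp Q t) z = hkp (hkL DIM('a) Q) t z / t"
    unfolding neg_lap_def hkp_def hkL_def using t by (simp add: field_simps power2_eq_square)
qed

lemma hkp_1: "hkp 1 t = hk t" "hkp [:1:] t = hk t"
  by (auto simp: hkp_def)

lemma hk_Ck: "0 < t \<Longrightarrow> Ck k (hk t :: 'a::euclidean_space \<Rightarrow> real)"
  using hkp_Ck[of t k 1] by (simp add: hkp_1)

lemma neg_lap_cmult:
  fixes u :: "'a::euclidean_space \<Rightarrow> real"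
  assumes "Ck 2 u" shows "neg_lap (\<lambda>x. c * u x) = (\<lambda>x. c * neg_lap u x)"
proof -
  have "pdiff [b,b] (\<lambda>x. c * u x) = (\<lambda>x. c * pdiff [b,b] u x)" if "b \<in> Basis" for b
    by (rule pdiff_cmult[OF assms]) (use that in auto)
  then show ?thesis unfolding neg_lap_def lap_eq_pdiff by (auto simp: sum_distrib_left simp del: pdiff.simps)
qed

lemma hkp_neg_lap_pow:
  assumes t: "0 < t"
  shows "(neg_lap ^^ j) (hkp Q t) = (\<lambda>z::'a::euclidean_space. (1 / t) ^ j * hkp ((hkL DIM('a) ^^ j) Q) t z)"
proof (induction j)
  case (Suc j)
  have "(neg_lap ^^ Suc j) (hkp Q t) = neg_lap (\<lambda>z::'a. (1 / t) ^ j * hkp ((hkL DIM('a) ^^ j) Q) t z)"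
    using Suc by simp
  also have "\<dots> = (\<lambda>z. (1 / t) ^ j * neg_lap (hkp ((hkL DIM('a) ^^ j) Q) t) z)"
    by (rule neg_lap_cmult[OF hkp_Ck[OF t]])
  finally show ?case by (simp add: hkp_neg_lap[OF t] fun_eq_iff)
qed simp

text \<open>Induction on the polynomial with the rate halved: one half bounds the remaining
  polynomial, the other the new factor through y \<le> (2/e) exp(e y/2).\<close>

lemma poly_exp_bound:
  fixes Q :: "real poly" and e :: real
  assumes "0 < e"
  shows "\<exists>C\<ge>0. \<forall>y\<ge>0. \<bar>poly Q y\<bar> \<le> C * exp (e * y)"
  using assms
proof (induction Q arbitrary: e)
  case 0 then show ?case by (intro exI[of _ 0]) auto
next
  case (pCons a Q)
  obtain C where C: "C \<ge> 0" "\<And>y. y \<ge> 0 \<Longrightarrow> \<bar>poly Q y\<bar> \<le> C * exp (e / 2 * y)"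
    using pCons.IH[of "e / 2"] pCons.prems by auto
  show ?case
  proof (intro exI[of _ "\<bar>a\<bar> + 2 / e * C"] conjI allI impI)
    show "0 \<le> \<bar>a\<bar> + 2 / e * C" using C pCons.prems by simp
    fix y :: real assume y: "0 \<le> y"
    have e2: "e / 2 * y \<le> exp (e / 2 * y)" using exp_ge_add_one_self[of "e / 2 * y"] by linarith
    have y2: "y \<le> 2 / e * exp (e / 2 * y)" using mult_left_mono[OF e2, of "2 / e"] pCons.prems by simp
    have "\<bar>poly (pCons a Q) y\<bar> \<le> \<bar>a\<bar> + y * \<bar>poly Q y\<bar>"
      using y by (simp add: abs_mult order_trans[OF abs_triangle_ineq])
    also have "y * \<bar>poly Q y\<bar> \<le> (2 / e * exp (e / 2 * y)) * (C * exp (e / 2 * y))"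
      using y2 C y pCons.prems by (intro mult_mono) auto
    also have "\<dots> = 2 / e * C * exp (e * y)" by (simp add: exp_add[symmetric] mult_ac)
    also have "\<bar>a\<bar> \<le> \<bar>a\<bar> * exp (e * y)" using y pCons.prems by (simp add: mult_le_cancel_left1)
    finally show "\<bar>poly (pCons a Q) y\<bar> \<le> (\<bar>a\<bar> + 2 / e * C) * exp (e * y)" by (simp add: algebra_simps)
  qed
qed

text \<open>The polynomial is absorbed by exp(y/8), half of the Gaussian rate 1/4. What remains is a
  Gaussian of doubled time, with a constant independent of t.\<close>

lemma hkp_bound: "\<exists>C\<ge>0. \<forall>t>0. \<forall>z::'a::euclidean_space. \<bar>hkp Q t z\<bar> \<le> C * hk (2 * t) z"
proof -
  obtain C where C: "C \<ge> 0" "\<And>y. y \<ge> 0 \<Longrightarrow> \<bar>poly Q y\<bar> \<le> C * exp (1/8 * y)"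
    using poly_exp_bound[of "1/8" Q] by auto
  show ?thesis
  proof (intro exI[of _ "C * 2 powr (real DIM('a) / 2)"] conjI allI impI)
    fix t :: real and z :: 'a assume t: "0 < t"
    have "\<bar>hkp Q t z\<bar> = \<bar>poly Q (z \<bullet> z / t)\<bar> * hk t z" by (simp add: hkp_def abs_mult)
    also have "\<dots> \<le> (C * exp (1/8 * (z \<bullet> z / t))) * hk t z" using C(2)[of "z \<bullet> z / t"] t by (intro mult_right_mono) auto
    also have "\<dots> = C * 2 powr (real DIM('a) / 2) * hk (2 * t) z"
    proof -
      have "exp (1/8 * (z \<bullet> z / t)) * exp (- ((z \<bullet> z) / (4 * t))) = exp (- ((z \<bullet> z) / (4 * (2 * t))))"
        using t by (simp add: exp_add[symmetric])
      moreover have "(4 * pi * t) powr (- (real DIM('a) / 2)) = 2 powr (real DIM('a) / 2) * (4 * pi * (2 * t)) powr (- (real DIM('a) / 2))"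
      proof -
        have "(4 * pi * (2 * t)) powr k = 2 powr k * (4 * pi * t) powr k" for k
          using powr_mult[of 2 "4 * pi * t" k] t by (simp add: mult_ac)
        then show ?thesis by (simp add: powr_minus)
      qed
      moreover have "C * e * (p * f) = C * d * (p' * g)" if "e * f = g" "p = d * p'" for e f g p d p' :: real
        using that by auto
      ultimately show ?thesis unfolding hk_def by blast
    qed
    finally show "\<bar>hkp Q t z\<bar> \<le> C * 2 powr (real DIM('a) / 2) * hk (2 * t) z" .
  qed (use C in auto)
qed

lemma DERIV_powr_scaled:
  fixes t c k :: real
  assumes "0 < t" "0 < c"
  shows "((\<lambda>t. (c * t) powr k) has_field_derivative (k / t) * (c * t) powr k) (at t)"
proof -
  have "((\<lambda>t. (c * t) powr k) has_field_derivative k * (c * t) powr (k - 1) * c) (at t)"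
    using assms by (auto intro!: derivative_eq_intros)
  moreover have "(c * t) powr (k - 1) = (c * t) powr k / (c * t)" using assms by (simp add: powr_diff)
  ultimately show ?thesis using assms by simp
qed

lemma hk_DERIV_time:
  fixes z :: "'a::euclidean_space"
  assumes t: "0 < t"
  shows "((\<lambda>t. hk t z) has_field_derivative - neg_lap (hk t) z) (at t)"
proof -
  have "((\<lambda>t. hk t z) has_field_derivative (z \<bullet> z / (4 * t\<^sup>2) - real DIM('a) / (2 * t)) * hk t z) (at t)"
    unfolding hk_def
    by (rule DERIV_cong[OF DERIV_mult[OF DERIV_powr_scaled DERIV_chain2[OF DERIV_exp DERIV_minus[OF DERIV_divide[OF DERIV_const DERIV_cmult[OF DERIV_ident]]]]]])
      (use t in \<open>auto simp: field_simps power2_eq_square\<close>)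
  moreover have "- neg_lap (hk t) z = (z \<bullet> z / (4 * t\<^sup>2) - real DIM('a) / (2 * t)) * hk t z"
    using hkp_neg_lap[OF t, of 1, where ?'a='a] t
    unfolding hkp_1 by (simp add: hkL_def hkD_def hkp_def pderiv_smult pderiv_1 pderiv_diff field_simps power2_eq_square)
  ultimately show ?thesis by simp
qed

section \<open>The heat flow\<close>

text \<open>The heat semigroup, written with the rescaled variable so that \<open>t = 0\<close> is included.\<close>

definition hf :: "('a::euclidean_space \<Rightarrow> real) \<Rightarrow> real \<Rightarrow> 'a \<Rightarrow> real" where
  "hf \<phi> t x = (LINT z|lborel. \<phi> (x - sqrt t *\<^sub>R z) * hk 1 z)"

lemma hk_scale: "0 < t \<Longrightarrow> sqrt t ^ DIM('a) * hk t (sqrt t *\<^sub>R z) = hk 1 (z::'a::euclidean_space)"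
proof -
  assume t: "0 < t"
  have "sqrt t ^ DIM('a) = t powr (real DIM('a) / 2)"
    using t by (simp add: powr_half_sqrt[symmetric] powr_realpow[symmetric] powr_powr)
  moreover have "(4 * pi * t) powr k = (4 * pi * 1) powr k * t powr k" for k
    by (simp add: powr_mult)
  moreover have "t powr (real DIM('a) / 2) * t powr (- (real DIM('a) / 2)) = 1"
    using t by (simp add: powr_add[symmetric])
  moreover have "sqrt t * (sqrt t * (z \<bullet> z)) = t * (z \<bullet> z)" using t by (simp flip: mult.assoc)
  ultimately show ?thesis using t by (simp add: hk_def) (simp flip: mult.assoc)
qed

lemma hf_eq:
  fixes \<phi> :: "'a::euclidean_space \<Rightarrow> real"
  assumes [measurable]: "\<phi> \<in> borel_measurable borel" and t: "0 < t"
  shows "hf \<phi> t x = (LINT y|lborel. \<phi> y * hk t (x - y))"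
proof -
  have "(LINT y|lborel. \<phi> y * hk t (x - y)) = \<bar>- sqrt t\<bar> ^ DIM('a) * (LINT z|lborel. \<phi> (x + (- sqrt t) *\<^sub>R z) * hk t (x - (x + (- sqrt t) *\<^sub>R z)))"
    by (rule integral_affine) (use t in auto)
  also have "\<dots> = (LINT z|lborel. sqrt t ^ DIM('a) * (\<phi> (x + (- sqrt t) *\<^sub>R z) * hk t (x - (x + (- sqrt t) *\<^sub>R z))))"
    using t by simp
  also have "\<dots> = hf \<phi> t x"
    unfolding hf_def
  proof (rule Bochner_Integration.integral_cong[OF refl])
    fix z :: 'a
    have "sqrt t ^ DIM('a) * (\<phi> (x + (- sqrt t) *\<^sub>R z) * hk t (x - (x + (- sqrt t) *\<^sub>R z))) =
        \<phi> (x - sqrt t *\<^sub>R z) * (sqrt t ^ DIM('a) * hk t (sqrt t *\<^sub>R z))" by simp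
    then show "sqrt t ^ DIM('a) * (\<phi> (x + (- sqrt t) *\<^sub>R z) * hk t (x - (x + (- sqrt t) *\<^sub>R z))) = \<phi> (x - sqrt t *\<^sub>R z) * hk 1 z"
      using hk_scale[OF t, of z] by simp
  qed
  finally show ?thesis by simp
qed

lemma hf_0[simp]: "hf \<phi> 0 x = \<phi> x"
  by (simp add: hf_def hk_integral)

lemma hf_measurable[measurable (raw)]:
  fixes \<phi> :: "'a::euclidean_space \<Rightarrow> real"
  assumes [measurable]: "\<phi> \<in> borel_measurable borel" "f \<in> borel_measurable M" "g \<in> borel_measurable M"
  shows "(\<lambda>w. hf \<phi> (f w) (g w)) \<in> borel_measurable M"
proof -
  have "(\<lambda>p. hf \<phi> (fst p) (snd p)) \<in> borel_measurable (borel \<Otimes>\<^sub>M borel)"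
    unfolding hf_def by (rule lborel.borel_measurable_lebesgue_integral) measurable
  from measurable_compose[OF measurable_Pair[OF assms(2,3)] this] show ?thesis by simp
qed

lemma hk_conv:
  fixes x :: "'a::euclidean_space"
  assumes "0 < s" "0 < t"
  shows "integrable lborel (\<lambda>z. hk s (x - z) * hk t z)"
    "(LINT z|lborel. hk s (x - z) * hk t z) = hk (s + t) x"
proof -
  show 1: "integrable lborel (\<lambda>z. hk s (x - z) * hk t z)"
    using hk_conv_nn[OF assms, of x] by (intro integrableI_nonneg) auto
  show "(LINT z|lborel. hk s (x - z) * hk t z) = hk (s + t) x"
    using hk_conv_nn[OF assms, of x] by (subst integral_eq_nn_integral) auto
qed

text \<open>The order of smoothness is a parameter because the mollifiers used later are powers of a
  positive part and only finitely often differentiable.\<close>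

definition tst :: "nat \<Rightarrow> ('a::euclidean_space \<Rightarrow> real) \<Rightarrow> bool" where
  "tst k \<phi> \<longleftrightarrow> Ck k \<phi> \<and> bdd_supp \<phi>"

lemma tst_neg_lap_pow: "tst (k + 2 * j) \<phi> \<Longrightarrow> tst k ((neg_lap ^^ j) \<phi>)"
  by (auto simp: tst_def intro: Ck_neg_lap_pow bdd_supp_neg_lap_pow)

lemma tst_mono: "tst k \<phi> \<Longrightarrow> j \<le> k \<Longrightarrow> tst j \<phi>"
  by (auto simp: tst_def intro: Ck_mono)

lemma tst_meas: "tst k \<phi> \<Longrightarrow> \<phi> \<in> borel_measurable borel"
  by (auto simp: tst_def dest: Ck_cont intro: borel_measurable_continuous_onI)

text \<open>Reduces estimates of the heat flow of a test function to the semigroup identity for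
  Gaussians: the initial datum is dominated by the kernel at time 1.\<close>

lemma tst_gauss: 
  assumes "tst k \<phi>" shows "\<exists>M>0. \<forall>x. \<bar>\<phi> x\<bar> \<le> M * hk 1 x"
proof -
  obtain M R where M: "0 < M" "0 < R" "\<And>x. \<bar>\<phi> x\<bar> \<le> M * indicator (cball 0 R) x"
    using bdd_supp_bounded[of \<phi>] assms by (auto simp: tst_def dest: Ck_cont)
  define c where "c = (4 * pi * 1) powr (- (real DIM('a) / 2)) * exp (- (R\<^sup>2 / 4))"
  have c: "c > 0" by (simp add: c_def)
  have "indicator (cball 0 R) x \<le> hk 1 x / c" for x :: 'a
  proof (cases "norm x \<le> R")
    case True
    then have "x \<bullet> x \<le> R\<^sup>2" using power_mono[of "norm x" R 2] by (simp add: dot_square_norm)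
    then have "c \<le> hk 1 x" unfolding c_def hk_def by (intro mult_left_mono) auto
    then show ?thesis using c True by (simp add: indicator_def)
  qed (use c in \<open>auto simp: indicator_def\<close>)
  then have "\<bar>\<phi> x\<bar> \<le> M / c * hk 1 x" for x
    using M(3)[of x] mult_left_mono[of "indicator (cball 0 R) x" "hk 1 x / c" M] M(1) by auto
  then show ?thesis using M c by (intro exI[of _ "M / c"]) auto
qed

lemma hf_gauss_bound:
  fixes \<phi> :: "'a::euclidean_space \<Rightarrow> real"
  assumes [measurable]: "\<phi> \<in> borel_measurable borel" and b: "\<And>x. \<bar>\<phi> x\<bar> \<le> M * hk s x" and s: "0 < s" and t: "0 < t"
  shows "\<bar>LINT y|lborel. \<phi> y * hk t (x - y)\<bar> \<le> M * hk (t + s) x"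
    and "integrable lborel (\<lambda>y. \<phi> y * hk t (x - y))"
proof -
  have i: "integrable lborel (\<lambda>y. M * (hk t (x - y) * hk s y))"
    by (intro integrable_mult_right hk_conv(1) s t)
  have le: "\<bar>\<phi> y * hk t (x - y)\<bar> \<le> M * (hk t (x - y) * hk s y)" for y
    using mult_right_mono[OF b[of y], of "hk t (x - y)"] by (simp add: abs_mult mult_ac)
  have M: "M * (hk t (x - y) * hk s y) \<ge> 0" for y using le[of y] by simp
  show 1: "integrable lborel (\<lambda>y. \<phi> y * hk t (x - y))"
    by (rule Bochner_Integration.integrable_bound[OF i]) (use le in \<open>auto intro!: always_eventually order_trans[OF le abs_ge_self]\<close>)
  have "\<bar>LINT y|lborel. \<phi> y * hk t (x - y)\<bar> \<le> (LINT y|lborel. \<bar>\<phi> y * hk t (x - y)\<bar>)"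
    by (rule integral_abs_bound)
  also have "\<dots> \<le> (LINT y|lborel. M * (hk t (x - y) * hk s y))"
    by (rule integral_mono) (use 1 i le in \<open>auto intro!: integrable_abs\<close>)
  also have "\<dots> = M * hk (t + s) x" using hk_conv(2)[OF t s, of x] by simp
  finally show "\<bar>LINT y|lborel. \<phi> y * hk t (x - y)\<bar> \<le> M * hk (t + s) x" .
qed

lemma hf_by_parts:
  assumes \<phi>: "tst (2 * j) \<phi>" and t: "0 < t"
  shows "hf ((neg_lap ^^ j) \<phi>) t x = (LINT y|lborel. \<phi> y * ((neg_lap ^^ j) (hk t)) (y - x))"
proof -
  have C: "Ck (2 * j) (\<lambda>y. hk t (y + (- x)))" by (rule Ck_translate[OF hk_Ck[OF t]])
  have "hf ((neg_lap ^^ j) \<phi>) t x = (LINT y|lborel. (neg_lap ^^ j) \<phi> y * hk t (x - y))"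
    using tst_neg_lap_pow[of 0 j \<phi>] \<phi> by (intro hf_eq[OF _ t]) (auto intro: tst_meas)
  also have "\<dots> = (LINT y|lborel. hk t (y + (- x)) * (neg_lap ^^ j) \<phi> y)"
    by (simp add: hk_sym[of t x] mult.commute)
  also have "\<dots> = (LINT y|lborel. (neg_lap ^^ j) (\<lambda>y. hk t (y + (- x))) y * \<phi> y)"
    using \<phi> C by (intro integral_neg_lap_pow[symmetric]) (auto simp: tst_def)
  also have "(neg_lap ^^ j) (\<lambda>y. hk t (y + (- x))) = (\<lambda>y. (neg_lap ^^ j) (hk t) (y + (- x)))"
    by (rule neg_lap_pow_translate[OF hk_Ck[OF t]])
  finally show ?thesis by (simp add: mult.commute)
qed

lemma hk_neg_lap_pow_bound:
  "\<exists>C\<ge>0. \<forall>t>0. \<forall>z::'a::euclidean_space. \<bar>(neg_lap ^^ j) (hk t) z\<bar> \<le> C * (1 / t) ^ j * hk (2 * t) z"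
proof -
  obtain C where C: "C \<ge> 0" "\<And>t z. t > 0 \<Longrightarrow> \<bar>hkp ((hkL DIM('a) ^^ j) 1) t (z::'a)\<bar> \<le> C * hk (2 * t) z"
    using hkp_bound[of "(hkL DIM('a) ^^ j) 1"] by auto
  show ?thesis
  proof (intro exI[of _ C] conjI allI impI)
    fix t :: real and z :: 'a assume t: "0 < t"
    have "(neg_lap ^^ j) (hk t) z = (1 / t) ^ j * hkp ((hkL DIM('a) ^^ j) 1) t z"
      using hkp_neg_lap_pow[OF t, of j 1, where ?'a='a] by (simp add: hkp_1)
    then show "\<bar>(neg_lap ^^ j) (hk t) z\<bar> \<le> C * (1 / t) ^ j * hk (2 * t) z"
      using C(2)[OF t, of z] mult_left_mono[of _ _ "(1 / t) ^ j"] t by (fastforce simp: abs_mult mult_ac)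
  qed (rule C(1))
qed

lemma hk_neg_lap_pow_cont: "0 < t \<Longrightarrow> continuous_on UNIV ((neg_lap ^^ j) (hk t))"
  by (rule Ck_cont[of 0]) (rule Ck_neg_lap_pow[OF hk_Ck])

text \<open>For t \<ge> 1 the Laplacians are moved to the kernel, each gaining 1/t at the cost of
  doubling its time; the dominating Gaussian of \<phi> adds 1, whence the time 1 + 2t. For t \<le> 1
  nothing is moved: the datum (-\<Delta>)^j \<phi> is itself dominated by a Gaussian, and 1 + t is
  compared with 1 + 2t.\<close>

lemma hf_decay:
  fixes \<phi> :: "'a::euclidean_space \<Rightarrow> real"
  assumes \<phi>: "tst (2 * j) \<phi>"
  shows "\<exists>C\<ge>0. \<forall>t\<ge>0. \<forall>x. \<bar>hf ((neg_lap ^^ j) \<phi>) t x\<bar> \<le> C * (1 + t) powr (- real j) * hk (1 + 2 * t) x"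
proof -
  let ?\<chi> = "(neg_lap ^^ j) \<phi>"
  have \<chi>: "tst 0 ?\<chi>" using tst_neg_lap_pow[of 0 j \<phi>] \<phi> by simp
  have [measurable]: "\<phi> \<in> borel_measurable borel" "?\<chi> \<in> borel_measurable borel"
    using \<phi> \<chi> by (auto intro: tst_meas)
  obtain M1 where M1: "M1 > 0" "\<And>x. \<bar>\<phi> x\<bar> \<le> M1 * hk 1 x" using tst_gauss[OF \<phi>] by auto
  obtain M2 where M2: "M2 > 0" "\<And>x. \<bar>?\<chi> x\<bar> \<le> M2 * hk 1 x" using tst_gauss[OF \<chi>] by auto
  obtain C where C: "C \<ge> 0" "\<And>t z. t > 0 \<Longrightarrow> \<bar>(neg_lap ^^ j) (hk t) (z::'a)\<bar> \<le> C * (1 / t) ^ j * hk (2 * t) z"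
    using hk_neg_lap_pow_bound by blast
  define D where "D = max (C * M1 * 2 ^ j) (M2 * 2 ^ j * 2 powr (real DIM('a) / 2))"
  show ?thesis
  proof (intro exI[of _ D] conjI allI impI)
    show "D \<ge> 0" using C M1 M2 by (simp add: D_def le_max_iff_disj)
    fix t :: real and x :: 'a assume t: "0 \<le> t"
    have pj: "(1 + t) powr (- real j) = (1 / (1 + t)) ^ j"
      using t by (simp add: powr_minus powr_realpow power_divide divide_inverse power_inverse)
    show "\<bar>hf ?\<chi> t x\<bar> \<le> D * (1 + t) powr (- real j) * hk (1 + 2 * t) x"
    proof (cases "t \<le> 1")
      case True
      have "\<bar>hf ?\<chi> t x\<bar> \<le> M2 * hk (1 + t) x"
      proof (cases "t = 0")
        case False
        then have "\<bar>LINT y|lborel. ?\<chi> y * hk t (x - y)\<bar> \<le> M2 * hk (t + 1) x"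
          using M2 t by (intro hf_gauss_bound) auto
        then show ?thesis using False t by (simp add: hf_eq add.commute)
      qed (use M2 in auto)
      also have "hk (1 + t) x \<le> ((1 + 2 * t) / (1 + t)) powr (real DIM('a) / 2) * hk (1 + 2 * t) x"
        by (rule hk_le) (use t in auto)
      also have "\<dots> \<le> 2 powr (real DIM('a) / 2) * hk (1 + 2 * t) x"
        using t by (intro mult_right_mono powr_mono2) (auto simp: field_simps)
      finally have "\<bar>hf ?\<chi> t x\<bar> \<le> (M2 * 2 powr (real DIM('a) / 2)) * 1 * hk (1 + 2 * t) x"
        using M2(1) by (simp add: mult.assoc)
      also have "\<dots> \<le> (M2 * 2 powr (real DIM('a) / 2)) * (2 ^ j * (1 / (1 + t)) ^ j) * hk (1 + 2 * t) x"
      proof (intro mult_right_mono mult_left_mono)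
        have "1 \<le> 2 * (1 / (1 + t))" using True t by (simp add: field_simps)
        then show "1 \<le> 2 ^ j * (1 / (1 + t)) ^ j" by (simp add: power_mult_distrib[symmetric] one_le_power)
      qed (use M2 in auto)
      also have "\<dots> = (M2 * 2 ^ j * 2 powr (real DIM('a) / 2)) * ((1 / (1 + t)) ^ j * hk (1 + 2 * t) x)" by simp
      also have "\<dots> \<le> D * ((1 / (1 + t)) ^ j * hk (1 + 2 * t) x)"
        using t by (intro mult_right_mono) (auto simp: D_def)
      finally show ?thesis by (simp add: pj mult.assoc)
    next
      case False
      then have t1: "1 \<le> t" "0 < t" by auto
      let ?K = "\<lambda>y. \<phi> y * ((neg_lap ^^ j) (hk t)) (y - x)"
      have kb: "\<bar>?K y\<bar> \<le> C * (1 / t) ^ j * (\<bar>\<phi> y\<bar> * hk (2 * t) (x - y))" for y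
        using mult_left_mono[OF C(2)[OF t1(2), of "y - x"], of "\<bar>\<phi> y\<bar>"] by (simp add: abs_mult mult_ac hk_sym[of _ x])
      have m[measurable]: "(neg_lap ^^ j) (hk t :: 'a \<Rightarrow> real) \<in> borel_measurable borel"
        using hk_neg_lap_pow_cont[OF t1(2)] by (rule borel_measurable_continuous_onI)
      have g: "\<bar>LINT y|lborel. \<bar>\<phi> y\<bar> * hk (2 * t) (x - y)\<bar> \<le> M1 * hk (2 * t + 1) x"
         "integrable lborel (\<lambda>y. \<bar>\<phi> y\<bar> * hk (2 * t) (x - y))"
        using hf_gauss_bound[of "\<lambda>y. \<bar>\<phi> y\<bar>" M1 1 "2 * t" x] M1 t1 by simp_all
      have "\<bar>hf ?\<chi> t x\<bar> = \<bar>LINT y|lborel. ?K y\<bar>" using hf_by_parts[OF \<phi> t1(2)] by simp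
      also have "\<dots> \<le> (LINT y|lborel. \<bar>?K y\<bar>)" by (rule integral_abs_bound)
      also have "\<dots> \<le> (LINT y|lborel. C * (1 / t) ^ j * (\<bar>\<phi> y\<bar> * hk (2 * t) (x - y)))"
      proof (rule integral_mono)
        show "integrable lborel (\<lambda>y. C * (1 / t) ^ j * (\<bar>\<phi> y\<bar> * hk (2 * t) (x - y)))"
          by (intro integrable_mult_right g)
        then show "integrable lborel (\<lambda>y. \<bar>?K y\<bar>)"
          by (rule Bochner_Integration.integrable_bound) (auto intro!: always_eventually order_trans[OF kb abs_ge_self])
      qed (rule kb)
      also have "\<dots> = C * (1 / t) ^ j * (LINT y|lborel. \<bar>\<phi> y\<bar> * hk (2 * t) (x - y))" by simp
      also have "\<dots> \<le> C * (1 / t) ^ j * (M1 * hk (2 * t + 1) x)"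
        using g(1) C(1) t1 by (intro mult_left_mono) auto
      also have "\<dots> \<le> C * (2 ^ j * (1 / (1 + t)) ^ j) * (M1 * hk (2 * t + 1) x)"
      proof (intro mult_right_mono mult_left_mono)
        have "1 / t \<le> 2 * (1 / (1 + t))" using t1 by (simp add: field_simps)
        then show "(1 / t) ^ j \<le> 2 ^ j * (1 / (1 + t)) ^ j"
          using t1 by (simp add: power_mult_distrib[symmetric] power_mono)
      qed (use C M1 in auto)
      also have "\<dots> = (C * M1 * 2 ^ j) * ((1 / (1 + t)) ^ j * hk (1 + 2 * t) x)" by (simp add: add.commute)
      also have "\<dots> \<le> D * ((1 / (1 + t)) ^ j * hk (1 + 2 * t) x)"
        using t by (intro mult_right_mono) (auto simp: D_def)
      finally show ?thesis by (simp add: pj mult.assoc)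
    qed
  qed
qed

text \<open>In rescaled form the integrand is continuous in t on the whole line, the real
  \<open>sqrt\<close> being continuous also at negative arguments, and is dominated by a multiple of
  the kernel at time 1. The initial time therefore needs no separate argument.\<close>

lemma hf_cont_time:
  fixes \<phi> :: "'a::euclidean_space \<Rightarrow> real"
  assumes \<phi>: "tst k \<phi>"
  shows "continuous_on UNIV (\<lambda>t. hf \<phi> t x)"
  unfolding hf_def
proof (rule continuous_on_integral_dominated)
  have c: "continuous_on UNIV \<phi>" using \<phi> by (auto simp: tst_def dest: Ck_cont)
  have [measurable]: "\<phi> \<in> borel_measurable borel" using \<phi> by (rule tst_meas)
  obtain M R where M: "0 < M" "0 < R" "\<And>x. \<bar>\<phi> x\<bar> \<le> M * indicator (cball 0 R) x"
    using bdd_supp_bounded[of \<phi>] \<phi> c by (auto simp: tst_def)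
  show "continuous_on UNIV (\<lambda>t. \<phi> (x - sqrt t *\<^sub>R z) * hk 1 z)" for z
    by (intro continuous_on_mult continuous_on_compose2[OF c] continuous_intros) auto
  show "(\<lambda>z. \<phi> (x - sqrt t *\<^sub>R z) * hk 1 z) \<in> borel_measurable lborel" for t by measurable
  have b: "\<bar>\<phi> w\<bar> \<le> M" for w
  proof -
    have "M * indicator (cball 0 R) w \<le> M" using M(1) by (simp add: indicator_def)
    then show ?thesis using M(3)[of w] by linarith
  qed
  show "\<exists>H. integrable lborel H \<and> (\<forall>t z. norm t \<le> R \<longrightarrow> z \<in> space lborel \<longrightarrow> \<bar>\<phi> (x - sqrt t *\<^sub>R z) * hk 1 z\<bar> \<le> H z)" for R
    by (intro exI[of _ "\<lambda>z. M * hk 1 z"] conjI integrable_mult_right hk_integrable)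
       (auto simp: abs_mult intro!: mult_right_mono b)
qed

lemma hf_DERIV:
  fixes \<phi> :: "'a::euclidean_space \<Rightarrow> real"
  assumes \<phi>: "tst 2 \<phi>" and t: "0 < t"
  shows "((\<lambda>t. hf \<phi> t x) has_field_derivative - hf (neg_lap \<phi>) t x) (at t)"
proof -
  have [measurable]: "\<phi> \<in> borel_measurable borel" using \<phi> by (rule tst_meas)
  obtain C where C: "C \<ge> 0" "\<And>t z. t > 0 \<Longrightarrow> \<bar>(neg_lap ^^ 1) (hk t) (z::'a)\<bar> \<le> C * (1 / t) ^ 1 * hk (2 * t) z"
    using hk_neg_lap_pow_bound[of 1] by blast
  \<comment> \<open>Supremum of the kernel bound over the times t + r with |r| < t/2: there 1/(t +
    r) \<le> 2/t, and the doubled time is at least t.\<close>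
  define K where "K = C * (2 / t) * (4 * pi * t) powr (- (real DIM('a) / 2))"
  have i\<phi>: "integrable lborel \<phi>" using \<phi> by (auto simp: tst_def intro: bdd_supp_integrable dest: Ck_cont)
  have m[measurable]: "neg_lap (hk s :: 'a \<Rightarrow> real) \<in> borel_measurable borel" if "0 < s" for s
    using hk_neg_lap_pow_cont[OF that, of 1] by (auto intro: borel_measurable_continuous_onI)
  have "((\<lambda>r. LINT y|lborel. \<phi> y * hk (t + r) (y - x)) has_field_derivative (LINT y|lborel. \<phi> y * (- neg_lap (hk (t + 0)) (y - x)))) (at 0)"
  proof (rule DERIV_integral_dominated[where r="t / 2" and H="\<lambda>y. \<bar>\<phi> y\<bar> * K" and G'="\<lambda>y r. \<phi> y * (- neg_lap (hk (t + r)) (y - x))"])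
    obtain M where M: "M > 0" "\<And>x. \<bar>\<phi> x\<bar> \<le> M * hk 1 x" using tst_gauss[OF \<phi>] by auto
    show "integrable lborel (\<lambda>y. \<phi> y * hk (t + r) (y - x))" if "\<bar>r\<bar> < t / 2" for r
      using hf_gauss_bound(2)[of \<phi> M 1 "t + r" x] M that t by (simp add: hk_sym[of _ x])
    show "(\<lambda>y. \<phi> y * - neg_lap (hk (t + 0)) (y - x)) \<in> borel_measurable lborel" using t by simp
    show "integrable lborel (\<lambda>y. \<bar>\<phi> y\<bar> * K)" using i\<phi> by (intro integrable_mult_left integrable_abs)
    fix y :: 'a and r assume r: "\<bar>r\<bar> < t / 2"
    then have tr: "0 < t + r" "t / 2 \<le> t + r" by auto
    have "((\<lambda>r. hk (t + r) (y - x)) has_field_derivative - neg_lap (hk (t + r)) (y - x) * (0 + 1)) (at r)"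
      by (rule DERIV_chain2[OF hk_DERIV_time]) (use tr in \<open>auto intro!: derivative_eq_intros\<close>)
    then show "((\<lambda>r. \<phi> y * hk (t + r) (y - x)) has_field_derivative \<phi> y * (- neg_lap (hk (t + r)) (y - x))) (at r)"
      by (intro DERIV_cmult) simp
    have "\<bar>neg_lap (hk (t + r)) (y - x)\<bar> \<le> C * (1 / (t + r)) * hk (2 * (t + r)) (y - x)"
      using C(2)[OF tr(1), of "y - x"] by simp
    also have "\<dots> \<le> K" unfolding K_def
    proof (intro mult_mono mult_left_mono)
      show "1 / (t + r) \<le> 2 / t" using tr t by (simp add: field_simps)
      have "hk (2 * (t + r)) (y - x) \<le> (4 * pi * (2 * (t + r))) powr (- (real DIM('a) / 2))"
        by (rule hk_le0) (use tr in auto)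
      also have "\<dots> \<le> (4 * pi * t) powr (- (real DIM('a) / 2))"
        using t tr by (intro powr_mono2') auto
      finally show "hk (2 * (t + r)) (y - x) \<le> (4 * pi * t) powr (- (real DIM('a) / 2))" .
    qed (use C t tr in auto)
    finally show "\<bar>\<phi> y * (- neg_lap (hk (t + r)) (y - x))\<bar> \<le> \<bar>\<phi> y\<bar> * K"
      by (simp add: abs_mult mult_left_mono)
  qed (use t in auto)
  also have "(LINT y|lborel. \<phi> y * (- neg_lap (hk (t + 0)) (y - x))) = - hf (neg_lap \<phi>) t x"
    using hf_by_parts[of 1 \<phi> t x] \<phi> t by simp
  finally have "((\<lambda>s. LINT y|lborel. \<phi> y * hk s (y - x)) has_field_derivative - hf (neg_lap \<phi>) t x) (at t)"
    by (subst (asm) DERIV_at_within_shift[of _ _ t 0 UNIV, symmetric, simplified, of "\<lambda>s. LINT y|lborel. \<phi> y * hk s (y - x)"])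
  then show ?thesis
    by (rule has_field_derivative_transform_within_open[of _ _ _ "{0<..}"])
       (use t in \<open>auto simp: hf_eq hk_sym[of _ x]\<close>)
qed

lemma hf_decay_time:
  fixes \<phi> :: "'a::euclidean_space \<Rightarrow> real"
  assumes \<phi>: "tst (2 * j) \<phi>"
  shows "\<exists>C\<ge>0. \<forall>t\<ge>0. \<forall>x. \<bar>hf ((neg_lap ^^ j) \<phi>) t x\<bar> \<le> C * (1 + t) powr (- (real j + real DIM('a) / 2))"
proof -
  obtain C where C: "C \<ge> 0" "\<And>t x. t \<ge> 0 \<Longrightarrow> \<bar>hf ((neg_lap ^^ j) \<phi>) t x\<bar> \<le> C * (1 + t) powr (- real j) * hk (1 + 2 * t) x"
    using hf_decay[OF \<phi>] by blast
  show ?thesis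
  proof (intro exI[of _ C] conjI allI impI)
    fix t :: real and x :: 'a assume t: "0 \<le> t"
    have "hk (1 + 2 * t) x \<le> (4 * pi * (1 + 2 * t)) powr (- (real DIM('a) / 2))"
      by (rule hk_le0) (use t in auto)
    also have "\<dots> \<le> (1 + t) powr (- (real DIM('a) / 2))"
    proof (rule powr_mono2')
      have "1 * (1 + t) \<le> 4 * pi * (1 + 2 * t)" using t pi_gt3 by (intro mult_mono) auto
      then show "1 + t \<le> 4 * pi * (1 + 2 * t)" by simp
    qed (use t in auto)
    finally have "C * (1 + t) powr (- real j) * hk (1 + 2 * t) x \<le> C * (1 + t) powr (- real j) * (1 + t) powr (- (real DIM('a) / 2))"
      using C by (intro mult_left_mono) auto
    also have "\<dots> = C * (1 + t) powr (- (real j + real DIM('a) / 2))" by (simp add: powr_add[symmetric])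
    finally show "\<bar>hf ((neg_lap ^^ j) \<phi>) t x\<bar> \<le> C * (1 + t) powr (- (real j + real DIM('a) / 2))"
      using C(2)[OF t, of x] by linarith
  qed (rule C(1))
qed

lemma RL_cong:
  assumes [measurable]: "\<psi> \<in> borel_measurable borel" "\<psi>' \<in> borel_measurable borel"
    and "\<And>t. 0 \<le> t \<Longrightarrow> \<psi> t = \<psi>' t" "0 \<le> q"
  shows "RL a \<psi> q = RL a \<psi>' q"
  unfolding RL_def using assms(3,4) by (intro arg_cong2[where f="(/)"] lpos_cong refl) auto

text \<open>The heat equation read as a fundamental theorem of calculus on [q, \<infinity>): the
  flow is the time integral of the flow of its negative Laplacian. The boundary term at infinity
  vanishes by the decay rate j + n/2, positive even for j = 0.\<close>

lemma hf_FTC: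
  fixes \<phi> :: "'a::euclidean_space \<Rightarrow> real"
  assumes \<phi>: "tst (2 * Suc j) \<phi>" and q: "0 \<le> q"
  shows "hf ((neg_lap ^^ j) \<phi>) q x = RL 1 (\<lambda>t. hf ((neg_lap ^^ Suc j) \<phi>) t x) q"
proof -
  let ?\<chi> = "(neg_lap ^^ j) \<phi>" and ?\<psi> = "(neg_lap ^^ Suc j) \<phi>"
  let ?f = "\<lambda>t. hf ?\<psi> (q + t) x"
  have \<chi>: "tst 2 ?\<chi>" using tst_neg_lap_pow[of 2 j \<phi>] \<phi> by simp
  have \<psi>: "tst 0 ?\<psi>" using tst_neg_lap_pow[of 0 "Suc j" \<phi>] \<phi> by simp
  have [measurable]: "?\<psi> \<in> borel_measurable borel" using \<psi> by (rule tst_meas)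
  have mf: "(\<lambda>t. hf ?\<psi> (q + t) x) \<in> borel_measurable borel" by measurable
  have m\<psi>: "(\<lambda>t. hf ?\<psi> t x) \<in> borel_measurable borel" by measurable
  obtain C where C: "C \<ge> 0" "\<And>t x. t \<ge> 0 \<Longrightarrow> \<bar>hf ?\<psi> t x\<bar> \<le> C * (1 + t) powr (- (real (Suc j) + real DIM('a) / 2))"
    using hf_decay_time[OF \<phi>] by blast
  obtain C' where C': "C' \<ge> 0" "\<And>t x. t \<ge> 0 \<Longrightarrow> \<bar>hf ?\<chi> t x\<bar> \<le> C' * (1 + t) powr (- (real j + real DIM('a) / 2))"
    using hf_decay_time[of j \<phi>] tst_mono[OF \<phi>] by auto
  have n: "- (real j * 2) < real DIM('a)" using less_le_trans[of "- (real j * 2)" 1 "real DIM('a)"] by (simp add: DIM_positive Suc_leI)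
  have e: "einterval 0 \<infinity> = {0<..}" by (auto simp: einterval_def)
  have i: "integrable lpos (\<lambda>t. t powr (1 - 1) * hf ?\<psi> (q + t) x)"
    by (rule RL_integrable[OF m\<psi> _ _ q C(2)]) (auto simp: add_nonneg_pos)
  have li: "integrable lpos ?f"
    by (rule integrable_lpos_bound[OF integrable_abs[OF i]], measurable)
  have "(LBINT t=0..\<infinity>. ?f t) = 0 - (- hf ?\<chi> q x)"
  proof (rule interval_integral_FTC_integrable[where F="\<lambda>t. - hf ?\<chi> (q + t) x"])
    fix t :: real assume "0 < ereal t" then have t: "0 < t" by simp
    have "((\<lambda>t. hf ?\<chi> (q + t) x) has_field_derivative - hf (neg_lap ?\<chi>) (q + t) x * (0 + 1)) (at t)"
      by (rule DERIV_chain2[OF hf_DERIV[OF \<chi>]]) (use q t in \<open>auto intro!: derivative_eq_intros\<close>)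
    from DERIV_minus[OF this] show "((\<lambda>t. - hf ?\<chi> (q + t) x) has_vector_derivative ?f t) (at t)"
      by (simp add: has_real_derivative_iff_has_vector_derivative[symmetric])
    have "continuous_on UNIV (\<lambda>t. hf ?\<psi> (q + t) x)"
      by (rule continuous_on_compose2[OF hf_cont_time[OF \<psi>]]) (auto intro!: continuous_intros)
    then show "isCont ?f t" by (simp add: continuous_on_eq_continuous_at)
  next
    show "set_integrable lborel (einterval 0 \<infinity>) ?f" unfolding e using li unfolding int_lpos(2)[OF mf] .
    have "continuous_on UNIV (\<lambda>t. - hf ?\<chi> (q + t) x)"
      by (intro continuous_on_minus continuous_on_compose2[OF hf_cont_time[OF \<chi>]]) (auto intro!: continuous_intros)
    then have "isCont (\<lambda>t. - hf ?\<chi> (q + t) x) 0" by (simp add: continuous_on_eq_continuous_at)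
    then have "((\<lambda>t. - hf ?\<chi> (q + t) x) \<longlongrightarrow> - hf ?\<chi> q x) (at_right 0)"
      by (auto simp: isCont_def elim: tendsto_within_subset)
    then show "(((\<lambda>t. - hf ?\<chi> (q + t) x) \<circ> real_of_ereal) \<longlongrightarrow> - hf ?\<chi> q x) (at_right 0)"
      unfolding zero_ereal_def ereal_tendsto_simps .
    have "((\<lambda>t. - hf ?\<chi> (q + t) x) \<longlongrightarrow> 0) at_top"
    proof (rule Lim_null_comparison)
      show "\<forall>\<^sub>F t in at_top. norm (- hf ?\<chi> (q + t) x) \<le> C' * (1 + (q + t)) powr (- (real j + real DIM('a) / 2))"
        using eventually_ge_at_top[of 0] by eventually_elim (use C'(2) q in auto)
      have "filterlim (\<lambda>t. (1 + q) + t) at_top at_top"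
        by (rule filterlim_tendsto_add_at_top[OF tendsto_const filterlim_ident])
      then have "((\<lambda>t. ((1 + q) + t) powr (- (real j + real DIM('a) / 2))) \<longlongrightarrow> 0) at_top"
        using n by (intro tendsto_neg_powr) auto
      then show "((\<lambda>t. C' * (1 + (q + t)) powr (- (real j + real DIM('a) / 2))) \<longlongrightarrow> 0) at_top"
        using tendsto_mult_right_zero by (fastforce simp: add.assoc)
    qed
    then show "(((\<lambda>t. - hf ?\<chi> (q + t) x) \<circ> real_of_ereal) \<longlongrightarrow> 0) (at_left \<infinity>)"
      unfolding ereal_tendsto_simps .
  qed simp
  also have "(LBINT t=0..\<infinity>. ?f t) = (LINT t|lpos. ?f t)"
    unfolding zero_ereal_def interval_integral_to_infinity_eq int_lpos(1)[OF mf] ..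
  finally have "(LINT t|lpos. ?f t) = hf ?\<chi> q x" by simp
  \<comment> \<open>\<open>t powr 0\<close> is 1 only for t \<noteq> 0, so the weight disappears
    under \<open>lpos\<close> but not as an identity of functions.\<close>
  moreover have "RL 1 (\<lambda>t. hf ?\<psi> t x) q = (LINT t|lpos. ?f t)"
  proof -
    have "(\<lambda>t. t powr (1 - 1) * hf ?\<psi> (q + t) x) \<in> borel_measurable borel" by measurable
    then have "(LINT t|lpos. t powr (1 - 1) * hf ?\<psi> (q + t) x) = (LINT t|lpos. ?f t)"
      by (rule lpos_cong[OF _ mf]) simp
    then show ?thesis unfolding RL_def by (simp del: funpow.simps)
  qed
  ultimately show ?thesis by simp
qed

text \<open>Iterates the previous identity and collects the integrations of order 1 by the semigroup
  law: an integral of order j + 1 undoes j + 1 Laplacians along the flow.\<close>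

lemma hf_RL:
  fixes \<phi> :: "'a::euclidean_space \<Rightarrow> real"
  assumes \<phi>: "tst (2 * Suc j) \<phi>" and q: "0 \<le> q"
  shows "hf \<phi> q x = RL (real (Suc j)) (\<lambda>t. hf ((neg_lap ^^ Suc j) \<phi>) t x) q"
  using \<phi>
proof (induction j)
  case 0
  then show ?case using hf_FTC[of 0 \<phi> q x] q by simp
next
  case (Suc j)
  note \<phi> = Suc.prems
  have [measurable]: "(neg_lap ^^ Suc (Suc j)) \<phi> \<in> borel_measurable borel" 
    by (rule tst_meas, rule tst_neg_lap_pow[of 0]) (use \<phi> in simp)
  have [measurable]: "(neg_lap ^^ (Suc j)) \<phi> \<in> borel_measurable borel" 
    by (rule tst_meas, rule tst_neg_lap_pow[of 0]) (use tst_mono[OF \<phi>] in simp)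
  have m1: "(\<lambda>t. hf ((neg_lap ^^ Suc j) \<phi>) t x) \<in> borel_measurable borel" by measurable
  have m2: "(\<lambda>t. hf ((neg_lap ^^ Suc (Suc j)) \<phi>) t x) \<in> borel_measurable borel" by measurable
  obtain C where C: "C \<ge> 0" "\<And>t x. t \<ge> 0 \<Longrightarrow> \<bar>hf ((neg_lap ^^ Suc (Suc j)) \<phi>) t x\<bar> \<le> C * (1 + t) powr (- (real (Suc (Suc j)) + real DIM('a) / 2))"
    using hf_decay_time[OF \<phi>] by blast
  have "hf \<phi> q x = RL (real (Suc j)) (\<lambda>t. hf ((neg_lap ^^ Suc j) \<phi>) t x) q"
    by (rule Suc.IH) (use tst_mono[OF \<phi>] in simp)
  also have "\<dots> = RL (real (Suc j)) (RL 1 (\<lambda>t. hf ((neg_lap ^^ Suc (Suc j)) \<phi>) t x)) q"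
    by (rule RL_cong[OF m1 _ hf_FTC[OF \<phi>] q]) (rule RL_measurable[OF m2])
  also have "\<dots> = RL (real (Suc j) + 1) (\<lambda>t. hf ((neg_lap ^^ Suc (Suc j)) \<phi>) t x) q"
    by (rule RL_semigroup(1)[OF m2 _ _ _ q C(2)]) auto
  finally show ?case by (simp add: add.commute)
qed

section \<open>The fractional power of the Laplacian on test functions\<close>

text \<open>This is \<open>(-\<Delta>)\<^sup>m\<^sup>+\<^sup>\<gamma>\<close> applied to the heat flow of \<open>\<phi>\<close> at time \<open>\<tau>\<close>: the integral of order \<open>1 - \<gamma>\<close> lowers the
  exponent \<open>m + 1\<close> of the Laplacian to \<open>m + \<gamma>\<close>, uniformly in \<open>0 \<le> \<gamma> < 1\<close>.\<close>

definition ztf :: "nat \<Rightarrow> real \<Rightarrow> ('a::euclidean_space \<Rightarrow> real) \<Rightarrow> real \<Rightarrow> 'a \<Rightarrow> real" where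
  "ztf m \<gamma> \<phi> \<tau> x = RL (1 - \<gamma>) (\<lambda>t. hf ((neg_lap ^^ Suc m) \<phi>) t x) \<tau>"

lemma ztf_measurable[measurable (raw)]:
  fixes \<phi> :: "'a::euclidean_space \<Rightarrow> real"
  assumes \<phi>: "tst (2 * Suc m) \<phi>" and [measurable]: "f \<in> borel_measurable M" "g \<in> borel_measurable M"
  shows "(\<lambda>w. ztf m \<gamma> \<phi> (f w) (g w)) \<in> borel_measurable M"
proof -
  have [measurable]: "(neg_lap ^^ Suc m) \<phi> \<in> borel_measurable borel" 
    by (rule tst_meas, rule tst_neg_lap_pow[of 0]) (use \<phi> in simp)
  have "(\<lambda>p. ztf m \<gamma> \<phi> (fst p) (snd p)) \<in> borel_measurable (borel \<Otimes>\<^sub>M borel)"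
    unfolding ztf_def RL_def
    by (intro borel_measurable_divide lpos.borel_measurable_lebesgue_integral) measurable
  from measurable_compose[OF measurable_Pair[OF assms(2,3)] this] show ?thesis by simp
qed

text \<open>The orders m + \<gamma> and 1 - \<gamma> add up to m + 1, so the integral of order s
  applied to \<open>ztf\<close> is the integral of order m + 1 applied to the flow of m + 1
  Laplacians. This is the inversion of (-\<Delta>)^s along the heat flow.\<close>

lemma ztf_RL:
  fixes \<phi> :: "'a::euclidean_space \<Rightarrow> real"
  assumes \<phi>: "tst (2 * Suc m) \<phi>" and g: "0 \<le> \<gamma>" "\<gamma> < 1" and s: "0 < real m + \<gamma>" and q: "0 \<le> q"
  shows "RL (real m + \<gamma>) (\<lambda>\<tau>. ztf m \<gamma> \<phi> \<tau> x) q = hf \<phi> q x"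
    and "integrable lpos (\<lambda>t. t powr (real m + \<gamma> - 1) * ztf m \<gamma> \<phi> (q + t) x)"
proof -
  have [measurable]: "(neg_lap ^^ Suc m) \<phi> \<in> borel_measurable borel" 
    by (rule tst_meas, rule tst_neg_lap_pow[of 0]) (use \<phi> in simp)
  obtain C where C: "C \<ge> 0" "\<And>t x. t \<ge> 0 \<Longrightarrow> \<bar>hf ((neg_lap ^^ Suc m) \<phi>) t x\<bar> \<le> C * (1 + t) powr (- (real (Suc m) + real DIM('a) / 2))"
    using hf_decay_time[OF \<phi>] by blast
  have mh: "(\<lambda>t. hf ((neg_lap ^^ Suc m) \<phi>) t x) \<in> borel_measurable borel" by measurable
  have e: "(\<lambda>\<tau>. ztf m \<gamma> \<phi> \<tau> x) = RL (1 - \<gamma>) (\<lambda>t. hf ((neg_lap ^^ Suc m) \<phi>) t x)" by (auto simp: ztf_def)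
  note R = RL_semigroup[of "\<lambda>t. hf ((neg_lap ^^ Suc m) \<phi>) t x" "real m + \<gamma>" "1 - \<gamma>" "real (Suc m) + real DIM('a) / 2" q C, OF mh s _ _ q C(2)]
  have "RL (real m + \<gamma>) (\<lambda>\<tau>. ztf m \<gamma> \<phi> \<tau> x) q = RL (real m + \<gamma> + (1 - \<gamma>)) (\<lambda>t. hf ((neg_lap ^^ Suc m) \<phi>) t x) q"
    unfolding e by (rule R(1)) (use g in auto)
  then show "RL (real m + \<gamma>) (\<lambda>\<tau>. ztf m \<gamma> \<phi> \<tau> x) q = hf \<phi> q x"
    using hf_RL[OF \<phi> q, of x] by (simp add: add.commute del: funpow.simps)
  show "integrable lpos (\<lambda>t. t powr (real m + \<gamma> - 1) * ztf m \<gamma> \<phi> (q + t) x)"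
    unfolding e[THEN fun_cong] by (rule R(2)) (use g in auto)
qed

lemma nn_lpos_shifted_powr:
  assumes g: "0 \<le> \<gamma>" "\<gamma> < 1" and b: "1 - \<gamma> < \<beta>" 
  shows "\<exists>K\<ge>0. \<forall>Y>0. (LINT t|lpos. t powr (- \<gamma>) * (Y + t) powr (- \<beta>)) = K * Y powr (1 - \<gamma> - \<beta>) \<and>
     integrable lpos (\<lambda>t. t powr (- \<gamma>) * (Y + t) powr (- \<beta>))"
proof -
  have i1: "integrable lpos (\<lambda>t. t powr (- \<gamma>) * (1 + t) powr (- \<beta>))"
    by (rule integrable_lpos_powr) (use g b in auto)
  define K where "K = (LINT t|lpos. t powr (- \<gamma>) * (1 + t) powr (- \<beta>))"
  have K: "K \<ge> 0" unfolding K_def by (intro integral_nonneg_AE) auto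
  have nK: "(\<integral>\<^sup>+t. ennreal (t powr (- \<gamma>) * (1 + t) powr (- \<beta>)) \<partial>lpos) = ennreal K"
    unfolding K_def by (rule nn_integral_eq_integral[OF i1]) auto
  show ?thesis
  proof (intro exI[of _ K] conjI allI impI K)
    fix Y :: real assume Y: "0 < Y"
    have "(\<integral>\<^sup>+t. ennreal (t powr (- \<gamma>) * (Y + t) powr (- \<beta>)) \<partial>lpos) = ennreal Y * (\<integral>\<^sup>+t. ennreal ((Y * t) powr (- \<gamma>) * (Y + Y * t) powr (- \<beta>)) \<partial>lpos)"
      by (rule nn_lpos_scale) (use Y in auto)
    also have "(\<integral>\<^sup>+t. ennreal ((Y * t) powr (- \<gamma>) * (Y + Y * t) powr (- \<beta>)) \<partial>lpos) = (\<integral>\<^sup>+t. ennreal (Y powr (- \<gamma> - \<beta>)) * ennreal (t powr (- \<gamma>) * (1 + t) powr (- \<beta>)) \<partial>lpos)"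
    proof (rule nn_lpos_cong)
      fix t :: real
      have "(Y * t) powr (- \<gamma>) * (Y + Y * t) powr (- \<beta>) = (Y * t) powr (- \<gamma>) * (Y * (1 + t)) powr (- \<beta>)" by (simp add: algebra_simps)
      also have "\<dots> = (Y powr (- \<gamma>) * Y powr (- \<beta>)) * (t powr (- \<gamma>) * (1 + t) powr (- \<beta>))" by (simp add: powr_mult)
      also have "Y powr (- \<gamma>) * Y powr (- \<beta>) = Y powr (- \<gamma> - \<beta>)" by (simp add: powr_add[symmetric])
      finally show "ennreal ((Y * t) powr (- \<gamma>) * (Y + Y * t) powr (- \<beta>)) = ennreal (Y powr (- \<gamma> - \<beta>)) * ennreal (t powr (- \<gamma>) * (1 + t) powr (- \<beta>))"
        by (simp add: ennreal_mult[symmetric])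
    qed
    also have "\<dots> = ennreal (Y powr (- \<gamma> - \<beta>)) * ennreal K" using nK by (subst nn_integral_cmult) auto
    also have "ennreal Y * \<dots> = ennreal (K * Y powr (1 - \<gamma> - \<beta>))"
    proof -
      have "Y * Y powr (- \<gamma> - \<beta>) = Y powr (1 - \<gamma> - \<beta>)" using Y powr_add[of Y 1 "- \<gamma> - \<beta>"] by (simp add: algebra_simps)
      then show ?thesis using K Y by (simp add: ennreal_mult[symmetric] mult.assoc[symmetric] mult.commute)
    qed
    finally have n: "(\<integral>\<^sup>+t. ennreal (t powr (- \<gamma>) * (Y + t) powr (- \<beta>)) \<partial>lpos) = ennreal (K * Y powr (1 - \<gamma> - \<beta>))" .
    then show "integrable lpos (\<lambda>t. t powr (- \<gamma>) * (Y + t) powr (- \<beta>))"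
      by (intro integrableI_nonneg) auto
    show "(LINT t|lpos. t powr (- \<gamma>) * (Y + t) powr (- \<beta>)) = K * Y powr (1 - \<gamma> - \<beta>)"
      using n K by (subst integral_eq_nn_integral) auto
  qed
qed

text \<open>The constant depends on \<gamma> and \<beta> only, as the integral is homogeneous in Y.
  With Y = 1 + \<tau> + |x|^2 this gives estimates uniform in time and space.\<close>

lemma RL_abs_le:
  assumes g: "0 \<le> \<gamma>" "\<gamma> < 1" and b: "1 - \<gamma> < \<beta>"
  shows "\<exists>K\<ge>0. \<forall>Y>0. \<forall>D \<tau> \<psi>. 0 \<le> D \<longrightarrow> \<psi> \<in> borel_measurable borel \<longrightarrow> (\<forall>t>0. \<bar>\<psi> (\<tau> + t)\<bar> \<le> D * (Y + t) powr (- \<beta>)) \<longrightarrow>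
     \<bar>RL (1 - \<gamma>) \<psi> \<tau>\<bar> \<le> D * K * Y powr (1 - \<gamma> - \<beta>)"
proof -
  obtain K where K: "K \<ge> 0" "\<And>Y. Y > 0 \<Longrightarrow> (LINT t|lpos. t powr (- \<gamma>) * (Y + t) powr (- \<beta>)) = K * Y powr (1 - \<gamma> - \<beta>)"
     "\<And>Y. Y > 0 \<Longrightarrow> integrable lpos (\<lambda>t. t powr (- \<gamma>) * (Y + t) powr (- \<beta>))"
    using nn_lpos_shifted_powr[OF g b] by auto
  have G: "0 < Gamma (1 - \<gamma>)" using g by (intro Gamma_real_pos) auto
  show ?thesis
  proof (intro exI[of _ "K / Gamma (1 - \<gamma>)"] conjI allI impI)
    fix Y D \<tau> :: real and \<psi> :: "real \<Rightarrow> real"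
    assume Y: "0 < Y" and D: "0 \<le> D" and [measurable]: "\<psi> \<in> borel_measurable borel" and le: "\<forall>t>0. \<bar>\<psi> (\<tau> + t)\<bar> \<le> D * (Y + t) powr (- \<beta>)"
    have b: "\<bar>t powr (1 - \<gamma> - 1) * \<psi> (\<tau> + t)\<bar> \<le> D * (t powr (- \<gamma>) * (Y + t) powr (- \<beta>))" if "0 < t" for t
      using mult_left_mono[of "\<bar>\<psi> (\<tau> + t)\<bar>" "D * (Y + t) powr (- \<beta>)" "t powr (- \<gamma>)"] le that by (simp add: abs_mult mult_ac)
    have i: "integrable lpos (\<lambda>t. D * (t powr (- \<gamma>) * (Y + t) powr (- \<beta>)))" using K(3)[OF Y] by simp
    have i2: "integrable lpos (\<lambda>t. t powr (1 - \<gamma> - 1) * \<psi> (\<tau> + t))"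
      by (rule integrable_lpos_bound[OF i]) (use b in auto)
    have "\<bar>LINT t|lpos. t powr (1 - \<gamma> - 1) * \<psi> (\<tau> + t)\<bar> \<le> (LINT t|lpos. \<bar>t powr (1 - \<gamma> - 1) * \<psi> (\<tau> + t)\<bar>)"
      by (rule integral_abs_bound)
    also have "\<dots> \<le> (LINT t|lpos. D * (t powr (- \<gamma>) * (Y + t) powr (- \<beta>)))"
      by (rule integral_mono_AE[OF integrable_abs[OF i2] i]) (use AE_lpos b in auto)
    also have "\<dots> = D * K * Y powr (1 - \<gamma> - \<beta>)" using K(2)[OF Y] by simp
    finally show "\<bar>RL (1 - \<gamma>) \<psi> \<tau>\<bar> \<le> D * (K / Gamma (1 - \<gamma>)) * Y powr (1 - \<gamma> - \<beta>)"
      unfolding RL_def using G by (simp add: field_simps)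
  qed (use K G in auto)
qed

text \<open>One of the m + 1 orders of time decay pays for the polynomial form of the Gaussian,
  leaving order m; the time integral of order 1 - \<gamma> reduces the spatial power of 1 + |x|^2
  from n/2 + 1 to n/2 + \<gamma>. This is the weight against which v is integrable, and it also
  holds at \<gamma> = 0.\<close>

lemma ztf_bound_space:
  fixes \<phi> :: "'a::euclidean_space \<Rightarrow> real"
  assumes \<phi>: "tst (2 * Suc m) \<phi>" and g: "0 \<le> \<gamma>" "\<gamma> < 1"
  shows "\<exists>C\<ge>0. \<forall>\<tau>\<ge>0. \<forall>x. \<bar>ztf m \<gamma> \<phi> \<tau> x\<bar> \<le> C * (1 + \<tau>) powr (- real m) * (1 + x \<bullet> x) powr (- (real DIM('a) / 2 + \<gamma>))"
proof -
  define n2 where "n2 = real DIM('a) / 2"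
  have n2: "0 < n2" by (simp add: n2_def)
  have [measurable]: "(neg_lap ^^ Suc m) \<phi> \<in> borel_measurable borel" 
    by (rule tst_meas, rule tst_neg_lap_pow[of 0]) (use \<phi> in simp)
  obtain C1 where C1: "C1 \<ge> 0" "\<And>t x. t \<ge> 0 \<Longrightarrow> \<bar>hf ((neg_lap ^^ Suc m) \<phi>) t x\<bar> \<le> C1 * (1 + t) powr (- real (Suc m)) * hk (1 + 2 * t) x"
    using hf_decay[OF \<phi>] by blast
  obtain C2 where C2: "C2 > 0" "\<And>q x. q \<ge> 0 \<Longrightarrow> hk (1 + 2 * q) (x::'a) \<le> C2 * (1 + q) * (1 + q + x \<bullet> x) powr (- n2 - 1)"
    using hk_poly_bound[where ?'a='a] by (auto simp: n2_def)
  obtain K where K: "K \<ge> 0" "\<And>Y D \<tau> \<psi>. 0 < Y \<Longrightarrow> 0 \<le> D \<Longrightarrow> \<psi> \<in> borel_measurable borel \<Longrightarrow> (\<forall>t>0. \<bar>\<psi> (\<tau> + t)\<bar> \<le> D * (Y + t) powr (- (n2 + 1))) \<Longrightarrow>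
     \<bar>RL (1 - \<gamma>) \<psi> \<tau>\<bar> \<le> D * K * Y powr (1 - \<gamma> - (n2 + 1))"
    using RL_abs_le[OF g, of "n2 + 1"] n2 g by auto
  show ?thesis
  proof (intro exI[of _ "C1 * C2 * K"] conjI allI impI)
    show "0 \<le> C1 * C2 * K" using C1 C2 K by simp
    fix \<tau> :: real and x :: 'a assume \<tau>: "0 \<le> \<tau>"
    define Y where "Y = 1 + \<tau> + x \<bullet> x"
    have Y: "0 < Y" "1 + x \<bullet> x \<le> Y" using \<tau> by (auto simp: Y_def add_pos_nonneg)
    have "\<bar>RL (1 - \<gamma>) (\<lambda>t. hf ((neg_lap ^^ Suc m) \<phi>) t x) \<tau>\<bar> \<le> (C1 * C2 * (1 + \<tau>) powr (- real m)) * K * Y powr (1 - \<gamma> - (n2 + 1))"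
    proof (rule K(2)[OF Y(1)])
      show "0 \<le> C1 * C2 * (1 + \<tau>) powr (- real m)" using C1 C2 by simp
      show "(\<lambda>t. hf ((neg_lap ^^ Suc m) \<phi>) t x) \<in> borel_measurable borel" by measurable
      show "\<forall>t>0. \<bar>hf ((neg_lap ^^ Suc m) \<phi>) (\<tau> + t) x\<bar> \<le> (C1 * C2 * (1 + \<tau>) powr (- real m)) * (Y + t) powr (- (n2 + 1))"
      proof (intro allI impI)
        fix t :: real assume t: "0 < t"
        let ?q = "\<tau> + t"
        have q: "0 \<le> ?q" using \<tau> t by simp
        have "\<bar>hf ((neg_lap ^^ Suc m) \<phi>) ?q x\<bar> \<le> C1 * (1 + ?q) powr (- real (Suc m)) * hk (1 + 2 * ?q) x" by (rule C1(2)[OF q])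
        also have "\<dots> \<le> C1 * (1 + ?q) powr (- real (Suc m)) * (C2 * (1 + ?q) * (1 + ?q + x \<bullet> x) powr (- n2 - 1))"
          using C2(2)[OF q, of x] C1(1) by (intro mult_left_mono) auto
        also have "\<dots> = C1 * C2 * ((1 + ?q) powr (- real (Suc m)) * (1 + ?q)) * (Y + t) powr (- (n2 + 1))"
        proof -
          have e: "- n2 - 1 = - (n2 + 1)" "1 + ?q + x \<bullet> x = Y + t" by (auto simp: Y_def)
          show ?thesis unfolding e by (simp only: mult_ac)
        qed
        also have "(1 + ?q) powr (- real (Suc m)) * (1 + ?q) = (1 + ?q) powr (- real m)"
          using q powr_add[of "1 + ?q" "- real (Suc m)" 1] by simp
        also have "(1 + ?q) powr (- real m) \<le> (1 + \<tau>) powr (- real m)"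
          using \<tau> t by (intro powr_mono2') auto
        finally show "\<bar>hf ((neg_lap ^^ Suc m) \<phi>) ?q x\<bar> \<le> (C1 * C2 * (1 + \<tau>) powr (- real m)) * (Y + t) powr (- (n2 + 1))"
          using C1(1) C2(1) by (simp add: mult_left_mono mult_right_mono)
      qed
    qed
    also have "1 - \<gamma> - (n2 + 1) = - (n2 + \<gamma>)" by simp
    also have "Y powr (- (n2 + \<gamma>)) \<le> (1 + x \<bullet> x) powr (- (n2 + \<gamma>))"
      using Y g n2 by (intro powr_mono2') (auto simp: add_pos_nonneg)
    finally have "\<bar>RL (1 - \<gamma>) (\<lambda>t. hf ((neg_lap ^^ Suc m) \<phi>) t x) \<tau>\<bar> \<le> (C1 * C2 * (1 + \<tau>) powr (- real m)) * K * (1 + x \<bullet> x) powr (- (n2 + \<gamma>))"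
      using C1(1) C2(1) K(1) by (simp add: mult_left_mono)
    then show "\<bar>ztf m \<gamma> \<phi> \<tau> x\<bar> \<le> C1 * C2 * K * (1 + \<tau>) powr (- real m) * (1 + x \<bullet> x) powr (- (real DIM('a) / 2 + \<gamma>))"
      unfolding ztf_def n2_def by (simp only: mult_ac)
  qed
qed

lemma hf_semigroup:
  fixes \<phi> :: "'a::euclidean_space \<Rightarrow> real"
  assumes \<phi>: "tst k \<phi>" and t: "0 < t" "0 < r"
  shows "(LINT y|lborel. hf \<phi> t y * hk r (x - y)) = hf \<phi> (t + r) x"
proof -
  have [measurable]: "\<phi> \<in> borel_measurable borel" using \<phi> by (rule tst_meas)
  obtain M where M: "M > 0" "\<And>x. \<bar>\<phi> x\<bar> \<le> M * hk 1 x" using tst_gauss[OF \<phi>] by auto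
  let ?F = "\<lambda>w y. \<phi> w * hk t (y - w) * hk r (x - y)"
  have inner: "(\<integral>\<^sup>+y. ennreal (hk t (y - w) * hk r (x - y)) \<partial>lborel) = ennreal (hk (t + r) (x - w))" for w
  proof -
    have "(\<integral>\<^sup>+y. ennreal (hk t (y - w) * hk r (x - y)) \<partial>lborel) = (\<integral>\<^sup>+y. ennreal (hk t ((x - y) - w) * hk r (x - (x - y))) \<partial>lborel)"
      by (rule nn_integral_shift(3)[symmetric]) measurable
    also have "\<dots> = (\<integral>\<^sup>+y. ennreal (hk t ((x - w) - y) * hk r y) \<partial>lborel)"
      by (simp add: algebra_simps)
    finally show ?thesis using hk_conv_nn[OF t] by simp
  qed
  have i: "integrable (lborel \<Otimes>\<^sub>M lborel) (\<lambda>(w, y). ?F w y)"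
  proof (subst integrable_iff_bounded, intro conjI)
    have "(\<integral>\<^sup>+z. ennreal (norm (case z of (w, y) \<Rightarrow> ?F w y)) \<partial>(lborel \<Otimes>\<^sub>M lborel)) = (\<integral>\<^sup>+w. \<integral>\<^sup>+y. ennreal (norm (?F w y)) \<partial>lborel \<partial>lborel)"
      by (subst lborel.nn_integral_fst[symmetric]) auto
    also have "\<dots> = (\<integral>\<^sup>+w. ennreal \<bar>\<phi> w\<bar> * (\<integral>\<^sup>+y. ennreal (hk t (y - w) * hk r (x - y)) \<partial>lborel) \<partial>lborel)"
      by (subst nn_integral_cmult[symmetric]) (auto simp: abs_mult ennreal_mult[symmetric] mult.assoc)
    also have "\<dots> = (\<integral>\<^sup>+w. ennreal (norm (\<phi> w * hk (t + r) (x - w))) \<partial>lborel)"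
      unfolding inner by (simp add: ennreal_mult[symmetric] abs_mult)
    also have "\<dots> < \<infinity>"
      using hf_gauss_bound(2)[of \<phi> M 1 "t + r" x] M t by (simp add: integrable_iff_bounded)
    finally show "(\<integral>\<^sup>+z. ennreal (norm (case z of (w, y) \<Rightarrow> ?F w y)) \<partial>(lborel \<Otimes>\<^sub>M lborel)) < \<infinity>" .
  qed measurable
  have in2: "(LINT y|lborel. hk t (y - w) * hk r (x - y)) = hk (t + r) (x - w)" for w
    using inner[of w] by (subst integral_eq_nn_integral) auto
  have "(LINT y|lborel. hf \<phi> t y * hk r (x - y)) = (LINT y|lborel. LINT w|lborel. ?F w y)"
    using t by (simp add: hf_eq)
  also have "\<dots> = (LINT w|lborel. LINT y|lborel. ?F w y)"
    by (rule lborel_pair.Fubini_integral[OF i])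
  also have "\<dots> = (LINT w|lborel. \<phi> w * hk (t + r) (x - w))"
    by (simp add: mult.assoc in2)
  also have "\<dots> = hf \<phi> (t + r) x" using t by (simp add: hf_eq)
  finally show ?thesis .
qed

text \<open>Both sides are time integrals of heat flows, so Fubini and the semigroup property move
  the convolution inside. Absolute convergence at infinity comes from the decay m + 1 + n/2 against
  t^(-\<gamma>).\<close>

lemma ztf_conv:
  fixes \<phi> :: "'a::euclidean_space \<Rightarrow> real"
  assumes \<phi>: "tst (2 * Suc m) \<phi>" and g: "0 \<le> \<gamma>" "\<gamma> < 1" and r: "0 < r"
  shows "(LINT y|lborel. ztf m \<gamma> \<phi> 0 y * hk r (x - y)) = ztf m \<gamma> \<phi> r x"
proof -
  let ?\<psi> = "(neg_lap ^^ Suc m) \<phi>"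
  have \<psi>: "tst 0 ?\<psi>" by (rule tst_neg_lap_pow[of 0]) (use \<phi> in simp)
  have [measurable]: "?\<psi> \<in> borel_measurable borel" using \<psi> by (rule tst_meas)
  have G: "0 < Gamma (1 - \<gamma>)" using g by (intro Gamma_real_pos) auto
  obtain C1 where C1: "C1 \<ge> 0" "\<And>t x. t \<ge> 0 \<Longrightarrow> \<bar>hf ?\<psi> t x\<bar> \<le> C1 * (1 + t) powr (- real (Suc m)) * hk (1 + 2 * t) x"
    using hf_decay[OF \<phi>] by blast
  have n: "0 < real m + real DIM('a) / 2" by (simp add: add_nonneg_pos)
  let ?F = "\<lambda>t y. t powr (1 - \<gamma> - 1) * hf ?\<psi> t y * hk r (x - y)"
  have b: "(\<integral>\<^sup>+y. ennreal (norm (?F t y)) \<partial>lborel) \<le> ennreal (C1 * (t powr (- \<gamma>) * (1 + t) powr (- (real (Suc m) + real DIM('a) / 2))))" if t: "0 < t" for t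
  proof -
    have "(\<integral>\<^sup>+y. ennreal (norm (?F t y)) \<partial>lborel) \<le> (\<integral>\<^sup>+y. ennreal (t powr (- \<gamma>) * (C1 * (1 + t) powr (- real (Suc m)))) * ennreal (hk r (x - y) * hk (1 + 2 * t) y) \<partial>lborel)"
    proof (rule nn_integral_mono)
      fix y
      have "norm (?F t y) = t powr (- \<gamma>) * \<bar>hf ?\<psi> t y\<bar> * hk r (x - y)" by (simp add: abs_mult del: funpow.simps)
      also have "\<dots> \<le> t powr (- \<gamma>) * (C1 * (1 + t) powr (- real (Suc m)) * hk (1 + 2 * t) y) * hk r (x - y)"
        using C1(2)[of t y] t by (intro mult_right_mono mult_left_mono) auto
      also have "\<dots> = t powr (- \<gamma>) * (C1 * (1 + t) powr (- real (Suc m))) * (hk r (x - y) * hk (1 + 2 * t) y)" by (simp only: mult_ac)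
      finally show "ennreal (norm (?F t y)) \<le> ennreal (t powr (- \<gamma>) * (C1 * (1 + t) powr (- real (Suc m)))) * ennreal (hk r (x - y) * hk (1 + 2 * t) y)"
        using C1(1) by (simp add: ennreal_mult[symmetric] ennreal_leI del: funpow.simps of_nat_Suc)
    qed
    also have "\<dots> = ennreal (t powr (- \<gamma>) * (C1 * (1 + t) powr (- real (Suc m)))) * ennreal (hk (r + (1 + 2 * t)) x)"
      using hk_conv_nn[of r "1 + 2 * t" x] r t by (subst nn_integral_cmult) auto
    also have "\<dots> \<le> ennreal (t powr (- \<gamma>) * (C1 * (1 + t) powr (- real (Suc m)))) * ennreal ((1 + t) powr (- (real DIM('a) / 2)))"
    proof (intro mult_left_mono ennreal_leI)
      have "hk (r + (1 + 2 * t)) x \<le> (4 * pi * (r + (1 + 2 * t))) powr (- (real DIM('a) / 2))" by (rule hk_le0) (use r t in auto)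
      also have "\<dots> \<le> (1 + t) powr (- (real DIM('a) / 2))"
      proof (rule powr_mono2')
        have "1 * (1 + t) \<le> 4 * pi * (r + (1 + 2 * t))" using t r pi_gt3 by (intro mult_mono) auto
        then show "1 + t \<le> 4 * pi * (r + (1 + 2 * t))" by simp
      qed (use t in auto)
      finally show "hk (r + (1 + 2 * t)) x \<le> (1 + t) powr (- (real DIM('a) / 2))" .
    qed auto
    also have "\<dots> = ennreal (C1 * (t powr (- \<gamma>) * (1 + t) powr (- (real (Suc m) + real DIM('a) / 2))))"
    proof -
      have "(1 + t) powr (- real (Suc m)) * (1 + t) powr (- (real DIM('a) / 2)) = (1 + t) powr (- (real (Suc m) + real DIM('a) / 2))"
        by (simp add: powr_add[symmetric])
      then show ?thesis using C1(1) by (simp add: ennreal_mult[symmetric] mult_ac)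
    qed
    finally show ?thesis .
  qed
  have i: "integrable (lpos \<Otimes>\<^sub>M lborel) (\<lambda>(t, y). ?F t y)"
  proof (subst integrable_iff_bounded, intro conjI)
    show "(\<lambda>(t, y). ?F t y) \<in> borel_measurable (lpos \<Otimes>\<^sub>M lborel)" by measurable
    have "(\<integral>\<^sup>+z. ennreal (norm (case z of (t, y) \<Rightarrow> ?F t y)) \<partial>(lpos \<Otimes>\<^sub>M lborel)) = (\<integral>\<^sup>+t. \<integral>\<^sup>+y. ennreal (norm (?F t y)) \<partial>lborel \<partial>lpos)"
      by (subst lborel.nn_integral_fst[symmetric], measurable)
    also have "\<dots> \<le> (\<integral>\<^sup>+t. ennreal (C1 * (t powr (- \<gamma>) * (1 + t) powr (- (real (Suc m) + real DIM('a) / 2)))) \<partial>lpos)"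
      by (rule nn_lpos_mono) (rule b)
    also have "\<dots> < \<infinity>"
    proof -
      have "integrable lpos (\<lambda>t. C1 * (t powr (- \<gamma>) * (1 + t) powr (- (real (Suc m) + real DIM('a) / 2))))"
        using g n by (intro integrable_mult_right integrable_lpos_powr) auto
      then show ?thesis using C1(1) by (subst nn_integral_eq_integral) auto
    qed
    finally show "(\<integral>\<^sup>+z. ennreal (norm (case z of (t, y) \<Rightarrow> ?F t y)) \<partial>(lpos \<Otimes>\<^sub>M lborel)) < \<infinity>" .
  qed
  have "(LINT y|lborel. ztf m \<gamma> \<phi> 0 y * hk r (x - y)) = (LINT y|lborel. LINT t|lpos. ?F t y) / Gamma (1 - \<gamma>)"
    unfolding ztf_def RL_def by (simp del: funpow.simps)
  also have "(LINT y|lborel. LINT t|lpos. ?F t y) = (LINT t|lpos. LINT y|lborel. ?F t y)"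
    by (rule lpos_lborel.Fubini_integral[OF i])
  also have "\<dots> = (LINT t|lpos. t powr (1 - \<gamma> - 1) * hf ?\<psi> (r + t) x)"
  proof (rule lpos_cong)
    show "(\<lambda>t. LINT y|lborel. ?F t y) \<in> borel_measurable borel"
      by (rule lborel.borel_measurable_lebesgue_integral) measurable
    show "(LINT y|lborel. ?F t y) = t powr (1 - \<gamma> - 1) * hf ?\<psi> (r + t) x" if "0 < t" for t
      using hf_semigroup[OF \<psi> that r, of x] by (simp add: mult.assoc add.commute del: funpow.simps)
  qed measurable
  finally show ?thesis unfolding ztf_def RL_def by simp
qed

section \<open>Hoelder regularity and second differences\<close>

text \<open>Keeps the coordinates of z belonging to A. Letting A grow to the full basis leads from x
  to x + z one coordinate at a time, as needed when only partial derivatives are at hand.\<close>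

definition bcomp :: "'a::euclidean_space set \<Rightarrow> 'a \<Rightarrow> 'a" where
  "bcomp A z = (\<Sum>b\<in>A. (z \<bullet> b) *\<^sub>R b)"

lemma bcomp_inner:
  assumes "A \<subseteq> Basis" "c \<in> Basis"
  shows "bcomp A z \<bullet> c = (if c \<in> A then z \<bullet> c else 0)"
proof -
  have fin: "finite A" using assms(1) finite_Basis finite_subset by blast
  have "bcomp A z \<bullet> c = (\<Sum>b\<in>A. (z \<bullet> b) * (b \<bullet> c))" by (simp add: bcomp_def inner_sum_left)
  also have "\<dots> = (\<Sum>b\<in>A. if b = c then z \<bullet> c else 0)"
    using assms by (intro sum.cong refl) (auto simp: inner_Basis subset_iff)
  finally show ?thesis using fin by simp
qed

lemma bcomp_norm: "A \<subseteq> Basis \<Longrightarrow> norm (bcomp A z) \<le> norm z"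
  by (rule norm_le_componentwise) (simp add: bcomp_inner)

lemma bcomp_Basis: "bcomp Basis z = z"
  by (simp add: bcomp_def euclidean_representation)

lemma bcomp_insert: "finite A \<Longrightarrow> b \<notin> A \<Longrightarrow> bcomp (insert b A) z = bcomp A z + (z \<bullet> b) *\<^sub>R b"
  by (simp add: bcomp_def add.commute)

lemma MVT_abs:
  fixes F :: "real \<Rightarrow> real"
  assumes "\<And>t. (F has_field_derivative F' t) (at t)"
  shows "\<exists>\<theta>. \<bar>\<theta>\<bar> \<le> \<bar>h\<bar> \<and> F h - F 0 = h * F' \<theta>"
proof -
  consider "h > 0" | "h = 0" | "h < 0" by linarith
  then show ?thesis
  proof cases
    case 1
    obtain z where "0 < z" "z < h" "F h - F 0 = (h - 0) * F' z"
      using MVT2[of 0 h F F'] assms 1 by blast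
    then show ?thesis by (intro exI[of _ z]) auto
  next
    case 3
    obtain z where "h < z" "z < 0" "F 0 - F h = (0 - h) * F' z"
      using MVT2[of h 0 F F'] assms 3 by blast
    then show ?thesis by (intro exI[of _ z]) (auto simp: algebra_simps)
  qed auto
qed

text \<open>Telescopes over the coordinates with the mean value theorem in each. An intermediate
  point differs from x by a partial sum of coordinates and a further part of one coordinate, each of
  size at most S, hence the radius R + 2 * S for the bounds on the partials.\<close>

lemma Ck_line_bound:
  fixes u :: "'a::euclidean_space \<Rightarrow> real"
  assumes "Ck (Suc k) u"
  shows "\<exists>C\<ge>0. \<forall>x z. norm x \<le> R \<longrightarrow> norm z \<le> S \<longrightarrow> \<bar>u (x + z) - u x\<bar> \<le> C * norm z"
proof -
  have "\<exists>M\<ge>0. \<forall>y. norm y \<le> R + 2 * S \<longrightarrow> \<bar>pdiff [b] u y\<bar> \<le> M" if "b \<in> Basis" for b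
  proof -
    have "continuous_on (cball 0 (R + 2 * S)) (pdiff [b] u)"
      using Ck_pdiff_cont[OF assms, of "[b]"] that by (auto elim: continuous_on_subset)
    then have "compact (pdiff [b] u ` cball 0 (R + 2 * S))" by (rule compact_continuous_image) simp
    then have "bounded (pdiff [b] u ` cball 0 (R + 2 * S))" by (rule compact_imp_bounded)
    then obtain M where "0 < M" "\<forall>y\<in>pdiff [b] u ` cball 0 (R + 2 * S). norm y \<le> M"
      unfolding bounded_pos by blast
    then show ?thesis by (intro exI[of _ M]) (auto simp del: pdiff.simps)
  qed
  then obtain M where M: "\<And>b. b \<in> Basis \<Longrightarrow> M b \<ge> 0" "\<And>b y. b \<in> Basis \<Longrightarrow> norm y \<le> R + 2 * S \<Longrightarrow> \<bar>pdiff [b] u y\<bar> \<le> M b"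
    by metis
  show ?thesis
  proof (intro exI[of _ "sum M Basis"] conjI allI impI)
    show "0 \<le> sum M Basis" using M(1) by (rule sum_nonneg)
    fix x z :: 'a assume x: "norm x \<le> R" and z: "norm z \<le> S"
    have "\<bar>u (x + bcomp A z) - u x\<bar> \<le> sum M A * norm z" if "A \<subseteq> Basis" for A
      using finite_subset[OF that finite_Basis] that
    proof (induction A rule: finite_induct)
      case empty then show ?case by (simp add: bcomp_def)
    next
      case (insert b A)
      then have b: "b \<in> Basis" and A: "A \<subseteq> Basis" by auto
      let ?x = "x + bcomp A z"
      obtain \<theta> where \<theta>: "\<bar>\<theta>\<bar> \<le> \<bar>z \<bullet> b\<bar>" "u (?x + (z \<bullet> b) *\<^sub>R b) - u (?x + 0 *\<^sub>R b) = (z \<bullet> b) * pdiff [b] u (?x + \<theta> *\<^sub>R b)"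
        using MVT_abs[OF Ck_DERIV_line[OF assms b, of ?x], of "z \<bullet> b"] by blast
      have zb: "\<bar>z \<bullet> b\<bar> \<le> norm z" using b by (rule Basis_le_norm)
      have "norm (?x + \<theta> *\<^sub>R b) \<le> norm x + norm (bcomp A z) + norm (\<theta> *\<^sub>R b)"
        by (meson norm_triangle_ineq norm_triangle_le add_mono order_refl)
      also have "\<dots> \<le> R + 2 * S" using x z bcomp_norm[OF A, of z] \<theta>(1) zb b by simp
      finally have "\<bar>pdiff [b] u (?x + \<theta> *\<^sub>R b)\<bar> \<le> M b" by (rule M(2)[OF b])
      then have "\<bar>(z \<bullet> b) * pdiff [b] u (?x + \<theta> *\<^sub>R b)\<bar> \<le> norm z * M b"
        unfolding abs_mult using zb by (intro mult_mono) auto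
      then have 1: "\<bar>u (?x + (z \<bullet> b) *\<^sub>R b) - u ?x\<bar> \<le> M b * norm z"
        using \<theta>(2) by (simp add: mult.commute del: pdiff.simps)
      have "x + bcomp (insert b A) z = ?x + (z \<bullet> b) *\<^sub>R b" using insert by (simp add: bcomp_insert)
      then have "\<bar>u (x + bcomp (insert b A) z) - u x\<bar> \<le> \<bar>u (?x + (z \<bullet> b) *\<^sub>R b) - u ?x\<bar> + \<bar>u ?x - u x\<bar>" by (simp only:)
      also have "\<dots> \<le> M b * norm z + sum M A * norm z" using 1 insert.IH[OF A] by linarith
      also have "\<dots> = sum M (insert b A) * norm z" using insert by (simp add: algebra_simps)
      finally show ?case .
    qed
    from this[of Basis] show "\<bar>u (x + z) - u x\<bar> \<le> sum M Basis * norm z" by (simp add: bcomp_Basis)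
  qed
qed

lemma Ck_loc_hoelder:
  fixes u :: "'a::euclidean_space \<Rightarrow> real"
  assumes "Ck (Suc k) u" "0 < \<beta>" "\<beta> \<le> 1"
  shows "loc_hoelder_on UNIV \<beta> u"
  unfolding loc_hoelder_on_def
proof (intro allI impI)
  fix K :: "'a set" assume "compact K \<and> K \<subseteq> UNIV"
  then have "bounded K" by (auto intro: compact_imp_bounded)
  then obtain R where R: "R > 0" "\<And>x. x \<in> K \<Longrightarrow> norm x \<le> R" unfolding bounded_pos by auto
  obtain C where C: "C \<ge> 0" "\<And>x z. norm x \<le> R \<Longrightarrow> norm z \<le> 2 * R \<Longrightarrow> \<bar>u (x + z) - u x\<bar> \<le> C * norm z"
    using Ck_line_bound[OF assms(1), of R "2 * R"] by auto
  show "\<exists>C. \<forall>x\<in>K. \<forall>y\<in>K. \<bar>u x - u y\<bar> \<le> C * dist x y powr \<beta>"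
  proof (intro exI ballI)
    fix x y assume xy: "x \<in> K" "y \<in> K"
    have d: "norm (x - y) \<le> 2 * R" using R(2)[OF xy(1)] R(2)[OF xy(2)] norm_triangle_ineq4[of x y] by linarith
    have "\<bar>u x - u y\<bar> \<le> C * norm (x - y)" using C(2)[of y "x - y"] R(2)[OF xy(2)] d by simp
    also have "norm (x - y) \<le> (2 * R) powr (1 - \<beta>) * norm (x - y) powr \<beta>"
    proof (cases "x = y")
      case False
      have "norm (x - y) = norm (x - y) powr (1 - \<beta>) * norm (x - y) powr \<beta>" using False by (simp add: powr_add[symmetric])
      also have "\<dots> \<le> (2 * R) powr (1 - \<beta>) * norm (x - y) powr \<beta>"
        using d assms by (intro mult_right_mono powr_mono2) auto
      finally show ?thesis .
    qed simp
    finally show "\<bar>u x - u y\<bar> \<le> (C * (2 * R) powr (1 - \<beta>)) * dist x y powr \<beta>"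
      using C(1) by (simp add: dist_norm mult.assoc mult_left_mono)
  qed
qed

lemma Ck_hoelder_basic_le:
  fixes u :: "'a::euclidean_space \<Rightarrow> real"
  assumes "Ck_hoelder_basic k \<beta> u" "0 < \<beta>" "\<beta> \<le> 1" "set bs \<subseteq> Basis" "length bs \<le> k"
  shows "loc_hoelder_on UNIV \<beta> (pdiff bs u)"
proof (cases "length bs = k")
  case True then show ?thesis using assms by (auto simp: Ck_hoelder_basic_def)
next
  case False
  then have "Ck (Suc 0) (pdiff bs u)" using assms by (intro Ck_pdiff) (auto simp: Ck_hoelder_basic_def elim: Ck_mono)
  then show ?thesis using assms by (intro Ck_loc_hoelder)
qed

text \<open>For exponents above 1 the convention provides a further derivative, so the derivatives
  of order k are locally Lipschitz; the exponent can be cut down to \<open>min 1 \<alpha>\<close>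
  without changing k.\<close>

lemma Ck_hoelder_loc_basic:
  fixes u :: "'a::euclidean_space \<Rightarrow> real"
  assumes "Ck_hoelder_loc k \<alpha> u" "0 < \<alpha>"
  shows "Ck_hoelder_basic k (min 1 \<alpha>) u"
proof (cases "\<alpha> \<le> 1")
  case True
  then have "nat (\<lceil>\<alpha>\<rceil> - 1) = 0" by (simp add: ceiling_le_iff)
  then show ?thesis using assms True by (simp add: Ck_hoelder_loc_def)
next
  case False
  define j where "j = nat (\<lceil>\<alpha>\<rceil> - 1)"
  have "j \<ge> 1" using False by (simp add: j_def le_nat_iff)
  then have C: "Ck (Suc k) u" using assms(1)
    unfolding Ck_hoelder_loc_def Let_def j_def[symmetric] Ck_hoelder_basic_def by (auto elim: Ck_mono)
  have "loc_hoelder_on UNIV 1 (pdiff bs u)" if "set bs \<subseteq> Basis" "length bs = k" for bs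
    by (rule Ck_loc_hoelder[of 0]) (use C that in \<open>auto intro!: Ck_pdiff\<close>)
  then show ?thesis using C False by (auto simp: Ck_hoelder_basic_def elim: Ck_mono)
qed

text \<open>Minus the symmetric second difference. Against an even kernel it replaces the first
  difference and turns the principal value into an absolutely convergent integral.\<close>

definition sd :: "('a::euclidean_space \<Rightarrow> real) \<Rightarrow> 'a \<Rightarrow> 'a \<Rightarrow> real" where
  "sd v z x = 2 * v x - v (x + z) - v (x - z)"

lemma loc_hoelder_cball:
  assumes "loc_hoelder_on UNIV \<beta> (g :: 'a::euclidean_space \<Rightarrow> real)"
  shows "\<exists>C\<ge>0. \<forall>x y. norm x \<le> R \<longrightarrow> norm y \<le> R \<longrightarrow> \<bar>g x - g y\<bar> \<le> C * norm (x - y) powr \<beta>"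
proof -
  obtain C where C: "\<forall>x\<in>cball 0 R. \<forall>y\<in>cball 0 R. \<bar>g x - g y\<bar> \<le> C * dist x y powr \<beta>"
    using assms[unfolded loc_hoelder_on_def, rule_format, of "cball 0 R"] by auto
  have "C * norm (x - y) powr \<beta> \<le> max C 0 * norm (x - y) powr \<beta>" for x y :: 'a
    by (intro mult_right_mono) auto
  moreover have "\<bar>g x - g y\<bar> \<le> C * norm (x - y) powr \<beta>" if "norm x \<le> R" "norm y \<le> R" for x y
    using C that by (simp add: dist_norm)
  ultimately have "\<bar>g x - g y\<bar> \<le> max C 0 * norm (x - y) powr \<beta>" if "norm x \<le> R" "norm y \<le> R" for x y
    using that by (meson order_trans)
  then show ?thesis by (intro exI[of _ "max C 0"]) auto
qed

lemma sd_bound_0: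
  assumes "loc_hoelder_on UNIV \<beta> (g :: 'a::euclidean_space \<Rightarrow> real)"
  shows "\<exists>C\<ge>0. \<forall>x z. norm x \<le> R \<longrightarrow> norm z \<le> 1 \<longrightarrow> \<bar>sd g z x\<bar> \<le> C * norm z powr \<beta>"
proof -
  obtain C where C: "C \<ge> 0" "\<And>x y. norm x \<le> R + 1 \<Longrightarrow> norm y \<le> R + 1 \<Longrightarrow> \<bar>g x - g y\<bar> \<le> C * norm (x - y) powr \<beta>"
    using loc_hoelder_cball[OF assms, of "R + 1"] by auto
  show ?thesis
  proof (intro exI[of _ "2 * C"] conjI allI impI)
    fix x z :: 'a assume x: "norm x \<le> R" and z: "norm z \<le> 1"
    have "norm (x + z) \<le> R + 1" "norm (x - z) \<le> R + 1"
      using x z norm_triangle_ineq[of x z] norm_triangle_ineq4[of x z] by auto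
    then have "\<bar>g (x + z) - g x\<bar> \<le> C * norm z powr \<beta>" "\<bar>g (x - z) - g x\<bar> \<le> C * norm z powr \<beta>"
      using C(2)[of "x + z" x] C(2)[of "x - z" x] x by auto
    then show "\<bar>sd g z x\<bar> \<le> 2 * C * norm z powr \<beta>" unfolding sd_def by linarith
  qed (use C in auto)
qed

text \<open>The coordinates are added in pairs, z at one point and -z at the reflected one. The
  derivative of each pair is a difference of values of one partial derivative, so its Hoelder bound
  contributes the exponent \<beta> on top of the factor |z| from the mean value theorem.\<close>

lemma sd_bound_1:
  fixes g :: "'a::euclidean_space \<Rightarrow> real"
  assumes g: "Ck (Suc k) g" and h: "\<And>b. b \<in> Basis \<Longrightarrow> loc_hoelder_on UNIV \<beta> (pdiff [b] g)" and \<beta>: "0 < \<beta>"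
  shows "\<exists>C\<ge>0. \<forall>x z. norm x \<le> R \<longrightarrow> norm z \<le> 1 \<longrightarrow> \<bar>sd g z x\<bar> \<le> C * norm z powr (1 + \<beta>)"
proof -
  have "\<forall>b\<in>Basis. \<exists>C\<ge>0. \<forall>x y. norm x \<le> R + 2 \<longrightarrow> norm y \<le> R + 2 \<longrightarrow> \<bar>pdiff [b] g x - pdiff [b] g y\<bar> \<le> C * norm (x - y) powr \<beta>"
    using h loc_hoelder_cball by blast
  then obtain C where C: "\<And>b. b \<in> Basis \<Longrightarrow> C b \<ge> 0" "\<And>b x y. b \<in> Basis \<Longrightarrow> norm x \<le> R + 2 \<Longrightarrow> norm y \<le> R + 2 \<Longrightarrow>
      \<bar>pdiff [b] g x - pdiff [b] g y\<bar> \<le> C b * norm (x - y) powr \<beta>" by metis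
  show ?thesis
  proof (intro exI[of _ "sum C Basis * 4 powr \<beta>"] conjI allI impI)
    show "0 \<le> sum C Basis * 4 powr \<beta>" using C(1) by (auto intro!: mult_nonneg_nonneg sum_nonneg)
    fix x z :: 'a assume x: "norm x \<le> R" and z: "norm z \<le> 1"
    define E where "E A = g (x + bcomp A z) + g (x - bcomp A z)" for A
    define W where "W = (4 * norm z) powr \<beta> * norm z"
    have "\<bar>E A - 2 * g x\<bar> \<le> sum C A * W" if "A \<subseteq> Basis" for A
      using finite_subset[OF that finite_Basis] that
    proof (induction A rule: finite_induct)
      case empty then show ?case by (simp add: E_def bcomp_def)
    next
      case (insert b A)
      then have b: "b \<in> Basis" and A: "A \<subseteq> Basis" by auto
      let ?y = "x + bcomp A z" and ?y' = "x - bcomp A z"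
      let ?F = "\<lambda>t. g (?y + t *\<^sub>R b) + g (?y' + (-t) *\<^sub>R b)"
      let ?F' = "\<lambda>t. pdiff [b] g (?y + t *\<^sub>R b) + pdiff [b] g (?y' + (-t) *\<^sub>R b) * (- 1)"
      have "(?F has_field_derivative ?F' t) (at t)" for t
        by (intro DERIV_add Ck_DERIV_line[OF g b] DERIV_chain2[where f="\<lambda>s. g (?y' + s *\<^sub>R b)"]) (auto intro!: derivative_eq_intros)
      then obtain \<theta> where \<theta>: "\<bar>\<theta>\<bar> \<le> \<bar>z \<bullet> b\<bar>" "?F (z \<bullet> b) - ?F 0 = (z \<bullet> b) * ?F' \<theta>"
        using MVT_abs[of ?F ?F' "z \<bullet> b"] by blast
      have zb: "\<bar>z \<bullet> b\<bar> \<le> norm z" using b by (rule Basis_le_norm)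
      have w: "norm (bcomp A z + \<theta> *\<^sub>R b) \<le> 2 * norm z"
        using norm_triangle_ineq[of "bcomp A z" "\<theta> *\<^sub>R b"] bcomp_norm[OF A, of z] \<theta>(1) zb b by simp
      \<comment> \<open>The two points are reflections of each other in x, at distance twice a
        vector of norm at most 2 |z|; this is the origin of the 4.\<close>
      have e: "?y + \<theta> *\<^sub>R b = x + (bcomp A z + \<theta> *\<^sub>R b)" "?y' + (- \<theta>) *\<^sub>R b = x - (bcomp A z + \<theta> *\<^sub>R b)"
        by (simp_all add: algebra_simps)
      have nn: "norm (?y + \<theta> *\<^sub>R b) \<le> R + 2" "norm (?y' + (- \<theta>) *\<^sub>R b) \<le> R + 2"
        unfolding e using x z w norm_triangle_ineq[of x "bcomp A z + \<theta> *\<^sub>R b"] norm_triangle_ineq4[of x "bcomp A z + \<theta> *\<^sub>R b"] by linarith+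
      have "norm ((?y + \<theta> *\<^sub>R b) - (?y' + (- \<theta>) *\<^sub>R b)) = norm (2 *\<^sub>R (bcomp A z + \<theta> *\<^sub>R b))"
        unfolding e by (rule arg_cong[of _ _ norm]) (simp add: scaleR_2)
      also have "\<dots> \<le> 4 * norm z" using w by simp
      finally have d: "norm ((?y + \<theta> *\<^sub>R b) - (?y' + (- \<theta>) *\<^sub>R b)) \<le> 4 * norm z" .
      have "\<bar>?F' \<theta>\<bar> \<le> C b * norm ((?y + \<theta> *\<^sub>R b) - (?y' + (- \<theta>) *\<^sub>R b)) powr \<beta>"
        using C(2)[OF b nn] by (simp del: pdiff.simps)
      also have "\<dots> \<le> C b * (4 * norm z) powr \<beta>"
        using d C(1)[OF b] \<beta> by (intro mult_left_mono powr_mono2) auto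
      finally have "\<bar>(z \<bullet> b) * ?F' \<theta>\<bar> \<le> norm z * (C b * (4 * norm z) powr \<beta>)"
        unfolding abs_mult using zb by (intro mult_mono) auto
      then have 1: "\<bar>?F (z \<bullet> b) - ?F 0\<bar> \<le> C b * W" unfolding \<theta>(2) W_def by (simp add: mult_ac del: pdiff.simps)
      have 2: "E (insert b A) = ?F (z \<bullet> b)" "E A = ?F 0"
        using insert by (auto simp: E_def bcomp_insert algebra_simps)
      have "\<bar>E (insert b A) - 2 * g x\<bar> \<le> \<bar>?F (z \<bullet> b) - ?F 0\<bar> + \<bar>E A - 2 * g x\<bar>" unfolding 2 by linarith
      also have "\<dots> \<le> C b * W + sum C A * W" using 1 insert.IH[OF A] by linarith
      also have "\<dots> = sum C (insert b A) * W" using insert by (simp add: algebra_simps)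
      finally show ?case .
    qed
    from this[OF order_refl] have "\<bar>sd g z x\<bar> \<le> sum C Basis * W" unfolding E_def bcomp_Basis sd_def by linarith
    also have "W = 4 powr \<beta> * norm z powr (1 + \<beta>)"
      unfolding W_def by (simp add: powr_mult powr_add)
    finally show "\<bar>sd g z x\<bar> \<le> sum C Basis * 4 powr \<beta> * norm z powr (1 + \<beta>)" by (simp add: mult_ac)
  qed
qed

lemma sd_bound:
  fixes v :: "'a::euclidean_space \<Rightarrow> real"
  assumes v: "Ck_hoelder_loc (2 * m + nat \<lfloor>2 * \<gamma>\<rfloor>) (2 * \<gamma> - of_int \<lfloor>2 * \<gamma>\<rfloor> + \<epsilon>) v" and g: "0 < \<gamma>" "\<gamma> < 1" and e: "0 < \<epsilon>"
  shows "\<exists>\<sigma>. 2 * \<gamma> < \<sigma> \<and> \<sigma> < 2 * \<gamma> + 1 \<and> (\<forall>bs R. set bs \<subseteq> Basis \<longrightarrow> length bs \<le> 2 * m \<longrightarrow>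
     (\<exists>C\<ge>0. \<forall>x z. norm x \<le> R \<longrightarrow> norm z \<le> 1 \<longrightarrow> \<bar>sd (pdiff bs v) z x\<bar> \<le> C * norm z powr \<sigma>))"
    and "Ck (2 * m) v"
proof -
  define k where "k = nat \<lfloor>2 * \<gamma>\<rfloor>"
  define fr where "fr = 2 * \<gamma> - of_int \<lfloor>2 * \<gamma>\<rfloor>"
  have fr: "0 \<le> fr" "fr < 1" unfolding fr_def by linarith+
  have k: "real k = of_int \<lfloor>2 * \<gamma>\<rfloor>" using g by (simp add: k_def)
  define \<beta> where "\<beta> = min 1 (fr + \<epsilon>)"
  have \<beta>: "0 < \<beta>" "\<beta> \<le> 1" "fr < \<beta>" using fr e by (auto simp: \<beta>_def)
  have B: "Ck_hoelder_basic (2 * m + k) \<beta> v"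
    using Ck_hoelder_loc_basic[OF v] fr(1) e unfolding \<beta>_def fr_def k_def by linarith
  then show "Ck (2 * m) v" by (auto simp: Ck_hoelder_basic_def elim: Ck_mono)
  have k01: "k = 0 \<or> k = 1" using g unfolding k_def by linarith
  \<comment> \<open>The first entry exceeds 2\<gamma> because \<beta> exceeds the fractional part of
    2\<gamma>. The cap keeps \<sigma> below 2\<gamma> + 1, so that n + 2\<gamma> - \<sigma> stays
    positive in every dimension, as the integrability lemma for norm powers requires.\<close>
  define \<sigma> where "\<sigma> = min (real k + \<beta>) (2 * \<gamma> + 1/2)"
  have *: "\<exists>C\<ge>0. \<forall>x z. norm x \<le> R \<longrightarrow> norm z \<le> 1 \<longrightarrow> \<bar>sd (pdiff bs v) z x\<bar> \<le> C * norm z powr (real k + \<beta>)"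
    if bs: "set bs \<subseteq> Basis" "length bs \<le> 2 * m" for bs R
    using k01
  proof
    assume "k = 0"
    then show ?thesis using sd_bound_0[OF Ck_hoelder_basic_le[OF B \<beta>(1,2) bs(1)]] bs by simp
  next
    assume k1: "k = 1"
    have "Ck (Suc 0) (pdiff bs v)" using B bs k1 by (intro Ck_pdiff) (auto simp: Ck_hoelder_basic_def elim: Ck_mono)
    moreover have "loc_hoelder_on UNIV \<beta> (pdiff [b] (pdiff bs v))" if "b \<in> Basis" for b
      using Ck_hoelder_basic_le[OF B \<beta>(1,2), of "b # bs"] bs that k1 by simp
    ultimately show ?thesis using sd_bound_1[of 0 "pdiff bs v" \<beta> R] \<beta>(1) k1 by simp
  qed
  show "\<exists>\<sigma>. 2 * \<gamma> < \<sigma> \<and> \<sigma> < 2 * \<gamma> + 1 \<and> (\<forall>bs R. set bs \<subseteq> Basis \<longrightarrow> length bs \<le> 2 * m \<longrightarrow>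
     (\<exists>C\<ge>0. \<forall>x z. norm x \<le> R \<longrightarrow> norm z \<le> 1 \<longrightarrow> \<bar>sd (pdiff bs v) z x\<bar> \<le> C * norm z powr \<sigma>))"
  proof (rule exI[of _ \<sigma>], intro conjI allI impI)
    show "2 * \<gamma> < \<sigma>" "\<sigma> < 2 * \<gamma> + 1" using \<beta> k by (auto simp: \<sigma>_def fr_def)
    fix bs :: "'a list" and R assume bs: "set bs \<subseteq> Basis" "length bs \<le> 2 * m"
    obtain C where C: "C \<ge> 0" "\<And>x z. norm x \<le> R \<Longrightarrow> norm z \<le> 1 \<Longrightarrow> \<bar>sd (pdiff bs v) z x\<bar> \<le> C * norm z powr (real k + \<beta>)"
      using *[OF bs] by blast
    have "norm z powr (real k + \<beta>) \<le> norm z powr \<sigma>" if "norm z \<le> 1" for z :: 'a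
    proof (cases "z = 0")
      case False then show ?thesis using that by (intro powr_mono') (auto simp: \<sigma>_def)
    qed simp
    then show "\<exists>C\<ge>0. \<forall>x z. norm x \<le> R \<longrightarrow> norm z \<le> 1 \<longrightarrow> \<bar>sd (pdiff bs v) z x\<bar> \<le> C * norm z powr \<sigma>"
      using C by (intro exI[of _ C]) (meson mult_left_mono order_trans)
  qed
qed

section \<open>The weighted space and the pointwise fractional Laplacian\<close>

text \<open>Comparable with 1/(1 + |y|^a), but written through 1 + |y|^2, for which shifts and
  products obey elementary quadratic inequalities.\<close>

definition wt :: "real \<Rightarrow> 'a::euclidean_space \<Rightarrow> real" where
  "wt a y = (1 + y \<bullet> y) powr (- (a / 2))"

lemma wt_nonneg[simp]: "0 \<le> wt a y" by (simp add: wt_def)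

lemma one_inner_pos: "0 < 1 + (y::'a::euclidean_space) \<bullet> y"
  by (simp add: add_pos_nonneg)

lemma wt_measurable[measurable]: "wt a \<in> borel_measurable borel"
  unfolding wt_def[abs_def] by measurable

lemma wt_le:
  assumes "0 < K" "0 \<le> a" "1 + y \<bullet> y \<le> K * (1 + w \<bullet> w)"
  shows "wt a w \<le> K powr (a / 2) * wt a y"
proof -
  have "(K * (1 + w \<bullet> w)) powr (- (a / 2)) \<le> (1 + y \<bullet> y) powr (- (a / 2))"
    using assms one_inner_pos[of y] by (intro powr_mono2') auto
  then have "K powr (a / 2) * (K powr (- (a / 2)) * (1 + w \<bullet> w) powr (- (a / 2))) \<le> K powr (a / 2) * wt a y"
    by (intro mult_left_mono) (auto simp: powr_mult wt_def)
  then show ?thesis using assms(1) by (simp add: mult.assoc[symmetric] powr_add[symmetric] wt_def)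
qed

lemma inner_add_le: "(x + z) \<bullet> (x + z) \<le> 2 * (x \<bullet> x) + 2 * (z \<bullet> (z::'a::euclidean_space))"
proof -
  have "0 \<le> (x - z) \<bullet> (x - z)" by simp
  then show ?thesis by (simp add: inner_add_left inner_add_right inner_diff_left inner_diff_right inner_commute)
qed

lemma inner_le_R: "norm x \<le> R \<Longrightarrow> x \<bullet> x \<le> R\<^sup>2"
  using power_mono[of "norm x" R 2] by (simp add: dot_square_norm)

text \<open>Peetre's inequality 1 + |y|^2 \<le> 2 (1 + |x|^2)(1 + |x - y|^2), raised to the power
  a/2.\<close>

lemma wt_shift:
  assumes "norm x \<le> R" "0 \<le> a"
  shows "wt a (x - y) \<le> (2 * (1 + R\<^sup>2)) powr (a / 2) * wt a y" "wt a (y - x) \<le> (2 * (1 + R\<^sup>2)) powr (a / 2) * wt a y"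
proof -
  have "y \<bullet> y \<le> 2 * (x \<bullet> x) + 2 * ((x - y) \<bullet> (x - y))" using inner_add_le[of x "y - x"]
    by (simp add: inner_diff_left inner_diff_right inner_commute algebra_simps)
  also have "\<dots> \<le> 2 * R\<^sup>2 + 2 * ((x - y) \<bullet> (x - y))" using inner_le_R[OF assms(1)] by simp
  finally have le: "y \<bullet> y \<le> 2 * R\<^sup>2 + 2 * ((x - y) \<bullet> (x - y))" .
  have "1 + Y \<le> 2 * (1 + Q) * (1 + D)" if "Y \<le> 2 * Q + 2 * D" "0 \<le> D" "0 \<le> Q" for Y Q D :: real
  proof -
    have e: "2 * (1 + Q) * (1 + D) = 2 + 2 * Q + 2 * D + 2 * (Q * D)" by (simp add: algebra_simps)
    show ?thesis unfolding e using that mult_nonneg_nonneg[of Q D] by linarith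
  qed
  from this[OF le] have "1 + y \<bullet> y \<le> 2 * (1 + R\<^sup>2) * (1 + (x - y) \<bullet> (x - y))" by simp
  moreover have p: "0 < 2 * (1 + R\<^sup>2)" by (simp add: add_pos_nonneg)
  ultimately show 1: "wt a (x - y) \<le> (2 * (1 + R\<^sup>2)) powr (a / 2) * wt a y" using assms by (intro wt_le) auto
  have "wt a (y - x) = wt a (x - y)" by (simp add: wt_def inner_diff_left inner_diff_right inner_commute algebra_simps)
  with 1 show "wt a (y - x) \<le> (2 * (1 + R\<^sup>2)) powr (a / 2) * wt a y" by simp
qed

lemma inner_powr_half: "(z \<bullet> z) powr (a / 2) = norm (z::'a::euclidean_space) powr a"
proof -
  have "norm z = (z \<bullet> z) powr (1 / 2)" by (simp add: norm_eq_sqrt_inner powr_half_sqrt)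
  then have "norm z powr a = ((z \<bullet> z) powr (1 / 2)) powr a" by simp
  also have "\<dots> = (z \<bullet> z) powr (a / 2)" unfolding powr_powr by simp
  finally show ?thesis by simp
qed

text \<open>Away from the origin the kernel is bounded by the weight centred at any point of a ball,
  since |x + z|^2 \<le> 2R^2 + 2|z|^2 and |z| \<ge> \<rho>. This is how membership in
  \<open>Ls_space\<close> controls the far part of the singular integral.\<close>

lemma wt_far:
  fixes x z :: "'a::euclidean_space"
  assumes "norm x \<le> R" "0 \<le> a" "0 < \<rho>" "\<rho> \<le> norm z"
  shows "norm z powr (- a) \<le> ((1 + 2 * R\<^sup>2) / \<rho>\<^sup>2 + 2) powr (a / 2) * wt a (x + z)"
proof -
  let ?K = "(1 + 2 * R\<^sup>2) / \<rho>\<^sup>2 + 2"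
  have K: "0 < ?K" using assms by (intro add_nonneg_pos divide_nonneg_nonneg) (auto)
  have z2: "z \<bullet> z = (norm z)\<^sup>2" by (simp add: dot_square_norm)
  have "\<rho>\<^sup>2 \<le> z \<bullet> z" using assms unfolding z2 by (intro power_mono) auto
  then have "1 \<le> (z \<bullet> z) / \<rho>\<^sup>2" using assms by simp
  then have "(1 + 2 * R\<^sup>2) * 1 \<le> (1 + 2 * R\<^sup>2) * ((z \<bullet> z) / \<rho>\<^sup>2)" by (intro mult_left_mono) auto
  moreover have "1 + (x + z) \<bullet> (x + z) \<le> 1 + 2 * R\<^sup>2 + 2 * (z \<bullet> z)"
    using inner_add_le[of x z] inner_le_R[OF assms(1)] by linarith
  ultimately have le: "1 + (x + z) \<bullet> (x + z) \<le> ?K * (z \<bullet> z)" by (simp add: distrib_right)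
  have "(?K * (z \<bullet> z)) powr (- (a / 2)) \<le> wt a (x + z)"
    unfolding wt_def using le assms one_inner_pos[of "x + z"] by (intro powr_mono2') auto
  moreover have "(?K * (z \<bullet> z)) powr (- (a / 2)) = ?K powr (- (a / 2)) * norm z powr (- a)"
  proof -
    have "(z \<bullet> z) powr (- (a / 2)) = norm z powr (- a)" using inner_powr_half[of z "- a"] by simp
    then show ?thesis by (simp add: powr_mult)
  qed
  ultimately have "?K powr (a / 2) * (?K powr (- (a / 2)) * norm z powr (- a)) \<le> ?K powr (a / 2) * wt a (x + z)"
    by (intro mult_left_mono) auto
  then show ?thesis using K by (simp add: mult.assoc[symmetric] powr_add[symmetric])
qed

lemma integrable_le:
  fixes f :: "'a::euclidean_space \<Rightarrow> real"
  assumes "integrable lborel g" "f \<in> borel_measurable borel" "\<And>x. \<bar>f x\<bar> \<le> g x"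
  shows "integrable lborel f"
proof (rule Bochner_Integration.integrable_bound[OF assms(1)])
  show "AE x in lborel. norm (f x) \<le> norm (g x)"
    by (rule AE_I2) (use assms(3) in \<open>simp add: order_trans[OF _ abs_ge_self]\<close>)
qed (use assms(2) in simp)

lemma Ls_integrable:
  fixes v :: "'a::euclidean_space \<Rightarrow> real"
  assumes v: "v \<in> Ls_space \<gamma>" and [measurable]: "v \<in> borel_measurable borel" and g: "0 \<le> \<gamma>"
  shows "integrable lborel (\<lambda>y. \<bar>v y\<bar> * wt (real DIM('a) + 2 * \<gamma>) y)"
proof (rule integrable_le)
  let ?a = "real DIM('a) + 2 * \<gamma>"
  show "integrable lborel (\<lambda>y. 2 * (\<bar>v y\<bar> / (1 + norm y powr ?a)))"
    using v by (intro integrable_mult_right) (simp add: Ls_space_def)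
  fix y :: 'a
  have "1 \<le> (1 + y \<bullet> y) powr (?a / 2)" using g by (intro ge_one_powr_ge_zero) auto
  moreover have "norm y powr ?a \<le> (1 + y \<bullet> y) powr (?a / 2)"
  proof (cases "y = 0")
    case False
    have "norm y powr ?a = (y \<bullet> y) powr (?a / 2)" by (rule inner_powr_half[symmetric])
    also have "\<dots> \<le> (1 + y \<bullet> y) powr (?a / 2)" using g by (intro powr_mono2) auto
    finally show ?thesis .
  qed simp
  ultimately have "1 + norm y powr ?a \<le> 2 * (1 + y \<bullet> y) powr (?a / 2)" by simp
  then have "wt ?a y \<le> 2 / (1 + norm y powr ?a)"
    unfolding wt_def powr_minus using one_inner_pos[of y] by (simp add: divide_simps add_pos_nonneg)
  from mult_left_mono[OF this, of "\<bar>v y\<bar>"] show "\<bar>\<bar>v y\<bar> * wt ?a y\<bar> \<le> 2 * (\<bar>v y\<bar> / (1 + norm y powr ?a))"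
    by (simp add: abs_mult mult_ac)
qed measurable

lemma pred_cball[measurable]: "Measurable.pred borel (\<lambda>x. x \<in> cball (c::'a::euclidean_space) r)"
  unfolding mem_cball by measurable

lemma integrable_norm_powr_near:
  assumes p: "0 < p" "p < real DIM('a::euclidean_space)"
  shows "integrable lborel (\<lambda>z::'a. norm z powr (- p) * indicator (cball 0 r) z)"
proof (cases "0 < r")
  case True
  obtain C where C: "C \<ge> 0" "(\<integral>\<^sup>+z. ennreal (norm z powr (- p)) * indicator (cball 0 r) z \<partial>(lborel::'a measure)) \<le> ennreal (C * r powr (real DIM('a) - p))"
    using nn_norm_powr_near[OF p] True by auto
  have "(\<integral>\<^sup>+z. ennreal (norm z powr (- p) * indicator (cball 0 r) z) \<partial>(lborel::'a measure)) < \<infinity>"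
    by (rule le_less_trans[OF _ le_less_trans[OF C(2)]]) (auto intro!: nn_integral_mono simp: indicator_def)
  moreover have "(\<lambda>z::'a. norm z powr (- p) * indicator (cball 0 r) z) \<in> borel_measurable borel" by measurable
  ultimately show ?thesis by (intro integrableI_nonneg) auto
next
  case False
  have "norm z powr (- p) * indicator (cball 0 r) z = 0" for z :: 'a using False by (auto simp: indicator_def) (metis norm_le_zero_iff not_less order_trans)
  then have "(\<lambda>z::'a. norm z powr (- p) * indicator (cball 0 r) z) = (\<lambda>z. 0)" by (rule ext)
  then show ?thesis by (simp only:) simp
qed

lemma integrable_norm_powr_far:
  assumes p: "real DIM('a::euclidean_space) < p"
  shows "integrable lborel (\<lambda>z::'a. norm z powr (- p) * indicator {z. 1 \<le> norm z} z)"
proof -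
  have "(\<integral>\<^sup>+z. ennreal (norm z powr (- p) * indicator {z. 1 \<le> norm z} z) \<partial>(lborel::'a measure)) < \<infinity>"
    by (rule le_less_trans[OF _ nn_norm_powr_far[OF p]]) (auto intro!: nn_integral_mono simp: indicator_def)
  then show ?thesis by (intro integrableI_nonneg) auto
qed

lemma wt_integrable:
  assumes a: "real DIM('a::euclidean_space) < a"
  shows "integrable lborel (wt a :: 'a \<Rightarrow> real)"
proof (rule integrable_le)
  show "integrable lborel (\<lambda>z::'a. indicator (cball 0 1) z + norm z powr (- a) * indicator {z. 1 \<le> norm z} z)"
    by (intro Bochner_Integration.integrable_add integrable_indicator_cball integrable_norm_powr_far a)
  have a0: "0 < a" using a by (meson of_nat_0_le_iff le_less_trans)
  fix z :: 'a
  show "\<bar>wt a z\<bar> \<le> indicator (cball 0 1) z + norm z powr (- a) * indicator {z. 1 \<le> norm z} z"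
  proof (cases "norm z \<le> 1")
    case True
    have "wt a z \<le> 1" unfolding wt_def using a0 powr_mono2'[of "- (a / 2)" 1 "1 + z \<bullet> z"] by simp
    then show ?thesis using True by (simp add: indicator_def)
  next
    case False
    have "wt a z \<le> (z \<bullet> z) powr (- (a / 2))"
      unfolding wt_def using a0 False by (intro powr_mono2') auto
    also have "\<dots> = norm z powr (- a)" using inner_powr_half[of z "- a"] by simp
    finally show ?thesis using False by (simp add: indicator_def)
  qed
qed measurable

lemma sd_integrable:
  fixes v :: "'a::euclidean_space \<Rightarrow> real"
  assumes g: "0 < \<gamma>" "\<gamma> < 1" and v: "v \<in> Ls_space \<gamma>" and [measurable]: "v \<in> borel_measurable borel"
  shows far_integrable: "0 < \<rho> \<Longrightarrow> integrable lborel (\<lambda>z. (v x - v (x + z)) * norm z powr (- (real DIM('a) + 2 * \<gamma>)) * indicator {z. \<rho> < norm z} z)"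
    and "2 * \<gamma> < \<sigma> \<Longrightarrow> \<sigma> < 2 * \<gamma> + 1 \<Longrightarrow> (\<And>z. norm z \<le> 1 \<Longrightarrow> \<bar>sd v z x\<bar> \<le> C * norm z powr \<sigma>) \<Longrightarrow>
      integrable lborel (\<lambda>z. sd v z x * norm z powr (- (real DIM('a) + 2 * \<gamma>)))"
proof -
  let ?a = "real DIM('a) + 2 * \<gamma>"
  have [measurable]: "sd v z \<in> borel_measurable borel" for z unfolding sd_def[abs_def] by measurable
  have [measurable]: "(\<lambda>z. sd v z x) \<in> borel_measurable borel" unfolding sd_def by measurable
  have iv: "integrable lborel (\<lambda>y. \<bar>v y\<bar> * wt ?a y)" using Ls_integrable[OF v] g by simp
  have far: "integrable lborel (\<lambda>z. (v x - v (x + z)) * norm z powr (- ?a) * indicator {z. \<rho> < norm z} z)" if \<rho>: "0 < \<rho>" for \<rho>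
  proof (rule integrable_le)
    define K where "K R = ((1 + 2 * R\<^sup>2) / \<rho>\<^sup>2 + 2) powr (?a / 2)" for R
    show "integrable lborel (\<lambda>z. \<bar>v x\<bar> * (K 0 * wt ?a z) + K (norm x) * (\<bar>v (z + x)\<bar> * wt ?a (z + x)))"
      using wt_integrable[of ?a, where ?'a='a] g integrable_shift(1)[OF iv, of x]
      by (intro Bochner_Integration.integrable_add integrable_mult_right) auto
    fix z :: 'a
    show "\<bar>(v x - v (x + z)) * norm z powr (- ?a) * indicator {z. \<rho> < norm z} z\<bar> \<le> \<bar>v x\<bar> * (K 0 * wt ?a z) + K (norm x) * (\<bar>v (z + x)\<bar> * wt ?a (z + x))"
    proof (cases "\<rho> < norm z")
      case True
      have 1: "norm z powr (- ?a) \<le> K 0 * wt ?a z" using wt_far[of "0::'a" 0 ?a \<rho> z] True \<rho> g by (simp add: K_def)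
      have 2: "norm z powr (- ?a) \<le> K (norm x) * wt ?a (z + x)" using wt_far[of x "norm x" ?a \<rho> z] True \<rho> g by (simp add: K_def add.commute)
      have "\<bar>(v x - v (x + z)) * norm z powr (- ?a)\<bar> \<le> \<bar>v x\<bar> * norm z powr (- ?a) + \<bar>v (z + x)\<bar> * norm z powr (- ?a)"
        unfolding abs_mult using mult_right_mono[OF abs_triangle_ineq4[of "v x" "v (x + z)"], of "norm z powr (- ?a)"]
        by (simp add: algebra_simps)
      also have "\<dots> \<le> \<bar>v x\<bar> * (K 0 * wt ?a z) + \<bar>v (z + x)\<bar> * (K (norm x) * wt ?a (z + x))"
        using 1 2 by (intro add_mono mult_left_mono) auto
      finally show ?thesis using True by (simp add: mult_ac)
    qed (auto simp: K_def intro!: add_nonneg_nonneg)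
  qed measurable
  show "0 < \<rho> \<Longrightarrow> integrable lborel (\<lambda>z. (v x - v (x + z)) * norm z powr (- ?a) * indicator {z. \<rho> < norm z} z)" by (rule far)
  assume s: "2 * \<gamma> < \<sigma>" "\<sigma> < 2 * \<gamma> + 1" and b: "\<And>z. norm z \<le> 1 \<Longrightarrow> \<bar>sd v z x\<bar> \<le> C * norm z powr \<sigma>"
  have n1: "1 \<le> real DIM('a)" by (simp add: DIM_positive Suc_leI)
  have near: "integrable lborel (\<lambda>z. sd v z x * norm z powr (- ?a) * indicator (cball 0 1) z)"
  proof (rule integrable_le)
    show "integrable lborel (\<lambda>z::'a. C * (norm z powr (- (?a - \<sigma>)) * indicator (cball 0 1) z))"
      using s n1 by (intro integrable_mult_right integrable_norm_powr_near; linarith)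
    fix z :: 'a
    show "\<bar>sd v z x * norm z powr (- ?a) * indicator (cball 0 1) z\<bar> \<le> C * (norm z powr (- (?a - \<sigma>)) * indicator (cball 0 1) z)"
    proof (cases "norm z \<le> 1")
      case True
      have "\<bar>sd v z x * norm z powr (- ?a)\<bar> \<le> (C * norm z powr \<sigma>) * norm z powr (- ?a)"
        unfolding abs_mult using b[OF True] by (intro mult_mono) auto
      also have "\<dots> = C * norm z powr (- (?a - \<sigma>))"
      proof -
        have e: "- (?a - \<sigma>) = \<sigma> + (- ?a)" by simp
        show ?thesis unfolding e powr_add by simp
      qed
      finally show ?thesis using True by simp
    qed simp
  qed measurable
  \<comment> \<open>The far first differences at z and at -z add up to the second difference outside
    the unit ball, which complements the near part.\<close>
  have "integrable lborel (\<lambda>z. sd v z x * norm z powr (- ?a) * indicator (cball 0 1) z +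
     ((v x - v (x + z)) * norm z powr (- ?a) * indicator {z. 1 < norm z} z +
      (v x - v (x + (0 - z))) * norm (0 - z) powr (- ?a) * indicator {z. 1 < norm z} (0 - z)))"
    by (intro Bochner_Integration.integrable_add near far integrable_shift(3)[OF far]) auto
  moreover have "sd v z x * norm z powr (- ?a) * indicator (cball 0 1) z +
     ((v x - v (x + z)) * norm z powr (- ?a) * indicator {z. 1 < norm z} z +
      (v x - v (x + (0 - z))) * norm (0 - z) powr (- ?a) * indicator {z. 1 < norm z} (0 - z)) = sd v z x * norm z powr (- ?a)" for z
    by (cases "norm z \<le> 1") (auto simp: sd_def algebra_simps indicator_def)
  ultimately show "integrable lborel (\<lambda>z. sd v z x * norm z powr (- ?a))" by simp
qed

text \<open>Substituting y = x + z and y = x - z and averaging replaces the first difference by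
  \<open>sd\<close>, whence the factor 1/2. The truncated region is symmetric, so this is legitimate
  for each radius, and absolute convergence lets the radius tend to 0.\<close>

lemma frac_lap_formula:
  fixes v :: "'a::euclidean_space \<Rightarrow> real"
  assumes g: "0 < \<gamma>" "\<gamma> < 1" and v: "v \<in> Ls_space \<gamma>" and [measurable]: "v \<in> borel_measurable borel"
    and s: "2 * \<gamma> < \<sigma>" "\<sigma> < 2 * \<gamma> + 1" and b: "\<And>z. norm z \<le> 1 \<Longrightarrow> \<bar>sd v z x\<bar> \<le> C * norm z powr \<sigma>"
  shows "frac_lap_defined \<gamma> v x"
    and "frac_lap \<gamma> v x = frac_const DIM('a) \<gamma> * ((LINT z|lborel. sd v z x * norm z powr (- (real DIM('a) + 2 * \<gamma>))) / 2)"
proof -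
  let ?a = "real DIM('a) + 2 * \<gamma>"
  have [measurable]: "(\<lambda>z. sd v z x) \<in> borel_measurable borel" unfolding sd_def by measurable
  define h where "h r y = (v x - v y) * norm (y - x) powr (- ?a) * indicator {z. r < norm z} (y - x)" for r y
  have [measurable]: "h r \<in> borel_measurable borel" for r unfolding h_def by measurable
  have hz: "h r (z + x) = (v x - v (x + z)) * norm z powr (- ?a) * indicator {z. r < norm z} z" for r z
    by (simp add: h_def add.commute)
  have hz': "h r (x - z) = (v x - v (x - z)) * norm z powr (- ?a) * indicator {z. r < norm z} z" for r z
    by (simp add: h_def indicator_def)
  have ih: "integrable lborel (h r)" if r: "0 < r" for r
    using integrable_shift(2)[OF far_integrable[OF g v assms(4) r, of x], of x] by (simp add: h_def[abs_def])
  have set: "indicator {y. r < dist x y} y *\<^sub>R ((v x - v y) / norm (x - y) powr ?a) = h r y" for r y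
  proof -
    have pm: "norm (y - x) powr (- ?a) = inverse (norm (x - y) powr ?a)"
      unfolding powr_minus norm_minus_commute[of y x] ..
    show ?thesis unfolding h_def pm by (simp add: dist_norm norm_minus_commute[of y x] divide_inverse indicator_def)
  qed
  have pv: "pv_trunc \<gamma> v x r = (LINT z|lborel. sd v z x * norm z powr (- ?a) * indicator {z. r < norm z} z) / 2" if r: "0 < r" for r
  proof -
    have "pv_trunc \<gamma> v x r = (LINT y|lborel. h r y)"
      unfolding pv_trunc_def set_lebesgue_integral_def set ..
    also have "\<dots> = ((LINT z|lborel. h r (z + x)) + (LINT z|lborel. h r (x - z))) / 2"
      by (simp add: integral_shift)
    also have "(LINT z|lborel. h r (z + x)) + (LINT z|lborel. h r (x - z)) = (LINT z|lborel. h r (z + x) + h r (x - z))"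
      by (rule Bochner_Integration.integral_add[symmetric]) (intro integrable_shift ih r)+
    also have "\<dots> = (LINT z|lborel. sd v z x * norm z powr (- ?a) * indicator {z. r < norm z} z)"
      by (simp add: hz hz' sd_def algebra_simps)
    finally show ?thesis .
  qed
  have I: "integrable lborel (\<lambda>z. sd v z x * norm z powr (- ?a))"
    by (rule sd_integrable(2)[OF g v assms(4) s b])
  have "((\<lambda>r. (LINT z|lborel. sd v z x * norm z powr (- ?a) * indicator {z. r < norm z} z) / 2) \<longlongrightarrow> (LINT z|lborel. sd v z x * norm z powr (- ?a)) / 2) (at_right 0)"
    unfolding tendsto_at_iff_sequentially
  proof (intro allI impI)
    fix X :: "nat \<Rightarrow> real" assume X: "\<forall>i. X i \<in> {0<..} - {0}" "X \<longlonglongrightarrow> 0"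
    have "(\<lambda>i. LINT z|lborel. sd v z x * norm z powr (- ?a) * indicator {z. X i < norm z} z) \<longlonglongrightarrow> (LINT z|lborel. sd v z x * norm z powr (- ?a))"
    proof (rule integral_dominated_convergence[where w="\<lambda>z. \<bar>sd v z x * norm z powr (- ?a)\<bar>"])
      show "AE z in lborel. (\<lambda>i. sd v z x * norm z powr (- ?a) * indicator {z. X i < norm z} z) \<longlonglongrightarrow> sd v z x * norm z powr (- ?a)"
      proof (rule AE_I2)
        fix z :: 'a
        show "(\<lambda>i. sd v z x * norm z powr (- ?a) * indicator {z. X i < norm z} z) \<longlonglongrightarrow> sd v z x * norm z powr (- ?a)"
        proof (cases "z = 0")
          case False
          then have "\<forall>\<^sub>F i in sequentially. X i < norm z" using X(2) by (intro order_tendstoD) auto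
          then have "\<forall>\<^sub>F i in sequentially. sd v z x * norm z powr (- ?a) * indicator {z. X i < norm z} z = sd v z x * norm z powr (- ?a)"
            by eventually_elim simp
          then show ?thesis by (rule tendsto_eventually)
        qed simp
      qed
      show "integrable lborel (\<lambda>z. \<bar>sd v z x * norm z powr (- ?a)\<bar>)" using I by (rule integrable_abs)
    qed (auto simp: indicator_def)
    then show "((\<lambda>r. (LINT z|lborel. sd v z x * norm z powr (- ?a) * indicator {z. r < norm z} z) / 2) \<circ> X) \<longlonglongrightarrow> (LINT z|lborel. sd v z x * norm z powr (- ?a)) / 2"
      unfolding o_def by (intro tendsto_divide) auto
  qed
  then have L: "(pv_trunc \<gamma> v x \<longlongrightarrow> (LINT z|lborel. sd v z x * norm z powr (- ?a)) / 2) (at_right 0)"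
    by (rule Lim_transform_eventually) (auto simp: eventually_at_filter pv)
  show "frac_lap_defined \<gamma> v x"
    unfolding frac_lap_defined_def set_integrable_def set using L ih by blast
  show "frac_lap \<gamma> v x = frac_const DIM('a) \<gamma> * ((LINT z|lborel. sd v z x * norm z powr (- ?a)) / 2)"
    unfolding frac_lap_def using g tendsto_Lim[OF _ L] by simp
qed

section \<open>A smooth truncation of the kernel\<close>

lemma lpos_scale:
  fixes f :: "real \<Rightarrow> real"
  assumes [measurable]: "f \<in> borel_measurable borel" and c: "0 < c"
  shows "(LINT t|lpos. f t) = c * (LINT t|lpos. f (c * t))"
proof -
  have "(LINT t|lpos. f t) = (LINT t|lborel. indicator {0<..} t * f t)"
    by (subst int_lpos) (auto simp: set_lebesgue_integral_def)
  also have "\<dots> = c * (LINT t|lborel. indicator {0<..} (0 + c * t) * f (0 + c * t))"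
    using c by (subst lborel_integral_real_affine[of c _ 0]) auto
  also have "(LINT t|lborel. indicator {0<..} (0 + c * t) * f (0 + c * t)) = (LINT t|lpos. f (c * t))"
    using c by (subst int_lpos)
      (auto simp: set_lebesgue_integral_def indicator_def zero_less_mult_iff intro!: Bochner_Integration.integral_cong)
  finally show ?thesis .
qed

lemma DERIV_pos_part_pow:
  fixes y :: real
  assumes "2 \<le> N"
  shows "((\<lambda>y. (max 0 y) ^ N) has_field_derivative real N * (max 0 y) ^ (N - 1)) (at y)"
proof -
  consider "y > 0" | "y < 0" | "y = 0" by linarith
  then show ?thesis
  proof cases
    case 1
    have "((\<lambda>y. y ^ N) has_field_derivative real N * y ^ (N - 1)) (at y)"
      by (auto intro!: derivative_eq_intros)
    then have "((\<lambda>y. (max 0 y) ^ N) has_field_derivative real N * y ^ (N - 1)) (at y)"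
      by (rule has_field_derivative_transform_within_open[of _ _ _ "{0<..}"]) (use 1 in auto)
    then show ?thesis using 1 by simp
  next
    case 2
    have "((\<lambda>y. 0) has_field_derivative 0) (at y)" by simp
    then have d: "((\<lambda>y. (max 0 y) ^ N) has_field_derivative 0) (at y)"
      by (rule has_field_derivative_transform_within_open[of _ _ _ "{..<0}"]) (use 2 assms in auto)
    have "(max 0 y) ^ (N - 1) = 0" using 2 assms by (subst max_absorb1) (auto intro!: zero_power)
    then show ?thesis using d by (simp only: mult_zero_right)
  next
    case 3
    have "((\<lambda>h::real. (max 0 h) ^ N / h) \<longlongrightarrow> 0) (at 0)"
    proof (rule Lim_null_comparison)
      show "\<forall>\<^sub>F h::real in at 0. norm ((max 0 h) ^ N / h) \<le> \<bar>h\<bar> ^ (N - 1)"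
      proof (rule always_eventually, rule allI)
        fix h :: real
        show "norm ((max 0 h) ^ N / h) \<le> \<bar>h\<bar> ^ (N - 1)"
        proof (cases "h > 0")
          case True
          have "h ^ N = h * h ^ (N - 1)" using assms by (cases N) auto
          then show ?thesis using True by simp
        next
          case False
          then have "(max 0 h) ^ N = 0" using assms by (subst max_absorb1) (auto intro!: zero_power)
          then show ?thesis by (simp only: div_0 norm_zero) simp
        qed
      qed
      have "((\<lambda>h::real. \<bar>h\<bar> ^ (N - 1)) \<longlongrightarrow> \<bar>0\<bar> ^ (N - 1)) (at 0)" by (intro tendsto_intros)
      moreover have "\<bar>0::real\<bar> ^ (N - 1) = 0" using assms by (simp add: zero_power)
      ultimately show "((\<lambda>h::real. \<bar>h\<bar> ^ (N - 1)) \<longlongrightarrow> 0) (at 0)" by (simp only:)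
    qed
    moreover have "(max 0 (0::real)) ^ (N - 1) = 0" "(max 0 (0::real)) ^ N = 0" using assms by (simp_all add: zero_power)
    ultimately show ?thesis unfolding 3 has_field_derivative_iff by (simp only: diff_0_right mult_zero_right)
  qed
qed

text \<open>Differentiation multiplies by a coordinate and lowers the power by one, so smoothness of
  order below N follows by induction within this family.\<close>

definition bump :: "nat \<Rightarrow> 'a::euclidean_space \<Rightarrow> real" where
  "bump N z = (max 0 (1 - z \<bullet> z)) ^ N"

lemma bump_nonneg[simp]: "0 \<le> bump N z" by (simp add: bump_def)

lemma bump_cont: "continuous_on UNIV (bump N)"
  unfolding bump_def by (intro continuous_intros)

lemma bump_measurable[measurable]: "bump N \<in> borel_measurable borel"
  by (rule borel_measurable_continuous_onI[OF bump_cont])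

lemma bump_even[simp]: "bump N (- z) = bump N z" by (simp add: bump_def)

lemma bump_Ck: "k < N \<Longrightarrow> Ck k (bump N :: 'a::euclidean_space \<Rightarrow> real)"
proof (induction k arbitrary: N)
  case 0 then show ?case by (simp add: Ck_0 bump_cont)
next
  case (Suc k)
  show ?case
  proof (rule Ck_SucI[OF bump_cont])
    fix b :: 'a
    show "Ck k (\<lambda>x. (- 2 * real N) * ((x \<bullet> b) * bump (N - 1) x))"
      by (intro Ck_cmult Ck_mult Ck_inner Suc.IH) (use Suc.prems in auto)
    fix x :: 'a
    have e: "1 - (x + t *\<^sub>R b) \<bullet> (x + t *\<^sub>R b) = 1 - (x \<bullet> x + 2 * t * (x \<bullet> b) + t\<^sup>2 * (b \<bullet> b))" for t
      by (simp add: inner_add_left inner_add_right inner_commute power2_eq_square)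
    have "((\<lambda>t. (max 0 (1 - (x \<bullet> x + 2 * t * (x \<bullet> b) + t\<^sup>2 * (b \<bullet> b)))) ^ N) has_field_derivative
       (real N * (max 0 (1 - (x \<bullet> x + 2 * 0 * (x \<bullet> b) + 0\<^sup>2 * (b \<bullet> b)))) ^ (N - 1)) * (- 2 * (x \<bullet> b))) (at 0)"
      by (rule DERIV_chain2[OF DERIV_pos_part_pow]) (use Suc.prems in \<open>auto intro!: derivative_eq_intros\<close>)
    then show "((\<lambda>t. bump N (x + t *\<^sub>R b)) has_field_derivative (- 2 * real N) * ((x \<bullet> b) * bump (N - 1) x)) (at 0)"
      unfolding bump_def e by (simp add: mult_ac)
  qed
qed

lemma bump_supp: "bdd_supp (bump N :: 'a::euclidean_space \<Rightarrow> real)" if "0 < N"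
proof -
  have "bump N x = 0" if "1 < norm x" for x :: 'a
  proof -
    have "1 < x \<bullet> x" using that power_strict_mono[of 1 "norm x" 2] by (simp add: dot_square_norm)
    then show ?thesis using \<open>0 < N\<close> by (simp add: bump_def)
  qed
  then show ?thesis unfolding bdd_supp_def by blast
qed

text \<open>Normalising constant for writing |z|^(-a) as a superposition of dilated bumps: the
  substitution t = |z| u in the integral of t^(-a-1) \<open>bump N\<close> (z/t) produces |z|^(-a)
  times this number.\<close>

definition kcI :: "nat \<Rightarrow> real \<Rightarrow> real" where
  "kcI N a = (LINT u|lpos. u powr (- a - 1) * (max 0 (1 - 1 / u\<^sup>2)) ^ N)"

lemma powr_tail_integrable: 
  assumes "0 < a" "0 < r"
  shows "integrable lpos (\<lambda>u. u powr (- a - 1) * indicator {r..} u)" "(LINT u|lpos. u powr (- a - 1) * indicator {r..} u) = r powr (- a) / a"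
proof -
  have "(\<integral>\<^sup>+u. ennreal (u powr (- a - 1) * indicator {r..} u) \<partial>lpos) = (\<integral>\<^sup>+u. ennreal (u powr (- a - 1)) * indicator {r..} u \<partial>lpos)"
    by (intro nn_integral_cong) (auto simp: indicator_def)
  also have "\<dots> = ennreal (r powr (- a) / a)" by (rule nn_lpos_powr_tail[OF assms])
  finally have n: "(\<integral>\<^sup>+u. ennreal (u powr (- a - 1) * indicator {r..} u) \<partial>lpos) = ennreal (r powr (- a) / a)" .
  then show "integrable lpos (\<lambda>u. u powr (- a - 1) * indicator {r..} u)" by (intro integrableI_nonneg) auto
  show "(LINT u|lpos. u powr (- a - 1) * indicator {r..} u) = r powr (- a) / a"
    using n assms by (subst integral_eq_nn_integral) auto
qed

lemma kcI_props:
  assumes a: "0 < a" and N: "0 < N"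
  shows "integrable lpos (\<lambda>u. u powr (- a - 1) * (max 0 (1 - 1 / u\<^sup>2)) ^ N)" and "0 < kcI N a"
proof -
  show i: "integrable lpos (\<lambda>u. u powr (- a - 1) * (max 0 (1 - 1 / u\<^sup>2)) ^ N)"
  proof (rule integrable_lpos_bound[OF powr_tail_integrable(1)[OF a zero_less_one]])
    fix u :: real assume u: "0 < u"
    have m1: "max 0 (1 - 1 / u\<^sup>2) \<le> 1" by simp
    have "(max 0 (1 - 1 / u\<^sup>2)) ^ N \<le> indicator {1..} u"
    proof (cases "1 \<le> u")
      case True then show ?thesis using m1 by (simp add: power_le_one)
    next
      case False
      then have "1 - 1 / u\<^sup>2 \<le> 0" using u by (simp add: field_simps power_le_one)
      then have m0: "max 0 (1 - 1 / u\<^sup>2) = 0" by simp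
      show ?thesis unfolding m0 zero_power[OF N] by simp
    qed
    then show "\<bar>u powr (- a - 1) * (max 0 (1 - 1 / u\<^sup>2)) ^ N\<bar> \<le> u powr (- a - 1) * indicator {1..} u"
      by (simp add: abs_mult mult_left_mono)
  qed measurable
  have "0 < (3/4) ^ N * (2 powr (- a) / a)" using a by simp
  also have "\<dots> = (LINT u|lpos. (3/4) ^ N * (u powr (- a - 1) * indicator {2..} u))"
    using powr_tail_integrable[OF a, of 2] by simp
  also have "\<dots> \<le> kcI N a" unfolding kcI_def
  proof (rule integral_mono_AE[OF _ i])
    show "integrable lpos (\<lambda>u. (3/4) ^ N * (u powr (- a - 1) * indicator {2..} u))"
      by (intro integrable_mult_right powr_tail_integrable a) simp
    show "AE u in lpos. (3/4) ^ N * (u powr (- a - 1) * indicator {2..} u) \<le> u powr (- a - 1) * (max 0 (1 - 1 / u\<^sup>2)) ^ N"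
    proof (rule AE_I2)
      fix u :: real
      show "(3/4) ^ N * (u powr (- a - 1) * indicator {2..} u) \<le> u powr (- a - 1) * (max 0 (1 - 1 / u\<^sup>2)) ^ N"
      proof (cases "2 \<le> u")
        case True
        then have "4 \<le> u\<^sup>2" using power_mono[of 2 u 2] by simp
        then have "1 / u\<^sup>2 \<le> 1 / 4" by (intro divide_left_mono) auto
        then have k: "3/4 \<le> max 0 (1 - 1 / u\<^sup>2)" by simp
        have "(3/4) ^ N \<le> (max 0 (1 - 1 / u\<^sup>2)) ^ N" by (rule power_mono[OF k]) simp
        from mult_left_mono[OF this, of "u powr (- a - 1)"] show ?thesis using True by (simp add: mult.commute)
      qed simp
    qed
  qed
  finally show "0 < kcI N a" .
qed

text \<open>Only the scales t > 1 of that superposition are kept. This removes the singularity at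
  the origin and changes nothing for |z| \<ge> 1, because the bump at z/t vanishes unless t > |z|.
  The summand 0 puts the argument into the form of \<open>Ck_affine\<close>.\<close>

definition kfar :: "nat \<Rightarrow> real \<Rightarrow> 'a::euclidean_space \<Rightarrow> real" where
  "kfar N a z = (LINT t|lpos. (indicator {1<..} t * t powr (- a - 1) / kcI N a) * bump N (0 + inverse t *\<^sub>R z))"

lemma kfar_even: "kfar N a (- z) = kfar N a z"
  by (simp add: kfar_def)

lemma kfar_nonneg: "0 < a \<Longrightarrow> 0 < N \<Longrightarrow> 0 \<le> kfar N a z"
  unfolding kfar_def using kcI_props(2)[of a N] by (intro integral_nonneg_AE AE_I2) (auto simp: indicator_def)

lemma kfar_scaled:
  assumes a: "0 < a" and N: "0 < N" and z: "z \<noteq> (0::'a::euclidean_space)"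
  shows "kfar N a z = norm z powr (- a) * ((LINT u|lpos. indicator {1<..} (norm z * u) * (u powr (- a - 1) * (max 0 (1 - 1 / u\<^sup>2)) ^ N)) / kcI N a)"
proof -
  let ?r = "norm z"
  have r: "0 < ?r" using z by simp
  have "kfar N a z = ?r * (LINT u|lpos. (indicator {1<..} (?r * u) * (?r * u) powr (- a - 1) / kcI N a) * bump N (0 + inverse (?r * u) *\<^sub>R z))"
    unfolding kfar_def by (rule lpos_scale) (use r in auto)
  also have "(LINT u|lpos. (indicator {1<..} (?r * u) * (?r * u) powr (- a - 1) / kcI N a) * bump N (0 + inverse (?r * u) *\<^sub>R z)) =
     (LINT u|lpos. (?r powr (- a - 1) / kcI N a) * (indicator {1<..} (?r * u) * (u powr (- a - 1) * (max 0 (1 - 1 / u\<^sup>2)) ^ N)))"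
  proof (rule lpos_cong)
    fix u :: real assume u: "0 < u"
    have "(inverse (?r * u) *\<^sub>R z) \<bullet> (inverse (?r * u) *\<^sub>R z) = 1 / u\<^sup>2"
      using r u by (simp add: dot_square_norm power2_eq_square field_simps)
    then have "bump N (0 + inverse (?r * u) *\<^sub>R z) = (max 0 (1 - 1 / u\<^sup>2)) ^ N" by (simp add: bump_def)
    then show "(indicator {1<..} (?r * u) * (?r * u) powr (- a - 1) / kcI N a) * bump N (0 + inverse (?r * u) *\<^sub>R z) =
       (?r powr (- a - 1) / kcI N a) * (indicator {1<..} (?r * u) * (u powr (- a - 1) * (max 0 (1 - 1 / u\<^sup>2)) ^ N))"
      by (simp add: powr_mult)
  qed measurable
  also have "?r * \<dots> = (?r * ?r powr (- a - 1)) * ((LINT u|lpos. indicator {1<..} (norm z * u) * (u powr (- a - 1) * (max 0 (1 - 1 / u\<^sup>2)) ^ N)) / kcI N a)"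
    by simp
  also have "?r * ?r powr (- a - 1) = ?r powr (- a)" using r powr_add[of ?r 1 "- a - 1"] by simp
  finally show ?thesis .
qed

lemma kfar_ge1:
  assumes a: "0 < a" and N: "0 < N" and z: "1 \<le> norm (z::'a::euclidean_space)"
  shows "kfar N a z = norm z powr (- a)"
proof -
  have z0: "z \<noteq> 0" using z by auto
  have "(LINT u|lpos. indicator {1<..} (norm z * u) * (u powr (- a - 1) * (max 0 (1 - 1 / u\<^sup>2)) ^ N)) = kcI N a"
    unfolding kcI_def
  proof (rule lpos_cong)
    fix u :: real assume u: "0 < u"
    show "indicator {1<..} (norm z * u) * (u powr (- a - 1) * (max 0 (1 - 1 / u\<^sup>2)) ^ N) = u powr (- a - 1) * (max 0 (1 - 1 / u\<^sup>2)) ^ N"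
    proof (cases "1 < norm z * u")
      case False
      have "1 * u \<le> norm z * u" using z u by (intro mult_right_mono) auto
      then have "u \<le> 1" using False by simp
      then have "1 - 1 / u\<^sup>2 \<le> 0" using u by (simp add: field_simps power_le_one)
      then show ?thesis using N by (simp add: max_def)
    qed simp
  qed measurable
  then show ?thesis using kfar_scaled[OF a N z0] kcI_props(2)[OF a N] by simp
qed

lemma kfar_le:
  assumes a: "0 < a" and N: "0 < N" and z: "z \<noteq> (0::'a::euclidean_space)"
  shows "kfar N a z \<le> norm z powr (- a)"
proof -
  have "(LINT u|lpos. indicator {1<..} (norm z * u) * (u powr (- a - 1) * (max 0 (1 - 1 / u\<^sup>2)) ^ N)) \<le> kcI N a"
    unfolding kcI_def
  proof (rule integral_mono[OF _ kcI_props(1)[OF a N]])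
    show "integrable lpos (\<lambda>u. indicator {1<..} (norm z * u) * (u powr (- a - 1) * (max 0 (1 - 1 / u\<^sup>2)) ^ N))"
      by (rule integrable_lpos_bound[OF kcI_props(1)[OF a N]]) (auto simp: indicator_def)
  qed (auto simp: indicator_def)
  then have "(LINT u|lpos. indicator {1<..} (norm z * u) * (u powr (- a - 1) * (max 0 (1 - 1 / u\<^sup>2)) ^ N)) / kcI N a \<le> 1"
    using kcI_props(2)[OF a N] by simp
  from mult_left_mono[OF this, of "norm z powr (- a)"] show ?thesis using kfar_scaled[OF a N z] by simp
qed

text \<open>Each derivative brings out a factor 1/t \<le> 1, so all orders obey the same estimate. A
  derivative at x only sees scales t \<ge> |x|/R, with R a radius of the support; the tail of
  t^(-a-1) from there on has size |x|^(-a).\<close>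

lemma kfar_Ck:
  assumes a: "0 < a" and N: "k < N"
  shows "Ck k (kfar N a :: 'a::euclidean_space \<Rightarrow> real)"
    and "set bs \<subseteq> Basis \<Longrightarrow> length bs \<le> k \<Longrightarrow> \<exists>C\<ge>0. \<forall>x::'a. \<bar>pdiff bs (kfar N a) x\<bar> \<le> C * wt a x"
proof -
  let ?c = "\<lambda>t. indicator {1<..} t * t powr (- a - 1) / kcI N a"
  let ?G = "\<lambda>t x::'a. ?c t * bump N (0 + inverse t *\<^sub>R x)"
  have N0: "0 < N" using N by simp
  have I: "0 < kcI N a" by (rule kcI_props(2)[OF a N0])
  have C: "Ck k (bump N :: 'a \<Rightarrow> real)" by (rule bump_Ck[OF N])
  have CG: "Ck k (?G t)" for t by (intro Ck_cmult Ck_affine C)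
  have pG: "pdiff bs (?G t) = (\<lambda>x. ?c t * (inverse t ^ length bs * pdiff bs (bump N) (0 + inverse t *\<^sub>R x)))"
    if "set bs \<subseteq> Basis" "length bs \<le> k" for bs t
    using pdiff_cmult[OF Ck_affine[OF C], of bs "?c t" 0 "inverse t"] pdiff_affine[OF C, of bs 0 "inverse t"] that by simp
  have dom: "\<exists>M R. 0 < M \<and> 0 < R \<and> (\<forall>t>0. \<forall>x. \<bar>pdiff bs (?G t) x\<bar> \<le> M * (t powr (- a - 1) * indicator {max 1 (norm x / R)..} t)) \<and>
     (\<forall>t x. \<bar>pdiff bs (?G t) x\<bar> \<le> M * (t powr (- a - 1) * indicator {1..} t))"
    if bs: "set bs \<subseteq> Basis" "length bs \<le> k" for bs
  proof -
    obtain M R where M: "0 < M" "0 < R" "\<And>x. \<bar>pdiff bs (bump N) x\<bar> \<le> M * indicator (cball 0 R) (x::'a)"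
      using bdd_supp_bounded[OF Ck_pdiff_cont[OF C bs(2,1)] bdd_supp_pdiff[OF bump_supp[OF N0]]] by blast
    have b: "\<bar>pdiff bs (?G t) x\<bar> \<le> M / kcI N a * (t powr (- a - 1) * indicator {max 1 (norm x / R)..} t)" for t and x :: 'a
    proof (cases "1 < t")
      case True
      have "inverse t ^ length bs \<le> 1" using True by (intro power_le_one) (auto simp: field_simps)
      moreover have "indicator (cball 0 R) (0 + inverse t *\<^sub>R x) = (indicator {max 1 (norm x / R)..} t :: real)"
        using True M(2) by (auto simp: indicator_def field_simps)
      ultimately have "inverse t ^ length bs * \<bar>pdiff bs (bump N) (0 + inverse t *\<^sub>R x)\<bar> \<le> 1 * (M * indicator {max 1 (norm x / R)..} t)"
        using M(3)[of "0 + inverse t *\<^sub>R x"] True by (intro mult_mono) auto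
      from mult_left_mono[OF this, of "t powr (- a - 1) / kcI N a"] show ?thesis
        unfolding pG[OF bs] using True I by (simp add: abs_mult mult_ac)
    next
      case False
      then show ?thesis unfolding pG[OF bs] using M I by simp
    qed
    have b2: "\<bar>pdiff bs (?G t) x\<bar> \<le> M / kcI N a * (t powr (- a - 1) * indicator {1..} t)" for t and x :: 'a
    proof -
      have "M / kcI N a * (t powr (- a - 1) * indicator {max 1 (norm x / R)..} t) \<le> M / kcI N a * (t powr (- a - 1) * indicator {1..} t)"
        using M I by (intro mult_left_mono) (auto simp: indicator_def)
      then show ?thesis using b[of t x] by linarith
    qed
    show ?thesis using b b2 M I by (intro exI[of _ "M / kcI N a"] exI[of _ R]) auto
  qed
  have meas: "(\<lambda>t. pdiff bs (?G t) x) \<in> borel_measurable lpos" if bs: "set bs \<subseteq> Basis" "length bs \<le> k" for bs x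
  proof -
    have [measurable]: "pdiff bs (bump N :: 'a \<Rightarrow> real) \<in> borel_measurable borel"
      by (rule borel_measurable_continuous_onI[OF Ck_pdiff_cont[OF C bs(2,1)]])
    show ?thesis unfolding pG[OF bs] by measurable
  qed
  have H: "\<exists>H. integrable lpos H \<and> (\<forall>x t. norm x \<le> R \<longrightarrow> t \<in> space lpos \<longrightarrow> \<bar>pdiff bs (?G t) x\<bar> \<le> H t)"
    if bs: "set bs \<subseteq> Basis" "length bs \<le> k" for bs R
  proof -
    obtain M where M: "\<And>t x. \<bar>pdiff bs (?G t) x\<bar> \<le> M * (t powr (- a - 1) * indicator {1..} t)"
      using dom[OF bs] by blast
    show ?thesis
      by (rule exI[of _ "\<lambda>t. M * (t powr (- a - 1) * indicator {1..} t)"])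
        (intro conjI allI impI integrable_mult_right powr_tail_integrable a M zero_less_one)
  qed
  have e: "kfar N a = (\<lambda>x. LINT t|lpos. ?G t x)" by (simp add: kfar_def fun_eq_iff)
  show "Ck k (kfar N a :: 'a \<Rightarrow> real)" unfolding e
    by (rule Ck_integral(1)[OF CG meas H])
  assume bs: "set bs \<subseteq> Basis" "length bs \<le> k"
  have pe: "pdiff bs (kfar N a) = (\<lambda>x. LINT t|lpos. pdiff bs (?G t) x)" unfolding e
    by (rule Ck_integral(2)[OF CG meas H bs])
  obtain M R where M: "0 < M" "0 < R" "\<And>t x. 0 < t \<Longrightarrow> \<bar>pdiff bs (?G t) x\<bar> \<le> M * (t powr (- a - 1) * indicator {max 1 (norm x / R)..} t)"
    using dom[OF bs] by blast
  show "\<exists>C\<ge>0. \<forall>x::'a. \<bar>pdiff bs (kfar N a) x\<bar> \<le> C * wt a x"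
  proof (intro exI[of _ "M / a * (1 + R\<^sup>2) powr (a / 2)"] conjI allI)
    show "0 \<le> M / a * (1 + R\<^sup>2) powr (a / 2)" using M a by simp
    fix x :: 'a
    define \<rho> where "\<rho> = max 1 (norm x / R)"
    have \<rho>: "1 \<le> \<rho>" "norm x \<le> R * \<rho>" using M(2) by (auto simp: \<rho>_def max_def field_simps)
    have i: "integrable lpos (\<lambda>t. M * (t powr (- a - 1) * indicator {\<rho>..} t))"
      using \<rho> by (intro integrable_mult_right powr_tail_integrable a) simp
    have i2: "integrable lpos (\<lambda>t. pdiff bs (?G t) x)"
      by (rule integrable_lpos_bound[OF i]) (use M(3)[of _ x] meas[OF bs, of x] in \<open>auto simp: \<rho>_def simp del: pdiff.simps\<close>)
    have \<rho>le: "\<rho> powr (- a) \<le> (1 + R\<^sup>2) powr (a / 2) * wt a x"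
    proof -
      have "(norm x)\<^sup>2 \<le> (R * \<rho>)\<^sup>2" using \<rho> by (intro power_mono) auto
      moreover have "1 \<le> \<rho>\<^sup>2" using \<rho>(1) by (simp add: one_le_power)
      ultimately have "1 + x \<bullet> x \<le> (1 + R\<^sup>2) * \<rho>\<^sup>2" by (simp add: dot_square_norm algebra_simps power_mult_distrib)
      then have "((1 + R\<^sup>2) * \<rho>\<^sup>2) powr (- (a / 2)) \<le> wt a x"
        unfolding wt_def using one_inner_pos[of x] a by (intro powr_mono2') auto
      moreover have "(\<rho>\<^sup>2) powr (- (a / 2)) = \<rho> powr (- a)"
        using inner_powr_half[of \<rho> "- a"] \<rho> by (simp add: power2_eq_square)
      ultimately have "(1 + R\<^sup>2) powr (- (a / 2)) * \<rho> powr (- a) \<le> wt a x" by (simp add: powr_mult)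
      from mult_left_mono[OF this, of "(1 + R\<^sup>2) powr (a / 2)"] have "((1 + R\<^sup>2) powr (a / 2) * (1 + R\<^sup>2) powr (- (a / 2))) * \<rho> powr (- a) \<le> (1 + R\<^sup>2) powr (a / 2) * wt a x"
        by (simp add: mult.assoc)
      moreover have "(1 + R\<^sup>2) powr (a / 2) * (1 + R\<^sup>2) powr (- (a / 2)) = 1"
        by (simp add: powr_add[symmetric] add_nonneg_eq_0_iff)
      ultimately show ?thesis by simp
    qed
    have "\<bar>pdiff bs (kfar N a) x\<bar> \<le> (LINT t|lpos. \<bar>pdiff bs (?G t) x\<bar>)" unfolding pe by (rule integral_abs_bound)
    also have "\<dots> \<le> (LINT t|lpos. M * (t powr (- a - 1) * indicator {\<rho>..} t))"
    proof (rule integral_mono_AE[OF integrable_abs[OF i2] i])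
      show "AE t in lpos. \<bar>pdiff bs (?G t) x\<bar> \<le> M * (t powr (- a - 1) * indicator {\<rho>..} t)"
        using AE_lpos unfolding \<rho>_def by eventually_elim (rule M(3))
    qed
    also have "\<dots> = M / a * \<rho> powr (- a)" using powr_tail_integrable(2)[OF a, of \<rho>] \<rho> by simp
    also have "\<dots> \<le> M / a * ((1 + R\<^sup>2) powr (a / 2) * wt a x)"
      using M(1) a by (intro mult_left_mono[OF \<rho>le]) auto
    finally show "\<bar>pdiff bs (kfar N a) x\<bar> \<le> M / a * (1 + R\<^sup>2) powr (a / 2) * wt a x"
      by (simp only: mult.assoc)
  qed
qed

section \<open>Regularity of the fractional Laplacian\<close>

lemma sd_alt: "sd v z = (\<lambda>x. 2 * v x + (-1) * (v (x + z) + v (x + (- z))))"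
  by (auto simp: sd_def)

lemma Ck_sd: "Ck k v \<Longrightarrow> Ck k (sd v (z::'a::euclidean_space))"
  unfolding sd_alt by (intro Ck_add Ck_cmult Ck_translate)

lemma pdiff_sd:
  fixes v :: "'a::euclidean_space \<Rightarrow> real"
  assumes v: "Ck k v" and bs: "length bs \<le> k" "set bs \<subseteq> Basis"
  shows "pdiff bs (sd v z) = sd (pdiff bs v) z"
proof -
  have t: "Ck k (\<lambda>x. v (x + z) + v (x + (- z)))" by (intro Ck_add Ck_translate v)
  have "pdiff bs (sd v z) = (\<lambda>x. pdiff bs (\<lambda>x. 2 * v x) x + pdiff bs (\<lambda>x. (-1) * (v (x + z) + v (x + (- z)))) x)"
    unfolding sd_alt by (rule pdiff_add[OF Ck_cmult[OF v] Ck_cmult[OF t] bs])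
  also have "\<dots> = (\<lambda>x. 2 * pdiff bs v x + (-1) * pdiff bs (\<lambda>x. v (x + z) + v (x + (- z))) x)"
    unfolding pdiff_cmult[OF v bs] pdiff_cmult[OF t bs] ..
  also have "\<dots> = (\<lambda>x. 2 * pdiff bs v x + (-1) * (pdiff bs v (x + z) + pdiff bs v (x + (- z))))"
    unfolding pdiff_add[OF Ck_translate[OF v] Ck_translate[OF v] bs] pdiff_translate[OF v bs] ..
  finally show ?thesis unfolding sd_alt .
qed

text \<open>The derivatives of v have no control at infinity, so the kernel is split. Its singular
  part \<open>?K0\<close> lives in the unit ball, and there derivatives fall on v through the local
  bounds for second differences. The remainder \<open>?K1\<close> is smooth with weighted bounds,
  and there derivatives fall on the kernel, leaving v itself to be integrated against the
  weight.\<close>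

lemma frac_lap_regular:
  fixes v :: "'a::euclidean_space \<Rightarrow> real"
  assumes g: "0 < \<gamma>" "\<gamma> < 1" and v: "v \<in> Ls_space \<gamma>" and C: "Ck k v"
    and s: "2 * \<gamma> < \<sigma>" "\<sigma> < 2 * \<gamma> + 1"
    and b: "\<And>bs R. set bs \<subseteq> Basis \<Longrightarrow> length bs \<le> k \<Longrightarrow>
      \<exists>C\<ge>0. \<forall>x z. norm x \<le> R \<longrightarrow> norm z \<le> 1 \<longrightarrow> \<bar>sd (pdiff bs v) z x\<bar> \<le> C * norm z powr \<sigma>"
  shows "Ck k (frac_lap \<gamma> v)"
proof -
  let ?a = "real DIM('a) + 2 * \<gamma>"
  define N where "N = Suc k"
  have a0: "0 < ?a" using g by (simp add: add_nonneg_pos)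
  have n1: "1 \<le> real DIM('a)" by (simp add: DIM_positive Suc_leI)
  have N: "k < N" "0 < N" by (auto simp: N_def)
  let ?K1 = "kfar N ?a :: 'a \<Rightarrow> real"
  let ?K0 = "\<lambda>z::'a. norm z powr (- ?a) - ?K1 z"
  have cv: "continuous_on UNIV v" using C by (rule Ck_cont)
  have [measurable]: "v \<in> borel_measurable borel" using cv by (rule borel_measurable_continuous_onI)
  have CK: "Ck k ?K1" by (rule kfar_Ck(1)[OF a0 N(1)])
  have [measurable]: "?K1 \<in> borel_measurable borel" using Ck_cont[OF CK] by (rule borel_measurable_continuous_onI)
  have iv: "integrable lborel (\<lambda>y. \<bar>v y\<bar> * wt ?a y)" using Ls_integrable[OF v] g by simp
  have iw: "integrable lborel (wt ?a :: 'a \<Rightarrow> real)" using g by (intro wt_integrable) auto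
  obtain CK1 where CK1: "CK1 \<ge> 0" "\<And>x. \<bar>?K1 x\<bar> \<le> CK1 * wt ?a x" using kfar_Ck(2)[OF a0 N(1), of "[] :: 'a list"] by auto
  have iK1: "integrable lborel ?K1"
    by (rule integrable_le[OF integrable_mult_right[OF iw, of CK1]]) (use CK1 in auto)
  define A where "A x = (LINT z|lborel. sd v z x * ?K0 z)" for x
  define B where "B x = (LINT y|lborel. v y * ?K1 (x - y))" for x
  have bB: "\<bar>v y * pdiff bs ?K1 (x + (- y))\<bar> \<le> (CC * (2 * (1 + R\<^sup>2)) powr (?a / 2)) * (\<bar>v y\<bar> * wt ?a y)"
    if "norm x \<le> R" "\<And>x. \<bar>pdiff bs ?K1 x\<bar> \<le> CC * wt ?a x" "0 \<le> CC" for bs x y R CC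
  proof -
    have "\<bar>pdiff bs ?K1 (x - y)\<bar> \<le> CC * wt ?a (x - y)" by (rule that)
    also have "\<dots> \<le> CC * ((2 * (1 + R\<^sup>2)) powr (?a / 2) * wt ?a y)"
      using wt_shift(1)[OF that(1), of ?a y] a0 that(3) by (intro mult_left_mono) auto
    finally have L: "\<bar>pdiff bs ?K1 (x - y)\<bar> \<le> CC * ((2 * (1 + R\<^sup>2)) powr (?a / 2) * wt ?a y)" .
    from mult_left_mono[OF L, of "\<bar>v y\<bar>"] show ?thesis by (simp add: abs_mult mult_ac)
  qed
  have CB: "Ck k (\<lambda>x. LINT y|lborel. v y * ?K1 (x + (- y)))"
  proof (rule Ck_integral(1))
    show "Ck k (\<lambda>x. v y * ?K1 (x + (- y)))" for y by (intro Ck_cmult Ck_translate CK)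
    fix bs :: "'a list" assume bs: "set bs \<subseteq> Basis" "length bs \<le> k"
    have p: "pdiff bs (\<lambda>x. v y * ?K1 (x + (- y))) = (\<lambda>x. v y * pdiff bs ?K1 (x + (- y)))" for y
      unfolding pdiff_cmult[OF Ck_translate[OF CK] bs(2,1)] pdiff_translate[OF CK bs(2,1)] ..
    have [measurable]: "pdiff bs ?K1 \<in> borel_measurable borel" by (rule borel_measurable_continuous_onI[OF Ck_pdiff_cont[OF CK bs(2,1)]])
    show "(\<lambda>y. pdiff bs (\<lambda>x. v y * ?K1 (x + (- y))) x) \<in> borel_measurable lborel" for x unfolding p by measurable
    fix R
    obtain CC where CC: "CC \<ge> 0" "\<And>x. \<bar>pdiff bs ?K1 x\<bar> \<le> CC * wt ?a x" using kfar_Ck(2)[OF a0 N(1) bs] by auto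
    show "\<exists>H. integrable lborel H \<and> (\<forall>x z. norm x \<le> R \<longrightarrow> z \<in> space lborel \<longrightarrow> \<bar>pdiff bs (\<lambda>x. v z * ?K1 (x + (- z))) x\<bar> \<le> H z)"
      unfolding p using bB[OF _ CC(2,1)]
      by (intro exI[of _ "\<lambda>y. (CC * (2 * (1 + R\<^sup>2)) powr (?a / 2)) * (\<bar>v y\<bar> * wt ?a y)"] conjI integrable_mult_right iv) blast
  qed
  \<comment> \<open>\<open>?K0\<close> vanishes for |z| \<ge> 1 and lies between 0 and |z|^(-a)
    inside, by \<open>kfar_ge1\<close>, \<open>kfar_nonneg\<close> and \<open>kfar_le\<close>; only
    the behaviour of the second difference near the origin matters.\<close>
  have bA: "\<bar>d * ?K0 z\<bar> \<le> CC * (norm z powr (- (?a - \<sigma>)) * indicator (cball 0 1) z)"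
    if "norm z \<le> 1 \<Longrightarrow> \<bar>d\<bar> \<le> CC * norm z powr \<sigma>" "z = 0 \<Longrightarrow> d = 0" for d CC and z :: 'a
  proof (cases "norm z < 1")
    case True
    show ?thesis
    proof (cases "z = 0")
      case False
      have "0 \<le> ?K1 z" "?K1 z \<le> norm z powr (- ?a)"
        using kfar_nonneg[OF a0 N(2), of z] kfar_le[OF a0 N(2) False] by auto
      then have k: "\<bar>?K0 z\<bar> \<le> norm z powr (- ?a)" by linarith
      have "\<bar>d * ?K0 z\<bar> \<le> (CC * norm z powr \<sigma>) * norm z powr (- ?a)"
        unfolding abs_mult using k that(1) True by (intro mult_mono) auto
      also have "\<dots> = CC * norm z powr (- (?a - \<sigma>))"
      proof -
        have e: "- (?a - \<sigma>) = \<sigma> + (- ?a)" by simp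
        show ?thesis unfolding e powr_add by simp
      qed
      finally show ?thesis using True by simp
    qed (use that in auto)
  next
    case False
    then have "?K0 z = 0" using kfar_ge1[OF a0 N(2), of z] by simp
    then show ?thesis using False that(1) by (cases "norm z = 1") (auto simp: indicator_def)
  qed
  have inear: "integrable lborel (\<lambda>z::'a. CC * (norm z powr (- (?a - \<sigma>)) * indicator (cball 0 1) z))" for CC
    using s n1 by (intro integrable_mult_right integrable_norm_powr_near; linarith)
  have CA: "Ck k A" unfolding A_def
  proof (rule Ck_integral(1))
    show "Ck k (\<lambda>x. sd v z x * ?K0 z)" for z by (intro Ck_mult Ck_sd C Ck_const)
    fix bs :: "'a list" assume bs: "set bs \<subseteq> Basis" "length bs \<le> k"
    have p: "pdiff bs (\<lambda>x. sd v z x * ?K0 z) = (\<lambda>x. sd (pdiff bs v) z x * ?K0 z)" for z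
      using pdiff_cmult[OF Ck_sd[OF C] bs(2,1), of "?K0 z" z] unfolding pdiff_sd[OF C bs(2,1)] by (simp add: mult.commute)
    have [measurable]: "pdiff bs v \<in> borel_measurable borel" by (rule borel_measurable_continuous_onI[OF Ck_pdiff_cont[OF C bs(2,1)]])
    show "(\<lambda>z. pdiff bs (\<lambda>x. sd v z x * ?K0 z) x) \<in> borel_measurable lborel" for x unfolding p unfolding sd_def by measurable
    fix R
    obtain CC where CC: "CC \<ge> 0" "\<And>x z. norm x \<le> R \<Longrightarrow> norm z \<le> 1 \<Longrightarrow> \<bar>sd (pdiff bs v) z x\<bar> \<le> CC * norm z powr \<sigma>"
      using b[OF bs, of R] by auto
    show "\<exists>H. integrable lborel H \<and> (\<forall>x z. norm x \<le> R \<longrightarrow> z \<in> space lborel \<longrightarrow> \<bar>pdiff bs (\<lambda>x. sd v z x * ?K0 z) x\<bar> \<le> H z)"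
      unfolding p
      by (intro exI[of _ "\<lambda>z. CC * (norm z powr (- (?a - \<sigma>)) * indicator (cball 0 1) z)"] conjI allI impI inear bA CC(2))
         (auto simp: sd_def)
  qed
  define \<kappa> where "\<kappa> = (LINT z|lborel. ?K1 z)"
  have eq: "frac_lap \<gamma> v x = frac_const DIM('a) \<gamma> * ((A x + (2 * \<kappa> * v x - 2 * (LINT y|lborel. v y * ?K1 (x + (- y))))) / 2)" for x
  proof -
    obtain CC where CC: "CC \<ge> 0" "\<And>z. norm z \<le> 1 \<Longrightarrow> \<bar>sd v z x\<bar> \<le> CC * norm z powr \<sigma>"
      using b[of "[]" "norm x"] by auto
    have I: "integrable lborel (\<lambda>z. sd v z x * norm z powr (- ?a))"
      by (rule sd_integrable(2)[OF g v _ s CC(2)]) auto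
    have [measurable]: "(\<lambda>z. sd v z x) \<in> borel_measurable borel" unfolding sd_def by measurable
    have iA: "integrable lborel (\<lambda>z. sd v z x * ?K0 z)"
      by (rule integrable_le[OF inear[of CC] _ bA]) (use CC in \<open>auto simp: sd_def\<close>)
    have i3: "integrable lborel (\<lambda>y. v y * ?K1 (x - y))"
      by (rule integrable_le[OF integrable_mult_right[OF iv, of "CK1 * (2 * (1 + (norm x)\<^sup>2)) powr (?a / 2)"]])
         (use bB[of x "norm x" "[]" CK1] CK1 in auto)
    define h where "h y = v y * ?K1 (x - y)" for y
    have [measurable]: "h \<in> borel_measurable borel" unfolding h_def by measurable
    have ih: "integrable lborel h" unfolding h_def[abs_def] by (rule i3)
    \<comment> \<open>Evenness of \<open>kfar\<close> gives v(x + z) and v(x - z) the same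
      convolution, hence the factor 2 in front of it.\<close>
    have e1: "h (x - z) = v (x - z) * ?K1 z" "h (z + x) = v (x + z) * ?K1 z" for z
      using kfar_even[of N ?a z] by (simp_all add: h_def add.commute)
    have "(LINT z|lborel. sd v z x * norm z powr (- ?a)) = (LINT z|lborel. sd v z x * ?K0 z + ((2 * v x) * ?K1 z - h (z + x) - h (x - z)))"
      unfolding e1 by (rule Bochner_Integration.integral_cong[OF refl]) (simp add: sd_def algebra_simps)
    also have "\<dots> = A x + ((2 * v x) * \<kappa> - (LINT z|lborel. h (z + x)) - (LINT z|lborel. h (x - z)))"
      using iA iK1 integrable_shift(1)[OF ih, of x] integrable_shift(3)[OF ih, of x]
      by (simp add: A_def \<kappa>_def)
    also have "(LINT z|lborel. h (z + x)) = (LINT y|lborel. h y)" by (rule integral_shift) simp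
    also have "(LINT z|lborel. h (x - z)) = (LINT y|lborel. h y)" by (rule integral_shift) simp
    finally have "(LINT z|lborel. sd v z x * norm z powr (- ?a)) = A x + (2 * \<kappa> * v x - 2 * (LINT y|lborel. v y * ?K1 (x + (- y))))"
      by (simp add: h_def)
    then show ?thesis using frac_lap_formula(2)[OF g v _ s CC(2)] by simp
  qed
  have "Ck k (\<lambda>x. frac_const DIM('a) \<gamma> * ((1/2) * (A x + (2 * \<kappa> * v x - 2 * (LINT y|lborel. v y * ?K1 (x + (- y)))))))"
    by (intro Ck_cmult Ck_add Ck_diff CA CB C)
  then show ?thesis by (simp add: eq[abs_def])
qed

lemma sd_test_bound:
  fixes \<phi> :: "'a::euclidean_space \<Rightarrow> real"
  assumes \<phi>: "tst 2 \<phi>" and g: "0 < \<gamma>" "\<gamma> < 1"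
  shows "\<exists>\<sigma>. 2 * \<gamma> < \<sigma> \<and> \<sigma> < 2 * \<gamma> + 1 \<and> (\<forall>R. \<exists>C\<ge>0. \<forall>x z. norm x \<le> R \<longrightarrow> norm z \<le> 1 \<longrightarrow> \<bar>sd \<phi> z x\<bar> \<le> C * norm z powr \<sigma>)"
proof -
  define \<sigma> where "\<sigma> = min 2 (2 * \<gamma> + 1/2)"
  have C: "Ck (Suc (Suc 0)) \<phi>" using \<phi> by (simp add: tst_def numeral_2_eq_2)
  have h: "loc_hoelder_on UNIV 1 (pdiff [b] \<phi>)" if "b \<in> Basis" for b
    by (rule Ck_loc_hoelder[of 0]) (use C that in \<open>auto simp: Ck_Suc[of "Suc 0"]\<close>)
  have "\<exists>C\<ge>0. \<forall>x z. norm x \<le> R \<longrightarrow> norm z \<le> 1 \<longrightarrow> \<bar>sd \<phi> z x\<bar> \<le> C * norm z powr \<sigma>" for R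
  proof -
    obtain C where C: "C \<ge> 0" "\<And>x z. norm x \<le> R \<Longrightarrow> norm z \<le> 1 \<Longrightarrow> \<bar>sd \<phi> z x\<bar> \<le> C * norm z powr (1 + 1)"
      using sd_bound_1[OF C h, of R] by auto
    have "norm z powr (1 + 1) \<le> norm z powr \<sigma>" if "norm z \<le> 1" for z :: 'a
    proof (cases "z = 0")
      case False then show ?thesis using that by (intro powr_mono') (auto simp: \<sigma>_def)
    qed simp
    then show ?thesis using C by (intro exI[of _ C]) (meson mult_left_mono order_trans)
  qed
  then show ?thesis using g by (intro exI[of _ \<sigma>]) (auto simp: \<sigma>_def)
qed

lemma tst_Ls:
  fixes \<phi> :: "'a::euclidean_space \<Rightarrow> real"
  assumes \<phi>: "tst k \<phi>" shows "\<phi> \<in> Ls_space \<gamma>"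
proof -
  have i: "integrable lborel \<phi>" using \<phi> by (auto simp: tst_def intro: bdd_supp_integrable dest: Ck_cont)
  have [measurable]: "\<phi> \<in> borel_measurable borel" using \<phi> by (rule tst_meas)
  have "integrable lborel (\<lambda>x. \<bar>\<phi> x\<bar> / (1 + norm x powr (real DIM('a) + 2 * \<gamma>)))"
  proof (rule integrable_le[OF integrable_abs[OF i]])
    show "\<bar>\<bar>\<phi> x\<bar> / (1 + norm x powr (real DIM('a) + 2 * \<gamma>))\<bar> \<le> \<bar>\<phi> x\<bar>" for x
      by (simp add: divide_le_eq mult_left_le add_pos_nonneg mult_le_cancel_left1)
  qed measurable
  then show ?thesis by (simp add: Ls_space_def)
qed

section \<open>The weak form of the equation\<close>

text \<open>Subordination of the singular kernel to the heat kernel. The prefactor is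
  1/|Gamma(-\<gamma>)|, and the computation identifies \<open>frac_const\<close> as the constant
  belonging to the symbol |\<xi>|^(2\<gamma>).\<close>

lemma frac_kernel_time:
  fixes z :: "'a::euclidean_space"
  assumes g: "0 < \<gamma>" "\<gamma> < 1" and z: "z \<noteq> 0"
  shows "(\<integral>\<^sup>+t. ennreal (\<gamma> / Gamma (1 - \<gamma>) * (t powr (- \<gamma> - 1) * hk t z)) \<partial>lpos) = ennreal (frac_const DIM('a) \<gamma> * norm z powr (- (real DIM('a) + 2 * \<gamma>)))"
proof -
  define n2 where "n2 = real DIM('a) / 2"
  have n2: "0 < n2" by (simp add: n2_def)
  have G: "0 < Gamma (1 - \<gamma>)" "0 < Gamma (n2 + \<gamma>)" using g n2 by (auto intro!: Gamma_real_pos)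
  have zz: "0 < 0 + (z \<bullet> z) / 4" using z by simp
  have 1: "(\<integral>\<^sup>+t. ennreal (t powr (- \<gamma> - 1) * hk t z) \<partial>lpos) = ennreal ((4 * pi) powr (- n2) * Gamma (n2 + \<gamma>) * ((z \<bullet> z) / 4) powr (- (n2 + \<gamma>)))"
    using hk_time_integral[of "- \<gamma>" 0 z, OF _ order_refl zz] g n2 by (simp add: n2_def algebra_simps)
  have "((z \<bullet> z) / 4) powr (- (n2 + \<gamma>)) = (z \<bullet> z) powr (- (n2 + \<gamma>)) / 4 powr (- (n2 + \<gamma>))" by (rule powr_divide)
  also have "(z \<bullet> z) powr (- (n2 + \<gamma>)) = norm z powr (- (real DIM('a) + 2 * \<gamma>))"
  proof -
    have e: "- (n2 + \<gamma>) = (- (real DIM('a) + 2 * \<gamma>)) / 2" by (simp add: n2_def add_divide_distrib)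
    show ?thesis unfolding e inner_powr_half ..
  qed
  also have "4 powr (- (n2 + \<gamma>)) = inverse ((4::real) powr (n2 + \<gamma>))" by (rule powr_minus)
  finally have 2: "((z \<bullet> z) / 4) powr (- (n2 + \<gamma>)) = 4 powr (n2 + \<gamma>) * norm z powr (- (real DIM('a) + 2 * \<gamma>))"
    by (simp only: divide_inverse inverse_inverse_eq mult.commute)
  have 3: "(4 * pi) powr (- n2) * 4 powr (n2 + \<gamma>) = 2 powr (2 * \<gamma>) / pi powr n2"
  proof -
    have "(4::real) powr \<gamma> = 2 powr (2 * \<gamma>)" using powr_powr[of 2 2 \<gamma>] by simp
    moreover have "(4 * pi) powr (- n2) = 4 powr (- n2) * pi powr (- n2)" by (rule powr_mult)
    moreover have "(4::real) powr (- n2) * 4 powr (n2 + \<gamma>) = 4 powr \<gamma>" by (simp add: powr_add[symmetric])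
    moreover have "pi powr (- n2) = inverse (pi powr n2)" by (rule powr_minus)
    ultimately show ?thesis by (metis (no_types, opaque_lifting) divide_inverse mult.assoc mult.commute)
  qed
  have "(\<integral>\<^sup>+t. ennreal (\<gamma> / Gamma (1 - \<gamma>) * (t powr (- \<gamma> - 1) * hk t z)) \<partial>lpos) = ennreal (\<gamma> / Gamma (1 - \<gamma>)) * (\<integral>\<^sup>+t. ennreal (t powr (- \<gamma> - 1) * hk t z) \<partial>lpos)"
  proof -
    have k: "0 \<le> \<gamma> / Gamma (1 - \<gamma>)" using g G by simp
    show ?thesis unfolding ennreal_mult'[OF k] by (rule nn_integral_cmult) measurable
  qed
  also have "\<dots> = ennreal (\<gamma> / Gamma (1 - \<gamma>) * ((4 * pi) powr (- n2) * Gamma (n2 + \<gamma>) * ((z \<bullet> z) / 4) powr (- (n2 + \<gamma>))))"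
    unfolding 1 using g G by (subst ennreal_mult) auto
  also have "\<gamma> / Gamma (1 - \<gamma>) * ((4 * pi) powr (- n2) * Gamma (n2 + \<gamma>) * ((z \<bullet> z) / 4) powr (- (n2 + \<gamma>))) =
     \<gamma> / Gamma (1 - \<gamma>) * Gamma (n2 + \<gamma>) * ((4 * pi) powr (- n2) * 4 powr (n2 + \<gamma>)) * norm z powr (- (real DIM('a) + 2 * \<gamma>))"
    unfolding 2 by (simp only: mult_ac)
  also have "\<dots> = frac_const DIM('a) \<gamma> * norm z powr (- (real DIM('a) + 2 * \<gamma>))"
    unfolding 3 unfolding frac_const_def n2_def by (simp add: field_simps)
  finally show ?thesis .
qed

lemma hf_diff:
  fixes \<phi> :: "'a::euclidean_space \<Rightarrow> real"
  assumes \<phi>: "tst 2 \<phi>" and t: "0 < t"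
  shows "\<phi> x - hf \<phi> t x = (LINT r|lpos. hf (neg_lap \<phi>) r x * indicator {..t} r)"
    and "integrable lpos (\<lambda>r. hf (neg_lap \<phi>) r x)"
proof -
  have \<phi>1: "tst (2 * Suc 0) \<phi>" using \<phi> by simp
  have [measurable]: "neg_lap \<phi> \<in> borel_measurable borel"
    using tst_meas[OF tst_neg_lap_pow[of 0 1 \<phi>]] \<phi> by (simp add: numeral_2_eq_2)
  have mh: "(\<lambda>r. hf (neg_lap \<phi>) r x) \<in> borel_measurable borel" by measurable
  obtain C where C: "C \<ge> 0" "\<And>t x. t \<ge> 0 \<Longrightarrow> \<bar>hf (neg_lap \<phi>) t x\<bar> \<le> C * (1 + t) powr (- (real (Suc 0) + real DIM('a) / 2))"
    using hf_decay_time[OF \<phi>1] by auto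
  have i0: "integrable lpos (\<lambda>t. t powr (1 - 1) * hf (neg_lap \<phi>) (0 + t) x)"
    by (rule RL_integrable[OF mh _ _ _ C(2)]) auto
  show i: "integrable lpos (\<lambda>r. hf (neg_lap \<phi>) r x)"
    by (rule integrable_lpos_bound[OF integrable_abs[OF i0] mh]) simp
  have R: "RL 1 (\<lambda>r. hf (neg_lap \<phi>) r x) q = (LINT r|lpos. hf (neg_lap \<phi>) (q + r) x)" for q
  proof -
    have "(LINT r|lpos. r powr (1 - 1) * hf (neg_lap \<phi>) (q + r) x) = (LINT r|lpos. hf (neg_lap \<phi>) (q + r) x)"
      by (rule lpos_cong) auto
    then show ?thesis by (simp add: RL_def)
  qed
  have "\<phi> x = (LINT r|lpos. hf (neg_lap \<phi>) r x)" using hf_FTC[OF \<phi>1, of 0 x] R[of 0] by simp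
  moreover have "hf \<phi> t x = (LINT r|lpos. hf (neg_lap \<phi>) (t + r) x)" using hf_FTC[OF \<phi>1, of t x] R[of t] t by simp
  moreover have "(LINT r|lpos. hf (neg_lap \<phi>) (t + r) x) = (LINT r|lpos. hf (neg_lap \<phi>) r x * indicator {t<..} r)"
    by (subst lpos_shift[OF _ t]) auto
  moreover have "(LINT r|lpos. hf (neg_lap \<phi>) r x) - (LINT r|lpos. hf (neg_lap \<phi>) r x * indicator {t<..} r) = (LINT r|lpos. hf (neg_lap \<phi>) r x - hf (neg_lap \<phi>) r x * indicator {t<..} r)"
    by (rule Bochner_Integration.integral_diff[symmetric]) (use i in \<open>auto intro!: integrable_real_mult_indicator\<close>)
  moreover have "(LINT r|lpos. hf (neg_lap \<phi>) r x - hf (neg_lap \<phi>) r x * indicator {t<..} r) = (LINT r|lpos. hf (neg_lap \<phi>) r x * indicator {..t} r)"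
    by (rule lpos_cong) (auto simp: indicator_def)
  ultimately show "\<phi> x - hf \<phi> t x = (LINT r|lpos. hf (neg_lap \<phi>) r x * indicator {..t} r)" by simp
qed

text \<open>The singular integral and the heat-flow expression agree on test functions. After
  subordination the second difference integrates to 2 (\<phi> - P_t \<phi>), P_t being the heat
  flow; writing this as a time integral of the flow of -\<Delta>\<phi> and exchanging the two time
  integrals, the weight t^(-\<gamma>-1) over t \<ge> r becomes r^(-\<gamma>)/\<gamma>, the weight of
  an integral of order 1 - \<gamma>.\<close>

lemma frac_lap_test:
  fixes \<phi> :: "'a::euclidean_space \<Rightarrow> real"
  assumes \<phi>: "tst 2 \<phi>" and g: "0 < \<gamma>" "\<gamma> < 1"
  shows "frac_const DIM('a) \<gamma> * ((LINT z|lborel. sd \<phi> z x * norm z powr (- (real DIM('a) + 2 * \<gamma>))) / 2) = ztf 0 \<gamma> \<phi> 0 x"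
proof -
  let ?a = "real DIM('a) + 2 * \<gamma>" and ?k = "\<gamma> / Gamma (1 - \<gamma>)" and ?c = "frac_const DIM('a) \<gamma>"
  have G: "0 < Gamma (1 - \<gamma>)" using g by (intro Gamma_real_pos) auto
  have [measurable]: "\<phi> \<in> borel_measurable borel" using \<phi> by (rule tst_meas)
  have [measurable]: "neg_lap \<phi> \<in> borel_measurable borel"
    using tst_meas[OF tst_neg_lap_pow[of 0 1 \<phi>]] \<phi> by (simp add: numeral_2_eq_2)
  have [measurable]: "(\<lambda>z. sd \<phi> z x) \<in> borel_measurable borel" unfolding sd_def by measurable
  obtain \<sigma> C where s: "2 * \<gamma> < \<sigma>" "\<sigma> < 2 * \<gamma> + 1" "\<And>z. norm z \<le> 1 \<Longrightarrow> \<bar>sd \<phi> z x\<bar> \<le> C * norm z powr \<sigma>"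
    using sd_test_bound[OF \<phi> g] by (metis order_refl)
  have I: "integrable lborel (\<lambda>z. sd \<phi> z x * norm z powr (- ?a))"
    by (rule sd_integrable(2)[OF g tst_Ls[OF \<phi>] _ s]) auto
  have c0: "0 < ?c" unfolding frac_const_def using g G by (auto intro!: divide_pos_pos mult_pos_pos Gamma_real_pos add_nonneg_pos)
  obtain M where M: "M > 0" "\<And>x. \<bar>\<phi> x\<bar> \<le> M * hk 1 x" using tst_gauss[OF \<phi>] by auto
  let ?F = "\<lambda>z t. sd \<phi> z x * (?k * (t powr (- \<gamma> - 1) * hk t z))"
  have inner: "(\<integral>\<^sup>+t. ennreal (norm (?F z t)) \<partial>lpos) = ennreal (norm (?c * (sd \<phi> z x * norm z powr (- ?a))))" for z
  proof (cases "z = 0")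
    case True then show ?thesis by (simp add: sd_def)
  next
    case False
    have "(\<integral>\<^sup>+t. ennreal (norm (?F z t)) \<partial>lpos) = (\<integral>\<^sup>+t. ennreal \<bar>sd \<phi> z x\<bar> * ennreal (?k * (t powr (- \<gamma> - 1) * hk t z)) \<partial>lpos)"
      using g G by (intro nn_integral_cong) (auto simp: abs_mult ennreal_mult[symmetric])
    also have "\<dots> = ennreal \<bar>sd \<phi> z x\<bar> * ennreal (?c * norm z powr (- ?a))"
      using frac_kernel_time[OF g False] by (subst nn_integral_cmult) auto
    finally show ?thesis using c0 by (simp add: ennreal_mult[symmetric] abs_mult mult_ac)
  qed
  have iF: "integrable (lborel \<Otimes>\<^sub>M lpos) (\<lambda>(z, t). ?F z t)"
  proof (subst integrable_iff_bounded, intro conjI)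
    show "(\<lambda>(z, t). ?F z t) \<in> borel_measurable (lborel \<Otimes>\<^sub>M lpos)" unfolding sd_def by measurable
    have "(\<integral>\<^sup>+w. ennreal (norm (case w of (z, t) \<Rightarrow> ?F z t)) \<partial>(lborel \<Otimes>\<^sub>M lpos)) = (\<integral>\<^sup>+z. \<integral>\<^sup>+t. ennreal (norm (?F z t)) \<partial>lpos \<partial>lborel)"
      unfolding sd_def by (subst lpos.nn_integral_fst[symmetric], measurable)
    also have "\<dots> = (\<integral>\<^sup>+z. ennreal (norm (?c * (sd \<phi> z x * norm z powr (- ?a)))) \<partial>lborel)" unfolding inner ..
    also have "\<dots> < \<infinity>" using integrable_mult_right[OF I, of ?c] unfolding integrable_iff_bounded by blast
    finally show "(\<integral>\<^sup>+w. ennreal (norm (case w of (z, t) \<Rightarrow> ?F z t)) \<partial>(lborel \<Otimes>\<^sub>M lpos)) < \<infinity>" .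
  qed
  have tin: "(LINT t|lpos. ?F z t) = ?c * (sd \<phi> z x * norm z powr (- ?a))" for z
  proof (cases "z = 0")
    case True then show ?thesis by (simp add: sd_def)
  next
    case False
    have "(LINT t|lpos. ?k * (t powr (- \<gamma> - 1) * hk t z)) = ?c * norm z powr (- ?a)"
      using frac_kernel_time[OF g False] c0 g G by (subst integral_eq_nn_integral) auto
    moreover have "(LINT t|lpos. ?F z t) = sd \<phi> z x * (LINT t|lpos. ?k * (t powr (- \<gamma> - 1) * hk t z))"
      by (rule integral_mult_right_zero)
    ultimately show ?thesis by (simp add: mult_ac)
  qed
  \<comment> \<open>The kernel has mass one and is even, so the three terms of \<open>sd\<close>
    give 2 \<phi>(x) and twice the heat flow.\<close>
  have zin: "(LINT z|lborel. ?F z t) = 2 * ?k * (t powr (- \<gamma> - 1) * (\<phi> x - hf \<phi> t x))" if t: "0 < t" for t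
  proof -
    define h where "h y = \<phi> y * hk t (x - y)" for y
    have [measurable]: "h \<in> borel_measurable borel" unfolding h_def by measurable
    have ih: "integrable lborel h" unfolding h_def[abs_def] by (rule hf_gauss_bound(2)[OF _ M(2) _ t]) auto
    have e: "h (x - z) = \<phi> (x - z) * hk t z" "h (z + x) = \<phi> (x + z) * hk t z" for z
      using hk_even[of t z] by (simp_all add: h_def add.commute)
    have hi: "(LINT y|lborel. h y) = hf \<phi> t x" unfolding h_def using hf_eq[OF _ t, of \<phi> x] by simp
    have "(LINT z|lborel. ?F z t) = (LINT z|lborel. (?k * t powr (- \<gamma> - 1)) * ((2 * \<phi> x) * hk t z - h (z + x) - h (x - z)))"
    proof -
      have alg: "(2 * p - q - r) * (k * (T * H)) = (k * T) * ((2 * p) * H - q * H - r * H)" for p q r k T H :: real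
        by (simp add: algebra_simps)
      show ?thesis unfolding e sd_def alg ..
    qed
    also have "\<dots> = (?k * t powr (- \<gamma> - 1)) * (LINT z|lborel. (2 * \<phi> x) * hk t z - h (z + x) - h (x - z))"
      by (rule integral_mult_right_zero)
    also have "(LINT z|lborel. (2 * \<phi> x) * hk t z - h (z + x) - h (x - z)) = (2 * \<phi> x) - (LINT z|lborel. h (z + x)) - (LINT z|lborel. h (x - z))"
      using hk_integrable[OF t, where ?'a='a] hk_integral[OF t, where ?'a='a] integrable_shift(1)[OF ih, of x] integrable_shift(3)[OF ih, of x]
      by simp
    also have "(LINT z|lborel. h (z + x)) = hf \<phi> t x" using integral_shift(1)[of h x] hi by simp
    also have "(LINT z|lborel. h (x - z)) = hf \<phi> t x" using integral_shift(3)[of h x] hi by simp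
    also have "(2 * \<phi> x) - hf \<phi> t x - hf \<phi> t x = 2 * (\<phi> x - hf \<phi> t x)" by simp
    finally show ?thesis by (simp only: mult_ac)
  qed
  let ?\<psi> = "\<lambda>r. hf (neg_lap \<phi>) r x"
  let ?H = "\<lambda>t r. t powr (- \<gamma> - 1) * ?\<psi> r * indicator {..t} r"
  have tail: "(\<integral>\<^sup>+t. ennreal (t powr (- \<gamma> - 1) * indicator {..t} r) \<partial>lpos) = ennreal (r powr (- \<gamma>) / \<gamma>)" if "0 < r" for r :: real
  proof -
    have "(\<integral>\<^sup>+t. ennreal (t powr (- \<gamma> - 1) * indicator {..t} r) \<partial>lpos) = (\<integral>\<^sup>+t. ennreal (t powr (- \<gamma> - 1)) * indicator {r..} t \<partial>lpos)"
      by (intro nn_integral_cong) (auto simp: indicator_def)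
    then show ?thesis using nn_lpos_powr_tail[OF g(1) that] by simp
  qed
  have mH: "(\<lambda>(t, r). ?H t r) \<in> borel_measurable (lpos \<Otimes>\<^sub>M lpos)"
    unfolding indicator_def atMost_iff of_bool_def by measurable
  have i\<psi>: "integrable lpos (\<lambda>r. r powr (- \<gamma>) * ?\<psi> r)"
  proof -
    obtain C where C: "\<And>t x. t \<ge> 0 \<Longrightarrow> \<bar>hf (neg_lap \<phi>) t x\<bar> \<le> C * (1 + t) powr (- (real (Suc 0) + real DIM('a) / 2))"
      using hf_decay_time[of "Suc 0" \<phi>] \<phi> by auto
    have "integrable lpos (\<lambda>r. r powr (1 - \<gamma> - 1) * ?\<psi> (0 + r))"
      by (rule RL_integrable[OF _ _ _ _ C]) (use g in \<open>auto intro: less_le_trans[of _ 1]\<close>)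
    then show ?thesis by simp
  qed
  have iH: "integrable (lpos \<Otimes>\<^sub>M lpos) (\<lambda>(t, r). ?H t r)"
  proof (subst integrable_iff_bounded, intro conjI mH)
    have "(\<integral>\<^sup>+w. ennreal (norm (case w of (t, r) \<Rightarrow> ?H t r)) \<partial>(lpos \<Otimes>\<^sub>M lpos)) = (\<integral>\<^sup>+r. \<integral>\<^sup>+t. ennreal (norm (?H t r)) \<partial>lpos \<partial>lpos)"
      using mH by (subst lpos_lpos.nn_integral_snd[symmetric]) (auto simp: split_beta')
    also have "\<dots> = (\<integral>\<^sup>+r. ennreal (norm ((1 / \<gamma>) * (r powr (- \<gamma>) * ?\<psi> r))) \<partial>lpos)"
    proof (rule nn_lpos_cong)
      fix r :: real assume r: "0 < r"
      have "(\<integral>\<^sup>+t. ennreal (norm (?H t r)) \<partial>lpos) = (\<integral>\<^sup>+t. ennreal \<bar>?\<psi> r\<bar> * ennreal (t powr (- \<gamma> - 1) * indicator {..t} r) \<partial>lpos)"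
        by (intro nn_integral_cong) (auto simp: abs_mult ennreal_mult[symmetric] mult_ac)
      also have "\<dots> = ennreal \<bar>?\<psi> r\<bar> * ennreal (r powr (- \<gamma>) / \<gamma>)"
      proof (subst nn_integral_cmult)
        show "(\<lambda>t. ennreal (t powr (- \<gamma> - 1) * indicator {..t} r)) \<in> borel_measurable lpos"
          unfolding indicator_def atMost_iff of_bool_def by measurable
      qed (simp add: tail[OF r])
      finally show "(\<integral>\<^sup>+t. ennreal (norm (?H t r)) \<partial>lpos) = ennreal (norm ((1 / \<gamma>) * (r powr (- \<gamma>) * ?\<psi> r)))"
        using g by (simp add: abs_mult ennreal_mult[symmetric] mult_ac)
    qed
    also have "\<dots> < \<infinity>" using integrable_mult_right[OF i\<psi>, of "1 / \<gamma>"] unfolding integrable_iff_bounded by blast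
    finally show "(\<integral>\<^sup>+w. ennreal (norm (case w of (t, r) \<Rightarrow> ?H t r)) \<partial>(lpos \<Otimes>\<^sub>M lpos)) < \<infinity>" .
  qed
  have "?c * (LINT z|lborel. sd \<phi> z x * norm z powr (- ?a)) = (LINT z|lborel. LINT t|lpos. ?F z t)"
    unfolding tin by simp
  also have "\<dots> = (LINT t|lpos. LINT z|lborel. ?F z t)"
    by (rule lborel_lpos.Fubini_integral[OF iF, symmetric])
  also have "\<dots> = (LINT t|lpos. (2 * ?k) * (LINT r|lpos. ?H t r))"
  proof (rule lpos_cong)
    show "(\<lambda>t. LINT z|lborel. ?F z t) \<in> borel_measurable borel"
      unfolding sd_def by (rule lborel.borel_measurable_lebesgue_integral) measurable
    have "(\<lambda>t. LINT r|lpos. ?H t r) \<in> borel_measurable lpos"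
      by (rule lpos.borel_measurable_lebesgue_integral) (use mH in simp)
    then have [measurable]: "(\<lambda>t. LINT r|lpos. ?H t r) \<in> borel_measurable borel" by simp
    show "(\<lambda>t. (2 * ?k) * (LINT r|lpos. ?H t r)) \<in> borel_measurable borel" by measurable
    fix t :: real assume t: "0 < t"
    have "(LINT r|lpos. ?H t r) = t powr (- \<gamma> - 1) * (\<phi> x - hf \<phi> t x)"
      unfolding hf_diff(1)[OF \<phi> t] by (simp add: mult.assoc)
    then show "(LINT z|lborel. ?F z t) = (2 * ?k) * (LINT r|lpos. ?H t r)" unfolding zin[OF t] by simp
  qed
  also have "\<dots> = (2 * ?k) * (LINT t|lpos. LINT r|lpos. ?H t r)" by (rule integral_mult_right_zero)
  also have "(LINT t|lpos. LINT r|lpos. ?H t r) = (LINT r|lpos. LINT t|lpos. ?H t r)"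
    by (rule lpos_lpos.Fubini_integral[OF iH, symmetric])
  also have "\<dots> = (LINT r|lpos. (1 / \<gamma>) * (r powr (- \<gamma>) * ?\<psi> r))"
  proof (rule lpos_cong)
    have "(\<lambda>r. LINT t|lpos. ?H t r) \<in> borel_measurable lpos"
      by (rule lpos.borel_measurable_lebesgue_integral)
        (use measurable_compose[OF measurable_pair_swap' mH] in \<open>simp add: split_beta'\<close>)
    then show "(\<lambda>r. LINT t|lpos. ?H t r) \<in> borel_measurable borel" by simp
    fix r :: real assume r: "0 < r"
    have m: "(\<lambda>t. t powr (- \<gamma> - 1) * indicator {..t} r) \<in> borel_measurable lpos"
      unfolding indicator_def atMost_iff of_bool_def by measurable
    have "(LINT t|lpos. t powr (- \<gamma> - 1) * indicator {..t} r) = r powr (- \<gamma>) / \<gamma>"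
      using tail[OF r] g m by (subst integral_eq_nn_integral) auto
    moreover have "(LINT t|lpos. ?H t r) = (LINT t|lpos. ?\<psi> r * (t powr (- \<gamma> - 1) * indicator {..t} r))"
      by (rule Bochner_Integration.integral_cong[OF refl]) (simp only: mult_ac)
    ultimately show "(LINT t|lpos. ?H t r) = (1 / \<gamma>) * (r powr (- \<gamma>) * ?\<psi> r)" by simp
  qed measurable
  also have "\<dots> = (1 / \<gamma>) * (LINT r|lpos. r powr (- \<gamma>) * ?\<psi> r)" by (rule integral_mult_right_zero)
  finally have "?c * ((LINT z|lborel. sd \<phi> z x * norm z powr (- ?a)) / 2) = (LINT r|lpos. r powr (- \<gamma>) * ?\<psi> r) / Gamma (1 - \<gamma>)"
    using g by simp
  then show ?thesis by (simp add: ztf_def RL_def)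
qed

section \<open>Pairing the singular integral with test functions\<close>

lemma bounded_on_cball:
  fixes v :: "'a::euclidean_space \<Rightarrow> real"
  assumes "continuous_on UNIV v"
  shows "\<exists>V\<ge>0. \<forall>x. norm x \<le> R \<longrightarrow> \<bar>v x\<bar> \<le> V"
proof -
  have "compact (v ` cball 0 R)"
    using assms by (intro compact_continuous_image) (auto elim: continuous_on_subset)
  then have "bounded (v ` cball 0 R)" by (rule compact_imp_bounded)
  then obtain V where "0 < V" "\<forall>y\<in>v ` cball 0 R. norm y \<le> V" unfolding bounded_pos by blast
  then show ?thesis by (intro exI[of _ V]) auto
qed

text \<open>Uniformity over a ball containing the support of the test function is what Fubini needs
  when the second difference falls on v.\<close>

lemma sd_kernel_uniform:
  fixes v :: "'a::euclidean_space \<Rightarrow> real"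
  assumes g: "0 < \<gamma>" "\<gamma> < 1" and v: "v \<in> Ls_space \<gamma>" and c: "continuous_on UNIV v"
    and s: "2 * \<gamma> < \<sigma>" "\<sigma> < 2 * \<gamma> + 1" and C: "0 \<le> C"
    and b: "\<And>x z. norm x \<le> R \<Longrightarrow> norm z \<le> 1 \<Longrightarrow> \<bar>sd v z x\<bar> \<le> C * norm z powr \<sigma>"
  shows "\<exists>D\<ge>0. \<forall>x. norm x \<le> R \<longrightarrow> (\<integral>\<^sup>+z. ennreal \<bar>sd v z x * norm z powr (- (real DIM('a) + 2 * \<gamma>))\<bar> \<partial>lborel) \<le> ennreal D"
proof -
  let ?a = "real DIM('a) + 2 * \<gamma>"
  have n1: "1 \<le> real DIM('a)" by (simp add: DIM_positive Suc_leI)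
  have [measurable]: "v \<in> borel_measurable borel" using c by (rule borel_measurable_continuous_onI)
  have iv: "integrable lborel (\<lambda>y. \<bar>v y\<bar> * wt ?a y)" using Ls_integrable[OF v] g by simp
  have iw: "integrable lborel (wt ?a :: 'a \<Rightarrow> real)" using g by (intro wt_integrable) auto
  obtain V where V: "V \<ge> 0" "\<And>x. norm x \<le> R \<Longrightarrow> \<bar>v x\<bar> \<le> V" using bounded_on_cball[OF c, of R] by auto
  define K where "K r = ((1 + 2 * r\<^sup>2) / 1\<^sup>2 + 2) powr (?a / 2)" for r :: real
  have K: "K r \<ge> 0" for r by (simp add: K_def)
  define q where "q z = norm (z::'a) powr (- (?a - \<sigma>)) * indicator (cball 0 1) z" for z
  define w where "w y = \<bar>v y\<bar> * wt ?a y" for y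
  have iq: "integrable lborel q" unfolding q_def[abs_def]
    using s n1 by (intro integrable_norm_powr_near; linarith)
  have iw': "integrable lborel w" unfolding w_def[abs_def] by (rule iv)
  have mw[measurable]: "w \<in> borel_measurable borel" unfolding w_def by measurable
  define D where "D = C * (LINT z|lborel. q z) + 2 * V * K 0 * (LINT z|lborel. wt ?a (z::'a)) + 2 * K R * (LINT z|lborel. w z)"
  have q0: "0 \<le> q z" "0 \<le> w z" for z by (auto simp: q_def w_def)
  show ?thesis
  proof (intro exI[of _ D] conjI allI impI)
    show "0 \<le> D" unfolding D_def using C V K q0 by (intro add_nonneg_nonneg mult_nonneg_nonneg integral_nonneg_AE) auto
    fix x :: 'a assume x: "norm x \<le> R"
    define H where "H z = C * q z + (2 * V * K 0) * wt ?a z + K R * w (z + x) + K R * w (x - z)" for z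
    have iH: "integrable lborel H" unfolding H_def[abs_def]
      using integrable_shift(1)[OF iw', of x] integrable_shift(3)[OF iw', of x] iq iw
      by (intro Bochner_Integration.integrable_add integrable_mult_right)
    have IH: "(LINT z|lborel. H z) = D" unfolding H_def D_def
      using integrable_shift(1)[OF iw', of x] integrable_shift(3)[OF iw', of x] iq iw integral_shift(1)[OF mw, of x] integral_shift(3)[OF mw, of x]
      by simp
    have H0: "0 \<le> H z" for z unfolding H_def using C V K q0 by (intro add_nonneg_nonneg mult_nonneg_nonneg) auto
    have le: "\<bar>sd v z x * norm z powr (- ?a)\<bar> \<le> H z" for z
    proof (cases "norm z \<le> 1")
      case True
      have "\<bar>sd v z x * norm z powr (- ?a)\<bar> \<le> (C * norm z powr \<sigma>) * norm z powr (- ?a)"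
        unfolding abs_mult using b[OF x True] by (intro mult_mono) auto
      also have "\<dots> = C * q z"
      proof -
        have e: "- (?a - \<sigma>) = \<sigma> + (- ?a)" by simp
        show ?thesis unfolding q_def e powr_add using True by simp
      qed
      also have "\<dots> \<le> H z" unfolding H_def using C V K q0 by (simp add: add_nonneg_nonneg)
      finally show ?thesis .
    next
      case False
      have a0: "0 \<le> ?a" using g by simp
      have 0: "norm z powr (- ?a) \<le> K 0 * wt ?a z" using wt_far[of "0::'a" 0 ?a 1 z] False a0 by (simp add: K_def)
      have 1: "norm z powr (- ?a) \<le> K R * wt ?a (z + x)" using wt_far[of x R ?a 1 z] False a0 x by (simp add: K_def add.commute)
      have 2: "norm z powr (- ?a) \<le> K R * wt ?a (x - z)" using wt_far[of x R ?a 1 "- z"] False a0 x by (simp add: K_def)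
      have "\<bar>sd v z x\<bar> \<le> 2 * V + \<bar>v (z + x)\<bar> + \<bar>v (x - z)\<bar>" using V(2)[OF x] by (simp add: sd_def add.commute)
      then have "\<bar>sd v z x * norm z powr (- ?a)\<bar> \<le> (2 * V + \<bar>v (z + x)\<bar> + \<bar>v (x - z)\<bar>) * norm z powr (- ?a)"
        unfolding abs_mult by (intro mult_mono) auto
      also have "\<dots> = 2 * V * norm z powr (- ?a) + \<bar>v (z + x)\<bar> * norm z powr (- ?a) + \<bar>v (x - z)\<bar> * norm z powr (- ?a)" by (simp add: algebra_simps)
      also have "\<dots> \<le> 2 * V * (K 0 * wt ?a z) + \<bar>v (z + x)\<bar> * (K R * wt ?a (z + x)) + \<bar>v (x - z)\<bar> * (K R * wt ?a (x - z))"
        using 0 1 2 V by (intro add_mono mult_left_mono) auto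
      also have "\<dots> \<le> H z" unfolding H_def w_def using C q0 by (simp add: algebra_simps)
      finally show ?thesis .
    qed
    have "(\<integral>\<^sup>+z. ennreal \<bar>sd v z x * norm z powr (- ?a)\<bar> \<partial>lborel) \<le> (\<integral>\<^sup>+z. ennreal (H z) \<partial>lborel)"
      by (intro nn_integral_mono ennreal_leI le)
    also have "\<dots> = ennreal D" using nn_integral_eq_integral[OF iH] H0 IH by simp
    finally show "(\<integral>\<^sup>+z. ennreal \<bar>sd v z x * norm z powr (- ?a)\<bar> \<partial>lborel) \<le> ennreal D" .
  qed
qed

text \<open>Far from the support \<phi>(x) vanishes, and \<phi>(x + z) or \<phi>(x - z) can be
  nonzero only for |z| \<ge> |x|/2. There the kernel is at most 2^a |x|^(-a), which leaves the
  integral of |\<phi>|. On the remaining ball the local bound suffices.\<close>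

lemma sd_test_decay:
  fixes \<phi> :: "'a::euclidean_space \<Rightarrow> real"
  assumes \<phi>: "tst 2 \<phi>" and g: "0 < \<gamma>" "\<gamma> < 1"
  shows "\<exists>C\<ge>0. \<forall>x. (\<integral>\<^sup>+z. ennreal \<bar>sd \<phi> z x * norm z powr (- (real DIM('a) + 2 * \<gamma>))\<bar> \<partial>lborel) \<le> ennreal (C * wt (real DIM('a) + 2 * \<gamma>) x)"
proof -
  let ?a = "real DIM('a) + 2 * \<gamma>"
  have a0: "0 \<le> ?a" using g by simp
  have c: "continuous_on UNIV \<phi>" using \<phi> by (auto simp: tst_def dest: Ck_cont)
  have [measurable]: "\<phi> \<in> borel_measurable borel" using \<phi> by (rule tst_meas)
  have i\<phi>: "integrable lborel \<phi>" using \<phi> by (auto simp: tst_def intro: bdd_supp_integrable dest: Ck_cont)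
  obtain R0 where R0: "\<And>x. R0 < norm x \<Longrightarrow> \<phi> x = 0" using \<phi> by (auto simp: tst_def bdd_supp_def)
  define R where "R = max 1 R0"
  have R: "1 \<le> R" "\<And>x. R < norm x \<Longrightarrow> \<phi> x = 0" using R0 by (auto simp: R_def)
  obtain \<sigma> where s: "2 * \<gamma> < \<sigma>" "\<sigma> < 2 * \<gamma> + 1" and b: "\<And>R. \<exists>C\<ge>0. \<forall>x z. norm x \<le> R \<longrightarrow> norm z \<le> 1 \<longrightarrow> \<bar>sd \<phi> z x\<bar> \<le> C * norm z powr \<sigma>"
    using sd_test_bound[OF \<phi> g] by blast
  obtain C where C: "C \<ge> 0" "\<And>x z. norm x \<le> 2 * R \<Longrightarrow> norm z \<le> 1 \<Longrightarrow> \<bar>sd \<phi> z x\<bar> \<le> C * norm z powr \<sigma>"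
    using b[of "2 * R"] by auto
  obtain D where D: "D \<ge> 0" "\<And>x. norm x \<le> 2 * R \<Longrightarrow> (\<integral>\<^sup>+z. ennreal \<bar>sd \<phi> z x * norm z powr (- ?a)\<bar> \<partial>lborel) \<le> ennreal D"
    using sd_kernel_uniform[OF g tst_Ls[OF \<phi>] c s C] by auto
  define P where "P = (LINT x|lborel. \<bar>\<phi> x\<bar>)"
  have P: "P \<ge> 0" unfolding P_def by (intro integral_nonneg_AE) auto
  have nP: "(\<integral>\<^sup>+z. ennreal \<bar>\<phi> z\<bar> \<partial>lborel) = ennreal P" unfolding P_def by (rule nn_integral_eq_integral[OF integrable_abs[OF i\<phi>]]) auto
  define K where "K = ((1 + 2 * 0\<^sup>2) / (2 * R)\<^sup>2 + 2) powr (?a / 2)"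
  \<comment> \<open>The first entry serves |x| \<le> 2R, where the weight is bounded below; the
    second serves |x| > 2R, its factor 2 counting the two shifts of \<phi>.\<close>
  define E where "E = max (D * (1 + (2 * R)\<^sup>2) powr (?a / 2)) (2 * P * 2 powr ?a * K)"
  show ?thesis
  proof (intro exI[of _ E] conjI allI)
    show "0 \<le> E" using D by (simp add: E_def le_max_iff_disj)
    fix x :: 'a
    show "(\<integral>\<^sup>+z. ennreal \<bar>sd \<phi> z x * norm z powr (- ?a)\<bar> \<partial>lborel) \<le> ennreal (E * wt ?a x)"
    proof (cases "norm x \<le> 2 * R")
      case True
      have "1 \<le> (1 + (2 * R)\<^sup>2) powr (?a / 2) * wt ?a x"
      proof -
        have "wt ?a 0 \<le> (1 + (2 * R)\<^sup>2) powr (?a / 2) * wt ?a x"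
          by (rule wt_le) (use inner_le_R[OF True] a0 in \<open>auto simp: add_pos_nonneg\<close>)
        then show ?thesis by (simp add: wt_def)
      qed
      from mult_left_mono[OF this D(1)] have "D \<le> D * (1 + (2 * R)\<^sup>2) powr (?a / 2) * wt ?a x" by (simp add: mult.assoc)
      also have "\<dots> \<le> E * wt ?a x" by (intro mult_right_mono) (auto simp: E_def)
      finally show ?thesis using D(2)[OF True] by (meson ennreal_leI order_trans)
    next
      case False
      then have xR: "2 * R < norm x" by simp
      have x0: "\<phi> x = 0" using xR R by auto
      have pt: "\<bar>sd \<phi> z x * norm z powr (- ?a)\<bar> \<le> (2 powr ?a * norm x powr (- ?a)) * (\<bar>\<phi> (z + x)\<bar> + \<bar>\<phi> (x - z)\<bar>)" for z
      proof (cases "norm z < norm x / 2")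
        case True
        have "R < norm (z + x)" "R < norm (x - z)"
          using True xR norm_triangle_ineq2[of x "- z"] norm_triangle_ineq2[of x z] by (auto simp: add.commute)
        then have "\<phi> (x + z) = 0" "\<phi> (x - z) = 0" using R(2) by (auto simp: add.commute)
        then show ?thesis using x0 by (simp add: sd_def)
      next
        case False
        have "norm z powr (- ?a) \<le> (norm x / 2) powr (- ?a)" using False xR R a0 by (intro powr_mono2') auto
        also have "\<dots> = norm x powr (- ?a) / 2 powr (- ?a)" by (rule powr_divide)
        also have "\<dots> = 2 powr ?a * norm x powr (- ?a)" unfolding powr_minus[of 2] by (simp add: divide_inverse)
        finally have 1: "norm z powr (- ?a) \<le> 2 powr ?a * norm x powr (- ?a)" .
        have 2: "\<bar>sd \<phi> z x\<bar> \<le> \<bar>\<phi> (z + x)\<bar> + \<bar>\<phi> (x - z)\<bar>" using x0 by (simp add: sd_def add.commute)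
        show ?thesis unfolding abs_mult using mult_mono[OF 2 1] by (simp add: mult.commute)
      qed
      have "(\<integral>\<^sup>+z. ennreal \<bar>sd \<phi> z x * norm z powr (- ?a)\<bar> \<partial>lborel) \<le> (\<integral>\<^sup>+z. ennreal (2 powr ?a * norm x powr (- ?a)) * (ennreal \<bar>\<phi> (z + x)\<bar> + ennreal \<bar>\<phi> (x - z)\<bar>) \<partial>lborel)"
        using pt by (intro nn_integral_mono) (simp add: ennreal_mult[symmetric] ennreal_plus[symmetric] del: ennreal_plus)
      also have "\<dots> = ennreal (2 powr ?a * norm x powr (- ?a)) * (ennreal P + ennreal P)"
        using nP nn_integral_shift(1)[of "\<lambda>z. ennreal \<bar>\<phi> z\<bar>" x] nn_integral_shift(3)[of "\<lambda>z. ennreal \<bar>\<phi> z\<bar>" x]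
        by (subst nn_integral_cmult) (auto simp: nn_integral_add)
      also have "\<dots> = ennreal (2 * P * 2 powr ?a * norm x powr (- ?a))"
        using P by (simp add: ennreal_mult[symmetric] ennreal_plus[symmetric] mult_ac del: ennreal_plus)
      also have "\<dots> \<le> ennreal (E * wt ?a x)"
      proof (rule ennreal_leI)
        have "norm x powr (- ?a) \<le> K * wt ?a x" using wt_far[of "0::'a" 0 ?a "2 * R" x] xR R a0 by (simp add: K_def)
        then have "2 * P * 2 powr ?a * norm x powr (- ?a) \<le> 2 * P * 2 powr ?a * (K * wt ?a x)" using P by (intro mult_left_mono) auto
        also have "\<dots> \<le> E * wt ?a x" unfolding mult.assoc[symmetric] by (intro mult_right_mono) (auto simp: E_def)
        finally show "2 * P * 2 powr ?a * norm x powr (- ?a) \<le> E * wt ?a x" .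
      qed
      finally show ?thesis .
    qed
  qed
qed

text \<open>For fixed z the second difference is symmetric with respect to integration in x, so it
  passes from v to \<phi>. Fubini is needed twice with different majorants: the local bound for v on
  the support of \<phi> before the exchange, the weighted decay for \<phi> after it.\<close>

lemma weak_frac_lap:
  fixes v \<phi> :: "'a::euclidean_space \<Rightarrow> real"
  assumes g: "0 < \<gamma>" "\<gamma> < 1" and v: "v \<in> Ls_space \<gamma>" and c: "continuous_on UNIV v"
    and s: "2 * \<gamma> < \<sigma>" "\<sigma> < 2 * \<gamma> + 1"
    and b: "\<And>R. \<exists>C\<ge>0. \<forall>x z. norm x \<le> R \<longrightarrow> norm z \<le> 1 \<longrightarrow> \<bar>sd v z x\<bar> \<le> C * norm z powr \<sigma>"
    and \<phi>: "tst 2 \<phi>"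
  shows "(LINT x|lborel. frac_lap \<gamma> v x * \<phi> x) = (LINT x|lborel. v x * ztf 0 \<gamma> \<phi> 0 x)"
proof -
  let ?a = "real DIM('a) + 2 * \<gamma>" and ?c = "frac_const DIM('a) \<gamma>"
  have cp: "continuous_on UNIV \<phi>" using \<phi> by (auto simp: tst_def dest: Ck_cont)
  have [measurable]: "v \<in> borel_measurable borel" using c by (rule borel_measurable_continuous_onI)
  have [measurable]: "\<phi> \<in> borel_measurable borel" using \<phi> by (rule tst_meas)
  have iv: "integrable lborel (\<lambda>y. \<bar>v y\<bar> * wt ?a y)" using Ls_integrable[OF v] g by simp
  obtain M R where M: "0 < M" "0 < R" "\<And>x. \<bar>\<phi> x\<bar> \<le> M * indicator (cball 0 R) x"
    using bdd_supp_bounded[OF cp] \<phi> by (auto simp: tst_def)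
  have i\<phi>: "integrable lborel \<phi>" using \<phi> cp by (auto simp: tst_def intro: bdd_supp_integrable)
  let ?F = "\<lambda>x z. \<phi> x * (sd v z x * norm z powr (- ?a))"
  let ?G = "\<lambda>x z. v x * (sd \<phi> z x * norm z powr (- ?a))"
  have mF: "(\<lambda>(x, z). ?F x z) \<in> borel_measurable (lborel \<Otimes>\<^sub>M lborel)" unfolding sd_def by measurable
  have mG: "(\<lambda>(x, z). ?G x z) \<in> borel_measurable (lborel \<Otimes>\<^sub>M lborel)" unfolding sd_def by measurable
  have msd[measurable]: "(\<lambda>z. sd v z x) \<in> borel_measurable borel" "(\<lambda>z. sd \<phi> z x) \<in> borel_measurable borel" for x
    unfolding sd_def by measurable
  have iF: "integrable (lborel \<Otimes>\<^sub>M lborel) (\<lambda>(x, z). ?F x z)"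
  proof (subst integrable_iff_bounded, intro conjI mF)
    obtain C where C: "C \<ge> 0" "\<And>x z. norm x \<le> R \<Longrightarrow> norm z \<le> 1 \<Longrightarrow> \<bar>sd v z x\<bar> \<le> C * norm z powr \<sigma>"
      using b[of R] by auto
    obtain D where D: "D \<ge> 0" "\<And>x. norm x \<le> R \<Longrightarrow> (\<integral>\<^sup>+z. ennreal \<bar>sd v z x * norm z powr (- ?a)\<bar> \<partial>lborel) \<le> ennreal D"
      using sd_kernel_uniform[OF g v c s C] by auto
    have "(\<integral>\<^sup>+w. ennreal (norm (case w of (x, z) \<Rightarrow> ?F x z)) \<partial>(lborel \<Otimes>\<^sub>M lborel)) = (\<integral>\<^sup>+x. \<integral>\<^sup>+z. ennreal (norm (?F x z)) \<partial>lborel \<partial>lborel)"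
      using mF by (subst lborel.nn_integral_fst[symmetric]) (auto simp: split_beta')
    also have "\<dots> \<le> (\<integral>\<^sup>+x. ennreal (D * \<bar>\<phi> x\<bar>) \<partial>lborel)"
    proof (rule nn_integral_mono)
      fix x :: 'a
      have "(\<integral>\<^sup>+z. ennreal (norm (?F x z)) \<partial>lborel) = (\<integral>\<^sup>+z. ennreal \<bar>\<phi> x\<bar> * ennreal \<bar>sd v z x * norm z powr (- ?a)\<bar> \<partial>lborel)"
        by (intro nn_integral_cong) (simp add: abs_mult ennreal_mult[symmetric])
      also have "\<dots> = ennreal \<bar>\<phi> x\<bar> * (\<integral>\<^sup>+z. ennreal \<bar>sd v z x * norm z powr (- ?a)\<bar> \<partial>lborel)"
        by (rule nn_integral_cmult) measurable
      also have "\<dots> \<le> ennreal (D * \<bar>\<phi> x\<bar>)"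
      proof (cases "norm x \<le> R")
        case True
        from mult_left_mono[OF D(2)[OF True], of "ennreal \<bar>\<phi> x\<bar>"] show ?thesis
          using D(1) by (simp add: ennreal_mult[symmetric] mult.commute)
      next
        case False
        then have "\<phi> x = 0" using M(3)[of x] by simp
        then show ?thesis by simp
      qed
      finally show "(\<integral>\<^sup>+z. ennreal (norm (?F x z)) \<partial>lborel) \<le> ennreal (D * \<bar>\<phi> x\<bar>)" .
    qed
    also have "\<dots> = ennreal (LINT x|lborel. D * \<bar>\<phi> x\<bar>)"
      using i\<phi> D by (intro nn_integral_eq_integral) auto
    finally show "(\<integral>\<^sup>+w. ennreal (norm (case w of (x, z) \<Rightarrow> ?F x z)) \<partial>(lborel \<Otimes>\<^sub>M lborel)) < \<infinity>"
      by (simp add: le_less_trans)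
  qed
  have iG: "integrable (lborel \<Otimes>\<^sub>M lborel) (\<lambda>(x, z). ?G x z)"
  proof (subst integrable_iff_bounded, intro conjI mG)
    obtain E where E: "E \<ge> 0" "\<And>x. (\<integral>\<^sup>+z. ennreal \<bar>sd \<phi> z x * norm z powr (- ?a)\<bar> \<partial>lborel) \<le> ennreal (E * wt ?a x)"
      using sd_test_decay[OF \<phi> g] by blast
    have "(\<integral>\<^sup>+w. ennreal (norm (case w of (x, z) \<Rightarrow> ?G x z)) \<partial>(lborel \<Otimes>\<^sub>M lborel)) = (\<integral>\<^sup>+x. \<integral>\<^sup>+z. ennreal (norm (?G x z)) \<partial>lborel \<partial>lborel)"
      using mG by (subst lborel.nn_integral_fst[symmetric]) (auto simp: split_beta')
    also have "\<dots> \<le> (\<integral>\<^sup>+x. ennreal (E * (\<bar>v x\<bar> * wt ?a x)) \<partial>lborel)"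
    proof (rule nn_integral_mono)
      fix x :: 'a
      have "(\<integral>\<^sup>+z. ennreal (norm (?G x z)) \<partial>lborel) = (\<integral>\<^sup>+z. ennreal \<bar>v x\<bar> * ennreal \<bar>sd \<phi> z x * norm z powr (- ?a)\<bar> \<partial>lborel)"
        by (intro nn_integral_cong) (simp add: abs_mult ennreal_mult[symmetric])
      also have "\<dots> = ennreal \<bar>v x\<bar> * (\<integral>\<^sup>+z. ennreal \<bar>sd \<phi> z x * norm z powr (- ?a)\<bar> \<partial>lborel)"
        by (rule nn_integral_cmult) measurable
      also have "\<dots> \<le> ennreal \<bar>v x\<bar> * ennreal (E * wt ?a x)" by (intro mult_left_mono E) simp
      also have "\<dots> = ennreal (E * (\<bar>v x\<bar> * wt ?a x))" using E(1) by (simp add: ennreal_mult[symmetric] mult_ac)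
      finally show "(\<integral>\<^sup>+z. ennreal (norm (?G x z)) \<partial>lborel) \<le> ennreal (E * (\<bar>v x\<bar> * wt ?a x))" .
    qed
    also have "\<dots> = ennreal (LINT x|lborel. E * (\<bar>v x\<bar> * wt ?a x))"
      using iv E by (intro nn_integral_eq_integral) auto
    finally show "(\<integral>\<^sup>+w. ennreal (norm (case w of (x, z) \<Rightarrow> ?G x z)) \<partial>(lborel \<Otimes>\<^sub>M lborel)) < \<infinity>"
      by (simp add: le_less_trans)
  qed
  \<comment> \<open>Translation invariance sends the shift by z on v to the shift by -z on \<phi>,
    and the pair of shifts is symmetric.\<close>
  have swap: "(LINT x|lborel. ?F x z) = (LINT x|lborel. ?G x z)" for z
  proof -
    have i: "integrable lborel (\<lambda>x. v (x + d) * \<phi> x)" for d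
      using \<phi> cp by (intro Ck_mult_integrable continuous_on_compose2[OF c]) (auto simp: tst_def intro!: continuous_intros)
    have i': "integrable lborel (\<lambda>x. v x * \<phi> (x + d))" for d
      using \<phi> cp by (intro Ck_mult_integrable c continuous_on_compose2[OF cp] bdd_supp_translate) (auto simp: tst_def intro!: continuous_intros)
    have e: "(LINT x|lborel. v (x + d) * \<phi> x) = (LINT x|lborel. v x * \<phi> (x + (- d)))" for d
      using integral_shift(1)[of "\<lambda>x. v x * \<phi> (x + (- d))" d] by simp
    have "(LINT x|lborel. sd v z x * \<phi> x) = (LINT x|lborel. 2 * (v (x + 0) * \<phi> x) - v (x + z) * \<phi> x - v (x + (- z)) * \<phi> x)"
      by (simp add: sd_def algebra_simps)
    also have "\<dots> = 2 * (LINT x|lborel. v (x + 0) * \<phi> x) - (LINT x|lborel. v (x + z) * \<phi> x) - (LINT x|lborel. v (x + (- z)) * \<phi> x)"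
      by (subst Bochner_Integration.integral_diff, intro Bochner_Integration.integrable_diff integrable_mult_right i, rule i,
          subst Bochner_Integration.integral_diff, intro integrable_mult_right i, rule i, simp)
    also have "\<dots> = 2 * (LINT x|lborel. v x * \<phi> (x + 0)) - (LINT x|lborel. v x * \<phi> (x + (- z))) - (LINT x|lborel. v x * \<phi> (x + z))"
      unfolding e by simp
    also have "\<dots> = (LINT x|lborel. 2 * (v x * \<phi> (x + 0)) - v x * \<phi> (x + (- z)) - v x * \<phi> (x + z))"
      by (subst Bochner_Integration.integral_diff, intro Bochner_Integration.integrable_diff integrable_mult_right i', rule i',
          subst Bochner_Integration.integral_diff, intro integrable_mult_right i', rule i', simp)
    also have "\<dots> = (LINT x|lborel. v x * sd \<phi> z x)" by (simp add: sd_def algebra_simps)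
    finally have 1: "(LINT x|lborel. sd v z x * \<phi> x) = (LINT x|lborel. v x * sd \<phi> z x)" .
    have "(LINT x|lborel. ?F x z) = (LINT x|lborel. norm z powr (- ?a) * (sd v z x * \<phi> x))"
      by (rule Bochner_Integration.integral_cong[OF refl]) (simp only: mult_ac)
    also have "\<dots> = (LINT x|lborel. norm z powr (- ?a) * (v x * sd \<phi> z x))" using 1 by simp
    also have "\<dots> = (LINT x|lborel. ?G x z)"
      by (rule Bochner_Integration.integral_cong[OF refl]) (simp only: mult_ac)
    finally show ?thesis .
  qed
  have "(LINT x|lborel. frac_lap \<gamma> v x * \<phi> x) = (LINT x|lborel. (?c / 2) * (LINT z|lborel. ?F x z))"
  proof (rule Bochner_Integration.integral_cong[OF refl])
    fix x :: 'a
    obtain C where C: "C \<ge> 0" "\<And>z. norm z \<le> 1 \<Longrightarrow> \<bar>sd v z x\<bar> \<le> C * norm z powr \<sigma>" using b[of "norm x"] by auto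
    show "frac_lap \<gamma> v x * \<phi> x = (?c / 2) * (LINT z|lborel. ?F x z)"
      using frac_lap_formula(2)[OF g v _ s C(2)] by simp
  qed
  also have "\<dots> = (?c / 2) * (LINT x|lborel. LINT z|lborel. ?F x z)" by (rule integral_mult_right_zero)
  also have "(LINT x|lborel. LINT z|lborel. ?F x z) = (LINT z|lborel. LINT x|lborel. ?F x z)"
    by (rule lborel_pair.Fubini_integral[OF iF, symmetric])
  also have "\<dots> = (LINT z|lborel. LINT x|lborel. ?G x z)" unfolding swap ..
  also have "\<dots> = (LINT x|lborel. LINT z|lborel. ?G x z)" by (rule lborel_pair.Fubini_integral[OF iG])
  also have "(?c / 2) * \<dots> = (LINT x|lborel. (?c / 2) * (LINT z|lborel. ?G x z))" by (rule integral_mult_right_zero[symmetric])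
  also have "\<dots> = (LINT x|lborel. v x * ztf 0 \<gamma> \<phi> 0 x)"
    by (rule Bochner_Integration.integral_cong[OF refl]) (simp add: frac_lap_test[OF \<phi> g, symmetric])
  finally show ?thesis .
qed

definition wlap :: "nat \<Rightarrow> real \<Rightarrow> ('a::euclidean_space \<Rightarrow> real) \<Rightarrow> 'a \<Rightarrow> real" where
  "wlap m \<gamma> v = (neg_lap ^^ m) (frac_lap \<gamma> v)"

text \<open>Regularity of order 2m of the fractional Laplacian justifies moving the m Laplacians
  onto \<phi>; the fractional part follows in weak form, and \<open>ztf 0\<close> of (-\<Delta>)^m
  \<phi> is \<open>ztf m\<close> of \<phi> by unfolding. At \<gamma> = 0 there is no singular
  integral: \<open>frac_lap\<close> is the identity, and \<open>ztf 0 0 \<phi> 0\<close> is \<phi>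
  by the fundamental theorem for the flow.\<close>

lemma strong_regularity:
  fixes v :: "'a::euclidean_space \<Rightarrow> real"
  assumes g: "0 \<le> \<gamma>" "\<gamma> < 1" and v: "v \<in> Ls_space \<gamma>"
    and h: "Ck_hoelder_loc (2 * m + nat \<lfloor>2 * \<gamma>\<rfloor>) (2 * \<gamma> - of_int \<lfloor>2 * \<gamma>\<rfloor> + \<epsilon>) v" and e: "0 < \<epsilon>"
  shows "Ck (2 * m) v" "Ck (2 * m) (frac_lap \<gamma> v)" "frac_lap_defined \<gamma> v x"
    and "tst (2 * Suc m) \<phi> \<Longrightarrow> (LINT x|lborel. wlap m \<gamma> v x * \<phi> x) = (LINT x|lborel. v x * ztf m \<gamma> \<phi> 0 x)"
proof -
  have main: "Ck (2 * m) v \<and> Ck (2 * m) (frac_lap \<gamma> v) \<and> frac_lap_defined \<gamma> v x \<and>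
     (\<forall>\<phi>. tst 2 \<phi> \<longrightarrow> (LINT x|lborel. frac_lap \<gamma> v x * \<phi> x) = (LINT x|lborel. v x * ztf 0 \<gamma> \<phi> 0 x))"
  proof (cases "\<gamma> = 0")
    case True
    have "Ck (2 * m) v" using h True e by (auto simp: Ck_hoelder_loc_def Let_def Ck_hoelder_basic_def elim: Ck_mono)
    moreover have "frac_lap \<gamma> v = v" using True by (auto simp: frac_lap_def)
    moreover have "ztf 0 \<gamma> \<phi> 0 x = \<phi> x" if "tst 2 \<phi>" for \<phi> :: "'a \<Rightarrow> real" and x
      using hf_FTC[of 0 \<phi> 0 x] that True by (simp add: ztf_def)
    ultimately show ?thesis using True by (simp add: frac_lap_defined_def)
  next
    case False
    then have g0: "0 < \<gamma>" using g by simp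
    obtain \<sigma> where s: "2 * \<gamma> < \<sigma>" "\<sigma> < 2 * \<gamma> + 1" and b: "\<And>bs R. set bs \<subseteq> Basis \<Longrightarrow> length bs \<le> 2 * m \<Longrightarrow>
       \<exists>C\<ge>0. \<forall>x z. norm x \<le> R \<longrightarrow> norm z \<le> 1 \<longrightarrow> \<bar>sd (pdiff bs v) z x\<bar> \<le> C * norm z powr \<sigma>"
      using sd_bound(1)[OF h g0 g(2) e] by blast
    have C: "Ck (2 * m) v" by (rule sd_bound(2)[OF h g0 g(2) e])
    have b0: "\<exists>C\<ge>0. \<forall>x z. norm x \<le> R \<longrightarrow> norm z \<le> 1 \<longrightarrow> \<bar>sd v z x\<bar> \<le> C * norm z powr \<sigma>" for R
      using b[of "[]" R] by simp
    obtain CC where CC: "\<And>z. norm z \<le> 1 \<Longrightarrow> \<bar>sd v z x\<bar> \<le> CC * norm z powr \<sigma>" using b0[of "norm x"] by auto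
    have "frac_lap_defined \<gamma> v x"
      by (rule frac_lap_formula(1)[OF g0 g(2) v _ s CC]) (use Ck_cont[OF C] in \<open>auto intro: borel_measurable_continuous_onI\<close>)
    then show ?thesis
      using C frac_lap_regular[OF g0 g(2) v C s b] weak_frac_lap[OF g0 g(2) v Ck_cont[OF C] s b0] by blast
  qed
  then show "Ck (2 * m) v" "Ck (2 * m) (frac_lap \<gamma> v)" "frac_lap_defined \<gamma> v x" by auto
  assume \<phi>: "tst (2 * Suc m) \<phi>"
  have t: "tst 2 ((neg_lap ^^ m) \<phi>)" by (rule tst_neg_lap_pow) (use \<phi> in simp)
  have "(LINT x|lborel. wlap m \<gamma> v x * \<phi> x) = (LINT x|lborel. frac_lap \<gamma> v x * (neg_lap ^^ m) \<phi> x)"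
    unfolding wlap_def using main \<phi> tst_mono[OF \<phi>, of "2 * m"] by (intro integral_neg_lap_pow) (auto simp: tst_def)
  also have "\<dots> = (LINT x|lborel. v x * ztf 0 \<gamma> ((neg_lap ^^ m) \<phi>) 0 x)" using main t by blast
  also have "ztf 0 \<gamma> ((neg_lap ^^ m) \<phi>) 0 = ztf m \<gamma> \<phi> 0" by (simp add: ztf_def fun_eq_iff)
  finally show "(LINT x|lborel. wlap m \<gamma> v x * \<phi> x) = (LINT x|lborel. v x * ztf m \<gamma> \<phi> 0 x)" .
qed

section \<open>The Riesz kernel\<close>

definition rk :: "real \<Rightarrow> 'a::euclidean_space \<Rightarrow> real" where
  "rk s z = riesz_const DIM('a) s * norm z powr (2 * s - real DIM('a))"

lemma riesz_const_pos: "0 < s \<Longrightarrow> s < real n / 2 \<Longrightarrow> 0 < riesz_const n s"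
  unfolding riesz_const_def by (auto intro!: divide_pos_pos mult_pos_pos Gamma_real_pos)

lemma rk_measurable[measurable]: "rk s \<in> borel_measurable borel"
  unfolding rk_def[abs_def] by measurable

lemma rk_nonneg: "0 < s \<Longrightarrow> s < real DIM('a) / 2 \<Longrightarrow> 0 \<le> rk s (z::'a::euclidean_space)"
  using riesz_const_pos[of s "DIM('a)"] by (simp add: rk_def)

lemma rk_sym: "rk s (x - y) = rk s (y - x)"
  by (simp add: rk_def norm_minus_commute)

lemma rk_eq: "rk s z = riesz_const DIM('a) s * (1 / norm z powr (real DIM('a) - 2 * s))" for z :: "'a::euclidean_space"
  using powr_minus_divide[of "norm z" "real DIM('a) - 2 * s"] by (simp add: rk_def)

text \<open>Subordination of the Riesz kernel with the weight t^(s-1)/Gamma(s); the computation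
  identifies the constant c_{n,s}. Convergence for large t is where s < n/2 enters.\<close>

lemma riesz_time:
  fixes z :: "'a::euclidean_space"
  assumes s: "0 < s" "s < real DIM('a) / 2" and z: "z \<noteq> 0"
  shows "(\<integral>\<^sup>+t. ennreal (t powr (s - 1) / Gamma s * hk t z) \<partial>lpos) = ennreal (rk s z)"
proof -
  define n2 where "n2 = real DIM('a) / 2"
  have G: "0 < Gamma s" "0 < Gamma (n2 - s)" using s by (auto intro!: Gamma_real_pos simp: n2_def)
  have zz: "0 < 0 + (z \<bullet> z) / 4" using z by simp
  have 1: "(\<integral>\<^sup>+t. ennreal (t powr (s - 1) * hk t z) \<partial>lpos) = ennreal ((4 * pi) powr (- n2) * Gamma (n2 - s) * ((z \<bullet> z) / 4) powr (s - n2))"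
    using hk_time_integral[of s 0 z, OF s(2) order_refl zz] by (simp add: n2_def)
  have "((z \<bullet> z) / 4) powr (s - n2) = (z \<bullet> z) powr (s - n2) / 4 powr (s - n2)" by (rule powr_divide)
  also have "(z \<bullet> z) powr (s - n2) = norm z powr (2 * s - real DIM('a))"
  proof -
    have e: "s - n2 = (2 * s - real DIM('a)) / 2" by (simp add: n2_def field_simps)
    show ?thesis unfolding e inner_powr_half ..
  qed
  finally have 2: "((z \<bullet> z) / 4) powr (s - n2) = norm z powr (2 * s - real DIM('a)) / 4 powr (s - n2)" .
  have 3: "(4 * pi) powr (- n2) / 4 powr (s - n2) = 1 / (pi powr n2 * 2 powr (2 * s))"
  proof -
    have a: "(4::real) powr s = 2 powr (2 * s)" using powr_powr[of 2 2 s] by simp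
    have b: "(4 * pi) powr (- n2) = 4 powr (- n2) * pi powr (- n2)" by (rule powr_mult)
    have c: "(4::real) powr (s - n2) = 4 powr s * 4 powr (- n2)" using powr_add[of 4 s "- n2"] by simp
    show ?thesis unfolding b c a powr_minus[of pi] by (simp add: divide_inverse)
  qed
  have k: "0 \<le> 1 / Gamma s" using G by simp
  have "(\<integral>\<^sup>+t. ennreal (t powr (s - 1) / Gamma s * hk t z) \<partial>lpos) = (\<integral>\<^sup>+t. ennreal (1 / Gamma s) * ennreal (t powr (s - 1) * hk t z) \<partial>lpos)"
    unfolding ennreal_mult'[OF k, symmetric] by simp
  also have "\<dots> = ennreal (1 / Gamma s) * (\<integral>\<^sup>+t. ennreal (t powr (s - 1) * hk t z) \<partial>lpos)"
    by (rule nn_integral_cmult) measurable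
  also have "\<dots> = ennreal (1 / Gamma s * ((4 * pi) powr (- n2) * Gamma (n2 - s) * ((z \<bullet> z) / 4) powr (s - n2)))"
    unfolding 1 ennreal_mult'[OF k, symmetric] ..
  also have "1 / Gamma s * ((4 * pi) powr (- n2) * Gamma (n2 - s) * ((z \<bullet> z) / 4) powr (s - n2)) =
     Gamma (n2 - s) / Gamma s * ((4 * pi) powr (- n2) / 4 powr (s - n2)) * norm z powr (2 * s - real DIM('a))"
    unfolding 2 by simp
  also have "\<dots> = rk s z" unfolding 3 rk_def riesz_const_def by (simp add: n2_def)
  finally show ?thesis .
qed

text \<open>The absolute value inside the convolution is needed for Fubini. It is dominated by a
  superposition of Gaussians with density \<open>q\<close> in time, integrable because m + \<gamma>
  > 0, and convolving each with the kernel at time r gives the decay (1 + r)^(-n/2). Since s < n/2,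
  this beats r^(s-1) at infinity.\<close>

lemma ztf_conv_bound:
  fixes \<phi> :: "'a::euclidean_space \<Rightarrow> real"
  assumes \<phi>: "tst (2 * Suc m) \<phi>" and g: "0 \<le> \<gamma>" "\<gamma> < 1" and s: "0 < real m + \<gamma>"
  shows "\<exists>C\<ge>0. \<forall>r>0. \<forall>y. (\<integral>\<^sup>+x. ennreal (\<bar>ztf m \<gamma> \<phi> 0 x\<bar> * hk r (y - x)) \<partial>lborel) \<le> ennreal (C * (1 + r) powr (- (real DIM('a) / 2)))"
proof -
  let ?\<psi> = "(neg_lap ^^ Suc m) \<phi>"
  have [measurable]: "?\<psi> \<in> borel_measurable borel" 
    by (rule tst_meas, rule tst_neg_lap_pow[of 0]) (use \<phi> in simp)
  have G: "0 < Gamma (1 - \<gamma>)" using g by (intro Gamma_real_pos) auto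
  obtain C1 where C1: "C1 \<ge> 0" "\<And>t x. t \<ge> 0 \<Longrightarrow> \<bar>hf ?\<psi> t x\<bar> \<le> C1 * (1 + t) powr (- real (Suc m)) * hk (1 + 2 * t) x"
    using hf_decay[OF \<phi>] by blast
  define q where "q t = C1 / Gamma (1 - \<gamma>) * (t powr (- \<gamma>) * (1 + t) powr (- real (Suc m)))" for t :: real
  have q0: "q t \<ge> 0" for t using C1 G by (simp add: q_def)
  have iq: "integrable lpos q" unfolding q_def[abs_def]
    by (intro integrable_mult_right integrable_lpos_powr) (use g s in auto)
  have [measurable]: "q \<in> borel_measurable borel" unfolding q_def[abs_def] by measurable
  define Q where "Q = (LINT t|lpos. q t)"
  have Q0: "Q \<ge> 0" unfolding Q_def using q0 by (intro integral_nonneg_AE) auto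
  have nQ: "(\<integral>\<^sup>+t. ennreal (q t) \<partial>lpos) = ennreal Q" unfolding Q_def using q0 by (intro nn_integral_eq_integral iq) auto
  have zb: "ennreal \<bar>ztf m \<gamma> \<phi> 0 x\<bar> \<le> (\<integral>\<^sup>+t. ennreal (q t * hk (1 + 2 * t) x) \<partial>lpos)" for x
  proof -
    have "ennreal \<bar>ztf m \<gamma> \<phi> 0 x\<bar> = ennreal (norm (LINT t|lpos. t powr (1 - \<gamma> - 1) * hf ?\<psi> (0 + t) x / Gamma (1 - \<gamma>)))"
      unfolding ztf_def RL_def by (simp del: funpow.simps)
    also have "\<dots> \<le> (\<integral>\<^sup>+t. ennreal (norm (t powr (1 - \<gamma> - 1) * hf ?\<psi> (0 + t) x / Gamma (1 - \<gamma>))) \<partial>lpos)"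
    \<comment> \<open>A non-integrable function has Bochner integral 0, so the inequality holds in
      either case.\<close>
    proof (cases "integrable lpos (\<lambda>t. t powr (1 - \<gamma> - 1) * hf ?\<psi> (0 + t) x / Gamma (1 - \<gamma>))")
      case True then show ?thesis by (rule integral_norm_bound_ennreal)
    next
      case False then show ?thesis unfolding not_integrable_integral_eq[OF False] by simp
    qed
    also have "\<dots> \<le> (\<integral>\<^sup>+t. ennreal (q t * hk (1 + 2 * t) x) \<partial>lpos)"
    proof (intro nn_lpos_mono ennreal_leI)
      fix t :: real assume t: "0 < t"
      have "\<bar>hf ?\<psi> t x\<bar> \<le> C1 * (1 + t) powr (- real (Suc m)) * hk (1 + 2 * t) x" using C1(2)[of t x] t by simp
      from mult_left_mono[OF this, of "t powr (- \<gamma>) / Gamma (1 - \<gamma>)"]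
      show "norm (t powr (1 - \<gamma> - 1) * hf ?\<psi> (0 + t) x / Gamma (1 - \<gamma>)) \<le> q t * hk (1 + 2 * t) x"
        using G by (simp add: q_def abs_mult mult_ac del: funpow.simps of_nat_Suc)
    qed
    finally show ?thesis .
  qed
  show ?thesis
  proof (intro exI[of _ Q] conjI allI impI Q0)
    fix r :: real and y :: 'a assume r: "0 < r"
    have "(\<integral>\<^sup>+x. ennreal (\<bar>ztf m \<gamma> \<phi> 0 x\<bar> * hk r (y - x)) \<partial>lborel) \<le> (\<integral>\<^sup>+x. \<integral>\<^sup>+t. ennreal (q t) * ennreal (hk r (y - x) * hk (1 + 2 * t) x) \<partial>lpos \<partial>lborel)"
    proof (rule nn_integral_mono)
      fix x :: 'a
      have "ennreal (\<bar>ztf m \<gamma> \<phi> 0 x\<bar> * hk r (y - x)) = ennreal \<bar>ztf m \<gamma> \<phi> 0 x\<bar> * ennreal (hk r (y - x))" by (simp add: ennreal_mult)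
      also have "\<dots> \<le> (\<integral>\<^sup>+t. ennreal (q t * hk (1 + 2 * t) x) \<partial>lpos) * ennreal (hk r (y - x))" by (intro mult_right_mono zb) simp
      also have "\<dots> = (\<integral>\<^sup>+t. ennreal (q t * hk (1 + 2 * t) x) * ennreal (hk r (y - x)) \<partial>lpos)" by (rule nn_integral_multc[symmetric]) measurable
      also have "\<dots> = (\<integral>\<^sup>+t. ennreal (q t) * ennreal (hk r (y - x) * hk (1 + 2 * t) x) \<partial>lpos)"
        using q0 by (intro nn_integral_cong) (simp add: ennreal_mult mult_ac)
      finally show "ennreal (\<bar>ztf m \<gamma> \<phi> 0 x\<bar> * hk r (y - x)) \<le> (\<integral>\<^sup>+t. ennreal (q t) * ennreal (hk r (y - x) * hk (1 + 2 * t) x) \<partial>lpos)" .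
    qed
    also have "\<dots> = (\<integral>\<^sup>+t. \<integral>\<^sup>+x. ennreal (q t) * ennreal (hk r (y - x) * hk (1 + 2 * t) x) \<partial>lborel \<partial>lpos)"
      by (rule lborel_lpos.Fubini'[symmetric]) measurable
    also have "\<dots> \<le> (\<integral>\<^sup>+t. ennreal (q t) * ennreal ((1 + r) powr (- (real DIM('a) / 2))) \<partial>lpos)"
    proof (rule nn_lpos_mono)
      fix t :: real assume t: "0 < t"
      have "(\<integral>\<^sup>+x. ennreal (q t) * ennreal (hk r (y - x) * hk (1 + 2 * t) x) \<partial>lborel) = ennreal (q t) * ennreal (hk (r + (1 + 2 * t)) y)"
        using hk_conv_nn[OF r, of "1 + 2 * t" y] t by (subst nn_integral_cmult) auto
      also have "\<dots> \<le> ennreal (q t) * ennreal ((1 + r) powr (- (real DIM('a) / 2)))"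
      proof (intro mult_left_mono ennreal_leI)
        have "hk (r + (1 + 2 * t)) y \<le> (4 * pi * (r + (1 + 2 * t))) powr (- (real DIM('a) / 2))" by (rule hk_le0) (use r t in auto)
        also have "\<dots> \<le> (1 + r) powr (- (real DIM('a) / 2))"
        proof (rule powr_mono2')
          have "1 * (1 + r) \<le> 4 * pi * (r + (1 + 2 * t))" using t r pi_gt3 by (intro mult_mono) auto
          then show "1 + r \<le> 4 * pi * (r + (1 + 2 * t))" by simp
        qed (use r in auto)
        finally show "hk (r + (1 + 2 * t)) y \<le> (1 + r) powr (- (real DIM('a) / 2))" .
      qed simp
      finally show "(\<integral>\<^sup>+x. ennreal (q t) * ennreal (hk r (y - x) * hk (1 + 2 * t) x) \<partial>lborel) \<le> ennreal (q t) * ennreal ((1 + r) powr (- (real DIM('a) / 2)))" .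
    qed
    also have "\<dots> = ennreal Q * ennreal ((1 + r) powr (- (real DIM('a) / 2)))" using nQ by (subst nn_integral_multc) auto
    also have "\<dots> = ennreal (Q * (1 + r) powr (- (real DIM('a) / 2)))" using Q0 by (simp add: ennreal_mult)
    finally show "(\<integral>\<^sup>+x. ennreal (\<bar>ztf m \<gamma> \<phi> 0 x\<bar> * hk r (y - x)) \<partial>lborel) \<le> ennreal (Q * (1 + r) powr (- (real DIM('a) / 2)))" .
  qed
qed

text \<open>The Riesz potential inverts (-\<Delta>)^s on test functions: written as a time integral
  of heat kernels, the convolution becomes \<open>ztf\<close> at time t, and the integral of order s
  of \<open>ztf\<close> is \<phi>. The singular point x = y is a null set.\<close>

lemma riesz_ztf:
  fixes \<phi> :: "'a::euclidean_space \<Rightarrow> real"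
  assumes \<phi>: "tst (2 * Suc m) \<phi>" and g: "0 \<le> \<gamma>" "\<gamma> < 1" and s: "0 < real m + \<gamma>" "real m + \<gamma> < real DIM('a) / 2"
  shows "(LINT x|lborel. ztf m \<gamma> \<phi> 0 x * rk (real m + \<gamma>) (x - y)) = \<phi> y"
proof -
  define s where "s = real m + \<gamma>"
  have s0: "0 < s" "s < real DIM('a) / 2" using s by (auto simp: s_def)
  have G: "0 < Gamma s" using s0 by (intro Gamma_real_pos) auto
  let ?z = "\<lambda>x. ztf m \<gamma> \<phi> 0 x"
  have [measurable]: "?z \<in> borel_measurable borel" using ztf_measurable[OF \<phi>, of "\<lambda>_. 0" borel "\<lambda>x. x"] by simp
  let ?F = "\<lambda>t x. ?z x * (t powr (s - 1) / Gamma s * hk t (y - x))"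
  have mF: "(\<lambda>(t, x). ?F t x) \<in> borel_measurable (lpos \<Otimes>\<^sub>M lborel)" by measurable
  obtain C where C: "C \<ge> 0" "\<And>r y. r > 0 \<Longrightarrow> (\<integral>\<^sup>+x. ennreal (\<bar>?z x\<bar> * hk r (y - x)) \<partial>lborel) \<le> ennreal (C * (1 + r) powr (- (real DIM('a) / 2)))"
    using ztf_conv_bound[OF \<phi> g s(1)] by blast
  have iF: "integrable (lpos \<Otimes>\<^sub>M lborel) (\<lambda>(t, x). ?F t x)"
  proof (subst integrable_iff_bounded, intro conjI mF)
    have "(\<integral>\<^sup>+w. ennreal (norm (case w of (t, x) \<Rightarrow> ?F t x)) \<partial>(lpos \<Otimes>\<^sub>M lborel)) = (\<integral>\<^sup>+t. \<integral>\<^sup>+x. ennreal (norm (?F t x)) \<partial>lborel \<partial>lpos)"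
      using mF by (subst lborel.nn_integral_fst[symmetric]) (auto simp: split_beta')
    also have "\<dots> \<le> (\<integral>\<^sup>+t. ennreal (C / Gamma s * (t powr (s - 1) * (1 + t) powr (- (real DIM('a) / 2)))) \<partial>lpos)"
    proof (rule nn_lpos_mono)
      fix t :: real assume t: "0 < t"
      have "(\<integral>\<^sup>+x. ennreal (norm (?F t x)) \<partial>lborel) = (\<integral>\<^sup>+x. ennreal (t powr (s - 1) / Gamma s) * ennreal (\<bar>?z x\<bar> * hk t (y - x)) \<partial>lborel)"
        using G by (intro nn_integral_cong) (simp add: ennreal_mult[symmetric] abs_mult mult_ac)
      also have "\<dots> = ennreal (t powr (s - 1) / Gamma s) * (\<integral>\<^sup>+x. ennreal (\<bar>?z x\<bar> * hk t (y - x)) \<partial>lborel)"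
        by (rule nn_integral_cmult) measurable
      also have "\<dots> \<le> ennreal (t powr (s - 1) / Gamma s) * ennreal (C * (1 + t) powr (- (real DIM('a) / 2)))"
        by (intro mult_left_mono C(2) t) simp
      also have "\<dots> = ennreal (C / Gamma s * (t powr (s - 1) * (1 + t) powr (- (real DIM('a) / 2))))"
        using C(1) G by (simp add: ennreal_mult[symmetric] mult_ac)
      finally show "(\<integral>\<^sup>+x. ennreal (norm (?F t x)) \<partial>lborel) \<le> ennreal (C / Gamma s * (t powr (s - 1) * (1 + t) powr (- (real DIM('a) / 2))))" .
    qed
    also have "\<dots> = ennreal (LINT t|lpos. C / Gamma s * (t powr (s - 1) * (1 + t) powr (- (real DIM('a) / 2))))"
      using C G s0 by (intro nn_integral_eq_integral integrable_mult_right integrable_lpos_powr) auto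
    finally show "(\<integral>\<^sup>+w. ennreal (norm (case w of (t, x) \<Rightarrow> ?F t x)) \<partial>(lpos \<Otimes>\<^sub>M lborel)) < \<infinity>"
      by (simp add: le_less_trans)
  qed
  have inner: "(LINT t|lpos. ?F t x) = ?z x * rk s (x - y)" if "x \<noteq> y" for x
  proof -
    have "(LINT t|lpos. t powr (s - 1) / Gamma s * hk t (y - x)) = rk s (x - y)"
      using riesz_time[OF s0, of "y - x"] that G rk_nonneg[OF s0, of "y - x"]
      by (subst integral_eq_nn_integral) (auto simp: rk_sym[of s x])
    moreover have "(LINT t|lpos. ?F t x) = ?z x * (LINT t|lpos. t powr (s - 1) / Gamma s * hk t (y - x))"
      by (rule integral_mult_right_zero)
    ultimately show ?thesis by simp
  qed
  have "(LINT x|lborel. ?z x * rk s (x - y)) = (LINT x|lborel. LINT t|lpos. ?F t x)"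
  proof (rule integral_cong_AE)
    show "AE x in lborel. ?z x * rk s (x - y) = (LINT t|lpos. ?F t x)"
      using AE_lborel_singleton[of y] by eventually_elim (rule inner[symmetric])
    show "(\<lambda>x. LINT t|lpos. ?F t x) \<in> borel_measurable lborel"
      by (rule lpos.borel_measurable_lebesgue_integral) measurable
  qed measurable
  also have "\<dots> = (LINT t|lpos. LINT x|lborel. ?F t x)" by (rule lpos_lborel.Fubini_integral[OF iF])
  also have "\<dots> = (LINT t|lpos. t powr (s - 1) * ztf m \<gamma> \<phi> (0 + t) y / Gamma s)"
  proof (rule lpos_cong)
    show "(\<lambda>t. LINT x|lborel. ?F t x) \<in> borel_measurable borel"
      by (rule lborel.borel_measurable_lebesgue_integral) measurable
    show "(\<lambda>t. t powr (s - 1) * ztf m \<gamma> \<phi> (0 + t) y / Gamma s) \<in> borel_measurable borel"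
      using ztf_measurable[OF \<phi>, of "\<lambda>t. 0 + t" borel "\<lambda>x. y"] by simp
    fix t :: real assume t: "0 < t"
    have "(LINT x|lborel. ?F t x) = (LINT x|lborel. (t powr (s - 1) / Gamma s) * (?z x * hk t (y - x)))"
      by (rule Bochner_Integration.integral_cong[OF refl]) (simp only: mult_ac)
    also have "\<dots> = (t powr (s - 1) / Gamma s) * ztf m \<gamma> \<phi> t y" using ztf_conv[OF \<phi> g t, of y] by simp
    finally show "(LINT x|lborel. ?F t x) = t powr (s - 1) * ztf m \<gamma> \<phi> (0 + t) y / Gamma s" by simp
  qed
  also have "\<dots> = RL s (\<lambda>t. ztf m \<gamma> \<phi> t y) 0" by (simp add: RL_def)
  also have "\<dots> = \<phi> y" unfolding s_def using ztf_RL(1)[OF \<phi> g s(1) order_refl, of y] by simp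
  finally show ?thesis by (simp add: s_def)
qed

section \<open>Mollifiers\<close>

text \<open>The type argument carries the dimension, which occurs nowhere else in this real
  number.\<close>

definition bumpI :: "'a::euclidean_space itself \<Rightarrow> nat \<Rightarrow> real" where
  "bumpI _ N = (LINT z|lborel. bump N (z::'a))"

lemma bump_integrable: "0 < N \<Longrightarrow> integrable lborel (bump N :: 'a::euclidean_space \<Rightarrow> real)"
  by (intro bdd_supp_integrable bump_cont bump_supp)

lemma bump_le1: "bump N z \<le> 1"
  unfolding bump_def by (intro power_le_one) auto

lemma bump_0: "1 < norm z \<Longrightarrow> 0 < N \<Longrightarrow> bump N z = 0"
  using power_strict_mono[of 1 "norm z" 2] by (simp add: bump_def dot_square_norm)

lemma bumpI_pos: "0 < N \<Longrightarrow> 0 < bumpI TYPE('a::euclidean_space) N"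
proof -
  assume N: "0 < N"
  have "0 < (3/4) ^ N * measure lborel (cball (0::'a) (1/2))" by simp
  also have "\<dots> = (LINT z|lborel. (3/4) ^ N * indicator (cball 0 (1/2)) (z::'a))" by simp
  also have "\<dots> \<le> bumpI TYPE('a) N" unfolding bumpI_def
  proof (rule integral_mono[OF _ bump_integrable[OF N]])
    show "integrable lborel (\<lambda>z::'a. (3/4::real) ^ N * indicator (cball 0 (1/2)) z)"
      by (intro integrable_mult_right integrable_indicator_cball)
    fix z :: 'a
    show "(3/4) ^ N * indicator (cball 0 (1/2)) z \<le> bump N z"
    proof (cases "norm z \<le> 1/2")
      case True
      then have "z \<bullet> z \<le> (1/2)\<^sup>2" by (rule inner_le_R)
      then have k: "3/4 \<le> max 0 (1 - z \<bullet> z)" by (simp add: power2_eq_square)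
      have "(3/4) ^ N \<le> (max 0 (1 - z \<bullet> z)) ^ N" by (rule power_mono[OF k]) simp
      then show ?thesis using True by (simp add: bump_def)
    qed simp
  qed
  finally show ?thesis .
qed

definition mol :: "nat \<Rightarrow> real \<Rightarrow> 'a::euclidean_space \<Rightarrow> real" where
  "mol N d z = (1 / (d ^ DIM('a) * bumpI TYPE('a) N)) * bump N (0 + (1 / d) *\<^sub>R z)"

lemma mol_nonneg: "0 < d \<Longrightarrow> 0 < N \<Longrightarrow> 0 \<le> mol N d (z::'a::euclidean_space)"
  using bumpI_pos[of N, where ?'a='a] by (simp add: mol_def)

lemma mol_even[simp]: "mol N d (- z) = mol N d z"
  by (simp add: mol_def)

lemma mol_0: "0 < d \<Longrightarrow> 0 < N \<Longrightarrow> d < norm z \<Longrightarrow> mol N d z = 0"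
  using bump_0[of "(1/d) *\<^sub>R z" N] by (simp add: mol_def field_simps)

lemma mol_tst: "0 < d \<Longrightarrow> k < N \<Longrightarrow> tst k (mol N d :: 'a::euclidean_space \<Rightarrow> real)"
proof -
  assume d: "0 < d" and k: "k < N"
  have "Ck k (mol N d :: 'a \<Rightarrow> real)" unfolding mol_def[abs_def] by (intro Ck_cmult Ck_affine bump_Ck k)
  moreover have "bdd_supp (mol N d :: 'a \<Rightarrow> real)" unfolding bdd_supp_def using mol_0[OF d, of N] k by (intro exI[of _ d]) auto
  ultimately show ?thesis by (simp add: tst_def)
qed

lemma mol_measurable[measurable]: "mol N d \<in> borel_measurable borel"
  unfolding mol_def[abs_def] by measurable

lemma mol_integral_scaled:
  fixes G :: "'a::euclidean_space \<Rightarrow> real"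
  assumes [measurable]: "G \<in> borel_measurable borel" and d: "0 < d"
  shows "(LINT y|lborel. G y * mol N d (y - x)) = (LINT w|lborel. G (x + d *\<^sub>R w) * bump N w) / bumpI TYPE('a) N"
proof -
  have "(LINT y|lborel. G y * mol N d (y - x)) = \<bar>d\<bar> ^ DIM('a) * (LINT w|lborel. G (x + d *\<^sub>R w) * mol N d (x + d *\<^sub>R w - x))"
    by (rule integral_affine) (use d in auto)
  also have "\<dots> = \<bar>d\<bar> ^ DIM('a) * (LINT w|lborel. (1 / (d ^ DIM('a) * bumpI TYPE('a) N)) * (G (x + d *\<^sub>R w) * bump N w))"
    using d by (simp add: mol_def mult_ac)
  also have "\<dots> = (LINT w|lborel. G (x + d *\<^sub>R w) * bump N w) / bumpI TYPE('a) N"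
    using d by simp
  finally show ?thesis .
qed

lemma mol_integral: "0 < d \<Longrightarrow> 0 < N \<Longrightarrow> (LINT y|lborel. mol N d (y::'a::euclidean_space)) = 1"
  using mol_integral_scaled[of "\<lambda>_::'a. 1" d N 0] bumpI_pos[of N, where ?'a='a] by (simp add: bumpI_def)

lemma mol_tendsto:
  fixes G :: "'a::euclidean_space \<Rightarrow> real"
  assumes c: "continuous_on UNIV G" and N: "0 < N"
  shows "(\<lambda>k. LINT y|lborel. G y * mol N (inverse (real (Suc k))) (y - x)) \<longlonglongrightarrow> G x"
proof -
  have [measurable]: "G \<in> borel_measurable borel" using c by (rule borel_measurable_continuous_onI)
  define d where "d k = inverse (real (Suc k))" for k
  have d: "0 < d k" "d k \<le> 1" for k by (auto simp: d_def field_simps)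
  have d0: "d \<longlonglongrightarrow> 0" unfolding d_def by (rule LIMSEQ_inverse_real_of_nat)
  obtain V where V: "V \<ge> 0" "\<And>y. norm y \<le> norm x + 1 \<Longrightarrow> \<bar>G y\<bar> \<le> V" using bounded_on_cball[OF c] by blast
  have B: "0 < bumpI TYPE('a) N" by (rule bumpI_pos[OF N])
  have "(\<lambda>k. LINT w|lborel. G (x + d k *\<^sub>R w) * bump N w) \<longlonglongrightarrow> (LINT w|lborel. G x * bump N (w::'a))"
  proof (rule integral_dominated_convergence[where w="\<lambda>w. V * bump N w"])
    show "integrable lborel (\<lambda>w::'a. V * bump N w)" by (intro integrable_mult_right bump_integrable N)
    show "AE w in lborel. (\<lambda>k. G (x + d k *\<^sub>R w) * bump N w) \<longlonglongrightarrow> G x * bump N (w::'a)"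
    proof (rule AE_I2)
      fix w :: 'a
      have "(\<lambda>k. x + d k *\<^sub>R w) \<longlonglongrightarrow> x + 0 *\<^sub>R w" by (intro tendsto_intros d0)
      then have "(\<lambda>k. G (x + d k *\<^sub>R w)) \<longlonglongrightarrow> G x"
        using c by (auto simp: continuous_on_sequentially o_def)
      then show "(\<lambda>k. G (x + d k *\<^sub>R w) * bump N w) \<longlonglongrightarrow> G x * bump N w" by (intro tendsto_mult) auto
    qed
    show "AE w in lborel. norm (G (x + d k *\<^sub>R w) * bump N w) \<le> V * bump N (w::'a)" for k
    proof (rule AE_I2)
      fix w :: 'a
      show "norm (G (x + d k *\<^sub>R w) * bump N w) \<le> V * bump N w"
      proof (cases "norm w \<le> 1")
        case True
        have "norm (d k *\<^sub>R w) \<le> 1" using True d[of k] by (simp add: mult_le_one)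
        then have "\<bar>G (x + d k *\<^sub>R w)\<bar> \<le> V" using norm_triangle_ineq[of x "d k *\<^sub>R w"] by (intro V(2)) linarith
        then show ?thesis by (simp add: abs_mult mult_right_mono)
      qed (use bump_0[of w N] N in auto)
    qed
  qed measurable
  then have "(\<lambda>k. (LINT w|lborel. G (x + d k *\<^sub>R w) * bump N w) / bumpI TYPE('a) N) \<longlonglongrightarrow> (LINT w|lborel. G x * bump N (w::'a)) / bumpI TYPE('a) N"
    using B by (intro tendsto_divide) auto
  moreover have "(LINT w|lborel. G x * bump N (w::'a)) / bumpI TYPE('a) N = G x" using B by (simp add: bumpI_def)
  moreover have "(LINT y|lborel. G y * mol N (d k) (y - x)) = (LINT w|lborel. G (x + d k *\<^sub>R w) * bump N w) / bumpI TYPE('a) N" for k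
    by (rule mol_integral_scaled) (use d in auto)
  ultimately show ?thesis by (simp add: d_def)
qed

section \<open>From the integral equation to the differential equation\<close>

text \<open>Pairing v with (-\<Delta>)^s \<phi> and exchanging integrals reduces the claim to
  \<open>riesz_ztf\<close>. Because F \<ge> 0, the inner integral of the absolute value is
  |(-\<Delta>)^s \<phi>| times v itself, so v in \<open>Ls_space\<close> is all that Fubini asks
  for; no growth bound on F enters. Both sides of the weak identity being continuous, mollifiers
  give equality at points.\<close>

lemma solution_of_integral:
  fixes v F :: "'a::euclidean_space \<Rightarrow> real"
  assumes g: "0 \<le> \<gamma>" "\<gamma> < 1" and s: "0 < real m + \<gamma>" "real m + \<gamma> < real DIM('a) / 2" and v: "v \<in> Ls_space \<gamma>"
    and h: "Ck_hoelder_loc (2 * m + nat \<lfloor>2 * \<gamma>\<rfloor>) (2 * \<gamma> - of_int \<lfloor>2 * \<gamma>\<rfloor> + \<epsilon>) v" and e: "0 < \<epsilon>"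
    and F: "continuous_on UNIV F" "\<And>y. 0 \<le> F y" 
    and iF: "\<And>x. integrable lborel (\<lambda>y. F y / norm (x - y) powr (real DIM('a) - 2 * (real m + \<gamma>)))"
    and vF: "\<And>x. v x = riesz_const DIM('a) (real m + \<gamma>) * (LINT y|lborel. F y / norm (x - y) powr (real DIM('a) - 2 * (real m + \<gamma>)))"
  shows "strong_solution m \<gamma> v F"
proof -
  define s where "s = real m + \<gamma>"
  have s0: "0 < s" "s < real DIM('a) / 2" using s by (auto simp: s_def)
  note R = strong_regularity[OF g v h e]
  have cv: "continuous_on UNIV v" by (rule Ck_cont[OF R(1)])
  have [measurable]: "v \<in> borel_measurable borel" using cv by (rule borel_measurable_continuous_onI)
  have [measurable]: "F \<in> borel_measurable borel" using F(1) by (rule borel_measurable_continuous_onI)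
  have iv: "integrable lborel (\<lambda>y. \<bar>v y\<bar> * wt (real DIM('a) + 2 * \<gamma>) y)" using Ls_integrable[OF v] g by simp
  have rkF: "F y * rk s (x - y) = riesz_const DIM('a) s * (F y / norm (x - y) powr (real DIM('a) - 2 * s))" for x y
    by (simp add: rk_eq)
  have iR: "integrable lborel (\<lambda>y. F y * rk s (x - y))" for x
    unfolding rkF using iF[of x] by (intro integrable_mult_right) (simp add: s_def)
  have vR: "v x = (LINT y|lborel. F y * rk s (x - y))" for x
    unfolding rkF integral_mult_right_zero using vF[of x] by (simp only: s_def)
  have nR: "(\<integral>\<^sup>+y. ennreal (F y * rk s (x - y)) \<partial>lborel) = ennreal (v x)" for x
    unfolding vR using F(2) rk_nonneg[OF s0] by (intro nn_integral_eq_integral iR) (auto intro!: AE_I2 mult_nonneg_nonneg)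
  have v0: "0 \<le> v x" for x unfolding vR using F(2) rk_nonneg[OF s0] by (intro integral_nonneg_AE AE_I2) (auto intro!: mult_nonneg_nonneg)
  have weak: "(LINT x|lborel. wlap m \<gamma> v x * \<phi> x) = (LINT x|lborel. F x * \<phi> x)" if \<phi>: "tst (2 * Suc m) \<phi>" for \<phi>
  proof -
    let ?z = "\<lambda>x. ztf m \<gamma> \<phi> 0 x"
    have [measurable]: "?z \<in> borel_measurable borel" using ztf_measurable[OF \<phi>, of "\<lambda>_. 0" borel "\<lambda>x. x"] by simp
    obtain C where C: "C \<ge> 0" "\<And>x. \<bar>?z x\<bar> \<le> C * wt (real DIM('a) + 2 * \<gamma>) x"
      using ztf_bound_space[OF \<phi> g] by (auto simp: wt_def add_divide_distrib)
    let ?H = "\<lambda>x y. ?z x * (F y * rk s (x - y))"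
    have mH: "(\<lambda>(x, y). ?H x y) \<in> borel_measurable (lborel \<Otimes>\<^sub>M lborel)" by measurable
    have iH: "integrable (lborel \<Otimes>\<^sub>M lborel) (\<lambda>(x, y). ?H x y)"
    proof (subst integrable_iff_bounded, intro conjI mH)
      have "(\<integral>\<^sup>+w. ennreal (norm (case w of (x, y) \<Rightarrow> ?H x y)) \<partial>(lborel \<Otimes>\<^sub>M lborel)) = (\<integral>\<^sup>+x. \<integral>\<^sup>+y. ennreal (norm (?H x y)) \<partial>lborel \<partial>lborel)"
        using mH by (subst lborel.nn_integral_fst[symmetric]) (auto simp: split_beta')
      also have "\<dots> \<le> (\<integral>\<^sup>+x. ennreal (C * (\<bar>v x\<bar> * wt (real DIM('a) + 2 * \<gamma>) x)) \<partial>lborel)"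
      proof (rule nn_integral_mono)
        fix x :: 'a
        have "(\<integral>\<^sup>+y. ennreal (norm (?H x y)) \<partial>lborel) = (\<integral>\<^sup>+y. ennreal \<bar>?z x\<bar> * ennreal (F y * rk s (x - y)) \<partial>lborel)"
          using F(2) rk_nonneg[OF s0] by (intro nn_integral_cong) (simp add: ennreal_mult[symmetric] abs_mult)
        also have "\<dots> = ennreal \<bar>?z x\<bar> * ennreal (v x)" unfolding nR[symmetric] by (rule nn_integral_cmult) measurable
        also have "\<dots> = ennreal (\<bar>?z x\<bar> * v x)" using v0 by (simp add: ennreal_mult)
        also have "\<dots> \<le> ennreal (C * (\<bar>v x\<bar> * wt (real DIM('a) + 2 * \<gamma>) x))"
          using mult_right_mono[OF C(2)[of x] v0[of x]] v0[of x] by (intro ennreal_leI) (simp add: mult_ac)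
        finally show "(\<integral>\<^sup>+y. ennreal (norm (?H x y)) \<partial>lborel) \<le> ennreal (C * (\<bar>v x\<bar> * wt (real DIM('a) + 2 * \<gamma>) x))" .
      qed
      also have "\<dots> = ennreal (LINT x|lborel. C * (\<bar>v x\<bar> * wt (real DIM('a) + 2 * \<gamma>) x))"
        using iv C by (intro nn_integral_eq_integral) auto
      finally show "(\<integral>\<^sup>+w. ennreal (norm (case w of (x, y) \<Rightarrow> ?H x y)) \<partial>(lborel \<Otimes>\<^sub>M lborel)) < \<infinity>"
        by (simp add: le_less_trans)
    qed
    have "(LINT x|lborel. v x * ?z x) = (LINT x|lborel. LINT y|lborel. ?H x y)"
      by (rule Bochner_Integration.integral_cong[OF refl]) (simp add: vR mult.commute)
    also have "\<dots> = (LINT y|lborel. LINT x|lborel. ?H x y)" by (rule lborel_pair.Fubini_integral[OF iH, symmetric])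
    also have "\<dots> = (LINT y|lborel. F y * \<phi> y)"
    proof (rule Bochner_Integration.integral_cong[OF refl])
      fix y :: 'a
      have "(LINT x|lborel. ?H x y) = (LINT x|lborel. F y * (?z x * rk s (x - y)))"
        by (rule Bochner_Integration.integral_cong[OF refl]) (simp only: mult_ac)
      also have "\<dots> = F y * \<phi> y" using riesz_ztf[OF \<phi> g s, of y] by (simp add: s_def)
      finally show "(LINT x|lborel. ?H x y) = F y * \<phi> y" .
    qed
    finally show ?thesis using R(4)[OF \<phi>] by simp
  qed
  have cw: "continuous_on UNIV (wlap m \<gamma> v)" unfolding wlap_def by (rule Ck_cont[OF Ck_neg_lap_pow[of 0]]) (use R(2) in simp)
  have wF: "wlap m \<gamma> v x = F x" for x
  proof -
    \<comment> \<open>The mollifiers must be test functions of order 2(m + 1), and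
      \<open>bump N\<close> is only of class C^k for k < N.\<close>
    define N where "N = 2 * Suc m + 1"
    have "(\<lambda>k. LINT y|lborel. wlap m \<gamma> v y * mol N (inverse (real (Suc k))) (y - x)) \<longlonglongrightarrow> wlap m \<gamma> v x"
      by (rule mol_tendsto[OF cw]) (simp add: N_def)
    moreover have "(\<lambda>k. LINT y|lborel. F y * mol N (inverse (real (Suc k))) (y - x)) \<longlonglongrightarrow> F x"
      by (rule mol_tendsto[OF F(1)]) (simp add: N_def)
    moreover have "(LINT y|lborel. wlap m \<gamma> v y * mol N (inverse (real (Suc k))) (y - x)) = (LINT y|lborel. F y * mol N (inverse (real (Suc k))) (y - x))" for k
    proof (rule weak)
      have "tst (2 * Suc m) (mol N (inverse (real (Suc k))) :: 'a \<Rightarrow> real)" by (rule mol_tst) (auto simp: N_def)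
      then show "tst (2 * Suc m) (\<lambda>y. mol N (inverse (real (Suc k))) (y - x))"
        unfolding tst_def using Ck_translate[of _ _ "- x"] bdd_supp_translate[of _ "- x"] by auto
    qed
    ultimately show ?thesis using LIMSEQ_unique by (simp only:) blast
  qed
  show ?thesis unfolding strong_solution_def
  proof (intro conjI allI impI v)
    show "\<exists>\<epsilon>'>0. Ck_hoelder_loc (2 * m + nat \<lfloor>2 * \<gamma>\<rfloor>) (2 * \<gamma> - of_int \<lfloor>2 * \<gamma>\<rfloor> + \<epsilon>') v" using h e by blast
    show "frac_lap_defined \<gamma> v x" for x by (rule R(3))
    show "continuous_on UNIV ((neg_lap ^^ m) (frac_lap \<gamma> v))" using cw by (simp add: wlap_def)
    show "(neg_lap ^^ m) (frac_lap \<gamma> v) x = F x" for x using wF by (simp add: wlap_def)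
    fix k x assume k: "k < m"
    have "Ck (Suc (Suc 0)) ((neg_lap ^^ k) (frac_lap \<gamma> v))"
      by (rule Ck_neg_lap_pow) (use Ck_mono[OF R(2)] k in auto)
    then show "lap_defined ((neg_lap ^^ k) (frac_lap \<gamma> v)) x" by (rule lap_defined_Ck)
  qed
qed

section \<open>The bubble kernel\<close>

text \<open>Density of the inverse Gamma distribution with shape s and scale R.\<close>

definition kb :: "real \<Rightarrow> real \<Rightarrow> real \<Rightarrow> real" where
  "kb s R q = R powr s / Gamma s * (q powr (- s - 1) * exp (- (R / q)))"

lemma kb_measurable[measurable]: "kb s R \<in> borel_measurable borel"
  unfolding kb_def[abs_def] by measurable

lemma kb_nonneg: "0 < s \<Longrightarrow> 0 \<le> kb s R q"
  unfolding kb_def using Gamma_real_pos[of s] by simp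

text \<open>The substitution \<open>r = 1 / (p + 1 / u)\<close> turns this convolution into a Gamma integral.\<close>

lemma kb_conv:
  assumes s: "0 < s" and R: "0 < R" and u: "0 < (u::real)"
  shows "(\<integral>\<^sup>+r. ennreal (kb s R r * (u - r) powr (s - 1) * indicator {..<u} r) \<partial>lpos) = ennreal (u powr (s - 1) * exp (- (R / u)))"
proof (rule nn_lpos_inverse)
  have G: "0 < Gamma s" using s by (rule Gamma_real_pos)
  show "(\<lambda>r. kb s R r * (u - r) powr (s - 1) * indicator {..<u} r) \<in> borel_measurable borel" by measurable
  show "0 \<le> kb s R t * (u - t) powr (s - 1) * indicator {..<u} t" for t using kb_nonneg[OF s] by simp
  show "0 \<le> u powr (s - 1) * exp (- (R / u))" by simp
  define c where "c = R powr s / Gamma s * exp (- (R / u)) * u powr (s - 1)"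
  have c: "0 \<le> c" using G by (simp add: c_def)
  let ?f = "\<lambda>t. ennreal (c * (t powr (s - 1) * exp (- R * t)))"
  have "(\<integral>\<^sup>+t. ennreal (kb s R (1 / t) * (u - 1 / t) powr (s - 1) * indicator {..<u} (1 / t) / t\<^sup>2) \<partial>lpos) = (\<integral>\<^sup>+p. ?f (p - 1 / u) * indicator {1 / u<..} p \<partial>lpos)"
  proof (rule nn_lpos_cong)
    fix p :: real assume p: "0 < p"
    show "ennreal (kb s R (1 / p) * (u - 1 / p) powr (s - 1) * indicator {..<u} (1 / p) / p\<^sup>2) = ?f (p - 1 / u) * indicator {1 / u<..} p"
    proof (cases "1 / u < p")
      case True
      then have T: "1 / p < u" using p u by (simp add: field_simps)
      have e1: "(1 / p) powr (- s - 1) = p powr (s + 1)" using p by (simp add: powr_divide divide_eq_eq powr_add[symmetric])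
      have e2: "p powr (s + 1) = p\<^sup>2 * p powr (s - 1)" using p by (simp add: powr_add[symmetric] add.commute flip: powr_numeral)
      have e3: "p powr (s - 1) * (u - 1 / p) powr (s - 1) = u powr (s - 1) * (p - 1 / u) powr (s - 1)"
      proof -
        have "p * (u - 1 / p) = u * (p - 1 / u)" using p u by (simp add: field_simps)
        then show ?thesis unfolding powr_mult[symmetric] by simp
      qed
      have e4: "exp (- (R / (1 / p))) = exp (- (R / u)) * exp (- R * (p - 1 / u))" using p u by (simp add: exp_add[symmetric] algebra_simps)
      have "kb s R (1 / p) * (u - 1 / p) powr (s - 1) / p\<^sup>2 = R powr s / Gamma s * ((p\<^sup>2 * p powr (s - 1)) * (exp (- (R / u)) * exp (- R * (p - 1 / u)))) * (u - 1 / p) powr (s - 1) / p\<^sup>2"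
        unfolding kb_def e1 e2 e4 ..
      also have "\<dots> = R powr s / Gamma s * exp (- (R / u)) * (p powr (s - 1) * (u - 1 / p) powr (s - 1)) * exp (- R * (p - 1 / u))"
        using p by simp
      also have "\<dots> = c * ((p - 1 / u) powr (s - 1) * exp (- R * (p - 1 / u)))" unfolding e3 c_def by (simp only: mult_ac)
      finally show ?thesis using True T by simp
    next
      case False
      then have "\<not> 1 / p < u" using p u by (simp add: field_simps)
      then show ?thesis using False by simp
    qed
  qed
  also have "\<dots> = (\<integral>\<^sup>+t. ?f t \<partial>lpos)" by (rule nn_lpos_shift[symmetric]) (use u in auto)
  also have "\<dots> = ennreal c * (\<integral>\<^sup>+t. ennreal (t powr (s - 1) * exp (- R * t)) \<partial>lpos)"
    unfolding ennreal_mult'[OF c] by (rule nn_integral_cmult) measurable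
  also have "\<dots> = ennreal (c * (Gamma s * R powr (- s)))"
    unfolding nn_lpos_Gamma[OF s R] ennreal_mult'[OF c] ..
  also have "c * (Gamma s * R powr (- s)) = u powr (s - 1) * exp (- (R / u)) * (R powr s * R powr (- s))"
    using G by (simp add: c_def)
  also have "R powr s * R powr (- s) = 1" using R by (simp add: powr_add[symmetric])
  finally show "(\<integral>\<^sup>+t. ennreal (kb s R (1 / t) * (u - 1 / t) powr (s - 1) * indicator {..<u} (1 / t) / t\<^sup>2) \<partial>lpos) = ennreal (u powr (s - 1) * exp (- (R / u)))"
    by simp
qed

text \<open>The weight \<open>t powr (s - 1)\<close> of the Riesz potential, tempered at infinity. Subtracting the convolution with the
  probability density \<open>kb s R\<close> in time is exactly what makes it integrable against functions decaying like \<open>t powr (- m)\<close>.\<close>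

definition aR :: "real \<Rightarrow> real \<Rightarrow> real \<Rightarrow> real" where
  "aR s R t = t powr (s - 1) * (1 - exp (- (R / t))) / Gamma s"

lemma aR_measurable[measurable]: "aR s R \<in> borel_measurable borel"
  unfolding aR_def[abs_def] by measurable

lemma aR_nonneg: "0 < s \<Longrightarrow> 0 < R \<Longrightarrow> 0 < t \<Longrightarrow> 0 \<le> aR s R t"
  unfolding aR_def using Gamma_real_pos[of s] by simp

lemma aR_integrable:
  assumes s: "0 < real m + \<gamma>" and g: "\<gamma> < 1" and R: "0 < R"
  shows "integrable lpos (\<lambda>t. aR (real m + \<gamma>) R t * (1 + t) powr (- real m))"
proof (rule integrable_lpos_bound)
  let ?s = "real m + \<gamma>"
  have G: "0 < Gamma ?s" using s by (rule Gamma_real_pos)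
  show "integrable lpos (\<lambda>t. (2 * max 1 R / Gamma ?s) * (t powr (?s - 1) * (1 + t) powr (- real (Suc m))))"
    by (intro integrable_mult_right integrable_lpos_powr) (use s g in auto)
  fix t :: real assume t: "0 < t"
  \<comment> \<open>One bound for both ranges: for t \<le> 1 the left side is at most 1, for t > 1
    at most R/t. The gain of 1/(1 + t) turns the exponent \<gamma> - 1 at infinity into \<gamma> - 2
    < -1.\<close>
  have e: "1 - exp (- (R / t)) \<le> 2 * max 1 R / (1 + t)"
  proof (cases "t \<le> 1")
    case True
    have "1 - exp (- (R / t)) \<le> 1" by simp
    also have "1 \<le> 2 * max 1 R / (1 + t)" using True t by (simp add: field_simps)
    finally show ?thesis .
  next
    case False
    have "1 - exp (- (R / t)) \<le> R / t" using exp_ge_add_one_self[of "- (R / t)"] by simp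
    also have "R / t \<le> 2 * max 1 R / (1 + t)"
    proof -
      have "R * (1 + t) \<le> max 1 R * (2 * t)" using False R t by (intro mult_mono) auto
      then show ?thesis using t by (simp add: field_simps)
    qed
    finally show ?thesis .
  qed
  have p: "(1 + t) powr (- real (Suc m)) = (1 + t) powr (- real m) / (1 + t)"
  proof -
    have e: "- real (Suc m) = - real m - 1" by simp
    show ?thesis unfolding e using t powr_diff[of "1 + t" "- real m" 1] by simp
  qed
  have "aR ?s R t * (1 + t) powr (- real m) = (t powr (?s - 1) / Gamma ?s * (1 + t) powr (- real m)) * (1 - exp (- (R / t)))"
    by (simp add: aR_def)
  also have "\<dots> \<le> (t powr (?s - 1) / Gamma ?s * (1 + t) powr (- real m)) * (2 * max 1 R / (1 + t))"
    using e G by (intro mult_left_mono) auto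
  also have "\<dots> = (2 * max 1 R / Gamma ?s) * (t powr (?s - 1) * (1 + t) powr (- real (Suc m)))"
    unfolding p by simp
  finally show "\<bar>aR ?s R t * (1 + t) powr (- real m)\<bar> \<le> (2 * max 1 R / Gamma ?s) * (t powr (?s - 1) * (1 + t) powr (- real (Suc m)))"
    using aR_nonneg[OF s R t] by (simp add: abs_mult)
qed measurable

text \<open>The heat flow of a profile averaged over an inverse Gamma time, that is, the convolution
  of the profile with the bubble kernel \<open>kap\<close>.\<close>

definition kh :: "real \<Rightarrow> real \<Rightarrow> ('a::euclidean_space \<Rightarrow> real) \<Rightarrow> 'a \<Rightarrow> real" where
  "kh s R \<eta> w = (LINT q|lpos. kb s R q * hf \<eta> q w)"

text \<open>By \<open>kb_conv\<close> the part t^(s-1) exp(-R/t) of the weight is the convolution of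
  \<open>kb\<close> with t^(s-1). Integrating \<open>ztf\<close> against t^(s-1)/Gamma(s) from time
  r on gives the heat flow at time r; the two parts of the weight thus give \<eta> itself and its
  average over times distributed by \<open>kb\<close>.\<close>

lemma aR_ztf:
  fixes \<eta> :: "'a::euclidean_space \<Rightarrow> real"
  assumes \<eta>: "tst (2 * Suc m) \<eta>" and g: "0 \<le> \<gamma>" "\<gamma> < 1" and s: "0 < real m + \<gamma>" and R: "0 < R"
  shows "(LINT t|lpos. aR (real m + \<gamma>) R t * ztf m \<gamma> \<eta> t w) = \<eta> w - kh (real m + \<gamma>) R \<eta> w"
proof -
  let ?s = "real m + \<gamma>"
  have G: "0 < Gamma ?s" using s by (rule Gamma_real_pos)
  have [measurable]: "\<eta> \<in> borel_measurable borel" using \<eta> by (rule tst_meas)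
  have mz[measurable]: "(\<lambda>t. ztf m \<gamma> \<eta> t w) \<in> borel_measurable borel"
    using ztf_measurable[OF \<eta>, of "\<lambda>t. t" borel "\<lambda>x. w"] by simp
  have i0: "integrable lpos (\<lambda>t. t powr (?s - 1) * ztf m \<gamma> \<eta> t w)"
    using ztf_RL(2)[OF \<eta> g s order_refl, of w] by simp
  have iW: "integrable lpos (\<lambda>u. (u powr (?s - 1) * exp (- (R / u))) * ztf m \<gamma> \<eta> u w)"
  proof (rule integrable_lpos_bound[OF integrable_abs[OF i0]])
    fix t :: real assume t: "0 < t"
    then have "exp (- (R / t)) \<le> 1" using R by simp
    from mult_left_mono[OF this, of "\<bar>t powr (?s - 1) * ztf m \<gamma> \<eta> t w\<bar>"]
    show "\<bar>t powr (?s - 1) * exp (- (R / t)) * ztf m \<gamma> \<eta> t w\<bar> \<le> \<bar>t powr (?s - 1) * ztf m \<gamma> \<eta> t w\<bar>"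
      by (simp add: abs_mult mult_ac)
  qed measurable
  have r0: "(LINT t|lpos. t powr (?s - 1) * ztf m \<gamma> \<eta> (r + t) w) = Gamma ?s * hf \<eta> r w" if "0 \<le> r" for r
    using ztf_RL(1)[OF \<eta> g s that, of w] G by (auto simp: RL_def divide_eq_eq mult.commute)
  have "(LINT r|lpos. kb ?s R r * (LINT t|lpos. t powr (?s - 1) * ztf m \<gamma> \<eta> (r + t) w)) = (LINT u|lpos. (u powr (?s - 1) * exp (- (R / u))) * ztf m \<gamma> \<eta> u w)"
    by (rule conv_lpos(1)[where g="kb ?s R" and h="\<lambda>t. t powr (?s - 1)" and \<psi>="\<lambda>t. ztf m \<gamma> \<eta> t w" and W="\<lambda>u. u powr (?s - 1) * exp (- (R / u))", OF _ _ _ _ _ _ _ kb_conv[OF s R] iW])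
       (auto simp: kb_nonneg[OF s])
  moreover have "(LINT r|lpos. kb ?s R r * (LINT t|lpos. t powr (?s - 1) * ztf m \<gamma> \<eta> (r + t) w)) = (LINT r|lpos. Gamma ?s * (kb ?s R r * hf \<eta> r w))"
  proof (rule lpos_cong)
    have "(\<lambda>r. LINT t|lpos. t powr (?s - 1) * ztf m \<gamma> \<eta> (r + t) w) \<in> borel_measurable borel"
      by (rule lpos.borel_measurable_lebesgue_integral) (use ztf_measurable[OF \<eta>, of "\<lambda>p. fst p + snd p" "borel \<Otimes>\<^sub>M lpos" "\<lambda>x. w"] in simp)
    then show "(\<lambda>r. kb ?s R r * (LINT t|lpos. t powr (?s - 1) * ztf m \<gamma> \<eta> (r + t) w)) \<in> borel_measurable borel" by measurable
  qed (use r0 in \<open>auto simp: mult_ac\<close>)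
  moreover have "\<dots> = Gamma ?s * kh ?s R \<eta> w" unfolding kh_def by (rule integral_mult_right_zero)
  ultimately have 1: "(LINT u|lpos. (u powr (?s - 1) * exp (- (R / u))) * ztf m \<gamma> \<eta> u w) = Gamma ?s * kh ?s R \<eta> w" by simp
  have "(LINT t|lpos. aR ?s R t * ztf m \<gamma> \<eta> t w) = (LINT t|lpos. (t powr (?s - 1) * ztf m \<gamma> \<eta> t w - (t powr (?s - 1) * exp (- (R / t))) * ztf m \<gamma> \<eta> t w) / Gamma ?s)"
    by (rule Bochner_Integration.integral_cong[OF refl]) (simp add: aR_def algebra_simps diff_divide_distrib)
  also have "\<dots> = ((LINT t|lpos. t powr (?s - 1) * ztf m \<gamma> \<eta> t w) - (LINT t|lpos. (t powr (?s - 1) * exp (- (R / t))) * ztf m \<gamma> \<eta> t w)) / Gamma ?s"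
    by (subst Bochner_Integration.integral_diff[OF i0 iW, symmetric]) (rule integral_divide_zero)
  also have "\<dots> = \<eta> w - kh ?s R \<eta> w" unfolding 1 using r0[of 0] G by (simp add: field_simps)
  finally show ?thesis .
qed

text \<open>With y = 2 sqrt R this is the normalised kernel y^(2s) / (|z|^2 + y^2)^(n/2+s), known
  for 0 < s < 1 as the Poisson kernel of the fractional extension problem. It has mass one, and R
  only sets its width.\<close>

definition kap :: "real \<Rightarrow> real \<Rightarrow> 'a::euclidean_space \<Rightarrow> real" where
  "kap s R z = R powr s / Gamma s * ((4 * pi) powr (- (real DIM('a) / 2)) * Gamma (real DIM('a) / 2 + s)) * (R + (z \<bullet> z) / 4) powr (- (real DIM('a) / 2 + s))"

lemma kap_nonneg: "0 < s \<Longrightarrow> 0 \<le> kap s R (z::'a::euclidean_space)"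
  unfolding kap_def using Gamma_real_pos[of s] Gamma_real_pos[of "real DIM('a) / 2 + s"] by (simp add: add_nonneg_pos)

lemma kap_cont: "0 < R \<Longrightarrow> continuous_on UNIV (kap s R :: 'a::euclidean_space \<Rightarrow> real)"
proof -
  assume R: "0 < R"
  have "0 < R + (z \<bullet> z) / 4" for z :: 'a using R by (intro add_pos_nonneg) auto
  then have "R + (z \<bullet> z) / 4 \<noteq> 0" for z :: 'a by (metis less_irrefl)
  then show ?thesis unfolding kap_def[abs_def] by (intro continuous_intros) auto
qed

lemma kap_time:
  fixes z :: "'a::euclidean_space"
  assumes s: "0 < s" and R: "0 < R"
  shows "(\<integral>\<^sup>+q. ennreal (kb s R q * hk q z) \<partial>lpos) = ennreal (kap s R z)"
proof -
  have G: "0 < Gamma s" using s by (rule Gamma_real_pos)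
  have k: "0 \<le> R powr s / Gamma s" using G by simp
  have zz: "0 < R + (z \<bullet> z) / 4" using R by (intro add_pos_nonneg) auto
  have b: "- s < real DIM('a) / 2" using s by (simp add: less_le_trans[of "-s" 0])
  have "(\<integral>\<^sup>+q. ennreal (kb s R q * hk q z) \<partial>lpos) = (\<integral>\<^sup>+q. ennreal (R powr s / Gamma s) * ennreal (q powr (- s - 1) * exp (- (R / q)) * hk q z) \<partial>lpos)"
    unfolding kb_def ennreal_mult'[OF k, symmetric] by (simp only: mult_ac)
  also have "\<dots> = ennreal (R powr s / Gamma s) * (\<integral>\<^sup>+q. ennreal (q powr (- s - 1) * exp (- (R / q)) * hk q z) \<partial>lpos)"
    by (rule nn_integral_cmult) measurable
  also have "\<dots> = ennreal (kap s R z)"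
    unfolding hk_time_integral[OF b less_imp_le[OF R] zz] ennreal_mult'[OF k, symmetric] kap_def
    by (simp add: algebra_simps)
  finally show ?thesis .
qed

text \<open>The function sqrt(R + |z|^2/4) has Lipschitz constant 1/2 and is at least sqrt R, so
  moving the point by d changes it by a factor of at most 1 + d/(2 sqrt R). The kernel is a power of
  it with exponent -(n + 2s).\<close>

lemma kap_harnack:
  fixes z z' :: "'a::euclidean_space"
  assumes s: "0 < s" and R: "0 < R" and d: "norm (z - z') \<le> d" "0 \<le> d"
  shows "kap s R z' \<le> (1 + d / (2 * sqrt R)) powr (real DIM('a) + 2 * s) * kap s R z"
proof -
  define p where "p = real DIM('a) / 2 + s"
  have p: "0 < p" using s by (simp add: p_def add_nonneg_pos)
  define A B E where "A = R + (z \<bullet> z) / 4" and "B = R + (z' \<bullet> z') / 4" and "E = 1 + d / (2 * sqrt R)"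
  have AB: "R \<le> A" "R \<le> B" by (auto simp: A_def B_def)
  have E: "1 \<le> E" using d R by (simp add: E_def)
  have sR: "0 < sqrt R" using R by simp
  have nz: "norm z \<le> norm z' + d" using d norm_triangle_sub[of z z'] by linarith
  have "(norm z' / 2)\<^sup>2 \<le> B" using R by (simp add: B_def dot_square_norm power_divide)
  then have h1: "norm z' / 2 \<le> sqrt B" by (rule real_le_rsqrt)
  have "z \<bullet> z \<le> (norm z' + d)\<^sup>2" using power_mono[OF nz, of 2] by (simp add: dot_square_norm)
  then have "A \<le> R + (norm z' + d)\<^sup>2 / 4" by (simp add: A_def)
  also have "\<dots> = B + norm z' / 2 * d + d\<^sup>2 / 4" by (simp add: B_def dot_square_norm power2_eq_square algebra_simps)
  also have "\<dots> \<le> B + sqrt B * d + d\<^sup>2 / 4" using mult_right_mono[OF h1 d(2)] by linarith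
  also have "\<dots> = (sqrt B + d / 2)\<^sup>2" using AB R by (simp add: power2_eq_square algebra_simps)
  also have "\<dots> \<le> (sqrt B * E)\<^sup>2"
  proof (rule power_mono)
    have "d / 2 = sqrt R * (d / (2 * sqrt R))" using sR by simp
    also have "\<dots> \<le> sqrt B * (d / (2 * sqrt R))" using AB d sR by (intro mult_right_mono) auto
    finally show "sqrt B + d / 2 \<le> sqrt B * E" by (simp add: E_def algebra_simps)
  qed (use AB R d in auto)
  also have "\<dots> = B * E\<^sup>2" using AB R by (simp add: power_mult_distrib)
  finally have "A \<le> B * E\<^sup>2" .
  then have "(B * E\<^sup>2) powr (- p) \<le> A powr (- p)" using AB R p by (intro powr_mono2') auto
  then have "B powr (- p) * (E\<^sup>2) powr (- p) \<le> A powr (- p)" by (simp add: powr_mult)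
  then have h: "(B powr (- p) * (E\<^sup>2) powr (- p)) * (E\<^sup>2) powr p \<le> A powr (- p) * (E\<^sup>2) powr p" by (rule mult_right_mono) simp
  have o: "(E\<^sup>2) powr (- p) * (E\<^sup>2) powr p = 1" using E by (simp add: powr_add[symmetric])
  have "B powr (- p) \<le> (E\<^sup>2) powr p * A powr (- p)"
    using h unfolding mult.assoc[of "B powr (- p)"] o by (simp only: mult_1_right mult.commute)
  also have "(E\<^sup>2) powr p = E powr (real DIM('a) + 2 * s)"
  proof -
    have "(E\<^sup>2) powr p = (E powr 2) powr p" using E by simp
    also have "\<dots> = E powr (2 * p)" by (rule powr_powr)
    finally show ?thesis by (simp add: p_def distrib_left)
  qed
  finally have le: "B powr (- p) \<le> E powr (real DIM('a) + 2 * s) * A powr (- p)" .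
  define c where "c = R powr s / Gamma s * ((4 * pi) powr (- (real DIM('a) / 2)) * Gamma (real DIM('a) / 2 + s))"
  have "0 \<le> c" unfolding c_def using Gamma_real_pos[OF s] Gamma_real_pos[OF p] by (simp add: p_def)
  moreover have "kap s R z = c * A powr (- p)" "kap s R z' = c * B powr (- p)"
    unfolding kap_def c_def p_def A_def B_def by (rule refl)+
  ultimately show ?thesis unfolding E_def[symmetric]
    using mult_left_mono[OF le, of c] by (simp only: mult_ac)
qed

lemma kh_kap:
  fixes \<eta> :: "'a::euclidean_space \<Rightarrow> real"
  assumes \<eta>: "tst k \<eta>" and nn: "\<And>x. 0 \<le> \<eta> x" and s: "0 < s" and R: "0 < R"
  shows "kh s R \<eta> w = (LINT y|lborel. \<eta> y * kap s R (w - y))" "integrable lborel (\<lambda>y. \<eta> y * kap s R (w - y))"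
proof -
  have c: "continuous_on UNIV \<eta>" using \<eta> by (auto simp: tst_def dest: Ck_cont)
  have [measurable]: "\<eta> \<in> borel_measurable borel" using \<eta> by (rule tst_meas)
  have [measurable]: "(kap s R :: 'a \<Rightarrow> real) \<in> borel_measurable borel" by (rule borel_measurable_continuous_onI[OF kap_cont[OF R]])
  show i: "integrable lborel (\<lambda>y. \<eta> y * kap s R (w - y))"
  proof -
    have "integrable lborel (\<lambda>y. kap s R (w - y) * \<eta> y)"
      using \<eta> c by (intro Ck_mult_integrable continuous_on_compose2[OF kap_cont[OF R]]) (auto simp: tst_def intro!: continuous_intros)
    then show ?thesis by (simp add: mult.commute)
  qed
  let ?F = "\<lambda>q y. kb s R q * (\<eta> y * hk q (w - y))"
  have mF: "(\<lambda>(q, y). ?F q y) \<in> borel_measurable (lpos \<Otimes>\<^sub>M lborel)" by measurable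
  have inner: "(\<integral>\<^sup>+q. ennreal (?F q y) \<partial>lpos) = ennreal (\<eta> y * kap s R (w - y))" for y
  proof -
    have "(\<integral>\<^sup>+q. ennreal (?F q y) \<partial>lpos) = (\<integral>\<^sup>+q. ennreal (\<eta> y) * ennreal (kb s R q * hk q (w - y)) \<partial>lpos)"
      unfolding ennreal_mult'[OF nn, symmetric] by (simp only: mult_ac)
    also have "\<dots> = ennreal (\<eta> y) * ennreal (kap s R (w - y))"
      using kap_time[OF s R, of "w - y"] by (subst nn_integral_cmult) auto
    finally show ?thesis by (simp add: ennreal_mult'[OF nn])
  qed
  have iF: "integrable (lpos \<Otimes>\<^sub>M lborel) (\<lambda>(q, y). ?F q y)"
  proof (subst integrable_iff_bounded, intro conjI mF)
    have "(\<integral>\<^sup>+z. ennreal (norm (case z of (q, y) \<Rightarrow> ?F q y)) \<partial>(lpos \<Otimes>\<^sub>M lborel)) = (\<integral>\<^sup>+y. \<integral>\<^sup>+q. ennreal (norm (?F q y)) \<partial>lpos \<partial>lborel)"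
      using mF by (subst lpos_lborel.nn_integral_snd[symmetric]) (auto simp: split_beta')
    also have "\<dots> = (\<integral>\<^sup>+y. \<integral>\<^sup>+q. ennreal (?F q y) \<partial>lpos \<partial>lborel)"
      using nn kb_nonneg[OF s] by (simp add: abs_mult)
    also have "\<dots> = ennreal (LINT y|lborel. \<eta> y * kap s R (w - y))"
      unfolding inner using nn kap_nonneg[OF s] by (intro nn_integral_eq_integral i) (auto intro!: AE_I2 mult_nonneg_nonneg)
    finally show "(\<integral>\<^sup>+z. ennreal (norm (case z of (q, y) \<Rightarrow> ?F q y)) \<partial>(lpos \<Otimes>\<^sub>M lborel)) < \<infinity>" by simp
  qed
  have "kh s R \<eta> w = (LINT q|lpos. LINT y|lborel. ?F q y)" unfolding kh_def
  proof (rule lpos_cong)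
    show "(\<lambda>q. LINT y|lborel. ?F q y) \<in> borel_measurable borel"
      by (rule lborel.borel_measurable_lebesgue_integral) measurable
    show "kb s R q * hf \<eta> q w = (LINT y|lborel. ?F q y)" if "0 < q" for q
      using hf_eq[OF _ that, of \<eta> w] by simp
  qed measurable
  also have "\<dots> = (LINT y|lborel. LINT q|lpos. ?F q y)" by (rule lpos_lborel.Fubini_integral[OF iF, symmetric])
  also have "\<dots> = (LINT y|lborel. \<eta> y * kap s R (w - y))"
  proof (rule Bochner_Integration.integral_cong[OF refl])
    fix y
    show "(LINT q|lpos. ?F q y) = \<eta> y * kap s R (w - y)"
      using inner[of y] nn kb_nonneg[OF s] kap_nonneg[OF s]
      by (subst integral_eq_nn_integral) (auto intro!: enn2real_ennreal mult_nonneg_nonneg AE_I2)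
  qed
  finally show "kh s R \<eta> w = (LINT y|lborel. \<eta> y * kap s R (w - y))" .
qed

text \<open>Averages the kernel inequality over both profiles, each of mass one. Supports in the
  unit ball add at most 2 to the displacement of the centres, so the factor tends to 1 as R grows,
  whatever the profiles and centres.\<close>

lemma kh_harnack:
  fixes \<eta> \<eta>' :: "'a::euclidean_space \<Rightarrow> real"
  assumes \<eta>: "tst k \<eta>" "\<And>x. 0 \<le> \<eta> x" "(LINT x|lborel. \<eta> x) = 1" "\<And>x. 1 < norm x \<Longrightarrow> \<eta> x = 0"
    and \<eta>': "tst k \<eta>'" "\<And>x. 0 \<le> \<eta>' x" "(LINT x|lborel. \<eta>' x) = 1" "\<And>x. 1 < norm x \<Longrightarrow> \<eta>' x = 0"
    and s: "0 < s" and R: "0 < R"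
  shows "kh s R \<eta> w \<le> (1 + (norm (w - w') + 2) / (2 * sqrt R)) powr (real DIM('a) + 2 * s) * kh s R \<eta>' w'"
proof -
  define E where "E = (1 + (norm (w - w') + 2) / (2 * sqrt R)) powr (real DIM('a) + 2 * s)"
  have E: "0 \<le> E" by (simp add: E_def)
  have i: "integrable lborel \<eta>" using \<eta>(1) by (auto simp: tst_def intro: bdd_supp_integrable dest: Ck_cont)
  have i': "integrable lborel \<eta>'" using \<eta>'(1) by (auto simp: tst_def intro: bdd_supp_integrable dest: Ck_cont)
  have 1: "kh s R \<eta> w \<le> E * kap s R (w' - y')" if y': "norm y' \<le> 1" for y'
  proof -
    have "kh s R \<eta> w \<le> (LINT y|lborel. \<eta> y * (E * kap s R (w' - y')))"
      unfolding kh_kap(1)[OF \<eta>(1,2) s R]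
    proof (rule integral_mono[OF kh_kap(2)[OF \<eta>(1,2) s R]])
      show "integrable lborel (\<lambda>y. \<eta> y * (E * kap s R (w' - y')))" by (intro integrable_mult_left i)
      fix y
      show "\<eta> y * kap s R (w - y) \<le> \<eta> y * (E * kap s R (w' - y'))"
      proof (cases "norm y \<le> 1")
        case True
        have "norm ((w' - y') - (w - y)) = norm ((w' - w) + (y - y'))" by (simp add: algebra_simps)
        also have "\<dots> \<le> norm (w' - w) + norm (y - y')" by (rule norm_triangle_ineq)
        also have "\<dots> \<le> norm (w - w') + 2" using True y' norm_triangle_ineq4[of y y'] by (simp add: norm_minus_commute)
        finally have "kap s R (w - y) \<le> E * kap s R (w' - y')" unfolding E_def by (intro kap_harnack s R) auto
        then show ?thesis using \<eta>(2) by (rule mult_left_mono)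
      qed (use \<eta>(4) in auto)
    qed
    also have "\<dots> = E * kap s R (w' - y')" using \<eta>(3) by simp
    finally show ?thesis .
  qed
  have "kh s R \<eta> w = (LINT y'|lborel. \<eta>' y' * kh s R \<eta> w)" using \<eta>'(3) by simp
  also have "\<dots> \<le> (LINT y'|lborel. E * (\<eta>' y' * kap s R (w' - y')))"
  proof (rule integral_mono)
    show "integrable lborel (\<lambda>y'. \<eta>' y' * kh s R \<eta> w)" by (intro integrable_mult_left i')
    show "integrable lborel (\<lambda>y'. E * (\<eta>' y' * kap s R (w' - y')))" by (intro integrable_mult_right kh_kap(2)[OF \<eta>'(1,2) s R])
    fix y'
    show "\<eta>' y' * kh s R \<eta> w \<le> E * (\<eta>' y' * kap s R (w' - y'))"
    proof (cases "norm y' \<le> 1")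
      case True
      from mult_left_mono[OF 1[OF True] \<eta>'(2)[of y']] show ?thesis by (simp only: mult_ac)
    qed (use \<eta>'(4) in auto)
  qed
  also have "\<dots> = E * kh s R \<eta>' w'" unfolding kh_kap(1)[OF \<eta>'(1,2) s R] by (rule integral_mult_right_zero)
  finally show ?thesis unfolding E_def .
qed

lemma kh_nonneg:
  fixes \<eta> :: "'a::euclidean_space \<Rightarrow> real"
  assumes "tst k \<eta>" "\<And>x. 0 \<le> \<eta> x" "0 < s" "0 < R"
  shows "0 \<le> kh s R \<eta> w"
  unfolding kh_kap(1)[OF assms] using assms(2) kap_nonneg[OF assms(3)]
  by (intro integral_nonneg_AE AE_I2 mult_nonneg_nonneg)

section \<open>Nonnegative weak solutions\<close>

lemma ztf_translate:
  fixes \<eta> :: "'a::euclidean_space \<Rightarrow> real"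
  assumes "Ck (2 * Suc m) \<eta>"
  shows "ztf m \<gamma> (\<lambda>y. \<eta> (y + d)) \<tau> y = ztf m \<gamma> \<eta> \<tau> (y + d)"
  unfolding ztf_def neg_lap_pow_translate[OF assms] hf_def by (simp add: algebra_simps del: funpow.simps)

lemma tst_translate: "tst k \<eta> \<Longrightarrow> tst k (\<lambda>y. \<eta> (y - x))"
  unfolding tst_def using Ck_translate[of k \<eta> "- x"] bdd_supp_translate[of \<eta> "- x"] by auto

text \<open>Shifting the weight by x costs a power of 1 + |x|^2, which half of the Gaussian absorbs;
  the other half is a Gaussian of time 2t with mass one.\<close>

lemma wt_hk_conv:
  assumes a: "0 < a" and t: "0 < t"
  shows "\<exists>K\<ge>0. \<forall>w::'a::euclidean_space. (\<integral>\<^sup>+x. ennreal (wt a (w - x) * hk t x) \<partial>lborel) \<le> ennreal (K * wt a w)"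
proof -
  define k where "k = a / 2"
  have k: "0 < k" using a by (simp add: k_def)
  define E where "E = exp (1 - k) * k powr k"
  have E: "0 \<le> E" by (simp add: E_def)
  define M where "M = max 1 (8 * t)"
  define c where "c = (2::real) powr (real DIM('a) / 2)"
  define K where "K = (2 * M) powr k * E * c"
  have K: "0 \<le> K" using E by (simp add: K_def c_def)
  have b: "wt a (w - x) * hk t x \<le> K * wt a w * hk (2 * t) x" for w x :: 'a
  proof -
    \<comment> \<open>Half of the Gaussian exponent |x|^2/(4t): exp(-y) is spent on the power of 1 +
      |x|^2, and the other factor is the exponential of \<open>hk (2 * t)\<close>.\<close>
    define y where "y = (x \<bullet> x) / (8 * t)"
    have y: "0 \<le> y" using t by (simp add: y_def)
    have "x \<bullet> x = 8 * t * y" using t by (simp add: y_def)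
    also have "\<dots> \<le> M * y" using y by (intro mult_right_mono) (auto simp: M_def)
    finally have "2 * (1 + (norm x)\<^sup>2) \<le> (2 * M) * (1 + y)" by (simp add: dot_square_norm M_def algebra_simps)
    then have "(2 * (1 + (norm x)\<^sup>2)) powr k \<le> ((2 * M) * (1 + y)) powr k" using k by (intro powr_mono2) (auto intro!: add_nonneg_nonneg)
    also have "\<dots> = (2 * M) powr k * (1 + y) powr k" by (rule powr_mult)
    finally have 1: "(2 * (1 + (norm x)\<^sup>2)) powr k \<le> (2 * M) powr k * (1 + y) powr k" .
    have 2: "exp (- y) \<le> E * (1 + y) powr (- k)" unfolding E_def by (rule exp_powr_bound[OF k y])
    have o: "(1 + y) powr k * (1 + y) powr (- k) = 1" using y by (simp add: powr_add[symmetric])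
    have "(4 * pi * t) powr (- (real DIM('a) / 2)) = c * (4 * pi * (2 * t)) powr (- (real DIM('a) / 2))"
    proof -
      have "4 * pi * (2 * t) = 2 * (4 * pi * t)" by simp
      then have "(4 * pi * (2 * t)) powr (- (real DIM('a) / 2)) = 2 powr (- (real DIM('a) / 2)) * (4 * pi * t) powr (- (real DIM('a) / 2))"
        by (simp only: powr_mult)
      moreover have "c * 2 powr (- (real DIM('a) / 2)) = 1" unfolding c_def by (simp add: powr_add[symmetric])
      ultimately show ?thesis by (simp flip: mult.assoc)
    qed
    moreover have "exp (- ((x \<bullet> x) / (4 * t))) = exp (- y) * exp (- ((x \<bullet> x) / (4 * (2 * t))))"
      using t by (simp add: y_def exp_add[symmetric] field_simps)
    ultimately have 3: "hk t x = exp (- y) * (c * hk (2 * t) x)" unfolding hk_def by (simp only: mult_ac)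
    have "wt a (w - x) * hk t x \<le> ((2 * (1 + (norm x)\<^sup>2)) powr k * wt a w) * hk t x"
      unfolding k_def using wt_shift(2)[of x "norm x" a w] a by (intro mult_right_mono) auto
    also have "\<dots> \<le> ((2 * M) powr k * (1 + y) powr k * wt a w) * ((E * (1 + y) powr (- k)) * (c * hk (2 * t) x))"
      unfolding 3 using 1 2 E by (intro mult_mono mult_right_mono) (auto simp: c_def)
    also have "\<dots> = ((1 + y) powr k * (1 + y) powr (- k)) * (K * wt a w * hk (2 * t) x)" unfolding K_def by (simp only: mult_ac)
    finally show ?thesis unfolding o by simp
  qed
  show ?thesis
  proof (intro exI[of _ K] conjI allI K)
    fix w :: 'a
    have n: "0 \<le> K * wt a w" using K by simp
    have "(\<integral>\<^sup>+x. ennreal (wt a (w - x) * hk t x) \<partial>lborel) \<le> (\<integral>\<^sup>+x. ennreal (K * wt a w) * ennreal (hk (2 * t) (x::'a)) \<partial>lborel)"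
      unfolding ennreal_mult'[OF n, symmetric] by (rule nn_integral_mono, rule ennreal_leI, rule b)
    also have "\<dots> = ennreal (K * wt a w)" using hk_nn_integral[of "2 * t", where ?'a='a] t by (subst nn_integral_cmult) auto
    finally show "(\<integral>\<^sup>+x. ennreal (wt a (w - x) * hk t x) \<partial>lborel) \<le> ennreal (K * wt a w)" .
  qed
qed

lemma aR_tendsto:
  assumes t: "0 < t"
  shows "(\<lambda>k. aR s (real (Suc k)) t) \<longlonglongrightarrow> t powr (s - 1) / Gamma s"
proof -
  have "filterlim (\<lambda>k. real (Suc k) / t) at_top sequentially"
    unfolding divide_inverse using t
    by (intro filterlim_at_top_mult_tendsto_pos[OF tendsto_const] filterlim_compose[OF filterlim_real_sequentially filterlim_Suc]) auto
  then have "(\<lambda>k. exp (- (real (Suc k) / t))) \<longlonglongrightarrow> 0"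
    by (intro filterlim_compose[OF exp_at_bot]) (simp add: filterlim_uminus_at_bot)
  then have "(\<lambda>k. t powr (s - 1) * (1 - exp (- (real (Suc k) / t))) / Gamma s) \<longlonglongrightarrow> t powr (s - 1) * (1 - 0) / Gamma s"
    unfolding divide_inverse[of _ "Gamma s"] by (intro tendsto_intros)
  then show ?thesis by (simp add: aR_def)
qed

lemma aR_mono:
  assumes "0 < s" "0 < t" "R \<le> R'"
  shows "aR s R t \<le> aR s R' t"
  unfolding aR_def using assms Gamma_real_pos[OF assms(1)]
  by (intro divide_right_mono mult_left_mono) (auto simp: divide_right_mono)

text \<open>The nonlinearity appears only through the source F, so the representation of v is a
  linear statement about nonnegative continuous functions linked by the weak identity.\<close>

locale weak_solution =
  fixes m :: nat and \<gamma> a :: real and v F :: "'a::euclidean_space \<Rightarrow> real"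
  assumes g: "0 \<le> \<gamma>" "\<gamma> < 1" and s: "0 < real m + \<gamma>" "real m + \<gamma> < real DIM('a) / 2"
    and a: "a = real DIM('a) + 2 * \<gamma>"
    and v: "v \<in> Ls_space \<gamma>" "continuous_on UNIV v" "\<And>x. 0 \<le> v x"
    and F: "continuous_on UNIV F" "\<And>x. 0 \<le> F x"
    and weak: "\<And>\<phi>. tst (2 * Suc m) \<phi> \<Longrightarrow> (LINT x|lborel. F x * \<phi> x) = (LINT x|lborel. v x * ztf m \<gamma> \<phi> 0 x)"
begin

abbreviation s :: real where "s \<equiv> real m + \<gamma>"

text \<open>Admissible mollifiers. The unit mass and the common support in the unit ball are what
  makes the comparison of two profiles uniform.\<close>

definition prof :: "('a \<Rightarrow> real) \<Rightarrow> bool" where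
  "prof \<eta> \<longleftrightarrow> tst (2 * Suc m) \<eta> \<and> (\<forall>x. 0 \<le> \<eta> x) \<and> (LINT x|lborel. \<eta> x) = 1 \<and> (\<forall>x. 1 < norm x \<longrightarrow> \<eta> x = 0)"

lemma prof_tst: "prof \<eta> \<Longrightarrow> tst (2 * Suc m) \<eta>" by (simp add: prof_def)

lemma prof_nonneg: "prof \<eta> \<Longrightarrow> 0 \<le> \<eta> x" by (simp add: prof_def)

lemma a_pos: "0 < a" using g by (simp add: a add_pos_nonneg)

lemma v_meas[measurable]: "v \<in> borel_measurable borel" using v(2) by (rule borel_measurable_continuous_onI)

lemma F_meas[measurable]: "F \<in> borel_measurable borel" using F(1) by (rule borel_measurable_continuous_onI)

lemma v_wt: "integrable lborel (\<lambda>y. v y * wt a y)"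
  using Ls_integrable[OF v(1) _ g(1)] v(3) by (simp add: a)

lemma v_wt_shift: "integrable lborel (\<lambda>y. v y * wt a (y - x))"
proof (rule integrable_le)
  show "integrable lborel (\<lambda>y. (2 * (1 + (norm x)\<^sup>2)) powr (a / 2) * (v y * wt a y))"
    by (intro integrable_mult_right v_wt)
  fix y :: 'a
  have "wt a (y - x) \<le> (2 * (1 + (norm x)\<^sup>2)) powr (a / 2) * wt a y" by (rule wt_shift(2)) (use a_pos in auto)
  from mult_left_mono[OF this v(3)[of y]] show "\<bar>v y * wt a (y - x)\<bar> \<le> (2 * (1 + (norm x)\<^sup>2)) powr (a / 2) * (v y * wt a y)"
    using v(3)[of y] by (simp add: abs_mult mult_ac)
qed measurable

section \<open>The mollified source and its integral in time\<close>

definition hh :: "('a \<Rightarrow> real) \<Rightarrow> 'a \<Rightarrow> real" where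
  "hh \<eta> x = (LINT y|lborel. F y * \<eta> (y - x))"

context
  fixes \<eta> :: "'a \<Rightarrow> real"
  assumes \<eta>: "prof \<eta>"
begin

lemma \<eta>_meas[measurable]: "\<eta> \<in> borel_measurable borel" by (rule tst_meas[OF prof_tst[OF \<eta>]])

lemma hh_measurable[measurable]: "hh \<eta> \<in> borel_measurable borel"
  unfolding hh_def[abs_def] by (rule lborel.borel_measurable_lebesgue_integral) measurable

lemma hh_nonneg: "0 \<le> hh \<eta> x"
  unfolding hh_def using F(2) prof_nonneg[OF \<eta>] by (intro integral_nonneg_AE AE_I2 mult_nonneg_nonneg)

text \<open>The point where the equation is used: the weak identity for the profile translated to
  x.\<close>

lemma hh_eq: "hh \<eta> x = (LINT y|lborel. v y * ztf m \<gamma> \<eta> 0 (y - x))"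
proof -
  have "Ck (2 * Suc m) \<eta>" using prof_tst[OF \<eta>] by (simp add: tst_def)
  from ztf_translate[OF this, of \<gamma> "- x"] show ?thesis
    unfolding hh_def using weak[OF tst_translate[OF prof_tst[OF \<eta>], of x]] by simp
qed

lemma ztf_le: "\<exists>C\<ge>0. \<forall>\<tau>\<ge>0. \<forall>x::'a. \<bar>ztf m \<gamma> \<eta> \<tau> x\<bar> \<le> C * (1 + \<tau>) powr (- real m) * wt a x"
  using ztf_bound_space[OF prof_tst[OF \<eta>] g] by (simp add: a wt_def add_divide_distrib)

text \<open>Finiteness of the heat flow of the mollified source is not evident, as F may grow; it is
  obtained by passing to v, whose weight survives convolution with the kernel. In return the pairing
  of v with the sign-changing \<open>ztf\<close> is seen to be nonnegative, being the heat flow of a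
  nonnegative function.\<close>

lemma hh_hk:
  assumes t: "0 < \<tau>"
  shows "(\<integral>\<^sup>+x. ennreal (hh \<eta> x * hk \<tau> (x - x0)) \<partial>lborel) = ennreal (LINT y|lborel. v y * ztf m \<gamma> \<eta> \<tau> (y - x0))"
    "0 \<le> (LINT y|lborel. v y * ztf m \<gamma> \<eta> \<tau> (y - x0))"
proof -
  note [measurable] = ztf_measurable[OF prof_tst[OF \<eta>]]
  let ?H = "\<lambda>x y. v y * ztf m \<gamma> \<eta> 0 (y - x) * hk \<tau> (x - x0)"
  obtain C where C: "C \<ge> 0" "\<And>x. \<bar>ztf m \<gamma> \<eta> 0 x\<bar> \<le> C * wt a x" using ztf_le by force
  obtain K where K: "K \<ge> 0" "\<And>w::'a. (\<integral>\<^sup>+x. ennreal (wt a (w - x) * hk \<tau> x) \<partial>lborel) \<le> ennreal (K * wt a w)"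
    using wt_hk_conv[OF a_pos t] by blast
  have mH: "(\<lambda>(x, y). ?H x y) \<in> borel_measurable (lborel \<Otimes>\<^sub>M lborel)" by measurable
  have iH: "integrable (lborel \<Otimes>\<^sub>M lborel) (\<lambda>(x, y). ?H x y)"
  proof (subst integrable_iff_bounded, intro conjI mH)
    have "(\<integral>\<^sup>+w. ennreal (norm (case w of (x, y) \<Rightarrow> ?H x y)) \<partial>(lborel \<Otimes>\<^sub>M lborel)) = (\<integral>\<^sup>+y. \<integral>\<^sup>+x. ennreal (norm (?H x y)) \<partial>lborel \<partial>lborel)"
      using mH by (subst lborel_pair.nn_integral_snd[symmetric]) (auto simp: split_beta')
    also have "\<dots> \<le> (\<integral>\<^sup>+y. ennreal (C * K * (v y * wt a (y - x0))) \<partial>lborel)"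
    proof (rule nn_integral_mono)
      fix y :: 'a
      have n: "0 \<le> C * v y" using C v(3)[of y] by simp
      have "(\<integral>\<^sup>+x. ennreal (norm (?H x y)) \<partial>lborel) \<le> (\<integral>\<^sup>+x. ennreal (C * v y) * ennreal (wt a (y - x) * hk \<tau> (x - x0)) \<partial>lborel)"
        unfolding ennreal_mult'[OF n, symmetric]
      proof (intro nn_integral_mono ennreal_leI)
        fix x :: 'a
        from mult_left_mono[OF C(2)[of "y - x"], of "v y * hk \<tau> (x - x0)"] v(3)[of y]
        show "norm (?H x y) \<le> C * v y * (wt a (y - x) * hk \<tau> (x - x0))" by (simp add: abs_mult mult_ac)
      qed
      also have "\<dots> = ennreal (C * v y) * (\<integral>\<^sup>+x. ennreal (wt a (y - x) * hk \<tau> (x - x0)) \<partial>lborel)" by (rule nn_integral_cmult) measurable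
      also have "(\<integral>\<^sup>+x. ennreal (wt a (y - x) * hk \<tau> (x - x0)) \<partial>lborel) = (\<integral>\<^sup>+x. ennreal (wt a ((y - x0) - (x - x0)) * hk \<tau> (x - x0)) \<partial>lborel)" by simp
      also have "\<dots> = (\<integral>\<^sup>+x. ennreal (wt a ((y - x0) - x) * hk \<tau> x) \<partial>lborel)" by (rule nn_integral_shift(2)) measurable
      also have "ennreal (C * v y) * \<dots> \<le> ennreal (C * v y) * ennreal (K * wt a (y - x0))" by (intro mult_left_mono K) simp
      also have "\<dots> = ennreal (C * K * (v y * wt a (y - x0)))" unfolding ennreal_mult'[OF n, symmetric] by (simp only: mult_ac)
      finally show "(\<integral>\<^sup>+x. ennreal (norm (?H x y)) \<partial>lborel) \<le> ennreal (C * K * (v y * wt a (y - x0)))" .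
    qed
    also have "\<dots> = ennreal (LINT y|lborel. C * K * (v y * wt a (y - x0)))"
      using v_wt_shift[of x0] v(3) C K by (intro nn_integral_eq_integral) auto
    finally show "(\<integral>\<^sup>+w. ennreal (norm (case w of (x, y) \<Rightarrow> ?H x y)) \<partial>(lborel \<Otimes>\<^sub>M lborel)) < \<infinity>" by (simp add: le_less_trans)
  qed
  have in1: "(LINT y|lborel. ?H x y) = hh \<eta> x * hk \<tau> (x - x0)" for x by (simp add: hh_eq)
  have i: "integrable lborel (\<lambda>x. hh \<eta> x * hk \<tau> (x - x0))"
    using lborel_pair.integrable_fst'[OF iH] by (simp add: hh_eq)
  have in2: "(LINT x|lborel. ?H x y) = v y * ztf m \<gamma> \<eta> \<tau> (y - x0)" for y
  proof -
    have "(LINT x|lborel. ?H x y) = (LINT x|lborel. v y * (ztf m \<gamma> \<eta> 0 (y - x) * hk \<tau> (y - x0 - (y - x))))"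
      by (simp add: mult.assoc)
    also have "\<dots> = (LINT x|lborel. v y * (ztf m \<gamma> \<eta> 0 x * hk \<tau> (y - x0 - x)))" by (rule integral_shift(3)) measurable
    also have "\<dots> = v y * ztf m \<gamma> \<eta> \<tau> (y - x0)" using ztf_conv[OF prof_tst[OF \<eta>] g t] by simp
    finally show ?thesis .
  qed
  have e: "(LINT x|lborel. hh \<eta> x * hk \<tau> (x - x0)) = (LINT y|lborel. v y * ztf m \<gamma> \<eta> \<tau> (y - x0))"
    unfolding in1[symmetric] in2[symmetric] by (rule lborel_pair.Fubini_integral[OF iH, symmetric])
  show "0 \<le> (LINT y|lborel. v y * ztf m \<gamma> \<eta> \<tau> (y - x0))" unfolding e[symmetric] using hh_nonneg by simp
  show "(\<integral>\<^sup>+x. ennreal (hh \<eta> x * hk \<tau> (x - x0)) \<partial>lborel) = ennreal (LINT y|lborel. v y * ztf m \<gamma> \<eta> \<tau> (y - x0))"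
    unfolding e[symmetric] using hh_nonneg by (intro nn_integral_eq_integral i) auto
qed

text \<open>The mollified v at \<open>x0\<close>, from which \<open>TT\<close> is subtracted: the
  same average taken with the profile spread out by the bubble of parameter R.\<close>

definition SS :: "'a \<Rightarrow> real" where "SS x0 = (LINT y|lborel. v y * \<eta> (y - x0))"
definition TT :: "real \<Rightarrow> 'a \<Rightarrow> real" where "TT R x0 = (LINT y|lborel. v y * kh s R \<eta> (y - x0))"

text \<open>Fubini with the time integral inside: for each y it gives \<eta> minus \<open>kh\<close>
  by \<open>aR_ztf\<close>. Absolute convergence separates into the truncated weight against (1 +
  t)^(-m) in time and v against its weight in space.\<close>

lemma time_split:
  assumes R: "0 < R"
  shows "(\<integral>\<^sup>+t. ennreal (aR s R t) * (\<integral>\<^sup>+x. ennreal (hh \<eta> x * hk t (x - x0)) \<partial>lborel) \<partial>lpos) = ennreal (SS x0 - TT R x0)"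
    "TT R x0 \<le> SS x0" "integrable lborel (\<lambda>y. v y * kh s R \<eta> (y - x0))"
proof -
  note [measurable] = ztf_measurable[OF prof_tst[OF \<eta>]]
  let ?H = "\<lambda>t y. aR s R t * (v y * ztf m \<gamma> \<eta> t (y - x0))"
  obtain C where C: "C \<ge> 0" "\<And>t x. 0 \<le> t \<Longrightarrow> \<bar>ztf m \<gamma> \<eta> t x\<bar> \<le> C * (1 + t) powr (- real m) * wt a x" using ztf_le by blast
  have mH: "(\<lambda>(t, y). ?H t y) \<in> borel_measurable (lpos \<Otimes>\<^sub>M lborel)" by measurable
  have iH: "integrable (lpos \<Otimes>\<^sub>M lborel) (\<lambda>(t, y). ?H t y)"
  proof (subst integrable_iff_bounded, intro conjI mH)
    define V where "V = (LINT y|lborel. v y * wt a (y - x0))"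
    have V: "(\<integral>\<^sup>+y. ennreal (v y * wt a (y - x0)) \<partial>lborel) = ennreal V" "0 \<le> V"
      unfolding V_def using v(3) by (auto intro!: nn_integral_eq_integral v_wt_shift)
    have "(\<integral>\<^sup>+w. ennreal (norm (case w of (t, y) \<Rightarrow> ?H t y)) \<partial>(lpos \<Otimes>\<^sub>M lborel)) = (\<integral>\<^sup>+t. \<integral>\<^sup>+y. ennreal (norm (?H t y)) \<partial>lborel \<partial>lpos)"
      using mH by (subst lborel.nn_integral_fst[symmetric]) (auto simp: split_beta')
    also have "\<dots> \<le> (\<integral>\<^sup>+t. ennreal (V * (C * (aR s R t * (1 + t) powr (- real m)))) \<partial>lpos)"
    proof (rule nn_lpos_mono)
      fix t :: real assume t: "0 < t"
      have n: "0 \<le> C * (aR s R t * (1 + t) powr (- real m))" using C aR_nonneg[OF s(1) R t] by simp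
      have "(\<integral>\<^sup>+y. ennreal (norm (?H t y)) \<partial>lborel) \<le> (\<integral>\<^sup>+y. ennreal (C * (aR s R t * (1 + t) powr (- real m))) * ennreal (v y * wt a (y - x0)) \<partial>lborel)"
        unfolding ennreal_mult'[OF n, symmetric]
      proof (intro nn_integral_mono ennreal_leI)
        fix y :: 'a
        from mult_left_mono[OF C(2)[of t "y - x0"], of "aR s R t * v y"] v(3)[of y] aR_nonneg[OF s(1) R t] t
        show "norm (?H t y) \<le> C * (aR s R t * (1 + t) powr (- real m)) * (v y * wt a (y - x0))" by (simp add: abs_mult mult_ac)
      qed
      also have "\<dots> = ennreal (C * (aR s R t * (1 + t) powr (- real m))) * ennreal V"
        unfolding V(1)[symmetric] by (rule nn_integral_cmult) measurable
      also have "\<dots> = ennreal (V * (C * (aR s R t * (1 + t) powr (- real m))))" unfolding ennreal_mult'[OF n, symmetric] by (simp only: mult_ac)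
      finally show "(\<integral>\<^sup>+y. ennreal (norm (?H t y)) \<partial>lborel) \<le> ennreal (V * (C * (aR s R t * (1 + t) powr (- real m))))" .
    qed
    also have "\<dots> < \<infinity>"
    proof -
      have "integrable lpos (\<lambda>t. V * (C * (aR s R t * (1 + t) powr (- real m))))"
        by (intro integrable_mult_right aR_integrable s g R)
      then have "(\<integral>\<^sup>+t. ennreal (norm (V * (C * (aR s R t * (1 + t) powr (- real m))))) \<partial>lpos) < \<infinity>"
        unfolding integrable_iff_bounded by blast
      then show ?thesis by (rule le_less_trans[rotated]) (intro nn_integral_mono ennreal_leI, simp)
    qed
    finally show "(\<integral>\<^sup>+w. ennreal (norm (case w of (t, y) \<Rightarrow> ?H t y)) \<partial>(lpos \<Otimes>\<^sub>M lborel)) < \<infinity>" .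
  qed
  have i1: "integrable lpos (\<lambda>t. aR s R t * (LINT y|lborel. v y * ztf m \<gamma> \<eta> t (y - x0)))"
    using lpos_lborel.integrable_fst'[OF iH] by simp
  have in2: "(LINT t|lpos. ?H t y) = v y * \<eta> (y - x0) - v y * kh s R \<eta> (y - x0)" for y
  proof -
    have "(LINT t|lpos. ?H t y) = (LINT t|lpos. v y * (aR s R t * ztf m \<gamma> \<eta> t (y - x0)))" by (simp only: mult_ac)
    also have "\<dots> = v y * (\<eta> (y - x0) - kh s R \<eta> (y - x0))" using aR_ztf[OF prof_tst[OF \<eta>] g s(1) R] by simp
    finally show ?thesis by (simp add: right_diff_distrib)
  qed
  have i2: "integrable lborel (\<lambda>y. v y * \<eta> (y - x0) - v y * kh s R \<eta> (y - x0))"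
    using lpos_lborel.integrable_snd[OF iH] unfolding in2 .
  have i3: "integrable lborel (\<lambda>y. v y * \<eta> (y - x0))"
    using tst_translate[OF prof_tst[OF \<eta>], of x0] v(2) by (intro Ck_mult_integrable) (auto simp: tst_def dest: Ck_cont)
  \<comment> \<open>Integrability of v against \<open>kh\<close> comes from subtraction: the
    difference is integrable as a marginal in Fubini's theorem, and the term with \<eta> has bounded
    support.\<close>
  have "integrable lborel (\<lambda>y. v y * \<eta> (y - x0) - (v y * \<eta> (y - x0) - v y * kh s R \<eta> (y - x0)))"
    by (rule Bochner_Integration.integrable_diff[OF i3 i2])
  then show i4: "integrable lborel (\<lambda>y. v y * kh s R \<eta> (y - x0))" by simp
  have "(LINT t|lpos. aR s R t * (LINT y|lborel. v y * ztf m \<gamma> \<eta> t (y - x0))) = (LINT t|lpos. LINT y|lborel. ?H t y)" by simp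
  also have "\<dots> = (LINT y|lborel. LINT t|lpos. ?H t y)" by (rule lpos_lborel.Fubini_integral[OF iH, symmetric])
  also have "\<dots> = SS x0 - TT R x0" unfolding in2 SS_def TT_def by (rule Bochner_Integration.integral_diff[OF i3 i4])
  finally have e: "(LINT t|lpos. aR s R t * (LINT y|lborel. v y * ztf m \<gamma> \<eta> t (y - x0))) = SS x0 - TT R x0" .
  have nn: "AE t in lpos. 0 \<le> aR s R t * (LINT y|lborel. v y * ztf m \<gamma> \<eta> t (y - x0))"
    using AE_lpos by eventually_elim (intro mult_nonneg_nonneg aR_nonneg s(1) R hh_hk(2))
  show "TT R x0 \<le> SS x0" using integral_nonneg_AE[OF nn] unfolding e by simp
  have "(\<integral>\<^sup>+t. ennreal (aR s R t) * (\<integral>\<^sup>+x. ennreal (hh \<eta> x * hk t (x - x0)) \<partial>lborel) \<partial>lpos) = (\<integral>\<^sup>+t. ennreal (aR s R t * (LINT y|lborel. v y * ztf m \<gamma> \<eta> t (y - x0))) \<partial>lpos)"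
    by (rule nn_lpos_cong) (simp add: hh_hk(1) ennreal_mult'[OF aR_nonneg[OF s(1) R]])
  also have "\<dots> = ennreal (SS x0 - TT R x0)" unfolding e[symmetric] by (rule nn_integral_eq_integral[OF i1 nn])
  finally show "(\<integral>\<^sup>+t. ennreal (aR s R t) * (\<integral>\<^sup>+x. ennreal (hh \<eta> x * hk t (x - x0)) \<partial>lborel) \<partial>lpos) = ennreal (SS x0 - TT R x0)" .
qed

text \<open>As R increases, the weight \<open>aR\<close> increases to t^(s-1)/Gamma(s), so the left
  side of \<open>time_split\<close> increases to the Riesz potential of the mollified source. The
  potential is bounded by \<open>SS\<close>, hence finite, and \<open>TT\<close> converges to what
  is left over.\<close>

lemma TT_limit:
  "\<exists>c\<ge>0. ennreal (SS x0) = ennreal c + (\<integral>\<^sup>+x. ennreal (hh \<eta> x * rk s (x - x0)) \<partial>lborel) \<and> (\<lambda>k. TT (real (Suc k)) x0) \<longlonglongrightarrow> c"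
proof -
  define J where "J = (\<integral>\<^sup>+x. ennreal (hh \<eta> x * rk s (x - x0)) \<partial>lborel)"
  define L where "L t = (\<integral>\<^sup>+x. ennreal (hh \<eta> x * hk t (x - x0)) \<partial>lborel)" for t
  have [measurable]: "L \<in> borel_measurable borel" unfolding L_def by measurable
  let ?f = "\<lambda>k t. ennreal (aR s (real (Suc k)) t) * L t * indicator {0<..} t"
  have G: "0 < Gamma s" using s(1) by (rule Gamma_real_pos)
  have "(\<lambda>k. \<integral>\<^sup>+t. ?f k t \<partial>lpos) \<longlonglongrightarrow> (\<integral>\<^sup>+t. ennreal (t powr (s - 1) / Gamma s) * L t * indicator {0<..} t \<partial>lpos)"
  proof (rule nn_integral_LIMSEQ)
    show "incseq ?f"
    proof (intro incseq_SucI le_funI)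
      fix k and t :: real
      show "?f k t \<le> ?f (Suc k) t"
      proof (cases "0 < t")
        case True
        then show ?thesis using aR_mono[OF s(1) True, of "real (Suc k)" "real (Suc (Suc k))"] by (simp add: mult_right_mono ennreal_leI)
      qed simp
    qed
    show "?f k \<in> borel_measurable lpos" for k by measurable
    show "(\<lambda>k. ?f k t) \<longlonglongrightarrow> ennreal (t powr (s - 1) / Gamma s) * L t * indicator {0<..} t" for t
    proof (cases "0 < t")
      case True
      \<comment> \<open>Multiplication of extended reals is continuous here only because L is
        finite, which is \<open>hh_hk\<close>.\<close>
      have "L t \<noteq> \<top>" unfolding L_def hh_hk(1)[OF True] by simp
      then show ?thesis using True aR_tendsto[OF True, of s]
        by (auto intro!: tendsto_mult_ennreal tendsto_ennrealI)
    qed simp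
  qed
  moreover have "(\<integral>\<^sup>+t. ?f k t \<partial>lpos) = ennreal (SS x0 - TT (real (Suc k)) x0)" for k
    unfolding time_split(1)[of "real (Suc k)" x0, OF of_nat_0_less_iff[THEN iffD2, OF zero_less_Suc], symmetric] L_def
    by (rule nn_lpos_cong) simp
  moreover have "(\<integral>\<^sup>+t. ennreal (t powr (s - 1) / Gamma s) * L t * indicator {0<..} t \<partial>lpos) = J"
  proof -
    have k: "0 \<le> t powr (s - 1) / Gamma s" for t using G by simp
    have "(\<integral>\<^sup>+t. ennreal (t powr (s - 1) / Gamma s) * L t * indicator {0<..} t \<partial>lpos) = (\<integral>\<^sup>+t. \<integral>\<^sup>+x. ennreal (hh \<eta> x) * ennreal (t powr (s - 1) / Gamma s * hk t (x - x0)) \<partial>lborel \<partial>lpos)"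
    proof (rule nn_lpos_cong)
      fix t :: real assume t: "0 < t"
      have "ennreal (t powr (s - 1) / Gamma s) * L t = (\<integral>\<^sup>+x. ennreal (t powr (s - 1) / Gamma s) * ennreal (hh \<eta> x * hk t (x - x0)) \<partial>lborel)"
        unfolding L_def by (rule nn_integral_cmult[symmetric]) measurable
      also have "\<dots> = (\<integral>\<^sup>+x. ennreal (hh \<eta> x) * ennreal (t powr (s - 1) / Gamma s * hk t (x - x0)) \<partial>lborel)"
        unfolding ennreal_mult'[OF k, symmetric] ennreal_mult'[OF hh_nonneg, symmetric] by (simp only: mult_ac)
      finally show "ennreal (t powr (s - 1) / Gamma s) * L t * indicator {0<..} t = (\<integral>\<^sup>+x. ennreal (hh \<eta> x) * ennreal (t powr (s - 1) / Gamma s * hk t (x - x0)) \<partial>lborel)" using t by simp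
    qed
    also have "\<dots> = (\<integral>\<^sup>+x. \<integral>\<^sup>+t. ennreal (hh \<eta> x) * ennreal (t powr (s - 1) / Gamma s * hk t (x - x0)) \<partial>lpos \<partial>lborel)"
      by (rule lpos_lborel.Fubini'[symmetric]) measurable
    also have "\<dots> = J" unfolding J_def
    proof (rule nn_integral_cong_AE)
      have "AE x in lborel. x \<noteq> x0" by (rule AE_lborel_singleton)
      then show "AE x in lborel. (\<integral>\<^sup>+t. ennreal (hh \<eta> x) * ennreal (t powr (s - 1) / Gamma s * hk t (x - x0)) \<partial>lpos) = ennreal (hh \<eta> x * rk s (x - x0))"
      proof eventually_elim
        fix x assume "x \<noteq> x0"
        then have "(\<integral>\<^sup>+t. ennreal (t powr (s - 1) / Gamma s * hk t (x - x0)) \<partial>lpos) = ennreal (rk s (x - x0))" by (intro riesz_time s) simp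
        then show "(\<integral>\<^sup>+t. ennreal (hh \<eta> x) * ennreal (t powr (s - 1) / Gamma s * hk t (x - x0)) \<partial>lpos) = ennreal (hh \<eta> x * rk s (x - x0))"
          by (subst nn_integral_cmult) (auto simp: ennreal_mult'[OF hh_nonneg])
      qed
    qed
    finally show ?thesis .
  qed
  ultimately have lim: "(\<lambda>k. ennreal (SS x0 - TT (real (Suc k)) x0)) \<longlonglongrightarrow> J" by simp
  have T0: "0 \<le> TT (real (Suc k)) x0" for k unfolding TT_def
    using v(3) prof_nonneg[OF \<eta>] s by (intro integral_nonneg_AE AE_I2 mult_nonneg_nonneg kh_nonneg[OF prof_tst[OF \<eta>]]) auto
  have S0: "0 \<le> SS x0" unfolding SS_def using v(3) prof_nonneg[OF \<eta>] by (intro integral_nonneg_AE AE_I2 mult_nonneg_nonneg)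
  have le: "J \<le> ennreal (SS x0)"
    by (rule LIMSEQ_le_const2[OF lim]) (use T0 in \<open>auto intro!: ennreal_leI exI[of _ 0]\<close>)
  then obtain j where j: "J = ennreal j" "0 \<le> j" by (cases J) (auto simp: top_unique)
  have jS: "j \<le> SS x0" using le j S0 by simp
  have "(\<lambda>k. SS x0 - TT (real (Suc k)) x0) \<longlonglongrightarrow> j"
    using lim time_split(2)[of "real (Suc _)" x0] j by (subst (asm) j(1), subst (asm) tendsto_ennreal_iff) auto
  then have "(\<lambda>k. SS x0 - (SS x0 - TT (real (Suc k)) x0)) \<longlonglongrightarrow> SS x0 - j" by (intro tendsto_intros)
  then show ?thesis using jS j by (intro exI[of _ "SS x0 - j"]) (auto simp: J_def[symmetric] ennreal_plus[symmetric] simp del: ennreal_plus)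
qed

end

text \<open>The Harnack inequality at the displacement \<open>x1 - x0\<close>, integrated against v
  \<ge> 0; its factor tends to 1 along R = k + 1. Used in both directions it shows that the limit
  depends neither on the profile nor on the centre.\<close>

lemma TT_limit_le:
  assumes \<eta>: "prof \<eta>" and \<eta>': "prof \<eta>'" and c: "(\<lambda>k. TT \<eta> (real (Suc k)) x0) \<longlonglongrightarrow> c" and c': "(\<lambda>k. TT \<eta>' (real (Suc k)) x1) \<longlonglongrightarrow> c'"
  shows "c \<le> c'"
proof -
  define E where "E k = (1 + (norm (x1 - x0) + 2) / (2 * sqrt (real (Suc k)))) powr (real DIM('a) + 2 * s)" for k
  have "(\<lambda>k. (1 + (norm (x1 - x0) + 2) / 2 * sqrt (inverse (real (Suc k)))) powr (real DIM('a) + 2 * s)) \<longlonglongrightarrow> (1 + (norm (x1 - x0) + 2) / 2 * sqrt 0) powr (real DIM('a) + 2 * s)"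
    by (intro tendsto_intros LIMSEQ_inverse_real_of_nat) auto
  moreover have "(1 + (norm (x1 - x0) + 2) / 2 * sqrt (inverse (real (Suc k)))) powr (real DIM('a) + 2 * s) = E k" for k
  proof -
    have e: "(norm (x1 - x0) + 2) / 2 * sqrt (inverse (real (Suc k))) = (norm (x1 - x0) + 2) / (2 * sqrt (real (Suc k)))"
      unfolding real_sqrt_inverse divide_inverse inverse_mult_distrib by (simp only: mult_ac)
    show ?thesis unfolding E_def e ..
  qed
  ultimately have E: "E \<longlonglongrightarrow> 1" by simp
  have l: "(\<lambda>k. E k * TT \<eta>' (real (Suc k)) x1) \<longlonglongrightarrow> 1 * c'" by (intro tendsto_mult E c')
  have "TT \<eta> (real (Suc k)) x0 \<le> E k * TT \<eta>' (real (Suc k)) x1" for k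
  proof -
    have "TT \<eta> (real (Suc k)) x0 \<le> (LINT y|lborel. E k * (v y * kh s (real (Suc k)) \<eta>' (y - x1)))"
      unfolding TT_def[OF \<eta>]
    proof (rule integral_mono[OF time_split(3)[OF \<eta>]])
      show "integrable lborel (\<lambda>y. E k * (v y * kh s (real (Suc k)) \<eta>' (y - x1)))" by (intro integrable_mult_right time_split(3)[OF \<eta>']) simp
      fix y :: 'a
      have "kh s (real (Suc k)) \<eta> (y - x0) \<le> (1 + (norm ((y - x0) - (y - x1)) + 2) / (2 * sqrt (real (Suc k)))) powr (real DIM('a) + 2 * s) * kh s (real (Suc k)) \<eta>' (y - x1)"
        by (rule kh_harnack[of "2 * Suc m"]) (use \<eta> \<eta>' s in \<open>auto simp: prof_def\<close>)
      also have "(y - x0) - (y - x1) = x1 - x0" by simp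
      finally have "kh s (real (Suc k)) \<eta> (y - x0) \<le> E k * kh s (real (Suc k)) \<eta>' (y - x1)" unfolding E_def .
      from mult_left_mono[OF this v(3)[of y]]
      show "v y * kh s (real (Suc k)) \<eta> (y - x0) \<le> E k * (v y * kh s (real (Suc k)) \<eta>' (y - x1))" by (simp only: mult_ac)
    qed simp
    then show ?thesis by (simp add: TT_def[OF \<eta>'])
  qed
  then have "c \<le> 1 * c'" by (intro LIMSEQ_le[OF c l]) blast
  then show ?thesis by simp
qed

text \<open>A single profile centred at 0 fixes the constant, and every other profile and centre has
  the same limit. If there were no profile, the claim would be vacuous.\<close>

lemma const_exists:
  "\<exists>c\<ge>0. \<forall>\<eta> x0. prof \<eta> \<longrightarrow> ennreal (LINT y|lborel. v y * \<eta> (y - x0)) = ennreal c + (\<integral>\<^sup>+x. ennreal (hh \<eta> x * rk s (x - x0)) \<partial>lborel)"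
proof (cases "\<exists>\<eta>. prof \<eta>")
  case True
  then obtain \<eta>0 where \<eta>0: "prof \<eta>0" by blast
  obtain c where c: "c \<ge> 0" "(\<lambda>k. TT \<eta>0 (real (Suc k)) 0) \<longlonglongrightarrow> c" using TT_limit[OF \<eta>0, of 0] by blast
  show ?thesis
  proof (intro exI[of _ c] conjI allI impI c(1))
    fix \<eta> x0 assume \<eta>: "prof \<eta>"
    obtain c' where c': "ennreal (SS \<eta> x0) = ennreal c' + (\<integral>\<^sup>+x. ennreal (hh \<eta> x * rk s (x - x0)) \<partial>lborel)" "(\<lambda>k. TT \<eta> (real (Suc k)) x0) \<longlonglongrightarrow> c'"
      using TT_limit[OF \<eta>, of x0] by blast
    have "c' = c" using TT_limit_le[OF \<eta> \<eta>0 c'(2) c(2)] TT_limit_le[OF \<eta>0 \<eta> c(2) c'(2)] by simp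
    then show "ennreal (LINT y|lborel. v y * \<eta> (y - x0)) = ennreal c + (\<integral>\<^sup>+x. ennreal (hh \<eta> x * rk s (x - x0)) \<partial>lborel)"
      using c'(1) by (simp add: SS_def[OF \<eta>])
  qed
qed auto

end

section \<open>Removing the mollification\<close>

lemma mol_mass: "0 < d \<Longrightarrow> 0 < N \<Longrightarrow> (\<integral>\<^sup>+u. ennreal (mol N d (u::'a::euclidean_space)) \<partial>lborel) = 1"
proof -
  assume d: "0 < d" and N: "0 < N"
  have "tst 0 (mol N d :: 'a \<Rightarrow> real)" by (rule mol_tst[OF d N])
  then have "integrable lborel (mol N d :: 'a \<Rightarrow> real)" by (auto simp: tst_def intro: bdd_supp_integrable dest: Ck_cont)
  then have "(\<integral>\<^sup>+u. ennreal (mol N d (u::'a)) \<partial>lborel) = ennreal (LINT u|lborel. mol N d (u::'a))"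
    by (rule nn_integral_eq_integral) (simp add: mol_nonneg d N)
  then show ?thesis by (simp add: mol_integral d N)
qed

text \<open>The radius r stands for either the distance |w - u| to a nearby point or the
  mollification scale; in both cases it is at least |w|/2.\<close>

lemma rk_scaled_mono:
  fixes z w :: "'a::euclidean_space"
  assumes s: "0 < s" "s < real DIM('a) / 2" and w: "w \<noteq> 0" and zw: "norm w / 2 \<le> r"
  shows "riesz_const DIM('a) s * r powr (2 * s - real DIM('a)) \<le> 2 powr (real DIM('a) - 2 * s) * rk s w"
proof -
  define p where "p = real DIM('a) - 2 * s"
  have p: "0 < p" using s by (simp add: p_def)
  have e: "2 * s - real DIM('a) = - p" by (simp add: p_def)
  have c: "0 < riesz_const DIM('a) s" by (rule riesz_const_pos[OF s])
  have "r powr (- p) \<le> (norm w / 2) powr (- p)" using zw w p by (intro powr_mono2') auto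
  also have "\<dots> = 2 powr p * norm w powr (- p)" unfolding powr_divide by (simp add: powr_minus_divide[of 2])
  finally have "riesz_const DIM('a) s * r powr (- p) \<le> riesz_const DIM('a) s * (2 powr p * norm w powr (- p))"
    using c by (intro mult_left_mono) auto
  then show ?thesis unfolding rk_def e p_def[symmetric] by (simp only: mult_ac)
qed

text \<open>The bound must be uniform in the scale d, to serve as majorant. If 2d \<le> |w|, the
  points averaged over keep distance |w|/2 from the singularity. Otherwise they lie in a ball of
  radius 3d about it, where the integral of |z|^(-p) scales like d^(n-p); the mollifier divides by
  d^n, and d^(-p) is comparable to |w|^(-p) or smaller as d > |w|/2.\<close>

lemma mol_rk_bound:
  assumes s: "0 < s" "s < real DIM('a::euclidean_space) / 2" and N: "0 < N"
  shows "\<exists>C\<ge>0. \<forall>d>0. \<forall>w::'a. w \<noteq> 0 \<longrightarrow> (\<integral>\<^sup>+u. ennreal (mol N d u * rk s (w - u)) \<partial>lborel) \<le> ennreal (C * rk s w)"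
proof -
  define p where "p = real DIM('a) - 2 * s"
  have p: "0 < p" "p < real DIM('a)" using s by (auto simp: p_def)
  have e: "2 * s - real DIM('a) = - p" by (simp add: p_def)
  define c where "c = riesz_const DIM('a) s"
  have c: "0 < c" unfolding c_def by (rule riesz_const_pos[OF s])
  have rkp: "rk s z = c * norm z powr (- p)" for z :: 'a unfolding rk_def c_def e ..
  define B where "B = bumpI TYPE('a) N"
  have B: "0 < B" unfolding B_def by (rule bumpI_pos[OF N])
  obtain C0 where C0: "C0 \<ge> 0" "\<And>r. r > 0 \<Longrightarrow> (\<integral>\<^sup>+z. ennreal (norm z powr (- p)) * indicator (cball 0 r) z \<partial>(lborel::'a measure)) \<le> ennreal (C0 * r powr (real DIM('a) - p))"
    using nn_norm_powr_near[OF p] by blast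
  define D where "D = C0 * 3 powr (real DIM('a) - p) / B"
  have D: "0 \<le> D" using C0 B by (simp add: D_def)
  define C where "C = (1 + D) * 2 powr p"
  have C: "2 powr p \<le> C" "D * 2 powr p \<le> C" using D by (auto simp: C_def algebra_simps)
  show ?thesis
  proof (intro exI[of _ C] conjI allI impI)
    show "0 \<le> C" using D by (simp add: C_def)
    fix d :: real and w :: 'a assume d: "0 < d" and w: "w \<noteq> 0"
    have rw: "0 \<le> rk s w" by (rule rk_nonneg[OF s])
    show "(\<integral>\<^sup>+u. ennreal (mol N d u * rk s (w - u)) \<partial>lborel) \<le> ennreal (C * rk s w)"
    proof (cases "2 * d \<le> norm w")
      case True
      have "(\<integral>\<^sup>+u. ennreal (mol N d u * rk s (w - u)) \<partial>lborel) \<le> (\<integral>\<^sup>+u. ennreal (C * rk s w) * ennreal (mol N d (u::'a)) \<partial>lborel)"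
        unfolding ennreal_mult''[OF mol_nonneg[OF d N], symmetric]
      proof (intro nn_integral_mono ennreal_leI)
        fix u :: 'a
        show "mol N d u * rk s (w - u) \<le> C * rk s w * mol N d u"
        proof (cases "norm u \<le> d")
          case True
          have "norm w / 2 \<le> norm (w - u)" using norm_triangle_ineq2[of w u] True \<open>2 * d \<le> norm w\<close> by linarith
          then have "rk s (w - u) \<le> 2 powr p * rk s w"
            using rk_scaled_mono[OF s w, of "norm (w - u)"] unfolding rk_def[of s "w - u"] p_def by simp
          also have "\<dots> \<le> C * rk s w" using C rw by (intro mult_right_mono) auto
          finally show ?thesis using mol_nonneg[OF d N, of u] by (simp add: mult.commute mult_left_mono)
        qed (simp add: mol_0 d N)
      qed
      also have "\<dots> = ennreal (C * rk s w)" using mol_mass[OF d N, where ?'a='a] by (subst nn_integral_cmult) auto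
      finally show ?thesis .
    next
      case False
      define q where "q = c / (d ^ DIM('a) * B)"
      have q: "0 \<le> q" using c d B by (simp add: q_def)
      let ?f = "\<lambda>z::'a. ennreal q * (ennreal (norm z powr (- p)) * indicator (cball 0 (3 * d)) z)"
      have "(\<integral>\<^sup>+u. ennreal (mol N d u * rk s (w - u)) \<partial>lborel) \<le> (\<integral>\<^sup>+u. ?f (w - u) \<partial>lborel)"
      proof (rule nn_integral_mono)
        fix u :: 'a
        show "ennreal (mol N d u * rk s (w - u)) \<le> ?f (w - u)"
        proof (cases "norm u \<le> d")
          case True
          have "norm (w - u) \<le> 3 * d" using norm_triangle_ineq4[of w u] True False by linarith
          moreover have "mol N d u * rk s (w - u) \<le> q * norm (w - u) powr (- p)"
          proof -
            have "mol N d u \<le> 1 / (d ^ DIM('a) * B)"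
              unfolding mol_def B_def[symmetric] by (rule mult_left_le) (use bump_le1 d B in auto)
            from mult_right_mono[OF this rk_nonneg[OF s, of "w - u"]] show ?thesis unfolding rkp q_def by simp
          qed
          ultimately show ?thesis by (simp add: ennreal_mult'[OF q, symmetric] ennreal_leI)
        qed (simp add: mol_0 d N)
      qed
      also have "\<dots> = (\<integral>\<^sup>+z. ?f z \<partial>lborel)" by (rule nn_integral_shift(3)) measurable
      also have "\<dots> = ennreal q * (\<integral>\<^sup>+z. ennreal (norm z powr (- p)) * indicator (cball 0 (3 * d)) z \<partial>(lborel::'a measure))"
        by (rule nn_integral_cmult) measurable
      also have "\<dots> \<le> ennreal q * ennreal (C0 * (3 * d) powr (real DIM('a) - p))" by (intro mult_left_mono C0) (use d in auto)
      also have "\<dots> = ennreal (D * (c * d powr (- p)))"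
      proof -
        have "(3 * d) powr (real DIM('a) - p) = 3 powr (real DIM('a) - p) * (d ^ DIM('a) * d powr (- p))"
          using d powr_add[of d "real DIM('a)" "- p"] by (simp add: powr_mult powr_realpow)
        then have "q * (C0 * (3 * d) powr (real DIM('a) - p)) = D * (c * d powr (- p))" unfolding q_def D_def using d by simp
        then show ?thesis unfolding ennreal_mult'[OF q, symmetric] by simp
      qed
      also have "\<dots> \<le> ennreal (C * rk s w)"
      proof (rule ennreal_leI)
        have "c * d powr (- p) \<le> 2 powr p * rk s w"
          using rk_scaled_mono[OF s w, of d] False unfolding c_def e p_def[symmetric] by simp
        from mult_left_mono[OF this D] have "D * (c * d powr (- p)) \<le> (D * 2 powr p) * rk s w" by (simp only: mult.assoc)
        also have "\<dots> \<le> C * rk s w" using C rw by (intro mult_right_mono) auto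
        finally show "D * (c * d powr (- p)) \<le> C * rk s w" .
      qed
      finally show ?thesis .
    qed
  qed
qed

text \<open>Flattening the kernel inside the ball of radius |w|/2 makes it continuous, so the
  general statement on mollifiers applies; for small scales only values outside that ball are
  met.\<close>

lemma mol_rk_tendsto:
  fixes w :: "'a::euclidean_space"
  assumes s: "0 < s" "s < real DIM('a) / 2" and N: "0 < N" and w: "w \<noteq> 0"
  shows "(\<lambda>k. \<integral>\<^sup>+u. ennreal (mol N (inverse (real (Suc k))) u * rk s (w - u)) \<partial>lborel) \<longlonglongrightarrow> ennreal (rk s w)"
proof -
  define r where "r = norm w / 2"
  have r: "0 < r" using w by (simp add: r_def)
  define q where "q z = riesz_const DIM('a) s * (max r (norm z)) powr (2 * s - real DIM('a))" for z :: 'a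
  have q0: "0 \<le> q z" for z using riesz_const_pos[OF s] by (simp add: q_def)
  have qc: "continuous_on UNIV q" unfolding q_def by (intro continuous_intros) (use r in auto)
  have qe: "q z = rk s z" if "r \<le> norm z" for z using that by (simp add: q_def rk_def max_absorb2)
  have [measurable]: "q \<in> borel_measurable borel" using qc by (rule borel_measurable_continuous_onI)
  let ?d = "\<lambda>k. inverse (real (Suc k))"
  have d: "0 < ?d k" for k by simp
  have "(\<lambda>k. ennreal (LINT y|lborel. q y * mol N (?d k) (y - w))) \<longlonglongrightarrow> ennreal (q w)"
    by (intro tendsto_ennrealI mol_tendsto qc N)
  moreover have "q w = rk s w" using w by (intro qe) (simp add: r_def)
  moreover have "\<forall>\<^sub>F k in sequentially. ennreal (LINT y|lborel. q y * mol N (?d k) (y - w)) = (\<integral>\<^sup>+u. ennreal (mol N (?d k) u * rk s (w - u)) \<partial>lborel)"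
  proof -
    have "\<forall>\<^sub>F k in sequentially. ?d k < r" using LIMSEQ_inverse_real_of_nat r by (rule order_tendstoD(2))
    then show ?thesis
    proof eventually_elim
      case (elim k)
      have "(LINT y|lborel. q y * mol N (?d k) (y - w)) = (LINT u|lborel. q (w - u) * mol N (?d k) (w - u - w))"
        by (rule integral_shift(3)[symmetric]) measurable
      also have "\<dots> = (LINT u|lborel. q (w - u) * mol N (?d k) u)" by simp
      finally have 1: "(LINT y|lborel. q y * mol N (?d k) (y - w)) = (LINT u|lborel. q (w - u) * mol N (?d k) u)" .
      have t: "tst 0 (mol N (?d k) :: 'a \<Rightarrow> real)" by (rule mol_tst[OF d N])
      have i: "integrable lborel (\<lambda>u. q (w - u) * mol N (?d k) u)"
        using t by (intro Ck_mult_integrable continuous_on_compose2[OF qc]) (auto simp: tst_def intro!: continuous_intros dest: Ck_cont)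
      have "ennreal (LINT y|lborel. q y * mol N (?d k) (y - w)) = (\<integral>\<^sup>+u. ennreal (q (w - u) * mol N (?d k) u) \<partial>lborel)"
        unfolding 1 using q0 mol_nonneg[OF d N] by (intro nn_integral_eq_integral[OF i, symmetric] AE_I2 mult_nonneg_nonneg)
      also have "\<dots> = (\<integral>\<^sup>+u. ennreal (mol N (?d k) u * rk s (w - u)) \<partial>lborel)"
      proof (rule nn_integral_cong)
        fix u :: 'a
        show "ennreal (q (w - u) * mol N (?d k) u) = ennreal (mol N (?d k) u * rk s (w - u))"
        proof (cases "norm u \<le> ?d k")
          case True
          have "2 * r = norm w" by (simp add: r_def)
          then have "r \<le> norm (w - u)" using norm_triangle_ineq2[of w u] True elim by linarith
          then show ?thesis by (simp add: qe mult.commute)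
        qed (use mol_0[OF d N, of k u] in auto)
      qed
      finally show ?case .
    qed
  qed
  ultimately show ?thesis using Lim_transform_eventually by fastforce
qed

context weak_solution
begin

lemma mol_prof: "0 < d \<Longrightarrow> d \<le> 1 \<Longrightarrow> prof (mol (Suc (2 * Suc m)) d)"
  unfolding prof_def by (auto intro!: mol_tst mol_nonneg mol_integral mol_0)

lemma hh_rk:
  assumes \<eta>: "prof \<eta>"
  shows "(\<integral>\<^sup>+x. ennreal (hh \<eta> x * rk s (x - x0)) \<partial>lborel) = (\<integral>\<^sup>+y. ennreal (F y) * (\<integral>\<^sup>+u. ennreal (\<eta> u * rk s (y - x0 - u)) \<partial>lborel) \<partial>lborel)"
proof -
  note \<eta>_meas[OF \<eta>, measurable]
  have hn: "ennreal (hh \<eta> x) = (\<integral>\<^sup>+y. ennreal (F y * \<eta> (y - x)) \<partial>lborel)" for x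
    unfolding hh_def
  proof (rule nn_integral_eq_integral[symmetric])
    show "integrable lborel (\<lambda>y. F y * \<eta> (y - x))"
      using tst_translate[OF prof_tst[OF \<eta>], of x] F(1) by (intro Ck_mult_integrable) (auto simp: tst_def dest: Ck_cont)
  qed (use F(2) prof_nonneg[OF \<eta>] in \<open>auto intro!: mult_nonneg_nonneg\<close>)
  have r: "0 \<le> rk s (z::'a)" for z by (rule rk_nonneg[OF s])
  have "(\<integral>\<^sup>+x. ennreal (hh \<eta> x * rk s (x - x0)) \<partial>lborel) = (\<integral>\<^sup>+x. \<integral>\<^sup>+y. ennreal (F y) * ennreal (\<eta> (y - x) * rk s (x - x0)) \<partial>lborel \<partial>lborel)"
  proof (rule nn_integral_cong)
    fix x :: 'a
    have "ennreal (hh \<eta> x * rk s (x - x0)) = (\<integral>\<^sup>+y. ennreal (F y * \<eta> (y - x)) * ennreal (rk s (x - x0)) \<partial>lborel)"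
      unfolding ennreal_mult'[OF hh_nonneg[OF \<eta>]] hn by (rule nn_integral_multc[symmetric]) measurable
    also have "\<dots> = (\<integral>\<^sup>+y. ennreal (F y) * ennreal (\<eta> (y - x) * rk s (x - x0)) \<partial>lborel)"
      unfolding ennreal_mult''[OF r, symmetric] ennreal_mult'[OF F(2), symmetric] by (simp only: mult.assoc)
    finally show "ennreal (hh \<eta> x * rk s (x - x0)) = (\<integral>\<^sup>+y. ennreal (F y) * ennreal (\<eta> (y - x) * rk s (x - x0)) \<partial>lborel)" .
  qed
  also have "\<dots> = (\<integral>\<^sup>+y. \<integral>\<^sup>+x. ennreal (F y) * ennreal (\<eta> (y - x) * rk s (x - x0)) \<partial>lborel \<partial>lborel)"
    by (rule lborel_pair.Fubini') measurable
  also have "\<dots> = (\<integral>\<^sup>+y. ennreal (F y) * (\<integral>\<^sup>+u. ennreal (\<eta> u * rk s (y - x0 - u)) \<partial>lborel) \<partial>lborel)"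
  proof (rule nn_integral_cong)
    fix y :: 'a
    have "(\<integral>\<^sup>+x. ennreal (F y) * ennreal (\<eta> (y - x) * rk s (x - x0)) \<partial>lborel) = ennreal (F y) * (\<integral>\<^sup>+x. ennreal (\<eta> (y - x) * rk s (y - x0 - (y - x))) \<partial>lborel)"
      by (subst nn_integral_cmult) auto
    also have "(\<integral>\<^sup>+x. ennreal (\<eta> (y - x) * rk s (y - x0 - (y - x))) \<partial>lborel) = (\<integral>\<^sup>+u. ennreal (\<eta> u * rk s (y - x0 - u)) \<partial>lborel)"
      by (rule nn_integral_shift(3)) measurable
    finally show "(\<integral>\<^sup>+x. ennreal (F y) * ennreal (\<eta> (y - x) * rk s (x - x0)) \<partial>lborel) = ennreal (F y) * (\<integral>\<^sup>+u. ennreal (\<eta> u * rk s (y - x0 - u)) \<partial>lborel)" .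
  qed
  finally show ?thesis .
qed

text \<open>The identity of \<open>const_exists\<close> for shrinking mollifiers. Its left side
  converges to v(x) by continuity, its right side by dominated convergence with a multiple of the
  limiting potential as majorant.\<close>

lemma representation: "\<exists>c\<ge>0. \<forall>x. ennreal (v x) = ennreal c + (\<integral>\<^sup>+y. ennreal (F y * rk s (y - x)) \<partial>lborel)"
proof -
  obtain c where c: "0 \<le> c" "\<And>\<eta> x0. prof \<eta> \<Longrightarrow> ennreal (LINT y|lborel. v y * \<eta> (y - x0)) = ennreal c + (\<integral>\<^sup>+x. ennreal (hh \<eta> x * rk s (x - x0)) \<partial>lborel)"
    using const_exists by blast
  let ?N = "Suc (2 * Suc m)"
  let ?mol = "\<lambda>k. mol ?N (inverse (real (Suc k)))"
  obtain C where C: "0 \<le> C" "\<And>d w. 0 < d \<Longrightarrow> (w::'a) \<noteq> 0 \<Longrightarrow> (\<integral>\<^sup>+u. ennreal (mol ?N d u * rk s (w - u)) \<partial>lborel) \<le> ennreal (C * rk s w)"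
    using mol_rk_bound[OF s, of ?N] by auto
  show ?thesis
  proof (intro exI[of _ c] conjI allI c(1))
    fix x :: 'a
    let ?G = "\<lambda>k y. \<integral>\<^sup>+u. ennreal (?mol k u * rk s (y - x - u)) \<partial>lborel"
    let ?A = "\<lambda>k. \<integral>\<^sup>+y. ennreal (F y) * ?G k y \<partial>lborel"
    let ?I = "\<integral>\<^sup>+y. ennreal (F y * rk s (y - x)) \<partial>lborel"
    have S: "(\<lambda>k. ennreal (LINT y|lborel. v y * ?mol k (y - x))) \<longlonglongrightarrow> ennreal (v x)"
      by (intro tendsto_ennrealI mol_tendsto v(2)) simp
    have eq: "ennreal (LINT y|lborel. v y * ?mol k (y - x)) = ennreal c + ?A k" for k
    proof -
      have p: "prof (?mol k)" by (rule mol_prof) (auto simp: field_simps)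
      show ?thesis unfolding c(2)[OF p] hh_rk[OF p] ..
    qed
    have nx: "AE y in lborel. y \<noteq> x" by (rule AE_lborel_singleton)
    have lim: "AE y in lborel. (\<lambda>k. ennreal (F y) * ?G k y) \<longlonglongrightarrow> ennreal (F y * rk s (y - x))"
      using nx
    proof eventually_elim
      case (elim y)
      have "(\<lambda>k. ?G k y) \<longlonglongrightarrow> ennreal (rk s (y - x))" using elim by (intro mol_rk_tendsto s) auto
      then have "(\<lambda>k. ennreal (F y) * ?G k y) \<longlonglongrightarrow> ennreal (F y) * ennreal (rk s (y - x))"
        by (intro ennreal_tendsto_cmult) auto
      then show ?case by (simp add: ennreal_mult'[OF F(2)])
    qed
    \<comment> \<open>Fatou's lemma comes before domination: the majorant is a multiple of the limit
      itself, so the limit must be known to be finite.\<close>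
    have fin: "?I < \<infinity>"
    proof -
      have "?I = (\<integral>\<^sup>+y. liminf (\<lambda>k. ennreal (F y) * ?G k y) \<partial>lborel)"
        by (rule nn_integral_cong_AE) (use lim in eventually_elim, simp add: lim_imp_Liminf)
      also have "\<dots> \<le> liminf ?A" by (rule nn_integral_liminf) measurable
      also have "\<dots> \<le> liminf (\<lambda>k. ennreal (LINT y|lborel. v y * ?mol k (y - x)))"
        unfolding eq by (intro Liminf_mono always_eventually allI) simp
      also have "\<dots> = ennreal (v x)" by (rule lim_imp_Liminf[OF _ S]) simp
      finally show ?thesis by (simp add: le_less_trans)
    qed
    have "?A \<longlonglongrightarrow> ?I"
    proof (rule nn_integral_dominated_convergence[where w="\<lambda>y. ennreal C * ennreal (F y * rk s (y - x))"])
      show "AE y in lborel. ennreal (F y) * ?G k y \<le> ennreal C * ennreal (F y * rk s (y - x))" for k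
        using nx
      proof eventually_elim
        case (elim y)
        have "?G k y \<le> ennreal (C * rk s (y - x))" using elim by (intro C) auto
        then have "ennreal (F y) * ?G k y \<le> ennreal (F y) * ennreal (C * rk s (y - x))" by (rule mult_left_mono) simp
        also have "\<dots> = ennreal C * ennreal (F y * rk s (y - x))"
          unfolding ennreal_mult'[OF F(2), symmetric] ennreal_mult'[OF C(1), symmetric] by (simp only: mult_ac)
        finally show ?case .
      qed
      have "(\<integral>\<^sup>+y. ennreal C * ennreal (F y * rk s (y - x)) \<partial>lborel) = ennreal C * ?I" by (rule nn_integral_cmult) measurable
      then show "(\<integral>\<^sup>+y. ennreal C * ennreal (F y * rk s (y - x)) \<partial>lborel) < \<infinity>" using fin by (simp add: ennreal_mult_less_top)
      show "AE y in lborel. (\<lambda>k. ennreal (F y) * ?G k y) \<longlonglongrightarrow> ennreal (F y * rk s (y - x))" by (rule lim)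
    qed measurable
    then have "(\<lambda>k. ennreal c + ?A k) \<longlonglongrightarrow> ennreal c + ?I" by (intro tendsto_add tendsto_const)
    then have "(\<lambda>k. ennreal (LINT y|lborel. v y * ?mol k (y - x))) \<longlonglongrightarrow> ennreal c + ?I" unfolding eq .
    from LIMSEQ_unique[OF S this] show "ennreal (v x) = ennreal c + ?I" .
  qed
qed

text \<open>The assumption is shaped for both alternatives of the theorem: a positive constant would
  bound v from below and leave all potentials finite, and each alternative refutes this
  combination.\<close>

lemma representation_0:
  assumes c0: "\<not> (\<exists>c>0. (\<forall>x. c \<le> v x) \<and> (\<forall>x. integrable lborel (\<lambda>y. F y * rk s (y - x))))"
  shows "integrable lborel (\<lambda>y. F y * rk s (y - x))" "v x = (LINT y|lborel. F y * rk s (y - x))"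
proof -
  obtain c where c: "0 \<le> c" "\<And>x. ennreal (v x) = ennreal c + (\<integral>\<^sup>+y. ennreal (F y * rk s (y - x)) \<partial>lborel)"
    using representation by blast
  have nn: "0 \<le> F y * rk s (y - x)" for x y using F(2) rk_nonneg[OF s] by simp
  have i: "integrable lborel (\<lambda>y. F y * rk s (y - x))" for x
  proof (rule integrableI_nonneg)
    have "(\<integral>\<^sup>+y. ennreal (F y * rk s (y - x)) \<partial>lborel) \<le> ennreal (v x)" unfolding c(2)[of x] by simp
    then show "(\<integral>\<^sup>+y. ennreal (F y * rk s (y - x)) \<partial>lborel) < \<infinity>" by (simp add: le_less_trans)
  qed (use nn in auto)
  have I0: "0 \<le> (LINT y|lborel. F y * rk s (y - x))" for x using nn by (intro integral_nonneg_AE AE_I2)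
  have e: "v x = c + (LINT y|lborel. F y * rk s (y - x))" for x
  proof -
    have "ennreal (v x) = ennreal (c + (LINT y|lborel. F y * rk s (y - x)))"
      unfolding c(2)[of x] using nn c(1) I0 by (subst nn_integral_eq_integral[OF i]) auto
    then show ?thesis using v(3)[of x] c(1) I0[of x] by (simp del: ennreal_plus)
  qed
  have "c \<le> v x" for x using e[of x] I0[of x] by simp
  then have "\<not> 0 < c" using c0 i by blast
  then have "c = 0" using c(1) by simp
  then show "v x = (LINT y|lborel. F y * rk s (y - x))" using e by simp
  show "integrable lborel (\<lambda>y. F y * rk s (y - x))" by (rule i)
qed

end

text \<open>On the ball of radius r the kernel is at least a constant times r^(2s-n), while the
  volume grows like r^n; the integral is thus at least a multiple of r^(2s), which is
  unbounded.\<close>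

lemma rk_not_integrable:
  assumes s: "0 < s" "s < real DIM('a::euclidean_space) / 2"
  shows "\<not> integrable lborel (rk s :: 'a \<Rightarrow> real)"
proof
  assume i: "integrable lborel (rk s :: 'a \<Rightarrow> real)"
  define c where "c = riesz_const DIM('a) s"
  have c: "0 < c" unfolding c_def by (rule riesz_const_pos[OF s])
  define I where "I = (LINT z|lborel. rk s (z::'a))"
  define w where "w = measure lborel (cball (0::'a) 1)"
  have w: "0 < w" by (simp add: w_def)
  have "c * w * r powr (2 * s) \<le> I" if r: "0 < r" for r
  proof -
    have "c * w * r powr (2 * s) = (c * r powr (2 * s - real DIM('a))) * measure lborel (cball (0::'a) r)"
    proof -
      have "measure lborel (cball (0::'a) r) = r powr real DIM('a) * w"
        using r by (simp add: w_def content_cball powr_realpow)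
      moreover have "r powr (2 * s) = r powr (2 * s - real DIM('a)) * r powr real DIM('a)" by (simp add: powr_add[symmetric])
      ultimately show ?thesis by (simp only: mult_ac)
    qed
    also have "\<dots> = (LINT z|lborel. (c * r powr (2 * s - real DIM('a))) * indicator (cball (0::'a) r) z)" by simp
    also have "\<dots> \<le> I" unfolding I_def
    proof (rule integral_mono_AE[OF _ i])
      show "integrable lborel (\<lambda>z. (c * r powr (2 * s - real DIM('a))) * indicator (cball (0::'a) r) z)"
        by (intro integrable_mult_right integrable_indicator_cball)
      have "AE z in lborel. z \<noteq> (0::'a)" by (rule AE_lborel_singleton)
      then show "AE z in lborel. (c * r powr (2 * s - real DIM('a))) * indicator (cball (0::'a) r) z \<le> rk s z"
      proof eventually_elim
        case (elim z)
        have "r powr (2 * s - real DIM('a)) \<le> norm z powr (2 * s - real DIM('a))" if "norm z \<le> r"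
          using that elim s by (intro powr_mono2') auto
        then show ?case using c rk_nonneg[OF s, of z] by (auto simp: rk_def c_def indicator_def)
      qed
    qed
    finally show ?thesis .
  qed
  moreover define r where "r = ((\<bar>I\<bar> + 1) / (c * w)) powr (1 / (2 * s))"
  have q: "0 < (\<bar>I\<bar> + 1) / (c * w)" using c w by simp
  have "r powr (2 * s) = (\<bar>I\<bar> + 1) / (c * w)" unfolding r_def powr_powr using s q c w by simp
  then have "c * w * r powr (2 * s) = \<bar>I\<bar> + 1" using c w by simp
  moreover have "0 < r" unfolding r_def powr_gt_zero using q by linarith
  ultimately show False by force
qed

section \<open>The two hypotheses excluding the constant\<close>

text \<open>Suppose v \<ge> c > 0. Decay at infinity is contradicted at once. Under the monotonicity
  hypothesis the source is at least the positive infimum of f(x, c), so finiteness of its Riesz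
  potential at the origin would make the Riesz kernel integrable.\<close>

lemma integral_of_solution:
  fixes f :: "'a::euclidean_space \<Rightarrow> real \<Rightarrow> real" and v :: "'a \<Rightarrow> real"
  assumes g: "0 \<le> \<gamma>" "\<gamma> < 1" and s: "0 < real m + \<gamma>" "real m + \<gamma> < real DIM('a) / 2"
    and v: "v \<in> Ls_space \<gamma>" "\<And>x. 0 \<le> v x" and st: "strong_solution m \<gamma> v (\<lambda>x. f x (v x))"
    and f: "\<And>x t. 0 \<le> t \<Longrightarrow> 0 \<le> f x t" and cF: "continuous_on UNIV (\<lambda>x. f x (v x))"
    and alt: "((\<forall>x t t'. 0 \<le> t \<and> t \<le> t' \<longrightarrow> f x t \<le> f x t') \<and> (\<forall>t>0. (INF x. f x t) > 0)) \<or> (v \<longlongrightarrow> 0) at_infinity"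
  shows "integral_solution (real m + \<gamma>) f v"
proof -
  define F where "F x = f x (v x)" for x
  obtain e where e: "0 < e" "Ck_hoelder_loc (2 * m + nat \<lfloor>2 * \<gamma>\<rfloor>) (2 * \<gamma> - of_int \<lfloor>2 * \<gamma>\<rfloor> + e) v"
    and wF: "wlap m \<gamma> v = F" using st unfolding strong_solution_def wlap_def F_def by blast
  note R = strong_regularity[OF g v(1) e(2,1)]
  interpret weak_solution m \<gamma> "real DIM('a) + 2 * \<gamma>" v F
  proof
    show "continuous_on UNIV v" by (rule Ck_cont[OF R(1)])
    show "continuous_on UNIV F" using cF by (simp add: F_def)
    show "0 \<le> F x" for x using f v(2) by (simp add: F_def)
    show "(LINT x|lborel. F x * \<phi> x) = (LINT x|lborel. v x * ztf m \<gamma> \<phi> 0 x)" if "tst (2 * Suc m) \<phi>" for \<phi>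
      using R(4)[OF that] unfolding wF .
  qed (use g s v in auto)
  have False if c: "0 < c" and cv: "\<And>x. c \<le> v x" and i: "\<And>x. integrable lborel (\<lambda>y. F y * rk (real m + \<gamma>) (y - x))" for c
    using alt
  proof
    assume "(v \<longlongrightarrow> 0) at_infinity"
    then have "c \<le> 0" by (rule tendsto_lowerbound) (use cv in \<open>auto simp: trivial_limit_at_infinity\<close>)
    then show False using c by simp
  next
    assume A: "(\<forall>x t t'. 0 \<le> t \<and> t \<le> t' \<longrightarrow> f x t \<le> f x t') \<and> (\<forall>t>0. (INF x. f x t) > 0)"
    define k where "k = (INF x. f x c)"
    have k: "0 < k" using A c by (simp add: k_def)
    have kF: "k \<le> F y" for y
    proof -
      have "k \<le> f y c" unfolding k_def by (rule cINF_lower) (use f c in \<open>auto intro!: bdd_belowI2[of _ 0]\<close>)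
      also have "\<dots> \<le> F y" using A c cv[of y] by (simp add: F_def)
      finally show ?thesis .
    qed
    have "integrable lborel (\<lambda>y::'a. k * rk (real m + \<gamma>) y)"
    proof (rule integrable_le)
      show "integrable lborel (\<lambda>y. F y * rk (real m + \<gamma>) y)" using i[of 0] by simp
      show "\<bar>k * rk (real m + \<gamma>) y\<bar> \<le> F y * rk (real m + \<gamma>) y" for y :: 'a
        using k kF[of y] rk_nonneg[OF s, of y] by (simp add: mult_right_mono)
    qed measurable
    then show False using k rk_not_integrable[OF s] by simp
  qed
  then have "\<not> (\<exists>c>0. (\<forall>x. c \<le> v x) \<and> (\<forall>x. integrable lborel (\<lambda>y. F y * rk (real m + \<gamma>) (y - x))))" by blast
  note rep = representation_0[OF this]
  have c: "riesz_const DIM('a) (real m + \<gamma>) \<noteq> 0" using riesz_const_pos[OF s] by simp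
  have q: "F y * rk (real m + \<gamma>) (y - x) = riesz_const DIM('a) (real m + \<gamma>) * (f y (v y) / norm (x - y) powr (real DIM('a) - 2 * (real m + \<gamma>)))" for x y
    by (simp add: rk_eq F_def norm_minus_commute)
  show ?thesis unfolding integral_solution_def
  proof (intro allI conjI)
    fix x
    show "integrable lborel (\<lambda>y. f y (v y) / norm (x - y) powr (real DIM('a) - 2 * (real m + \<gamma>)))"
    proof -
      have "integrable lborel (\<lambda>y. inverse (riesz_const DIM('a) (real m + \<gamma>)) * (F y * rk (real m + \<gamma>) (y - x)))"
        using rep(1)[of x] by (rule integrable_mult_right)
      then show ?thesis unfolding q mult.assoc[symmetric] left_inverse[OF c] mult_1_left .
    qed
    show "v x = riesz_const DIM('a) (real m + \<gamma>) * (LINT y|lborel. f y (v y) / norm (x - y) powr (real DIM('a) - 2 * (real m + \<gamma>)))"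
      using rep(2)[of x] unfolding q integral_mult_right_zero .
  qed
qed

text \<open>Over a closed unit ball the graph of the continuous function v is compact, and it lies
  in the domain of f because v \<ge> 0. The Hoelder bound on this compact set gives continuity along
  the graph.\<close>

lemma loc_hoelder_continuous:
  fixes f :: "'a::euclidean_space \<Rightarrow> real \<Rightarrow> real"
  assumes h: "loc_hoelder_on (UNIV \<times> {0..}) \<epsilon> (\<lambda>(x, t). f x t)" and e: "0 < \<epsilon>"
    and v: "continuous_on UNIV v" "\<And>x. 0 \<le> v x"
  shows "continuous_on UNIV (\<lambda>x. f x (v x))"
proof -
  have "isCont (\<lambda>x. f x (v x)) x" for x :: 'a
  proof -
    let ?K = "(\<lambda>y. (y, v y)) ` cball x 1"
    have "compact ?K" by (intro compact_continuous_image continuous_intros continuous_on_subset[OF v(1)]) auto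
    moreover have "?K \<subseteq> UNIV \<times> {0..}" using v(2) by auto
    ultimately have "\<exists>C. \<forall>p\<in>?K. \<forall>q\<in>?K. \<bar>(case p of (x, t) \<Rightarrow> f x t) - (case q of (x, t) \<Rightarrow> f x t)\<bar> \<le> C * dist p q powr \<epsilon>"
      using h[unfolded loc_hoelder_on_def, rule_format, of ?K] by simp
    then obtain C where C: "\<forall>p\<in>?K. \<forall>q\<in>?K. \<bar>(case p of (x, t) \<Rightarrow> f x t) - (case q of (x, t) \<Rightarrow> f x t)\<bar> \<le> C * dist p q powr \<epsilon>" ..
    have b: "\<bar>f y (v y) - f x (v x)\<bar> \<le> C * dist (y, v y) (x, v x) powr \<epsilon>" if "y \<in> cball x 1" for y
      using bspec[OF bspec[OF C, of "(y, v y)"], of "(x, v x)"] that by auto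
    have vc: "(v \<longlongrightarrow> v x) (at x)" using v(1) by (simp add: continuous_on_eq_continuous_at isCont_def)
    have "((\<lambda>y. dist (y, v y) (x, v x)) \<longlongrightarrow> dist (x, v x) (x, v x)) (at x)" by (intro tendsto_intros vc)
    then have "((\<lambda>y. C * dist (y, v y) (x, v x) powr \<epsilon>) \<longlongrightarrow> C * 0 powr \<epsilon>) (at x)"
      using e by (intro tendsto_mult tendsto_const tendsto_powr') auto
    then have "((\<lambda>y. C * dist (y, v y) (x, v x) powr \<epsilon>) \<longlongrightarrow> 0) (at x)" using e by simp
    moreover have "\<forall>\<^sub>F y in at x. norm (f y (v y) - f x (v x)) \<le> C * dist (y, v y) (x, v x) powr \<epsilon>"
      unfolding eventually_at using b by (intro exI[of _ 1]) (auto simp: dist_commute)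
    ultimately have "((\<lambda>y. f y (v y) - f x (v x)) \<longlongrightarrow> 0) (at x)" by (rule Lim_null_comparison[rotated])
    then show ?thesis unfolding isCont_def by (simp add: LIM_zero_iff)
  qed
  then show ?thesis by (simp add: continuous_on_eq_continuous_at)
qed

theorem theorem3p2:
  fixes s \<gamma> \<epsilon> :: real and m :: nat
    and f :: "'a::euclidean_space \<Rightarrow> real \<Rightarrow> real"
  assumes s_pos: "0 < s" and s_lt: "s < real DIM('a) / 2"
    and s_split: "s = real m + \<gamma>" and \<gamma>_ge: "0 \<le> \<gamma>" and \<gamma>_lt: "\<gamma> < 1"
    and \<epsilon>: "0 < \<epsilon>" "\<epsilon> < 1"
    and f_nonneg: "\<forall>x t. 0 \<le> t \<longrightarrow> 0 \<le> f x t"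
    and f_hoelder: "loc_hoelder_on (UNIV \<times> {0..}) \<epsilon> (\<lambda>(x, t). f x t)"
  shows
    "(\<forall>v. v \<in> Ls_space \<gamma> \<and>
          Ck_hoelder_loc (2 * m + nat \<lfloor>2 * \<gamma>\<rfloor>) (2 * \<gamma> - of_int \<lfloor>2 * \<gamma>\<rfloor> + \<epsilon>) v \<and>
          (\<forall>x. 0 \<le> v x) \<and>
          integral_solution s f v
        \<longrightarrow> strong_solution m \<gamma> v (\<lambda>x. f x (v x)))
     \<and>
     (\<forall>v. v \<in> Ls_space \<gamma> \<and> (\<forall>x. 0 \<le> v x) \<and>
          strong_solution m \<gamma> v (\<lambda>x. f x (v x)) \<and>
          (((\<forall>x t t'. 0 \<le> t \<and> t \<le> t' \<longrightarrow> f x t \<le> f x t') \<and>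
            (\<forall>t>0. (INF x. f x t) > 0))
           \<or> (v \<longlongrightarrow> 0) at_infinity)
        \<longrightarrow> integral_solution s f v)"
proof -
  note g = \<gamma>_ge \<gamma>_lt
  have s: "0 < real m + \<gamma>" "real m + \<gamma> < real DIM('a) / 2" using s_pos s_lt s_split by auto
  have 1: "strong_solution m \<gamma> v (\<lambda>x. f x (v x))"
    if v: "v \<in> Ls_space \<gamma>" "Ck_hoelder_loc (2 * m + nat \<lfloor>2 * \<gamma>\<rfloor>) (2 * \<gamma> - of_int \<lfloor>2 * \<gamma>\<rfloor> + \<epsilon>) v" "\<forall>x. 0 \<le> v x" "integral_solution s f v" for v
  proof (rule solution_of_integral[OF g s v(1,2) \<epsilon>(1)])
    show "continuous_on UNIV (\<lambda>x. f x (v x))"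
      by (rule loc_hoelder_continuous[OF f_hoelder \<epsilon>(1) Ck_cont[OF strong_regularity(1)[OF g v(1,2) \<epsilon>(1)]]]) (use v(3) in blast)
    show "0 \<le> f y (v y)" for y using f_nonneg v(3) by blast
    show "integrable lborel (\<lambda>y. f y (v y) / norm (x - y) powr (real DIM('a) - 2 * (real m + \<gamma>)))"
      "v x = riesz_const DIM('a) (real m + \<gamma>) * (LINT y|lborel. f y (v y) / norm (x - y) powr (real DIM('a) - 2 * (real m + \<gamma>)))" for x
      using v(4) unfolding integral_solution_def s_split by blast+
  qed
  have 2: "integral_solution s f v"
    if v: "v \<in> Ls_space \<gamma>" "\<forall>x. 0 \<le> v x" "strong_solution m \<gamma> v (\<lambda>x. f x (v x))"
      and alt: "((\<forall>x t t'. 0 \<le> t \<and> t \<le> t' \<longrightarrow> f x t \<le> f x t') \<and> (\<forall>t>0. (INF x. f x t) > 0)) \<or> (v \<longlongrightarrow> 0) at_infinity" for v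
    unfolding s_split
  proof (rule integral_of_solution[OF g s v(1) _ v(3) _ _ alt])
    show "0 \<le> v x" for x using v(2) by blast
    show "0 \<le> f x t" if "0 \<le> t" for x t using f_nonneg that by blast
    \<comment> \<open>Here continuity of the source is part of the notion of a strong solution: it
      equals the continuous function (-\<Delta>)^m (-\<Delta>)^\<gamma> v.\<close>
    show "continuous_on UNIV (\<lambda>x. f x (v x))"
    proof -
      have "(neg_lap ^^ m) (frac_lap \<gamma> v) = (\<lambda>x. f x (v x))" "continuous_on UNIV ((neg_lap ^^ m) (frac_lap \<gamma> v))"
        using v(3) unfolding strong_solution_def by (blast intro: ext)+
      then show ?thesis by simp
    qed
  qed
  show ?thesis using 1 2 by blast
qed

end
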